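(* Let $\mathcal G$ be a categorical group and let $\overline{\mathcal G}$ be its closure. Then the categorical representations of $\mathcal G$ (in $2\mathrm{Vect}$), together with the $1$-intertwiners and the $2$-intertwiners, form a monoidal bicategory $\mathrm{bicat}(\overline{\mathcal G},2\mathrm{Vect})$, with monoidal product given by the product $\boxtimes$ of categorical representations, $1$-intertwiners and $2$-intertwiners described in the context.
   Context: **Conventions.** Composition is always written in diagrammatic order. A monoidal bicategory is a one-object tricategory in the sense of Gordon–Power–Street. **Categorical group.** A categorical group $\mathcal G$ is a group object in the category of groupoids: a groupoid with object set $\mathcal G_0$ and composition $\cdot$, with functors $\circ:\mathcal G\times\mathcal G\to\mathcal G$ (product) and $(\ )^{-1}:\mathcal G\to\mathcal G$ and an object $1$, strictly satisfying the group laws. Its closure $\overline{\mathcal G}$ is the (strict) $2$-category with one object $\bullet$, hom-category $\overline{\mathcal G}(\bullet,\bullet)=\mathcal G$, and horizontal composition $\circ$. **$2\mathrm{Vect}$ (Kapranov–Voevodsky, coordinatized).** Objects: natural numbers $N\ge 0$. $1$-morphisms $N\to M$: $N\times M$ matrices $a=(a^i_j)$ with entries in $\mathbb N$. $2$-morphisms $a\to b$ (for $a,b:N\to M$): $N\times M$ matrices $\alpha$ whose entry $\alpha^i_j$ is a complex $a^i_j\times b^i_j$ matrix. Vertical composition: $(\alpha\cdot\beta)^i_j=\alpha^i_j\beta^i_j$; $1_a$ has identity matrices as entries. Horizontal composition of $1$-morphisms is matrix multiplication, with unit $1_N$ the identity matrix; for $2$-morphisms $(\alpha\circ\beta)^i_j=\bigoplus_k\alpha^i_k\otimes\beta^k_j$.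 The associators are the evident permutations of basis elements; units are strict. Monoidal product: $N\boxtimes M=NM$, $(a\boxtimes b)^{ij}_{kl}=a^i_kb^j_l$, $(\alpha\boxtimes\beta)^{ij}_{kl}=\alpha^i_k\otimes\beta^j_l$, with unit object $1$; the tensorator is the natural $2$-isomorphism $\tau:(a\boxtimes b)\circ(a'\boxtimes b')\to(a\circ a')\boxtimes(b\circ b')$ given by the evident permutation of basis elements; the remaining coherence data are trivial. **Categorical representations.** A categorical representation of $\mathcal G$ is a strictly unitary homomorphism $(R,\tilde R):\overline{\mathcal G}\to 2\mathrm{Vect}$ of bicategories, i.e. a pseudofunctor preserving identity $1$-morphisms strictly. Explicitly: an object $N=R(\bullet)$ (the dimension), a functor $R:\mathcal G\to 2\mathrm{Vect}(N,N)$ with $R(1)=1_N$, and natural $2$-isomorphisms $\tilde R_{X,Y}:R(X)\circ R(Y)\to R(X\circ Y)$ satisfying the usual associativity coherence condition, with $\tilde R_{1,X},\tilde R_{X,1}$ identities. **1-intertwiners.** A $1$-intertwiner $(h,\tilde h):(R,\tilde R)\to(T,\tilde T)$ is a pseudonatural transformation: a $1$-morphism $h_\bullet:R(\bullet)\to T(\bullet)$ in $2\mathrm{Vect}$ with $2$-isomorphisms $\tilde h(X):R(X)\circ h_\bullet\to h_\bullet\circ T(X)$, natural in $X\in\mathcal G$, such that $\tilde h(1)=1_{h_\bullet}$ and, up to associators, $(\tilde R_{X,Y}\circ 1_{h_\bullet})\cdot\tilde h(X\circ Y)=(1_{R(X)}\circ\tilde h(Y))\cdot(\tilde h(X)\circ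 1_{T(Y)})\cdot(1_{h_\bullet}\circ\tilde T_{X,Y})$. **2-intertwiners.** A $2$-intertwiner $\phi:(h,\tilde h)\to(k,\tilde k)$ is a modification: a $2$-morphism $\phi:h_\bullet\to k_\bullet$ with $\tilde h(X)\cdot(\phi\circ 1_{T(X)})=(1_{R(X)}\circ\phi)\cdot\tilde k(X)$ for all $X\in\mathcal G_0$. **Compositions.** $(h\circ k)_\bullet=h_\bullet\circ k_\bullet$, $\widetilde{h\circ k}(X)=(\tilde h(X)\circ 1_{k_\bullet})\cdot(1_{h_\bullet}\circ\tilde k(X))$ (up to associators); compositions of $2$-intertwiners are those of $2\mathrm{Vect}$. **Monoidal product.** For categorical representations: $(R\boxtimes T)(\bullet)=R(\bullet)\boxtimes T(\bullet)$, $(R\boxtimes T)(X)=R(X)\boxtimes T(X)$ (similarly on morphisms of $\mathcal G$), and $\widetilde{R\boxtimes T}_{X,Y}=\tau\cdot(\tilde R_{X,Y}\boxtimes\tilde T_{X,Y})$. For $1$-intertwiners $(h,\tilde h):R_1\to R_2$ and $(k,\tilde k):T_1\to T_2$: $(h\boxtimes k)_\bullet=h_\bullet\boxtimes k_\bullet$ and $\widetilde{h\boxtimes k}(X)=\tau\cdot(\tilde h(X)\boxtimes\tilde k(X))\cdot\tau^{-1}$. For $2$-intertwiners: $\alpha\boxtimes\beta$, computed in $2\mathrm{Vect}$. *)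

theory Defs
  imports Complex_Main "HOL-Library.FuncSet" "Jordan_Normal_Form.Matrix"
begin

text \<open>
  All compositions are written in diagrammatic order.  In a bicategory, \<open>\<cdot>\<close> is the vertical
  composition of 2-cells, \<open>\<star>\<close> the horizontal composition of 1-cells and \<open>\<ast>\<close> the horizontal
  composition of 2-cells.
\<close>

section \<open>Bicategories\<close>

record ('o, 'a, 'c) bicat =
  Obj :: "'o set"
  Arr :: "'a set"
  Cell :: "'c set"
  src :: "'a \<Rightarrow> 'o"
  tgt :: "'a \<Rightarrow> 'o"
  dom2 :: "'c \<Rightarrow> 'a"
  cod2 :: "'c \<Rightarrow> 'a"
  id1 :: "'o \<Rightarrow> 'a"
  id2 :: "'a \<Rightarrow> 'c"
  vcomp :: "'c \<Rightarrow> 'c \<Rightarrow> 'c" (infixl "\<cdot>\<index>" 65)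
  hcomp1 :: "'a \<Rightarrow> 'a \<Rightarrow> 'a" (infixr "\<star>\<index>" 72)
  hcomp2 :: "'c \<Rightarrow> 'c \<Rightarrow> 'c" (infixr "\<ast>\<index>" 72)
  associator :: "'a \<Rightarrow> 'a \<Rightarrow> 'a \<Rightarrow> 'c"
  lunitor :: "'a \<Rightarrow> 'c"
  runitor :: "'a \<Rightarrow> 'c"

definition hom1 :: "('o, 'a, 'c) bicat \<Rightarrow> 'o \<Rightarrow> 'o \<Rightarrow> 'a set" where
  "hom1 B X Y = {f \<in> Arr B. src B f = X \<and> tgt B f = Y}"

definition hom2 :: "('o, 'a, 'c) bicat \<Rightarrow> 'a \<Rightarrow> 'a \<Rightarrow> 'c set" where
  "hom2 B f g = {\<alpha> \<in> Cell B. dom2 B \<alpha> = f \<and> cod2 B \<alpha> = g}"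

definition composable :: "('o, 'a, 'c) bicat \<Rightarrow> ('a \<times> 'a) set" where
  "composable B = {(f, g). f \<in> Arr B \<and> g \<in> Arr B \<and> tgt B f = src B g}"

definition inverse_cells :: "('o, 'a, 'c) bicat \<Rightarrow> 'c \<Rightarrow> 'c \<Rightarrow> bool" where
  "inverse_cells B \<alpha> \<beta> \<longleftrightarrow> \<alpha> \<in> Cell B \<and> \<beta> \<in> hom2 B (cod2 B \<alpha>) (dom2 B \<alpha>) \<and>
     \<alpha> \<cdot>\<^bsub>B\<^esub> \<beta> = id2 B (dom2 B \<alpha>) \<and> \<beta> \<cdot>\<^bsub>B\<^esub> \<alpha> = id2 B (cod2 B \<alpha>)"

definition invertible2 :: "('o, 'a, 'c) bicat \<Rightarrow> 'c \<Rightarrow> bool" where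
  "invertible2 B \<alpha> \<longleftrightarrow> (\<exists>\<beta>. inverse_cells B \<alpha> \<beta>)"

definition inv2 :: "('o, 'a, 'c) bicat \<Rightarrow> 'c \<Rightarrow> 'c" where
  "inv2 B \<alpha> = (THE \<beta>. inverse_cells B \<alpha> \<beta>)"

locale bicategory =
  fixes B :: "('o, 'a, 'c) bicat" (structure)
  assumes src_obj: "f \<in> Arr B \<Longrightarrow> src B f \<in> Obj B"
    and tgt_obj: "f \<in> Arr B \<Longrightarrow> tgt B f \<in> Obj B"
    and dom2_arr: "\<alpha> \<in> Cell B \<Longrightarrow> dom2 B \<alpha> \<in> Arr B"
    and cod2_arr: "\<alpha> \<in> Cell B \<Longrightarrow> cod2 B \<alpha> \<in> Arr B"
    and cell_src: "\<alpha> \<in> Cell B \<Longrightarrow> src B (dom2 B \<alpha>) = src B (cod2 B \<alpha>)"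
    and cell_tgt: "\<alpha> \<in> Cell B \<Longrightarrow> tgt B (dom2 B \<alpha>) = tgt B (cod2 B \<alpha>)"
    and id1_hom: "X \<in> Obj B \<Longrightarrow> id1 B X \<in> hom1 B X X"
    and id2_hom: "f \<in> Arr B \<Longrightarrow> id2 B f \<in> hom2 B f f"
    and vcomp_hom: "\<lbrakk>\<alpha> \<in> hom2 B f g; \<beta> \<in> hom2 B g h\<rbrakk> \<Longrightarrow> \<alpha> \<cdot> \<beta> \<in> hom2 B f h"
    and vcomp_assoc: "\<lbrakk>\<alpha> \<in> hom2 B f g; \<beta> \<in> hom2 B g h; \<gamma> \<in> hom2 B h k\<rbrakk>
          \<Longrightarrow> (\<alpha> \<cdot> \<beta>) \<cdot> \<gamma> = \<alpha> \<cdot> (\<beta> \<cdot> \<gamma>)"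
    and vcomp_id2_left: "\<alpha> \<in> hom2 B f g \<Longrightarrow> id2 B f \<cdot> \<alpha> = \<alpha>"
    and vcomp_id2_right: "\<alpha> \<in> hom2 B f g \<Longrightarrow> \<alpha> \<cdot> id2 B g = \<alpha>"
    and hcomp1_hom: "\<lbrakk>f \<in> hom1 B X Y; g \<in> hom1 B Y Z\<rbrakk> \<Longrightarrow> f \<star> g \<in> hom1 B X Z"
    and hcomp2_hom: "\<lbrakk>\<alpha> \<in> hom2 B f f'; \<beta> \<in> hom2 B g g'; tgt B f = src B g\<rbrakk>
          \<Longrightarrow> \<alpha> \<ast> \<beta> \<in> hom2 B (f \<star> g) (f' \<star> g')"
    and hcomp2_id2: "(f, g) \<in> composable B \<Longrightarrow> id2 B f \<ast> id2 B g = id2 B (f \<star> g)"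
    and interchange: "\<lbrakk>\<alpha> \<in> hom2 B f f'; \<alpha>' \<in> hom2 B f' f''; \<beta> \<in> hom2 B g g'; \<beta>' \<in> hom2 B g' g'';
            tgt B f = src B g\<rbrakk> \<Longrightarrow> (\<alpha> \<cdot> \<alpha>') \<ast> (\<beta> \<cdot> \<beta>') = (\<alpha> \<ast> \<beta>) \<cdot> (\<alpha>' \<ast> \<beta>')"
    and associator_hom: "\<lbrakk>(f, g) \<in> composable B; (g, h) \<in> composable B\<rbrakk>
          \<Longrightarrow> associator B f g h \<in> hom2 B ((f \<star> g) \<star> h) (f \<star> (g \<star> h))"
    and associator_inv: "\<lbrakk>(f, g) \<in> composable B; (g, h) \<in> composable B\<rbrakk>
          \<Longrightarrow> invertible2 B (associator B f g h)"
    and associator_nat: "\<lbrakk>\<alpha> \<in> hom2 B f f'; \<beta> \<in> hom2 B g g'; \<gamma> \<in> hom2 B h h';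
            tgt B f = src B g; tgt B g = src B h\<rbrakk>
          \<Longrightarrow> ((\<alpha> \<ast> \<beta>) \<ast> \<gamma>) \<cdot> associator B f' g' h' = associator B f g h \<cdot> (\<alpha> \<ast> (\<beta> \<ast> \<gamma>))"
    and lunitor_hom: "f \<in> hom1 B X Y \<Longrightarrow> lunitor B f \<in> hom2 B (id1 B X \<star> f) f"
    and lunitor_inv: "f \<in> Arr B \<Longrightarrow> invertible2 B (lunitor B f)"
    and lunitor_nat: "\<lbrakk>\<alpha> \<in> hom2 B f g; f \<in> hom1 B X Y\<rbrakk>
          \<Longrightarrow> (id2 B (id1 B X) \<ast> \<alpha>) \<cdot> lunitor B g = lunitor B f \<cdot> \<alpha>"
    and runitor_hom: "f \<in> hom1 B X Y \<Longrightarrow> runitor B f \<in> hom2 B (f \<star> id1 B Y) f"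
    and runitor_inv: "f \<in> Arr B \<Longrightarrow> invertible2 B (runitor B f)"
    and runitor_nat: "\<lbrakk>\<alpha> \<in> hom2 B f g; f \<in> hom1 B X Y\<rbrakk>
          \<Longrightarrow> (\<alpha> \<ast> id2 B (id1 B Y)) \<cdot> runitor B g = runitor B f \<cdot> \<alpha>"
    and pentagon: "\<lbrakk>(f, g) \<in> composable B; (g, h) \<in> composable B; (h, k) \<in> composable B\<rbrakk>
          \<Longrightarrow> (associator B f g h \<ast> id2 B k) \<cdot> associator B f (g \<star> h) k
                \<cdot> (id2 B f \<ast> associator B g h k)
              = associator B (f \<star> g) h k \<cdot> associator B f g (h \<star> k)"
    and triangle: "\<lbrakk>f \<in> hom1 B X Y; g \<in> hom1 B Y Z\<rbrakk>
          \<Longrightarrow> associator B f (id1 B Y) g \<cdot> (id2 B f \<ast> lunitor B g) = runitor B f \<ast> id2 B g"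

definition adjoint_equivalence ::
    "('o, 'a, 'c) bicat \<Rightarrow> 'a \<Rightarrow> 'a \<Rightarrow> 'c \<Rightarrow> 'c \<Rightarrow> bool" where
  "adjoint_equivalence B f g \<eta> \<epsilon> \<longleftrightarrow>
     f \<in> Arr B \<and> g \<in> hom1 B (tgt B f) (src B f) \<and>
     \<eta> \<in> hom2 B (id1 B (src B f)) (f \<star>\<^bsub>B\<^esub> g) \<and> invertible2 B \<eta> \<and>
     \<epsilon> \<in> hom2 B (g \<star>\<^bsub>B\<^esub> f) (id1 B (tgt B f)) \<and> invertible2 B \<epsilon> \<and>
     inv2 B (lunitor B f) \<cdot>\<^bsub>B\<^esub> (\<eta> \<ast>\<^bsub>B\<^esub> id2 B f) \<cdot>\<^bsub>B\<^esub> associator B f g f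
       \<cdot>\<^bsub>B\<^esub> (id2 B f \<ast>\<^bsub>B\<^esub> \<epsilon>) \<cdot>\<^bsub>B\<^esub> runitor B f = id2 B f \<and>
     inv2 B (runitor B g) \<cdot>\<^bsub>B\<^esub> (id2 B g \<ast>\<^bsub>B\<^esub> \<eta>) \<cdot>\<^bsub>B\<^esub> inv2 B (associator B g f g)
       \<cdot>\<^bsub>B\<^esub> (\<epsilon> \<ast>\<^bsub>B\<^esub> id2 B g) \<cdot>\<^bsub>B\<^esub> lunitor B g = id2 B g"

definition full_sub :: "('o, 'a, 'c) bicat \<Rightarrow> ('o \<Rightarrow> bool) \<Rightarrow> ('o, 'a, 'c) bicat" where
  "full_sub B P = B\<lparr>Obj := {X \<in> Obj B. P X},
     Arr := {f \<in> Arr B. P (src B f) \<and> P (tgt B f)},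
     Cell := {\<alpha> \<in> Cell B. P (src B (dom2 B \<alpha>)) \<and> P (tgt B (dom2 B \<alpha>))}\<rparr>"

definition unit_bicat :: "(unit, unit, unit) bicat" where
  "unit_bicat = \<lparr>Obj = UNIV, Arr = UNIV, Cell = UNIV, src = (\<lambda>_. ()), tgt = (\<lambda>_. ()),
     dom2 = (\<lambda>_. ()), cod2 = (\<lambda>_. ()), id1 = (\<lambda>_. ()), id2 = (\<lambda>_. ()),
     vcomp = (\<lambda>_ _. ()), hcomp1 = (\<lambda>_ _. ()), hcomp2 = (\<lambda>_ _. ()),
     associator = (\<lambda>_ _ _. ()), lunitor = (\<lambda>_. ()), runitor = (\<lambda>_. ())\<rparr>"

definition prod_bicat :: "('o, 'a, 'c) bicat \<Rightarrow> ('p, 'b, 'd) bicat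
    \<Rightarrow> ('o \<times> 'p, 'a \<times> 'b, 'c \<times> 'd) bicat" where
  "prod_bicat B C = \<lparr>Obj = Obj B \<times> Obj C, Arr = Arr B \<times> Arr C, Cell = Cell B \<times> Cell C,
     src = map_prod (src B) (src C), tgt = map_prod (tgt B) (tgt C),
     dom2 = map_prod (dom2 B) (dom2 C), cod2 = map_prod (cod2 B) (cod2 C),
     id1 = map_prod (id1 B) (id1 C), id2 = map_prod (id2 B) (id2 C),
     vcomp = (\<lambda>(\<alpha>, \<beta>) (\<alpha>', \<beta>'). (\<alpha> \<cdot>\<^bsub>B\<^esub> \<alpha>', \<beta> \<cdot>\<^bsub>C\<^esub> \<beta>')),
     hcomp1 = (\<lambda>(f, g) (f', g'). (f \<star>\<^bsub>B\<^esub> f', g \<star>\<^bsub>C\<^esub> g')),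
     hcomp2 = (\<lambda>(\<alpha>, \<beta>) (\<alpha>', \<beta>'). (\<alpha> \<ast>\<^bsub>B\<^esub> \<alpha>', \<beta> \<ast>\<^bsub>C\<^esub> \<beta>')),
     associator = (\<lambda>(f, g) (f', g') (f'', g''). (associator B f f' f'', associator C g g' g'')),
     lunitor = map_prod (lunitor B) (lunitor C),
     runitor = map_prod (runitor B) (runitor C)\<rparr>"


section \<open>Pseudofunctors, pseudonatural transformations, modifications\<close>

text \<open>
  The maps making up a pseudofunctor, a transformation or a modification are required to be
  \<^const>\<open>undefined\<close> outside the cells of the source bicategory, so that equality in HOL is
  equality of the mathematical objects.
\<close>

record ('o, 'a, 'c, 'p, 'b, 'd) pseudofun =
  ps_obj :: "'o \<Rightarrow> 'p"
  ps_arr :: "'a \<Rightarrow> 'b"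
  ps_cell :: "'c \<Rightarrow> 'd"
  ps_comp :: "'a \<times> 'a \<Rightarrow> 'd"
  ps_unit :: "'o \<Rightarrow> 'd"

locale pseudofunctor = S: bicategory B + T: bicategory C
  for B :: "('o, 'a, 'c) bicat" and C :: "('p, 'b, 'd) bicat" +
  fixes F :: "('o, 'a, 'c, 'p, 'b, 'd) pseudofun"
  assumes ps_ext: "ps_obj F \<in> extensional (Obj B)" "ps_arr F \<in> extensional (Arr B)"
      "ps_cell F \<in> extensional (Cell B)" "ps_comp F \<in> extensional (composable B)"
      "ps_unit F \<in> extensional (Obj B)"
    and ps_obj_in: "X \<in> Obj B \<Longrightarrow> ps_obj F X \<in> Obj C"
    and ps_arr_hom: "f \<in> hom1 B X Y \<Longrightarrow> ps_arr F f \<in> hom1 C (ps_obj F X) (ps_obj F Y)"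
    and ps_cell_hom: "\<alpha> \<in> hom2 B f g \<Longrightarrow> ps_cell F \<alpha> \<in> hom2 C (ps_arr F f) (ps_arr F g)"
    and ps_cell_vcomp: "\<lbrakk>\<alpha> \<in> hom2 B f g; \<beta> \<in> hom2 B g h\<rbrakk>
          \<Longrightarrow> ps_cell F (\<alpha> \<cdot>\<^bsub>B\<^esub> \<beta>) = ps_cell F \<alpha> \<cdot>\<^bsub>C\<^esub> ps_cell F \<beta>"
    and ps_cell_id2: "f \<in> Arr B \<Longrightarrow> ps_cell F (id2 B f) = id2 C (ps_arr F f)"
    and ps_comp_hom: "(f, g) \<in> composable B \<Longrightarrow>
          ps_comp F (f, g) \<in> hom2 C (ps_arr F f \<star>\<^bsub>C\<^esub> ps_arr F g) (ps_arr F (f \<star>\<^bsub>B\<^esub> g))"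
    and ps_comp_inv: "(f, g) \<in> composable B \<Longrightarrow> invertible2 C (ps_comp F (f, g))"
    and ps_comp_nat: "\<lbrakk>\<alpha> \<in> hom2 B f f'; \<beta> \<in> hom2 B g g'; tgt B f = src B g\<rbrakk>
          \<Longrightarrow> (ps_cell F \<alpha> \<ast>\<^bsub>C\<^esub> ps_cell F \<beta>) \<cdot>\<^bsub>C\<^esub> ps_comp F (f', g')
            = ps_comp F (f, g) \<cdot>\<^bsub>C\<^esub> ps_cell F (\<alpha> \<ast>\<^bsub>B\<^esub> \<beta>)"
    and ps_unit_hom: "X \<in> Obj B \<Longrightarrow>
          ps_unit F X \<in> hom2 C (id1 C (ps_obj F X)) (ps_arr F (id1 B X))"
    and ps_unit_inv: "X \<in> Obj B \<Longrightarrow> invertible2 C (ps_unit F X)"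
    and ps_coh_assoc: "\<lbrakk>(f, g) \<in> composable B; (g, h) \<in> composable B\<rbrakk>
          \<Longrightarrow> (ps_comp F (f, g) \<ast>\<^bsub>C\<^esub> id2 C (ps_arr F h)) \<cdot>\<^bsub>C\<^esub> ps_comp F (f \<star>\<^bsub>B\<^esub> g, h)
                \<cdot>\<^bsub>C\<^esub> ps_cell F (associator B f g h)
            = associator C (ps_arr F f) (ps_arr F g) (ps_arr F h)
                \<cdot>\<^bsub>C\<^esub> (id2 C (ps_arr F f) \<ast>\<^bsub>C\<^esub> ps_comp F (g, h)) \<cdot>\<^bsub>C\<^esub> ps_comp F (f, g \<star>\<^bsub>B\<^esub> h)"
    and ps_coh_left: "f \<in> hom1 B X Y
          \<Longrightarrow> (ps_unit F X \<ast>\<^bsub>C\<^esub> id2 C (ps_arr F f)) \<cdot>\<^bsub>C\<^esub> ps_comp F (id1 B X, f)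
                \<cdot>\<^bsub>C\<^esub> ps_cell F (lunitor B f)
            = lunitor C (ps_arr F f)"
    and ps_coh_right: "f \<in> hom1 B X Y
          \<Longrightarrow> (id2 C (ps_arr F f) \<ast>\<^bsub>C\<^esub> ps_unit F Y) \<cdot>\<^bsub>C\<^esub> ps_comp F (f, id1 B Y)
                \<cdot>\<^bsub>C\<^esub> ps_cell F (runitor B f)
            = runitor C (ps_arr F f)"

definition strictly_unitary ::
    "('o, 'a, 'c) bicat \<Rightarrow> ('p, 'b, 'd) bicat \<Rightarrow> ('o, 'a, 'c, 'p, 'b, 'd) pseudofun \<Rightarrow> bool" where
  "strictly_unitary B C F \<longleftrightarrow> (\<forall>X\<in>Obj B.
     ps_arr F (id1 B X) = id1 C (ps_obj F X) \<and> ps_unit F X = id2 C (id1 C (ps_obj F X)))"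

record ('o, 'a, 'c, 'p, 'b, 'd) pseudonat =
  pt_src :: "('o, 'a, 'c, 'p, 'b, 'd) pseudofun"
  pt_tgt :: "('o, 'a, 'c, 'p, 'b, 'd) pseudofun"
  pt_map :: "'o \<Rightarrow> 'b"
  pt_nat :: "'a \<Rightarrow> 'd"

locale pseudonatural =
  F: pseudofunctor B C "pt_src \<sigma>" + G: pseudofunctor B C "pt_tgt \<sigma>"
  for B :: "('o, 'a, 'c) bicat" and C :: "('p, 'b, 'd) bicat"
    and \<sigma> :: "('o, 'a, 'c, 'p, 'b, 'd) pseudonat" +
  assumes pt_ext: "pt_map \<sigma> \<in> extensional (Obj B)" "pt_nat \<sigma> \<in> extensional (Arr B)"
    and pt_map_hom: "X \<in> Obj B \<Longrightarrow>
          pt_map \<sigma> X \<in> hom1 C (ps_obj (pt_src \<sigma>) X) (ps_obj (pt_tgt \<sigma>) X)"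
    and pt_nat_hom: "f \<in> hom1 B X Y \<Longrightarrow>
          pt_nat \<sigma> f \<in> hom2 C (ps_arr (pt_src \<sigma>) f \<star>\<^bsub>C\<^esub> pt_map \<sigma> Y)
                               (pt_map \<sigma> X \<star>\<^bsub>C\<^esub> ps_arr (pt_tgt \<sigma>) f)"
    and pt_nat_inv: "f \<in> Arr B \<Longrightarrow> invertible2 C (pt_nat \<sigma> f)"
    and pt_nat_nat: "\<lbrakk>f \<in> hom1 B X Y; \<alpha> \<in> hom2 B f g\<rbrakk> \<Longrightarrow>
          (ps_cell (pt_src \<sigma>) \<alpha> \<ast>\<^bsub>C\<^esub> id2 C (pt_map \<sigma> Y)) \<cdot>\<^bsub>C\<^esub> pt_nat \<sigma> g
          = pt_nat \<sigma> f \<cdot>\<^bsub>C\<^esub> (id2 C (pt_map \<sigma> X) \<ast>\<^bsub>C\<^esub> ps_cell (pt_tgt \<sigma>) \<alpha>)"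
    and pt_nat_unit: "X \<in> Obj B \<Longrightarrow>
          (ps_unit (pt_src \<sigma>) X \<ast>\<^bsub>C\<^esub> id2 C (pt_map \<sigma> X)) \<cdot>\<^bsub>C\<^esub> pt_nat \<sigma> (id1 B X)
          = lunitor C (pt_map \<sigma> X) \<cdot>\<^bsub>C\<^esub> inv2 C (runitor C (pt_map \<sigma> X))
              \<cdot>\<^bsub>C\<^esub> (id2 C (pt_map \<sigma> X) \<ast>\<^bsub>C\<^esub> ps_unit (pt_tgt \<sigma>) X)"
    and pt_nat_comp: "\<lbrakk>f \<in> hom1 B X Y; g \<in> hom1 B Y Z\<rbrakk> \<Longrightarrow>
          (ps_comp (pt_src \<sigma>) (f, g) \<ast>\<^bsub>C\<^esub> id2 C (pt_map \<sigma> Z)) \<cdot>\<^bsub>C\<^esub> pt_nat \<sigma> (f \<star>\<^bsub>B\<^esub> g)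
          = associator C (ps_arr (pt_src \<sigma>) f) (ps_arr (pt_src \<sigma>) g) (pt_map \<sigma> Z)
              \<cdot>\<^bsub>C\<^esub> (id2 C (ps_arr (pt_src \<sigma>) f) \<ast>\<^bsub>C\<^esub> pt_nat \<sigma> g)
              \<cdot>\<^bsub>C\<^esub> inv2 C (associator C (ps_arr (pt_src \<sigma>) f) (pt_map \<sigma> Y) (ps_arr (pt_tgt \<sigma>) g))
              \<cdot>\<^bsub>C\<^esub> (pt_nat \<sigma> f \<ast>\<^bsub>C\<^esub> id2 C (ps_arr (pt_tgt \<sigma>) g))
              \<cdot>\<^bsub>C\<^esub> associator C (pt_map \<sigma> X) (ps_arr (pt_tgt \<sigma>) f) (ps_arr (pt_tgt \<sigma>) g)
              \<cdot>\<^bsub>C\<^esub> (id2 C (pt_map \<sigma> X) \<ast>\<^bsub>C\<^esub> ps_comp (pt_tgt \<sigma>) (f, g))"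

text \<open>The components \<open>m\<close> of a modification from \<open>\<sigma>\<close> to \<open>\<tau>\<close>.\<close>

definition modification ::
    "('o, 'a, 'c) bicat \<Rightarrow> ('p, 'b, 'd) bicat \<Rightarrow> ('o, 'a, 'c, 'p, 'b, 'd) pseudonat
      \<Rightarrow> ('o, 'a, 'c, 'p, 'b, 'd) pseudonat \<Rightarrow> ('o \<Rightarrow> 'd) \<Rightarrow> bool" where
  "modification B C \<sigma> \<tau> m \<longleftrightarrow>
     (\<forall>X\<in>Obj B. m X \<in> hom2 C (pt_map \<sigma> X) (pt_map \<tau> X)) \<and>
     (\<forall>f\<in>Arr B. pt_nat \<sigma> f \<cdot>\<^bsub>C\<^esub> (m (src B f) \<ast>\<^bsub>C\<^esub> id2 C (ps_arr (pt_tgt \<sigma>) f))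
              = (id2 C (ps_arr (pt_src \<sigma>) f) \<ast>\<^bsub>C\<^esub> m (tgt B f)) \<cdot>\<^bsub>C\<^esub> pt_nat \<tau> f)"

definition invertible_modification ::
    "('o, 'a, 'c) bicat \<Rightarrow> ('p, 'b, 'd) bicat \<Rightarrow> ('o, 'a, 'c, 'p, 'b, 'd) pseudonat
      \<Rightarrow> ('o, 'a, 'c, 'p, 'b, 'd) pseudonat \<Rightarrow> ('o \<Rightarrow> 'd) \<Rightarrow> bool" where
  "invertible_modification B C \<sigma> \<tau> m \<longleftrightarrow>
     modification B C \<sigma> \<tau> m \<and> (\<forall>X\<in>Obj B. invertible2 C (m X))"

record ('o, 'a, 'c, 'p, 'b, 'd) modif =
  md_src :: "('o, 'a, 'c, 'p, 'b, 'd) pseudonat"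
  md_tgt :: "('o, 'a, 'c, 'p, 'b, 'd) pseudonat"
  md_map :: "'o \<Rightarrow> 'd"

definition pt_id :: "('o, 'a, 'c) bicat \<Rightarrow> ('p, 'b, 'd) bicat
    \<Rightarrow> ('o, 'a, 'c, 'p, 'b, 'd) pseudofun \<Rightarrow> ('o, 'a, 'c, 'p, 'b, 'd) pseudonat" where
  "pt_id B C F = \<lparr>pt_src = F, pt_tgt = F,
     pt_map = (\<lambda>X\<in>Obj B. id1 C (ps_obj F X)),
     pt_nat = (\<lambda>f\<in>Arr B. runitor C (ps_arr F f) \<cdot>\<^bsub>C\<^esub> inv2 C (lunitor C (ps_arr F f)))\<rparr>"

definition pt_then :: "('o, 'a, 'c) bicat \<Rightarrow> ('p, 'b, 'd) bicat
    \<Rightarrow> ('o, 'a, 'c, 'p, 'b, 'd) pseudonat \<Rightarrow> ('o, 'a, 'c, 'p, 'b, 'd) pseudonat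
    \<Rightarrow> ('o, 'a, 'c, 'p, 'b, 'd) pseudonat" where
  "pt_then B C \<sigma> \<tau> = \<lparr>pt_src = pt_src \<sigma>, pt_tgt = pt_tgt \<tau>,
     pt_map = (\<lambda>X\<in>Obj B. pt_map \<sigma> X \<star>\<^bsub>C\<^esub> pt_map \<tau> X),
     pt_nat = (\<lambda>f\<in>Arr B. let X = src B f; Y = tgt B f in
       inv2 C (associator C (ps_arr (pt_src \<sigma>) f) (pt_map \<sigma> Y) (pt_map \<tau> Y))
       \<cdot>\<^bsub>C\<^esub> (pt_nat \<sigma> f \<ast>\<^bsub>C\<^esub> id2 C (pt_map \<tau> Y))
       \<cdot>\<^bsub>C\<^esub> associator C (pt_map \<sigma> X) (ps_arr (pt_tgt \<sigma>) f) (pt_map \<tau> Y)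
       \<cdot>\<^bsub>C\<^esub> (id2 C (pt_map \<sigma> X) \<ast>\<^bsub>C\<^esub> pt_nat \<tau> f)
       \<cdot>\<^bsub>C\<^esub> inv2 C (associator C (pt_map \<sigma> X) (pt_map \<tau> X) (ps_arr (pt_tgt \<tau>) f)))\<rparr>"

text \<open>The bicategory of all pseudofunctors, pseudonatural transformations and modifications.\<close>

definition ps_bicat :: "('o, 'a, 'c) bicat \<Rightarrow> ('p, 'b, 'd) bicat
    \<Rightarrow> (('o, 'a, 'c, 'p, 'b, 'd) pseudofun, ('o, 'a, 'c, 'p, 'b, 'd) pseudonat,
        ('o, 'a, 'c, 'p, 'b, 'd) modif) bicat" where
  "ps_bicat B C = \<lparr>
     Obj = {F. pseudofunctor B C F},
     Arr = {\<sigma>. pseudonatural B C \<sigma>},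
     Cell = {m. pseudonatural B C (md_src m) \<and> pseudonatural B C (md_tgt m) \<and>
       pt_src (md_src m) = pt_src (md_tgt m) \<and> pt_tgt (md_src m) = pt_tgt (md_tgt m) \<and>
       modification B C (md_src m) (md_tgt m) (md_map m) \<and> md_map m \<in> extensional (Obj B)},
     src = pt_src, tgt = pt_tgt, dom2 = md_src, cod2 = md_tgt,
     id1 = pt_id B C,
     id2 = (\<lambda>\<sigma>. \<lparr>md_src = \<sigma>, md_tgt = \<sigma>, md_map = (\<lambda>X\<in>Obj B. id2 C (pt_map \<sigma> X))\<rparr>),
     vcomp = (\<lambda>m n. \<lparr>md_src = md_src m, md_tgt = md_tgt n,
       md_map = (\<lambda>X\<in>Obj B. md_map m X \<cdot>\<^bsub>C\<^esub> md_map n X)\<rparr>),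
     hcomp1 = pt_then B C,
     hcomp2 = (\<lambda>m n. \<lparr>md_src = pt_then B C (md_src m) (md_src n),
       md_tgt = pt_then B C (md_tgt m) (md_tgt n),
       md_map = (\<lambda>X\<in>Obj B. md_map m X \<ast>\<^bsub>C\<^esub> md_map n X)\<rparr>),
     associator = (\<lambda>\<sigma> \<tau> \<upsilon>. \<lparr>md_src = pt_then B C (pt_then B C \<sigma> \<tau>) \<upsilon>,
       md_tgt = pt_then B C \<sigma> (pt_then B C \<tau> \<upsilon>),
       md_map = (\<lambda>X\<in>Obj B. associator C (pt_map \<sigma> X) (pt_map \<tau> X) (pt_map \<upsilon> X))\<rparr>),
     lunitor = (\<lambda>\<sigma>. \<lparr>md_src = pt_then B C (pt_id B C (pt_src \<sigma>)) \<sigma>, md_tgt = \<sigma>,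
       md_map = (\<lambda>X\<in>Obj B. lunitor C (pt_map \<sigma> X))\<rparr>),
     runitor = (\<lambda>\<sigma>. \<lparr>md_src = pt_then B C \<sigma> (pt_id B C (pt_tgt \<sigma>)), md_tgt = \<sigma>,
       md_map = (\<lambda>X\<in>Obj B. runitor C (pt_map \<sigma> X))\<rparr>)\<rparr>"

text \<open>A pseudonatural (adjoint) equivalence from \<open>F\<close> to \<open>G\<close>.\<close>

definition pseudonatural_equivalence ::
    "('o, 'a, 'c) bicat \<Rightarrow> ('p, 'b, 'd) bicat \<Rightarrow> ('o, 'a, 'c, 'p, 'b, 'd) pseudofun
      \<Rightarrow> ('o, 'a, 'c, 'p, 'b, 'd) pseudofun \<Rightarrow> ('o, 'a, 'c, 'p, 'b, 'd) pseudonat \<Rightarrow> bool" where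
  "pseudonatural_equivalence B C F G \<sigma> \<longleftrightarrow> \<sigma> \<in> hom1 (ps_bicat B C) F G \<and>
     (\<exists>\<sigma>' \<eta> \<epsilon>. adjoint_equivalence (ps_bicat B C) \<sigma> \<sigma>' \<eta> \<epsilon>)"


subsection \<open>Operations on pseudofunctors\<close>

text \<open>The strict pseudofunctor \<open>B \<rightarrow> C\<close> with the given underlying maps.\<close>

definition ps_strict :: "('o, 'a, 'c) bicat \<Rightarrow> ('p, 'b, 'd) bicat \<Rightarrow> ('o \<Rightarrow> 'p) \<Rightarrow> ('a \<Rightarrow> 'b)
    \<Rightarrow> ('c \<Rightarrow> 'd) \<Rightarrow> ('o, 'a, 'c, 'p, 'b, 'd) pseudofun" where
  "ps_strict B C u v w = \<lparr>ps_obj = restrict u (Obj B), ps_arr = restrict v (Arr B),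
     ps_cell = restrict w (Cell B),
     ps_comp = (\<lambda>(f, g)\<in>composable B. id2 C (v f \<star>\<^bsub>C\<^esub> v g)),
     ps_unit = (\<lambda>X\<in>Obj B. id2 C (id1 C (u X)))\<rparr>"

definition ps_id :: "('o, 'a, 'c) bicat \<Rightarrow> ('o, 'a, 'c, 'o, 'a, 'c) pseudofun" where
  "ps_id B = ps_strict B B (\<lambda>X. X) (\<lambda>f. f) (\<lambda>\<alpha>. \<alpha>)"

definition ps_bang :: "('o, 'a, 'c) bicat \<Rightarrow> ('o, 'a, 'c, unit, unit, unit) pseudofun" where
  "ps_bang B = ps_strict B unit_bicat (\<lambda>_. ()) (\<lambda>_. ()) (\<lambda>_. ())"

definition ps_reassoc ::
    "('o, 'a, 'c) bicat \<Rightarrow> ('p, 'b, 'd) bicat \<Rightarrow> ('q, 'e, 'f) bicat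
      \<Rightarrow> (('o \<times> 'p) \<times> 'q, ('a \<times> 'b) \<times> 'e, ('c \<times> 'd) \<times> 'f,
          'o \<times> ('p \<times> 'q), 'a \<times> ('b \<times> 'e), 'c \<times> ('d \<times> 'f)) pseudofun" where
  "ps_reassoc B C D = ps_strict (prod_bicat (prod_bicat B C) D) (prod_bicat B (prod_bicat C D))
     (\<lambda>((X, Y), Z). (X, (Y, Z))) (\<lambda>((f, g), h). (f, (g, h))) (\<lambda>((\<alpha>, \<beta>), \<gamma>). (\<alpha>, (\<beta>, \<gamma>)))"

definition ps_const :: "('o, 'a, 'c) bicat \<Rightarrow> ('p, 'b, 'd) bicat \<Rightarrow> 'p
    \<Rightarrow> ('o, 'a, 'c, 'p, 'b, 'd) pseudofun" where
  "ps_const B C Z = \<lparr>ps_obj = (\<lambda>X\<in>Obj B. Z), ps_arr = (\<lambda>f\<in>Arr B. id1 C Z),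
     ps_cell = (\<lambda>\<alpha>\<in>Cell B. id2 C (id1 C Z)),
     ps_comp = (\<lambda>fg\<in>composable B. lunitor C (id1 C Z)),
     ps_unit = (\<lambda>X\<in>Obj B. id2 C (id1 C Z))\<rparr>"

text \<open>Composition \<open>B \<rightarrow> C \<rightarrow> D\<close>.\<close>

definition ps_then :: "('o, 'a, 'c) bicat \<Rightarrow> ('q, 'e, 'f) bicat
    \<Rightarrow> ('o, 'a, 'c, 'p, 'b, 'd) pseudofun \<Rightarrow> ('p, 'b, 'd, 'q, 'e, 'f) pseudofun
    \<Rightarrow> ('o, 'a, 'c, 'q, 'e, 'f) pseudofun" where
  "ps_then B D F G = \<lparr>ps_obj = (\<lambda>X\<in>Obj B. ps_obj G (ps_obj F X)),
     ps_arr = (\<lambda>f\<in>Arr B. ps_arr G (ps_arr F f)),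
     ps_cell = (\<lambda>\<alpha>\<in>Cell B. ps_cell G (ps_cell F \<alpha>)),
     ps_comp = (\<lambda>(f, g)\<in>composable B.
       ps_comp G (ps_arr F f, ps_arr F g) \<cdot>\<^bsub>D\<^esub> ps_cell G (ps_comp F (f, g))),
     ps_unit = (\<lambda>X\<in>Obj B. ps_unit G (ps_obj F X) \<cdot>\<^bsub>D\<^esub> ps_cell G (ps_unit F X))\<rparr>"

definition ps_pair :: "('o, 'a, 'c) bicat \<Rightarrow> ('o, 'a, 'c, 'p, 'b, 'd) pseudofun
    \<Rightarrow> ('o, 'a, 'c, 'q, 'e, 'f) pseudofun
    \<Rightarrow> ('o, 'a, 'c, 'p \<times> 'q, 'b \<times> 'e, 'd \<times> 'f) pseudofun" where
  "ps_pair B F G = \<lparr>ps_obj = (\<lambda>X\<in>Obj B. (ps_obj F X, ps_obj G X)),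
     ps_arr = (\<lambda>f\<in>Arr B. (ps_arr F f, ps_arr G f)),
     ps_cell = (\<lambda>\<alpha>\<in>Cell B. (ps_cell F \<alpha>, ps_cell G \<alpha>)),
     ps_comp = (\<lambda>fg\<in>composable B. (ps_comp F fg, ps_comp G fg)),
     ps_unit = (\<lambda>X\<in>Obj B. (ps_unit F X, ps_unit G X))\<rparr>"

definition ps_prod :: "('o, 'a, 'c) bicat \<Rightarrow> ('o2, 'a2, 'c2) bicat
    \<Rightarrow> ('o, 'a, 'c, 'p, 'b, 'd) pseudofun \<Rightarrow> ('o2, 'a2, 'c2, 'q, 'e, 'f) pseudofun
    \<Rightarrow> ('o \<times> 'o2, 'a \<times> 'a2, 'c \<times> 'c2, 'p \<times> 'q, 'b \<times> 'e, 'd \<times> 'f) pseudofun" where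
  "ps_prod B B' F G = \<lparr>ps_obj = (\<lambda>(X, Y)\<in>Obj (prod_bicat B B'). (ps_obj F X, ps_obj G Y)),
     ps_arr = (\<lambda>(f, g)\<in>Arr (prod_bicat B B'). (ps_arr F f, ps_arr G g)),
     ps_cell = (\<lambda>(\<alpha>, \<beta>)\<in>Cell (prod_bicat B B'). (ps_cell F \<alpha>, ps_cell G \<beta>)),
     ps_comp = (\<lambda>((f, g), (f', g'))\<in>composable (prod_bicat B B').
       (ps_comp F (f, f'), ps_comp G (g, g'))),
     ps_unit = (\<lambda>(X, Y)\<in>Obj (prod_bicat B B'). (ps_unit F X, ps_unit G Y))\<rparr>"


subsection \<open>Operations on pseudonatural transformations\<close>

text \<open>Whiskering \<open>\<sigma>\<close> with a pseudofunctor \<open>H\<close> on the source side, resp. on the target side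
  (\<open>B\<close> and \<open>D\<close> are the source and target bicategories of the result).\<close>

definition pt_pre :: "('o, 'a, 'c) bicat \<Rightarrow> ('q, 'e, 'f) bicat
    \<Rightarrow> ('o, 'a, 'c, 'p, 'b, 'd) pseudofun \<Rightarrow> ('p, 'b, 'd, 'q, 'e, 'f) pseudonat
    \<Rightarrow> ('o, 'a, 'c, 'q, 'e, 'f) pseudonat" where
  "pt_pre B D H \<sigma> = \<lparr>pt_src = ps_then B D H (pt_src \<sigma>), pt_tgt = ps_then B D H (pt_tgt \<sigma>),
     pt_map = (\<lambda>X\<in>Obj B. pt_map \<sigma> (ps_obj H X)),
     pt_nat = (\<lambda>f\<in>Arr B. pt_nat \<sigma> (ps_arr H f))\<rparr>"

definition pt_post :: "('o, 'a, 'c) bicat \<Rightarrow> ('q, 'e, 'f) bicat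
    \<Rightarrow> ('o, 'a, 'c, 'p, 'b, 'd) pseudonat \<Rightarrow> ('p, 'b, 'd, 'q, 'e, 'f) pseudofun
    \<Rightarrow> ('o, 'a, 'c, 'q, 'e, 'f) pseudonat" where
  "pt_post B D \<sigma> H = \<lparr>pt_src = ps_then B D (pt_src \<sigma>) H, pt_tgt = ps_then B D (pt_tgt \<sigma>) H,
     pt_map = (\<lambda>X\<in>Obj B. ps_arr H (pt_map \<sigma> X)),
     pt_nat = (\<lambda>f\<in>Arr B.
       ps_comp H (ps_arr (pt_src \<sigma>) f, pt_map \<sigma> (tgt B f)) \<cdot>\<^bsub>D\<^esub> ps_cell H (pt_nat \<sigma> f)
       \<cdot>\<^bsub>D\<^esub> inv2 D (ps_comp H (pt_map \<sigma> (src B f), ps_arr (pt_tgt \<sigma>) f)))\<rparr>"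

definition pt_prod :: "('o, 'a, 'c) bicat \<Rightarrow> ('o2, 'a2, 'c2) bicat
    \<Rightarrow> ('o, 'a, 'c, 'p, 'b, 'd) pseudonat \<Rightarrow> ('o2, 'a2, 'c2, 'q, 'e, 'f) pseudonat
    \<Rightarrow> ('o \<times> 'o2, 'a \<times> 'a2, 'c \<times> 'c2, 'p \<times> 'q, 'b \<times> 'e, 'd \<times> 'f) pseudonat" where
  "pt_prod B B' \<sigma> \<tau> = \<lparr>pt_src = ps_prod B B' (pt_src \<sigma>) (pt_src \<tau>),
     pt_tgt = ps_prod B B' (pt_tgt \<sigma>) (pt_tgt \<tau>),
     pt_map = (\<lambda>(X, Y)\<in>Obj (prod_bicat B B'). (pt_map \<sigma> X, pt_map \<tau> Y)),
     pt_nat = (\<lambda>(f, g)\<in>Arr (prod_bicat B B'). (pt_nat \<sigma> f, pt_nat \<tau> g))\<rparr>"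


subsection \<open>Pasting\<close>

text \<open>
  Pasting diagrams are expressed on nonempty paths of 1-cells, composed with brackets to the
  right.  \<open>paste B xs us vs ys \<alpha>\<close> is the 2-cell from the path \<open>xs @ us @ ys\<close> to the path
  \<open>xs @ vs @ ys\<close> induced by a 2-cell \<open>\<alpha>\<close> from the path \<open>us\<close> to the path \<open>vs\<close>; the associators
  that pasting diagrams leave implicit are those in \<open>path_split\<close>.
\<close>

fun path :: "('o, 'a, 'c) bicat \<Rightarrow> 'a list \<Rightarrow> 'a" where
  "path B [] = undefined"
| "path B [f] = f"
| "path B (f # g # fs) = f \<star>\<^bsub>B\<^esub> path B (g # fs)"

text \<open>For nonempty \<open>us\<close> and \<open>ys\<close>: the canonical 2-cell from \<open>path us \<star> path ys\<close> to
  \<open>path (us @ ys)\<close>.\<close>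

fun path_split :: "('o, 'a, 'c) bicat \<Rightarrow> 'a list \<Rightarrow> 'a list \<Rightarrow> 'c" where
  "path_split B [] ys = undefined"
| "path_split B [f] ys = id2 B (f \<star>\<^bsub>B\<^esub> path B ys)"
| "path_split B (f # g # us) ys =
     associator B f (path B (g # us)) (path B ys) \<cdot>\<^bsub>B\<^esub> (id2 B f \<ast>\<^bsub>B\<^esub> path_split B (g # us) ys)"

definition paste :: "('o, 'a, 'c) bicat \<Rightarrow> 'a list \<Rightarrow> 'a list \<Rightarrow> 'a list \<Rightarrow> 'a list \<Rightarrow> 'c \<Rightarrow> 'c" where
  "paste B xs us vs ys \<alpha> = foldr (\<lambda>f \<gamma>. id2 B f \<ast>\<^bsub>B\<^esub> \<gamma>) xs
     (if ys = [] then \<alpha>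
      else inv2 B (path_split B us ys) \<cdot>\<^bsub>B\<^esub> (\<alpha> \<ast>\<^bsub>B\<^esub> id2 B (path B ys)) \<cdot>\<^bsub>B\<^esub> path_split B vs ys)"

text \<open>The canonical 2-cell from \<open>path (map (ps_arr H) fs)\<close> to \<open>ps_arr H (path fs)\<close>, and the
  2-cell between paths of images under \<open>H\<close> induced by a 2-cell between paths.\<close>

fun ps_path :: "('o, 'a, 'c) bicat \<Rightarrow> ('p, 'b, 'd) bicat \<Rightarrow> ('o, 'a, 'c, 'p, 'b, 'd) pseudofun
    \<Rightarrow> 'a list \<Rightarrow> 'd" where
  "ps_path B C H [] = undefined"
| "ps_path B C H [f] = id2 C (ps_arr H f)"
| "ps_path B C H (f # g # fs) =
     (id2 C (ps_arr H f) \<ast>\<^bsub>C\<^esub> ps_path B C H (g # fs)) \<cdot>\<^bsub>C\<^esub> ps_comp H (f, path B (g # fs))"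

definition ps_on_paths :: "('o, 'a, 'c) bicat \<Rightarrow> ('p, 'b, 'd) bicat
    \<Rightarrow> ('o, 'a, 'c, 'p, 'b, 'd) pseudofun \<Rightarrow> 'a list \<Rightarrow> 'a list \<Rightarrow> 'c \<Rightarrow> 'd" where
  "ps_on_paths B C H us vs \<alpha> =
     ps_path B C H us \<cdot>\<^bsub>C\<^esub> ps_cell H \<alpha> \<cdot>\<^bsub>C\<^esub> inv2 C (ps_path B C H vs)"


section \<open>Monoidal bicategories\<close>

text \<open>
  A monoidal bicategory is a tricategory with one object, in the sense of Gordon, Power and Street;
  \<open>B\<close> is its only hom-bicategory, \<open>T\<close> the composition homomorphism \<open>B \<times> B \<rightarrow> B\<close> and \<open>U\<close> the unit
  homomorphism \<open>1 \<rightarrow> B\<close>.  Since \<open>l\<close> has components \<open>I \<otimes> X \<rightarrow> X\<close> while \<open>r\<close> has components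
  \<open>X \<rightarrow> X \<otimes> I\<close>, the cells \<open>\<mu>\<close> and \<open>\<rho>\<close> and the axioms need no chosen pseudo-inverses.
\<close>

locale monoidal_bicategory_data =
  fixes B :: "('o, 'a, 'c) bicat" (structure)
    and T :: "('o \<times> 'o, 'a \<times> 'a, 'c \<times> 'c, 'o, 'a, 'c) pseudofun"
    and U :: "(unit, unit, unit, 'o, 'a, 'c) pseudofun"
    and a :: "(('o \<times> 'o) \<times> 'o, ('a \<times> 'a) \<times> 'a, ('c \<times> 'c) \<times> 'c, 'o, 'a, 'c) pseudonat"
    and l :: "('o, 'a, 'c, 'o, 'a, 'c) pseudonat"
    and r :: "('o, 'a, 'c, 'o, 'a, 'c) pseudonat"
    and \<pi> :: "(('o \<times> 'o) \<times> 'o) \<times> 'o \<Rightarrow> 'c"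
    and \<mu> :: "'o \<times> 'o \<Rightarrow> 'c"
    and \<Lambda> :: "'o \<times> 'o \<Rightarrow> 'c"
    and \<rho> :: "'o \<times> 'o \<Rightarrow> 'c"
begin

abbreviation "B2 \<equiv> prod_bicat B B"
abbreviation "B3 \<equiv> prod_bicat B2 B"
abbreviation "B4 \<equiv> prod_bicat B3 B"

abbreviation "IdB \<equiv> ps_id B"
abbreviation "IdBB \<equiv> ps_id B2"
abbreviation "IdPt \<equiv> pt_id B B IdB"

text \<open>The pseudofunctor \<open>X \<rightarrow> B\<close> constant at the unit.\<close>
abbreviation "unit_on X \<equiv> ps_then X B (ps_bang X) U"

subsection \<open>Sources and targets of the structural cells\<close>

text \<open>\<open>(X \<otimes> Y) \<otimes> Z\<close> and \<open>X \<otimes> (Y \<otimes> Z)\<close>\<close>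
definition "tens_left = ps_then B3 B (ps_prod B2 B T IdB) T"
definition "tens_right =
  ps_then B3 B (ps_then B3 B2 (ps_reassoc B B B) (ps_prod B B2 IdB T)) T"

text \<open>\<open>I \<otimes> X\<close> and \<open>X \<otimes> I\<close>\<close>
definition "unit_tens = ps_then B B (ps_pair B (unit_on B) IdB) T"
definition "tens_unit = ps_then B B (ps_pair B IdB (unit_on B)) T"

text \<open>\<open>(W, X, Y, Z) \<mapsto> (W, X \<otimes> Y, Z)\<close>, \<open>(W \<otimes> X, Y, Z)\<close>, \<open>(W, X, Y \<otimes> Z)\<close> and \<open>(W, (X, Y, Z))\<close>\<close>
definition "mid_tens =
  ps_prod B3 B (ps_then B3 B2 (ps_reassoc B B B) (ps_prod B B2 IdB T)) IdB"
definition "fst_tens = ps_prod B3 B (ps_prod B2 B T IdB) IdB"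
definition "lst_tens = ps_then B4 B3 (ps_reassoc B2 B B) (ps_prod B2 B2 IdBB T)"
definition "split_fst = ps_strict B4 (prod_bicat B B3)
  (\<lambda>(((W, X), Y), Z). (W, ((X, Y), Z))) (\<lambda>(((f, g), h), k). (f, ((g, h), k)))
  (\<lambda>(((\<alpha>, \<beta>), \<gamma>), \<delta>). (\<alpha>, ((\<beta>, \<gamma>), \<delta>)))"

text \<open>\<open>(X, Y) \<mapsto> (I, X, Y)\<close>, \<open>(X, I, Y)\<close> and \<open>(X, Y, I)\<close>\<close>
definition "ins_fst = ps_prod B B (ps_pair B (unit_on B) IdB) IdB"
definition "ins_mid = ps_prod B B (ps_pair B IdB (unit_on B)) IdB"
definition "ins_lst = ps_pair B2 IdBB (unit_on B2)"

text \<open>\<open>\<pi>\<close> goes from \<open>(a \<otimes> 1) a (1 \<otimes> a)\<close> to \<open>a a\<close>.\<close>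
definition "pi_src = pt_then B4 B (pt_post B4 B (pt_prod B3 B a IdPt) T)
  (pt_then B4 B (pt_pre B4 B mid_tens a)
    (pt_post B4 B (pt_pre B4 B2 split_fst (pt_prod B B3 IdPt a)) T))"
definition "pi_tgt = pt_then B4 B (pt_pre B4 B fst_tens a) (pt_pre B4 B lst_tens a)"

text \<open>\<open>\<mu>\<close> goes from \<open>(r \<otimes> 1) a (1 \<otimes> l)\<close> to the identity.\<close>
definition "mu_src = pt_then B2 B (pt_post B2 B (pt_prod B B r IdPt) T)
  (pt_then B2 B (pt_pre B2 B ins_mid a) (pt_post B2 B (pt_prod B B IdPt l) T))"
definition "mu_tgt = pt_id B2 B T"

text \<open>\<open>\<Lambda>\<close> goes from \<open>l \<otimes> 1\<close> to \<open>a l\<close>.\<close>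
definition "lam_src = pt_post B2 B (pt_prod B B l IdPt) T"
definition "lam_tgt = pt_then B2 B (pt_pre B2 B ins_fst a) (pt_pre B2 B T l)"

text \<open>\<open>\<rho>\<close> goes from \<open>1 \<otimes> r\<close> to \<open>r a\<close>.\<close>
definition "rho_src = pt_post B2 B (pt_prod B B IdPt r) T"
definition "rho_tgt = pt_then B2 B (pt_pre B2 B T r) (pt_pre B2 B ins_lst a)"

subsection \<open>Notation for the axioms\<close>

abbreviation tens0 (infixr "\<boxtimes>\<^sub>0" 80) where "X \<boxtimes>\<^sub>0 Y \<equiv> ps_obj T (X, Y)"
abbreviation tens1 (infixr "\<boxtimes>\<^sub>1" 80) where "f \<boxtimes>\<^sub>1 g \<equiv> ps_arr T (f, g)"
abbreviation tens2 (infixr "\<boxtimes>\<^sub>2" 80) where "\<alpha> \<boxtimes>\<^sub>2 \<beta> \<equiv> ps_cell T (\<alpha>, \<beta>)"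
abbreviation "I \<equiv> ps_obj U ()"
abbreviation "i X \<equiv> id1 B X"
abbreviation "as X Y Z \<equiv> pt_map a ((X, Y), Z)"
abbreviation "lu X \<equiv> pt_map l X"
abbreviation "ru X \<equiv> pt_map r X"
abbreviation "asn f g h \<equiv> pt_nat a ((f, g), h)"

text \<open>The 2-cell from \<open>i X \<boxtimes>\<^sub>1 i Y\<close> to \<open>i (X \<boxtimes>\<^sub>0 Y)\<close>.\<close>
definition "tu X Y = inv2 B (ps_unit T (X, Y))"

text \<open>The pseudofunctors \<open>W \<otimes> -\<close> and \<open>- \<otimes> Z\<close>, used for whiskering with the tensor product.\<close>
definition "tens_l W = ps_then B B (ps_pair B (ps_const B B W) IdB) T"
definition "tens_r Z = ps_then B B (ps_pair B IdB (ps_const B B Z)) T"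

subsection \<open>The two sides of the axioms\<close>

text \<open>The nonabelian 4-cocycle condition\<close>

definition "cocycle_left V W X Y Z =
  paste B []
    [(as V W X \<boxtimes>\<^sub>1 i Y) \<boxtimes>\<^sub>1 i Z, as V (W \<boxtimes>\<^sub>0 X) Y \<boxtimes>\<^sub>1 i Z, (i V \<boxtimes>\<^sub>1 as W X Y) \<boxtimes>\<^sub>1 i Z]
    [as (V \<boxtimes>\<^sub>0 W) X Y \<boxtimes>\<^sub>1 i Z, as V W (X \<boxtimes>\<^sub>0 Y) \<boxtimes>\<^sub>1 i Z]
    [as V (W \<boxtimes>\<^sub>0 (X \<boxtimes>\<^sub>0 Y)) Z, i V \<boxtimes>\<^sub>1 as W (X \<boxtimes>\<^sub>0 Y) Z, i V \<boxtimes>\<^sub>1 (i W \<boxtimes>\<^sub>1 as X Y Z)]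
    (ps_on_paths B B (tens_r Z)
      [as V W X \<boxtimes>\<^sub>1 i Y, as V (W \<boxtimes>\<^sub>0 X) Y, i V \<boxtimes>\<^sub>1 as W X Y]
      [as (V \<boxtimes>\<^sub>0 W) X Y, as V W (X \<boxtimes>\<^sub>0 Y)]
      (\<pi> (((V, W), X), Y)))
  \<cdot> paste B [as (V \<boxtimes>\<^sub>0 W) X Y \<boxtimes>\<^sub>1 i Z]
    [as V W (X \<boxtimes>\<^sub>0 Y) \<boxtimes>\<^sub>1 i Z, as V (W \<boxtimes>\<^sub>0 (X \<boxtimes>\<^sub>0 Y)) Z, i V \<boxtimes>\<^sub>1 as W (X \<boxtimes>\<^sub>0 Y) Z]
    [as (V \<boxtimes>\<^sub>0 W) (X \<boxtimes>\<^sub>0 Y) Z, as V W ((X \<boxtimes>\<^sub>0 Y) \<boxtimes>\<^sub>0 Z)]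
    [i V \<boxtimes>\<^sub>1 (i W \<boxtimes>\<^sub>1 as X Y Z)]
    (\<pi> (((V, W), X \<boxtimes>\<^sub>0 Y), Z))
  \<cdot> paste B [as (V \<boxtimes>\<^sub>0 W) X Y \<boxtimes>\<^sub>1 i Z, as (V \<boxtimes>\<^sub>0 W) (X \<boxtimes>\<^sub>0 Y) Z]
    [as V W ((X \<boxtimes>\<^sub>0 Y) \<boxtimes>\<^sub>0 Z), i V \<boxtimes>\<^sub>1 (i W \<boxtimes>\<^sub>1 as X Y Z)]
    [(i V \<boxtimes>\<^sub>1 i W) \<boxtimes>\<^sub>1 as X Y Z, as V W (X \<boxtimes>\<^sub>0 (Y \<boxtimes>\<^sub>0 Z))]
    []
    (inv2 B (asn (i V) (i W) (as X Y Z)))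
  \<cdot> paste B [as (V \<boxtimes>\<^sub>0 W) X Y \<boxtimes>\<^sub>1 i Z, as (V \<boxtimes>\<^sub>0 W) (X \<boxtimes>\<^sub>0 Y) Z]
    [(i V \<boxtimes>\<^sub>1 i W) \<boxtimes>\<^sub>1 as X Y Z]
    [i (V \<boxtimes>\<^sub>0 W) \<boxtimes>\<^sub>1 as X Y Z]
    [as V W (X \<boxtimes>\<^sub>0 (Y \<boxtimes>\<^sub>0 Z))]
    (tu V W \<boxtimes>\<^sub>2 id2 B (as X Y Z))
  \<cdot> paste B []
    [as (V \<boxtimes>\<^sub>0 W) X Y \<boxtimes>\<^sub>1 i Z, as (V \<boxtimes>\<^sub>0 W) (X \<boxtimes>\<^sub>0 Y) Z, i (V \<boxtimes>\<^sub>0 W) \<boxtimes>\<^sub>1 as X Y Z]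
    [as ((V \<boxtimes>\<^sub>0 W) \<boxtimes>\<^sub>0 X) Y Z, as (V \<boxtimes>\<^sub>0 W) X (Y \<boxtimes>\<^sub>0 Z)]
    [as V W (X \<boxtimes>\<^sub>0 (Y \<boxtimes>\<^sub>0 Z))]
    (\<pi> (((V \<boxtimes>\<^sub>0 W, X), Y), Z))"

definition "cocycle_right V W X Y Z =
  paste B
    [(as V W X \<boxtimes>\<^sub>1 i Y) \<boxtimes>\<^sub>1 i Z, as V (W \<boxtimes>\<^sub>0 X) Y \<boxtimes>\<^sub>1 i Z]
    [(i V \<boxtimes>\<^sub>1 as W X Y) \<boxtimes>\<^sub>1 i Z, as V (W \<boxtimes>\<^sub>0 (X \<boxtimes>\<^sub>0 Y)) Z]
    [as V ((W \<boxtimes>\<^sub>0 X) \<boxtimes>\<^sub>0 Y) Z, i V \<boxtimes>\<^sub>1 (as W X Y \<boxtimes>\<^sub>1 i Z)]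
    [i V \<boxtimes>\<^sub>1 as W (X \<boxtimes>\<^sub>0 Y) Z, i V \<boxtimes>\<^sub>1 (i W \<boxtimes>\<^sub>1 as X Y Z)]
    (asn (i V) (as W X Y) (i Z))
  \<cdot> paste B
    [(as V W X \<boxtimes>\<^sub>1 i Y) \<boxtimes>\<^sub>1 i Z, as V (W \<boxtimes>\<^sub>0 X) Y \<boxtimes>\<^sub>1 i Z, as V ((W \<boxtimes>\<^sub>0 X) \<boxtimes>\<^sub>0 Y) Z]
    [i V \<boxtimes>\<^sub>1 (as W X Y \<boxtimes>\<^sub>1 i Z), i V \<boxtimes>\<^sub>1 as W (X \<boxtimes>\<^sub>0 Y) Z, i V \<boxtimes>\<^sub>1 (i W \<boxtimes>\<^sub>1 as X Y Z)]
    [i V \<boxtimes>\<^sub>1 as (W \<boxtimes>\<^sub>0 X) Y Z, i V \<boxtimes>\<^sub>1 as W X (Y \<boxtimes>\<^sub>0 Z)]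
    []
    (ps_on_paths B B (tens_l V)
      [as W X Y \<boxtimes>\<^sub>1 i Z, as W (X \<boxtimes>\<^sub>0 Y) Z, i W \<boxtimes>\<^sub>1 as X Y Z]
      [as (W \<boxtimes>\<^sub>0 X) Y Z, as W X (Y \<boxtimes>\<^sub>0 Z)]
      (\<pi> (((W, X), Y), Z)))
  \<cdot> paste B [(as V W X \<boxtimes>\<^sub>1 i Y) \<boxtimes>\<^sub>1 i Z]
    [as V (W \<boxtimes>\<^sub>0 X) Y \<boxtimes>\<^sub>1 i Z, as V ((W \<boxtimes>\<^sub>0 X) \<boxtimes>\<^sub>0 Y) Z, i V \<boxtimes>\<^sub>1 as (W \<boxtimes>\<^sub>0 X) Y Z]
    [as (V \<boxtimes>\<^sub>0 (W \<boxtimes>\<^sub>0 X)) Y Z, as V (W \<boxtimes>\<^sub>0 X) (Y \<boxtimes>\<^sub>0 Z)]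
    [i V \<boxtimes>\<^sub>1 as W X (Y \<boxtimes>\<^sub>0 Z)]
    (\<pi> (((V, W \<boxtimes>\<^sub>0 X), Y), Z))
  \<cdot> paste B []
    [(as V W X \<boxtimes>\<^sub>1 i Y) \<boxtimes>\<^sub>1 i Z, as (V \<boxtimes>\<^sub>0 (W \<boxtimes>\<^sub>0 X)) Y Z]
    [as ((V \<boxtimes>\<^sub>0 W) \<boxtimes>\<^sub>0 X) Y Z, as V W X \<boxtimes>\<^sub>1 (i Y \<boxtimes>\<^sub>1 i Z)]
    [as V (W \<boxtimes>\<^sub>0 X) (Y \<boxtimes>\<^sub>0 Z), i V \<boxtimes>\<^sub>1 as W X (Y \<boxtimes>\<^sub>0 Z)]
    (asn (as V W X) (i Y) (i Z))
  \<cdot> paste B [as ((V \<boxtimes>\<^sub>0 W) \<boxtimes>\<^sub>0 X) Y Z]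
    [as V W X \<boxtimes>\<^sub>1 (i Y \<boxtimes>\<^sub>1 i Z)]
    [as V W X \<boxtimes>\<^sub>1 i (Y \<boxtimes>\<^sub>0 Z)]
    [as V (W \<boxtimes>\<^sub>0 X) (Y \<boxtimes>\<^sub>0 Z), i V \<boxtimes>\<^sub>1 as W X (Y \<boxtimes>\<^sub>0 Z)]
    (id2 B (as V W X) \<boxtimes>\<^sub>2 tu Y Z)
  \<cdot> paste B [as ((V \<boxtimes>\<^sub>0 W) \<boxtimes>\<^sub>0 X) Y Z]
    [as V W X \<boxtimes>\<^sub>1 i (Y \<boxtimes>\<^sub>0 Z), as V (W \<boxtimes>\<^sub>0 X) (Y \<boxtimes>\<^sub>0 Z), i V \<boxtimes>\<^sub>1 as W X (Y \<boxtimes>\<^sub>0 Z)]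
    [as (V \<boxtimes>\<^sub>0 W) X (Y \<boxtimes>\<^sub>0 Z), as V W (X \<boxtimes>\<^sub>0 (Y \<boxtimes>\<^sub>0 Z))]
    []
    (\<pi> (((V, W), X), Y \<boxtimes>\<^sub>0 Z))"

text \<open>Left normalization\<close>

definition "left_norm_left X Y Z =
  paste B [(ru X \<boxtimes>\<^sub>1 i Y) \<boxtimes>\<^sub>1 i Z]
    [as X I Y \<boxtimes>\<^sub>1 i Z, as X (I \<boxtimes>\<^sub>0 Y) Z, i X \<boxtimes>\<^sub>1 as I Y Z]
    [as (X \<boxtimes>\<^sub>0 I) Y Z, as X I (Y \<boxtimes>\<^sub>0 Z)]
    [i X \<boxtimes>\<^sub>1 lu (Y \<boxtimes>\<^sub>0 Z)]
    (\<pi> (((X, I), Y), Z))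
  \<cdot> paste B []
    [(ru X \<boxtimes>\<^sub>1 i Y) \<boxtimes>\<^sub>1 i Z, as (X \<boxtimes>\<^sub>0 I) Y Z]
    [as X Y Z, ru X \<boxtimes>\<^sub>1 (i Y \<boxtimes>\<^sub>1 i Z)]
    [as X I (Y \<boxtimes>\<^sub>0 Z), i X \<boxtimes>\<^sub>1 lu (Y \<boxtimes>\<^sub>0 Z)]
    (asn (ru X) (i Y) (i Z))
  \<cdot> paste B [as X Y Z]
    [ru X \<boxtimes>\<^sub>1 (i Y \<boxtimes>\<^sub>1 i Z)]
    [ru X \<boxtimes>\<^sub>1 i (Y \<boxtimes>\<^sub>0 Z)]
    [as X I (Y \<boxtimes>\<^sub>0 Z), i X \<boxtimes>\<^sub>1 lu (Y \<boxtimes>\<^sub>0 Z)]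
    (id2 B (ru X) \<boxtimes>\<^sub>2 tu Y Z)
  \<cdot> paste B [as X Y Z]
    [ru X \<boxtimes>\<^sub>1 i (Y \<boxtimes>\<^sub>0 Z), as X I (Y \<boxtimes>\<^sub>0 Z), i X \<boxtimes>\<^sub>1 lu (Y \<boxtimes>\<^sub>0 Z)]
    [i (X \<boxtimes>\<^sub>0 (Y \<boxtimes>\<^sub>0 Z))]
    []
    (\<mu> (X, Y \<boxtimes>\<^sub>0 Z))
  \<cdot> paste B []
    [as X Y Z, i (X \<boxtimes>\<^sub>0 (Y \<boxtimes>\<^sub>0 Z))]
    [as X Y Z]
    []
    (runitor B (as X Y Z))"

definition "left_norm_right X Y Z =
  paste B [(ru X \<boxtimes>\<^sub>1 i Y) \<boxtimes>\<^sub>1 i Z, as X I Y \<boxtimes>\<^sub>1 i Z, as X (I \<boxtimes>\<^sub>0 Y) Z]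
    [i X \<boxtimes>\<^sub>1 as I Y Z, i X \<boxtimes>\<^sub>1 lu (Y \<boxtimes>\<^sub>0 Z)]
    [i X \<boxtimes>\<^sub>1 (lu Y \<boxtimes>\<^sub>1 i Z)]
    []
    (inv2 B (ps_on_paths B B (tens_l X) [lu Y \<boxtimes>\<^sub>1 i Z] [as I Y Z, lu (Y \<boxtimes>\<^sub>0 Z)] (\<Lambda> (Y, Z))))
  \<cdot> paste B [(ru X \<boxtimes>\<^sub>1 i Y) \<boxtimes>\<^sub>1 i Z, as X I Y \<boxtimes>\<^sub>1 i Z]
    [as X (I \<boxtimes>\<^sub>0 Y) Z, i X \<boxtimes>\<^sub>1 (lu Y \<boxtimes>\<^sub>1 i Z)]
    [(i X \<boxtimes>\<^sub>1 lu Y) \<boxtimes>\<^sub>1 i Z, as X Y Z]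
    []
    (inv2 B (asn (i X) (lu Y) (i Z)))
  \<cdot> paste B []
    [(ru X \<boxtimes>\<^sub>1 i Y) \<boxtimes>\<^sub>1 i Z, as X I Y \<boxtimes>\<^sub>1 i Z, (i X \<boxtimes>\<^sub>1 lu Y) \<boxtimes>\<^sub>1 i Z]
    [i (X \<boxtimes>\<^sub>0 Y) \<boxtimes>\<^sub>1 i Z]
    [as X Y Z]
    (ps_on_paths B B (tens_r Z)
      [ru X \<boxtimes>\<^sub>1 i Y, as X I Y, i X \<boxtimes>\<^sub>1 lu Y] [i (X \<boxtimes>\<^sub>0 Y)] (\<mu> (X, Y)))
  \<cdot> paste B []
    [i (X \<boxtimes>\<^sub>0 Y) \<boxtimes>\<^sub>1 i Z]
    [i ((X \<boxtimes>\<^sub>0 Y) \<boxtimes>\<^sub>0 Z)]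
    [as X Y Z]
    (tu (X \<boxtimes>\<^sub>0 Y) Z)
  \<cdot> paste B []
    [i ((X \<boxtimes>\<^sub>0 Y) \<boxtimes>\<^sub>0 Z), as X Y Z]
    [as X Y Z]
    []
    (lunitor B (as X Y Z))"

text \<open>Right normalization\<close>

definition "right_norm_left X Y Z =
  paste B [ru (X \<boxtimes>\<^sub>0 Y) \<boxtimes>\<^sub>1 i Z]
    [as X Y I \<boxtimes>\<^sub>1 i Z, as X (Y \<boxtimes>\<^sub>0 I) Z, i X \<boxtimes>\<^sub>1 as Y I Z]
    [as (X \<boxtimes>\<^sub>0 Y) I Z, as X Y (I \<boxtimes>\<^sub>0 Z)]
    [i X \<boxtimes>\<^sub>1 (i Y \<boxtimes>\<^sub>1 lu Z)]
    (\<pi> (((X, Y), I), Z))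
  \<cdot> paste B [ru (X \<boxtimes>\<^sub>0 Y) \<boxtimes>\<^sub>1 i Z, as (X \<boxtimes>\<^sub>0 Y) I Z]
    [as X Y (I \<boxtimes>\<^sub>0 Z), i X \<boxtimes>\<^sub>1 (i Y \<boxtimes>\<^sub>1 lu Z)]
    [(i X \<boxtimes>\<^sub>1 i Y) \<boxtimes>\<^sub>1 lu Z, as X Y Z]
    []
    (inv2 B (asn (i X) (i Y) (lu Z)))
  \<cdot> paste B [ru (X \<boxtimes>\<^sub>0 Y) \<boxtimes>\<^sub>1 i Z, as (X \<boxtimes>\<^sub>0 Y) I Z]
    [(i X \<boxtimes>\<^sub>1 i Y) \<boxtimes>\<^sub>1 lu Z]
    [i (X \<boxtimes>\<^sub>0 Y) \<boxtimes>\<^sub>1 lu Z]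
    [as X Y Z]
    (tu X Y \<boxtimes>\<^sub>2 id2 B (lu Z))
  \<cdot> paste B []
    [ru (X \<boxtimes>\<^sub>0 Y) \<boxtimes>\<^sub>1 i Z, as (X \<boxtimes>\<^sub>0 Y) I Z, i (X \<boxtimes>\<^sub>0 Y) \<boxtimes>\<^sub>1 lu Z]
    [i ((X \<boxtimes>\<^sub>0 Y) \<boxtimes>\<^sub>0 Z)]
    [as X Y Z]
    (\<mu> (X \<boxtimes>\<^sub>0 Y, Z))
  \<cdot> paste B []
    [i ((X \<boxtimes>\<^sub>0 Y) \<boxtimes>\<^sub>0 Z), as X Y Z]
    [as X Y Z]
    []
    (lunitor B (as X Y Z))"

definition "right_norm_right X Y Z =
  paste B []
    [ru (X \<boxtimes>\<^sub>0 Y) \<boxtimes>\<^sub>1 i Z, as X Y I \<boxtimes>\<^sub>1 i Z]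
    [(i X \<boxtimes>\<^sub>1 ru Y) \<boxtimes>\<^sub>1 i Z]
    [as X (Y \<boxtimes>\<^sub>0 I) Z, i X \<boxtimes>\<^sub>1 as Y I Z, i X \<boxtimes>\<^sub>1 (i Y \<boxtimes>\<^sub>1 lu Z)]
    (inv2 B (ps_on_paths B B (tens_r Z) [i X \<boxtimes>\<^sub>1 ru Y] [ru (X \<boxtimes>\<^sub>0 Y), as X Y I] (\<rho> (X, Y))))
  \<cdot> paste B []
    [(i X \<boxtimes>\<^sub>1 ru Y) \<boxtimes>\<^sub>1 i Z, as X (Y \<boxtimes>\<^sub>0 I) Z]
    [as X Y Z, i X \<boxtimes>\<^sub>1 (ru Y \<boxtimes>\<^sub>1 i Z)]
    [i X \<boxtimes>\<^sub>1 as Y I Z, i X \<boxtimes>\<^sub>1 (i Y \<boxtimes>\<^sub>1 lu Z)]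
    (asn (i X) (ru Y) (i Z))
  \<cdot> paste B [as X Y Z]
    [i X \<boxtimes>\<^sub>1 (ru Y \<boxtimes>\<^sub>1 i Z), i X \<boxtimes>\<^sub>1 as Y I Z, i X \<boxtimes>\<^sub>1 (i Y \<boxtimes>\<^sub>1 lu Z)]
    [i X \<boxtimes>\<^sub>1 i (Y \<boxtimes>\<^sub>0 Z)]
    []
    (ps_on_paths B B (tens_l X)
      [ru Y \<boxtimes>\<^sub>1 i Z, as Y I Z, i Y \<boxtimes>\<^sub>1 lu Z] [i (Y \<boxtimes>\<^sub>0 Z)] (\<mu> (Y, Z)))
  \<cdot> paste B [as X Y Z]
    [i X \<boxtimes>\<^sub>1 i (Y \<boxtimes>\<^sub>0 Z)]
    [i (X \<boxtimes>\<^sub>0 (Y \<boxtimes>\<^sub>0 Z))]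
    []
    (tu X (Y \<boxtimes>\<^sub>0 Z))
  \<cdot> paste B []
    [as X Y Z, i (X \<boxtimes>\<^sub>0 (Y \<boxtimes>\<^sub>0 Z))]
    [as X Y Z]
    []
    (runitor B (as X Y Z))"

end

locale monoidal_bicategory = monoidal_bicategory_data B T U a l r \<pi> \<mu> \<Lambda> \<rho> + bicategory B
  for B :: "('o, 'a, 'c) bicat" (structure) and T U a l r \<pi> \<mu> \<Lambda> \<rho> +
  assumes tensor: "pseudofunctor B2 B T"
    and unit: "pseudofunctor unit_bicat B U"
    and a_equiv: "pseudonatural_equivalence B3 B tens_left tens_right a"
    and l_equiv: "pseudonatural_equivalence B B unit_tens IdB l"
    and r_equiv: "pseudonatural_equivalence B B IdB tens_unit r"
    and pi_modif: "invertible_modification B4 B pi_src pi_tgt \<pi>"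
    and mu_modif: "invertible_modification B2 B mu_src mu_tgt \<mu>"
    and lam_modif: "invertible_modification B2 B lam_src lam_tgt \<Lambda>"
    and rho_modif: "invertible_modification B2 B rho_src rho_tgt \<rho>"
    and cocycle: "\<lbrakk>V \<in> Obj B; W \<in> Obj B; X \<in> Obj B; Y \<in> Obj B; Z \<in> Obj B\<rbrakk>
          \<Longrightarrow> cocycle_left V W X Y Z = cocycle_right V W X Y Z"
    and left_norm: "\<lbrakk>X \<in> Obj B; Y \<in> Obj B; Z \<in> Obj B\<rbrakk>
          \<Longrightarrow> left_norm_left X Y Z = left_norm_right X Y Z"
    and right_norm: "\<lbrakk>X \<in> Obj B; Y \<in> Obj B; Z \<in> Obj B\<rbrakk>
          \<Longrightarrow> right_norm_left X Y Z = right_norm_right X Y Z"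


section \<open>Categorical groups\<close>

record ('x, 'm) cat_group =
  GObj :: "'x set"
  GMor :: "'m set"
  gdom :: "'m \<Rightarrow> 'x"
  gcod :: "'m \<Rightarrow> 'x"
  gid :: "'x \<Rightarrow> 'm"
  gcomp :: "'m \<Rightarrow> 'm \<Rightarrow> 'm"
  gmul0 :: "'x \<Rightarrow> 'x \<Rightarrow> 'x"
  gmul1 :: "'m \<Rightarrow> 'm \<Rightarrow> 'm"
  ginv0 :: "'x \<Rightarrow> 'x"
  ginv1 :: "'m \<Rightarrow> 'm"
  gone :: "'x"

definition ghom :: "('x, 'm) cat_group \<Rightarrow> 'x \<Rightarrow> 'x \<Rightarrow> 'm set" where
  "ghom G X Y = {f \<in> GMor G. gdom G f = X \<and> gcod G f = Y}"

locale categorical_group =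
  fixes G :: "('x, 'm) cat_group"
  assumes
    \<comment> \<open>groupoid\<close>
    gdom_in: "f \<in> GMor G \<Longrightarrow> gdom G f \<in> GObj G"
    and gcod_in: "f \<in> GMor G \<Longrightarrow> gcod G f \<in> GObj G"
    and gid_hom: "X \<in> GObj G \<Longrightarrow> gid G X \<in> ghom G X X"
    and gcomp_hom: "\<lbrakk>f \<in> ghom G X Y; g \<in> ghom G Y Z\<rbrakk> \<Longrightarrow> gcomp G f g \<in> ghom G X Z"
    and gcomp_assoc: "\<lbrakk>f \<in> ghom G W X; g \<in> ghom G X Y; h \<in> ghom G Y Z\<rbrakk>
          \<Longrightarrow> gcomp G (gcomp G f g) h = gcomp G f (gcomp G g h)"
    and gcomp_gid: "f \<in> ghom G X Y \<Longrightarrow> gcomp G (gid G X) f = f"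
          "f \<in> ghom G X Y \<Longrightarrow> gcomp G f (gid G Y) = f"
    and groupoid: "f \<in> ghom G X Y
          \<Longrightarrow> \<exists>g\<in>ghom G Y X. gcomp G f g = gid G X \<and> gcomp G g f = gid G Y"
    \<comment> \<open>the product functor\<close>
    and gmul0_in: "\<lbrakk>X \<in> GObj G; Y \<in> GObj G\<rbrakk> \<Longrightarrow> gmul0 G X Y \<in> GObj G"
    and gmul1_hom: "\<lbrakk>f \<in> ghom G X X'; g \<in> ghom G Y Y'\<rbrakk>
          \<Longrightarrow> gmul1 G f g \<in> ghom G (gmul0 G X Y) (gmul0 G X' Y')"
    and gmul1_gid: "\<lbrakk>X \<in> GObj G; Y \<in> GObj G\<rbrakk>
          \<Longrightarrow> gmul1 G (gid G X) (gid G Y) = gid G (gmul0 G X Y)"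
    and gmul1_gcomp: "\<lbrakk>f \<in> ghom G X X'; f' \<in> ghom G X' X''; g \<in> ghom G Y Y'; g' \<in> ghom G Y' Y''\<rbrakk>
          \<Longrightarrow> gmul1 G (gcomp G f f') (gcomp G g g') = gcomp G (gmul1 G f g) (gmul1 G f' g')"
    \<comment> \<open>the inverse functor\<close>
    and ginv0_in: "X \<in> GObj G \<Longrightarrow> ginv0 G X \<in> GObj G"
    and ginv1_hom: "f \<in> ghom G X Y \<Longrightarrow> ginv1 G f \<in> ghom G (ginv0 G X) (ginv0 G Y)"
    and ginv1_gid: "X \<in> GObj G \<Longrightarrow> ginv1 G (gid G X) = gid G (ginv0 G X)"
    and ginv1_gcomp: "\<lbrakk>f \<in> ghom G X Y; g \<in> ghom G Y Z\<rbrakk>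
          \<Longrightarrow> ginv1 G (gcomp G f g) = gcomp G (ginv1 G f) (ginv1 G g)"
    \<comment> \<open>strict group laws, as equalities of functors\<close>
    and gone_in: "gone G \<in> GObj G"
    and gmul0_assoc: "\<lbrakk>X \<in> GObj G; Y \<in> GObj G; Z \<in> GObj G\<rbrakk>
          \<Longrightarrow> gmul0 G (gmul0 G X Y) Z = gmul0 G X (gmul0 G Y Z)"
    and gmul1_assoc: "\<lbrakk>f \<in> GMor G; g \<in> GMor G; h \<in> GMor G\<rbrakk>
          \<Longrightarrow> gmul1 G (gmul1 G f g) h = gmul1 G f (gmul1 G g h)"
    and gmul0_gone: "X \<in> GObj G \<Longrightarrow> gmul0 G (gone G) X = X" "X \<in> GObj G \<Longrightarrow> gmul0 G X (gone G) = X"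
    and gmul1_gone: "f \<in> GMor G \<Longrightarrow> gmul1 G (gid G (gone G)) f = f"
          "f \<in> GMor G \<Longrightarrow> gmul1 G f (gid G (gone G)) = f"
    and gmul0_ginv0: "X \<in> GObj G \<Longrightarrow> gmul0 G (ginv0 G X) X = gone G"
          "X \<in> GObj G \<Longrightarrow> gmul0 G X (ginv0 G X) = gone G"
    and gmul1_ginv1: "f \<in> GMor G \<Longrightarrow> gmul1 G (ginv1 G f) f = gid G (gone G)"
          "f \<in> GMor G \<Longrightarrow> gmul1 G f (ginv1 G f) = gid G (gone G)"

definition closure :: "('x, 'm) cat_group \<Rightarrow> (unit, 'x, 'm) bicat" where
  "closure G = \<lparr>Obj = {()}, Arr = GObj G, Cell = GMor G, src = (\<lambda>_. ()), tgt = (\<lambda>_. ()),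
     dom2 = gdom G, cod2 = gcod G, id1 = (\<lambda>_. gone G), id2 = gid G,
     vcomp = gcomp G, hcomp1 = gmul0 G, hcomp2 = gmul1 G,
     associator = (\<lambda>X Y Z. gid G (gmul0 G (gmul0 G X Y) Z)), lunitor = gid G, runitor = gid G\<rparr>"


section \<open>The 2-category of Kapranov--Voevodsky 2-vector spaces\<close>

text \<open>
  Bases of tensor products and direct sums are ordered lexicographically.  \<open>kron_by f\<close> is the
  Kronecker product with entries multiplied by \<open>f\<close>; the pair \<open>(i, j)\<close> of indices is encoded as
  \<open>i * n + j\<close>, with \<open>n\<close> the range of the second index.
\<close>

definition kron_by :: "('a \<Rightarrow> 'b \<Rightarrow> 'c) \<Rightarrow> 'a mat \<Rightarrow> 'b mat \<Rightarrow> 'c mat" where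
  "kron_by f A B = mat (dim_row A * dim_row B) (dim_col A * dim_col B)
     (\<lambda>(x, y). f (A $$ (x div dim_row B, y div dim_col B)) (B $$ (x mod dim_row B, y mod dim_col B)))"

abbreviation kron :: "'a::times mat \<Rightarrow> 'a mat \<Rightarrow> 'a mat" where
  "kron \<equiv> kron_by (*)"

text \<open>A 2-morphism is a matrix of complex matrices; its source and target are the matrices of the
  numbers of rows and columns of its entries.\<close>

definition tv_vcomp :: "complex mat mat \<Rightarrow> complex mat mat \<Rightarrow> complex mat mat" where
  "tv_vcomp \<alpha> \<beta> = mat (dim_row \<alpha>) (dim_col \<alpha>) (\<lambda>ij. \<alpha> $$ ij * \<beta> $$ ij)"

definition tv_hcomp :: "complex mat mat \<Rightarrow> complex mat mat \<Rightarrow> complex mat mat" where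
  "tv_hcomp \<alpha> \<beta> = mat (dim_row \<alpha>) (dim_col \<beta>)
     (\<lambda>(i, j). diag_block_mat (map (\<lambda>k. kron (\<alpha> $$ (i, k)) (\<beta> $$ (k, j))) [0..<dim_col \<alpha>]))"

text \<open>The position, in the basis of the entry \<open>(i, j)\<close> of \<open>a * b\<close>, of the element indexed by the
  intermediate index \<open>k\<close> and by \<open>p < a $$ (i, k)\<close> and \<open>q < b $$ (k, j)\<close>.\<close>

definition basis_pos :: "nat mat \<Rightarrow> nat mat \<Rightarrow> nat \<Rightarrow> nat \<Rightarrow> nat \<Rightarrow> nat \<Rightarrow> nat \<Rightarrow> nat" where
  "basis_pos a b i j k p q = (\<Sum>k'<k. a $$ (i, k') * b $$ (k', j)) + (p * b $$ (k, j) + q)"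

definition tv_assoc :: "nat mat \<Rightarrow> nat mat \<Rightarrow> nat mat \<Rightarrow> complex mat mat" where
  "tv_assoc a b c = mat (dim_row a) (dim_col c) (\<lambda>(i, l).
     mat (((a * b) * c) $$ (i, l)) ((a * (b * c)) $$ (i, l)) (\<lambda>(x, y).
       if \<exists>j<dim_col a. \<exists>k<dim_col b. \<exists>p<a $$ (i, j). \<exists>q<b $$ (j, k). \<exists>s<c $$ (k, l).
            x = basis_pos (a * b) c i l k (basis_pos a b i k j p q) s \<and>
            y = basis_pos a (b * c) i l j p (basis_pos b c j l k q s)
       then 1 else 0))"

definition TwoVect :: "(nat, nat mat, complex mat mat) bicat" where
  "TwoVect = \<lparr>Obj = UNIV, Arr = UNIV, Cell = UNIV, src = dim_row, tgt = dim_col,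
     dom2 = map_mat dim_row, cod2 = map_mat dim_col, id1 = 1\<^sub>m, id2 = map_mat 1\<^sub>m,
     vcomp = tv_vcomp, hcomp1 = (*), hcomp2 = tv_hcomp,
     associator = tv_assoc, lunitor = map_mat 1\<^sub>m, runitor = map_mat 1\<^sub>m\<rparr>"

text \<open>The monoidal product of \<open>N\<close> and \<open>M\<close> is \<open>N * M\<close>, that of 1-morphisms is \<^const>\<open>kron\<close>.\<close>

definition tv_tens2 :: "complex mat mat \<Rightarrow> complex mat mat \<Rightarrow> complex mat mat" where
  "tv_tens2 = kron_by kron"

text \<open>The tensorator from \<open>kron a b * kron a' b'\<close> to \<open>kron (a * a') (b * b')\<close>.\<close>

definition tensorator :: "nat mat \<Rightarrow> nat mat \<Rightarrow> nat mat \<Rightarrow> nat mat \<Rightarrow> complex mat mat" where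
  "tensorator a b a' b' = mat (dim_row a * dim_row b) (dim_col a' * dim_col b') (\<lambda>(u, v).
     let i = u div dim_row b; j = u mod dim_row b; k = v div dim_col b'; l = v mod dim_col b' in
     mat ((kron a b * kron a' b') $$ (u, v)) (kron (a * a') (b * b') $$ (u, v)) (\<lambda>(x, y).
       if \<exists>m<dim_col a. \<exists>n<dim_col b. \<exists>p<a $$ (i, m). \<exists>q<b $$ (j, n).
            \<exists>p'<a' $$ (m, k). \<exists>q'<b' $$ (n, l).
            x = basis_pos (kron a b) (kron a' b') u v (m * dim_col b + n)
                  (p * b $$ (j, n) + q) (p' * b' $$ (n, l) + q') \<and>
            y = basis_pos a a' i k m p p' * (b * b') $$ (j, l) + basis_pos b b' j l n q q'
       then 1 else 0))"


section \<open>Categorical representations\<close>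

type_synonym ('x, 'm) cat_rep = "(unit, 'x, 'm, nat, nat mat, complex mat mat) pseudofun"
type_synonym ('x, 'm) intertwiner1 = "(unit, 'x, 'm, nat, nat mat, complex mat mat) pseudonat"
type_synonym ('x, 'm) intertwiner2 = "(unit, 'x, 'm, nat, nat mat, complex mat mat) modif"

text \<open>The bicategory of strictly unitary homomorphisms from the closure of \<open>G\<close> to 2-vector spaces,
  pseudonatural transformations and modifications.\<close>

definition rep_bicat ::
    "('x, 'm) cat_group \<Rightarrow> (('x, 'm) cat_rep, ('x, 'm) intertwiner1, ('x, 'm) intertwiner2) bicat" where
  "rep_bicat G = full_sub (ps_bicat (closure G) TwoVect) (strictly_unitary (closure G) TwoVect)"

definition rep_tens0 :: "('x, 'm) cat_group \<Rightarrow> ('x, 'm) cat_rep \<Rightarrow> ('x, 'm) cat_rep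
    \<Rightarrow> ('x, 'm) cat_rep" where
  "rep_tens0 G R S = \<lparr>
     ps_obj = (\<lambda>x\<in>Obj (closure G). ps_obj R x * ps_obj S x),
     ps_arr = (\<lambda>X\<in>Arr (closure G). kron (ps_arr R X) (ps_arr S X)),
     ps_cell = (\<lambda>f\<in>Cell (closure G). tv_tens2 (ps_cell R f) (ps_cell S f)),
     ps_comp = (\<lambda>(X, Y)\<in>composable (closure G).
       tensorator (ps_arr R X) (ps_arr S X) (ps_arr R Y) (ps_arr S Y)
       \<cdot>\<^bsub>TwoVect\<^esub> tv_tens2 (ps_comp R (X, Y)) (ps_comp S (X, Y))),
     ps_unit = (\<lambda>x\<in>Obj (closure G). id2 TwoVect (id1 TwoVect (ps_obj R x * ps_obj S x)))\<rparr>"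

definition rep_tens1 :: "('x, 'm) cat_group \<Rightarrow> ('x, 'm) intertwiner1 \<Rightarrow> ('x, 'm) intertwiner1
    \<Rightarrow> ('x, 'm) intertwiner1" where
  "rep_tens1 G h k = \<lparr>
     pt_src = rep_tens0 G (pt_src h) (pt_src k),
     pt_tgt = rep_tens0 G (pt_tgt h) (pt_tgt k),
     pt_map = (\<lambda>x\<in>Obj (closure G). kron (pt_map h x) (pt_map k x)),
     pt_nat = (\<lambda>X\<in>Arr (closure G).
       tensorator (ps_arr (pt_src h) X) (ps_arr (pt_src k) X) (pt_map h ()) (pt_map k ())
       \<cdot>\<^bsub>TwoVect\<^esub> tv_tens2 (pt_nat h X) (pt_nat k X)
       \<cdot>\<^bsub>TwoVect\<^esub> inv2 TwoVect (tensorator (pt_map h ()) (pt_map k ())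
            (ps_arr (pt_tgt h) X) (ps_arr (pt_tgt k) X)))\<rparr>"

definition rep_tens2 :: "('x, 'm) cat_group \<Rightarrow> ('x, 'm) intertwiner2 \<Rightarrow> ('x, 'm) intertwiner2
    \<Rightarrow> ('x, 'm) intertwiner2" where
  "rep_tens2 G \<phi> \<psi> = \<lparr>
     md_src = rep_tens1 G (md_src \<phi>) (md_src \<psi>),
     md_tgt = rep_tens1 G (md_tgt \<phi>) (md_tgt \<psi>),
     md_map = (\<lambda>x\<in>Obj (closure G). tv_tens2 (md_map \<phi> x) (md_map \<psi> x))\<rparr>"

text \<open>The monoidal product as a homomorphism of bicategories: its compositor is the tensorator, and
  its unit constraint is trivial.\<close>

definition rep_tensor :: "('x, 'm) cat_group \<Rightarrow>
    (('x, 'm) cat_rep \<times> ('x, 'm) cat_rep, ('x, 'm) intertwiner1 \<times> ('x, 'm) intertwiner1,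
     ('x, 'm) intertwiner2 \<times> ('x, 'm) intertwiner2,
     ('x, 'm) cat_rep, ('x, 'm) intertwiner1, ('x, 'm) intertwiner2) pseudofun" where
  "rep_tensor G = (let B = rep_bicat G; BB = prod_bicat B B in \<lparr>
     ps_obj = (\<lambda>(R, S)\<in>Obj BB. rep_tens0 G R S),
     ps_arr = (\<lambda>(h, k)\<in>Arr BB. rep_tens1 G h k),
     ps_cell = (\<lambda>(\<phi>, \<psi>)\<in>Cell BB. rep_tens2 G \<phi> \<psi>),
     ps_comp = (\<lambda>((h, k), (h', k'))\<in>composable BB. \<lparr>
       md_src = rep_tens1 G h k \<star>\<^bsub>B\<^esub> rep_tens1 G h' k',
       md_tgt = rep_tens1 G (h \<star>\<^bsub>B\<^esub> h') (k \<star>\<^bsub>B\<^esub> k'),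
       md_map = (\<lambda>x\<in>Obj (closure G).
         tensorator (pt_map h x) (pt_map k x) (pt_map h' x) (pt_map k' x))\<rparr>),
     ps_unit = (\<lambda>(R, S)\<in>Obj BB. \<lparr>
       md_src = id1 B (rep_tens0 G R S),
       md_tgt = rep_tens1 G (id1 B R) (id1 B S),
       md_map = (\<lambda>x\<in>Obj (closure G). id2 TwoVect (id1 TwoVect (ps_obj R x * ps_obj S x)))\<rparr>)\<rparr>)"

end

theory Submission
  imports Defs
begin

text \<open>
  For lexicographically ordered bases, 2Vect has strict units and its monoidal product is strictly
  associative and unital; the only nontrivial structure cells are the associators and the tensorator,
  both of which permute basis elements, so the coherence conditions relating them are identities
  between permutations and can be checked on the coordinates of a basis element.

  The product of representations is \<open>\<langle>R, T\<rangle>\<close> followed by \<open>\<boxtimes> : 2Vect \<times> 2Vect \<rightarrow> 2Vect\<close>. Composition with a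
  strictly unitary pseudofunctor is itself a pseudofunctor between bicategories of strictly unitary
  pseudofunctors, and the pointwise product inherits strict associativity and unitality from
  \<open>\<boxtimes>\<close>. Its associativity and unit transformations can therefore be taken to be identities, and each
  pasting diagram in the axioms of a monoidal bicategory is then an identity. Associators in the
  calculations with pseudonatural transformations are absorbed by evaluating 2-cells between
  words of 1-cells, where whiskering is strictly associative.
\<close>

section \<open>Calculations in a bicategory\<close>

text \<open>The conditions needed of a tensor product are isolated in \<open>strict_tensor\<close>,
  and this notion reproduces itself: if a target carries such a tensor, so does the bicategory of
  strictly unitary pseudofunctors into it. The monoidal bicategory is therefore constructed once,
  for an arbitrary strict tensor, and representations are only an instance. Equality of the two
  triple products on objects, 1-cells and 2-cells is not enough for this. Since the product is not a
  strict homomorphism, its compositors have to agree as well; \<open>assoc_comp\<close> states this,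
  and for \<open>TwoVect\<close> it is an identity between shuffles of basis elements. Only then are
  the two triple products one and the same pseudofunctor, so that an identity transformation can be
  the associativity equivalence. Literal equality of pseudofunctors and transformations is available
  because their maps are extensional. Strictness of units is likewise inherited by the bicategory of
  pseudofunctors, whose 1-cells are records: composition with an identity returns the same record,
  and the unitors are identity cells.\<close>

lemma inverse_cells_unique:
  assumes "bicategory B" "inverse_cells B \<alpha> \<beta>" "inverse_cells B \<alpha> \<gamma>"
  shows "\<beta> = \<gamma>"
proof -
  interpret bicategory B by fact
  have *: "\<beta> \<in> hom2 B (cod2 B \<alpha>) (dom2 B \<alpha>)" "\<gamma> \<in> hom2 B (cod2 B \<alpha>) (dom2 B \<alpha>)"
    "\<alpha> \<in> hom2 B (dom2 B \<alpha>) (cod2 B \<alpha>)"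
    using assms by (auto simp: inverse_cells_def hom2_def)
  have "\<beta> = \<beta> \<cdot>\<^bsub>B\<^esub> (\<alpha> \<cdot>\<^bsub>B\<^esub> \<gamma>)"
    using assms(3) vcomp_id2_right[OF *(1)] by (simp add: inverse_cells_def)
  also have "\<dots> = (\<beta> \<cdot>\<^bsub>B\<^esub> \<alpha>) \<cdot>\<^bsub>B\<^esub> \<gamma>"
    using vcomp_assoc[OF *(1) *(3) *(2)] by simp
  also have "\<dots> = \<gamma>"
    using assms(2) vcomp_id2_left[OF *(2)] by (simp add: inverse_cells_def)
  finally show ?thesis .
qed

context bicategory
begin

declare src_obj [simp] tgt_obj [simp] dom2_arr [simp] cod2_arr [simp]

text \<open>As simplification rules these replace the endpoints of \<open>cod2\<close> by those of
  \<open>dom2\<close>, so that side conditions on endpoints reach a normal form. The axioms are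
  restated below with such equational side conditions in place of \<open>hom1\<close> and
  \<open>hom2\<close>, which the simplifier can discharge.\<close>

lemma src_cod2 [simp]: "\<alpha> \<in> Cell B \<Longrightarrow> src B (cod2 B \<alpha>) = src B (dom2 B \<alpha>)"
  and tgt_cod2 [simp]: "\<alpha> \<in> Cell B \<Longrightarrow> tgt B (cod2 B \<alpha>) = tgt B (dom2 B \<alpha>)"
  by (simp_all add: cell_src cell_tgt)

lemma id1_typing [simp]:
  assumes "X \<in> Obj B"
  shows "id1 B X \<in> Arr B" "src B (id1 B X) = X" "tgt B (id1 B X) = X"
  using id1_hom[OF assms] by (auto simp: hom1_def)

lemma id2_typing [simp]:
  assumes "f \<in> Arr B"
  shows "id2 B f \<in> Cell B" "dom2 B (id2 B f) = f" "cod2 B (id2 B f) = f"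
  using id2_hom[OF assms] by (auto simp: hom2_def)

lemma hcomp1_typing [simp]:
  assumes "f \<in> Arr B" "g \<in> Arr B" "tgt B f = src B g"
  shows "f \<star> g \<in> Arr B" "src B (f \<star> g) = src B f" "tgt B (f \<star> g) = tgt B g"
  using hcomp1_hom[of f "src B f" "tgt B f" g "tgt B g"] assms by (auto simp: hom1_def)

lemma vcomp_typing [simp]:
  assumes "\<alpha> \<in> Cell B" "\<beta> \<in> Cell B" "cod2 B \<alpha> = dom2 B \<beta>"
  shows "\<alpha> \<cdot> \<beta> \<in> Cell B" "dom2 B (\<alpha> \<cdot> \<beta>) = dom2 B \<alpha>" "cod2 B (\<alpha> \<cdot> \<beta>) = cod2 B \<beta>"
  using vcomp_hom[of \<alpha> "dom2 B \<alpha>" "cod2 B \<alpha>" \<beta> "cod2 B \<beta>"] assms by (auto simp: hom2_def)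

lemma hcomp2_typing [simp]:
  assumes "\<alpha> \<in> Cell B" "\<beta> \<in> Cell B" "tgt B (dom2 B \<alpha>) = src B (dom2 B \<beta>)"
  shows "\<alpha> \<ast> \<beta> \<in> Cell B" "dom2 B (\<alpha> \<ast> \<beta>) = dom2 B \<alpha> \<star> dom2 B \<beta>"
    "cod2 B (\<alpha> \<ast> \<beta>) = cod2 B \<alpha> \<star> cod2 B \<beta>"
  using hcomp2_hom[of \<alpha> "dom2 B \<alpha>" "cod2 B \<alpha>" \<beta> "dom2 B \<beta>" "cod2 B \<beta>"] assms
  by (auto simp: hom2_def)

lemma associator_typing [simp]:
  assumes "f \<in> Arr B" "g \<in> Arr B" "h \<in> Arr B" "tgt B f = src B g" "tgt B g = src B h"
  shows "associator B f g h \<in> Cell B" "dom2 B (associator B f g h) = (f \<star> g) \<star> h"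
    "cod2 B (associator B f g h) = f \<star> (g \<star> h)" "invertible2 B (associator B f g h)"
  using associator_hom[of f g h] associator_inv[of f g h] assms
  by (auto simp: hom2_def composable_def)

lemma vassoc:
  assumes "\<alpha> \<in> Cell B" "\<beta> \<in> Cell B" "\<gamma> \<in> Cell B" "cod2 B \<alpha> = dom2 B \<beta>" "cod2 B \<beta> = dom2 B \<gamma>"
  shows "(\<alpha> \<cdot> \<beta>) \<cdot> \<gamma> = \<alpha> \<cdot> (\<beta> \<cdot> \<gamma>)"
  by (rule vcomp_assoc) (use assms in \<open>auto simp: hom2_def\<close>)

lemma vid_left [simp]: "\<alpha> \<in> Cell B \<Longrightarrow> dom2 B \<alpha> = f \<Longrightarrow> id2 B f \<cdot> \<alpha> = \<alpha>"
  by (rule vcomp_id2_left) (auto simp: hom2_def)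

lemma vid_right [simp]: "\<alpha> \<in> Cell B \<Longrightarrow> cod2 B \<alpha> = f \<Longrightarrow> \<alpha> \<cdot> id2 B f = \<alpha>"
  by (rule vcomp_id2_right) (auto simp: hom2_def)

lemma id2_hcomp [simp]:
  "f \<in> Arr B \<Longrightarrow> g \<in> Arr B \<Longrightarrow> tgt B f = src B g \<Longrightarrow> id2 B f \<ast> id2 B g = id2 B (f \<star> g)"
  by (rule hcomp2_id2) (auto simp: composable_def)

lemma hcomp_vcomp:
  assumes "\<alpha> \<in> Cell B" "\<alpha>' \<in> Cell B" "\<beta> \<in> Cell B" "\<beta>' \<in> Cell B" "cod2 B \<alpha> = dom2 B \<alpha>'"
    "cod2 B \<beta> = dom2 B \<beta>'" "tgt B (dom2 B \<alpha>) = src B (dom2 B \<beta>)"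
  shows "(\<alpha> \<ast> \<beta>) \<cdot> (\<alpha>' \<ast> \<beta>') = (\<alpha> \<cdot> \<alpha>') \<ast> (\<beta> \<cdot> \<beta>')"
  by (rule interchange[symmetric]) (use assms in \<open>auto simp: hom2_def\<close>)

lemma whisk_left_vcomp:
  assumes "f \<in> Arr B" "\<alpha> \<in> Cell B" "\<beta> \<in> Cell B" "cod2 B \<alpha> = dom2 B \<beta>" "tgt B f = src B (dom2 B \<alpha>)"
  shows "id2 B f \<ast> (\<alpha> \<cdot> \<beta>) = (id2 B f \<ast> \<alpha>) \<cdot> (id2 B f \<ast> \<beta>)"
  using assms src_cod2[of \<alpha>] by (simp add: hcomp_vcomp)

lemma whisk_right_vcomp:
  assumes "f \<in> Arr B" "\<alpha> \<in> Cell B" "\<beta> \<in> Cell B" "cod2 B \<alpha> = dom2 B \<beta>" "src B f = tgt B (dom2 B \<alpha>)"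
  shows "(\<alpha> \<cdot> \<beta>) \<ast> id2 B f = (\<alpha> \<ast> id2 B f) \<cdot> (\<beta> \<ast> id2 B f)"
  using assms tgt_cod2[of \<alpha>] by (simp add: hcomp_vcomp)

lemma associator_natural:
  assumes "\<alpha> \<in> Cell B" "\<beta> \<in> Cell B" "\<gamma> \<in> Cell B"
    "tgt B (dom2 B \<alpha>) = src B (dom2 B \<beta>)" "tgt B (dom2 B \<beta>) = src B (dom2 B \<gamma>)"
    "f' = cod2 B \<alpha>" "g' = cod2 B \<beta>" "h' = cod2 B \<gamma>"
  shows "((\<alpha> \<ast> \<beta>) \<ast> \<gamma>) \<cdot> associator B f' g' h'
    = associator B (dom2 B \<alpha>) (dom2 B \<beta>) (dom2 B \<gamma>) \<cdot> (\<alpha> \<ast> (\<beta> \<ast> \<gamma>))"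
  by (rule associator_nat) (use assms in \<open>auto simp: hom2_def\<close>)

lemma pentagon_right:
  assumes "f \<in> Arr B" "g \<in> Arr B" "h \<in> Arr B" "k \<in> Arr B"
    "tgt B f = src B g" "tgt B g = src B h" "tgt B h = src B k"
  shows "(associator B f g h \<ast> id2 B k) \<cdot> (associator B f (g \<star> h) k \<cdot> (id2 B f \<ast> associator B g h k))
    = associator B (f \<star> g) h k \<cdot> associator B f g (h \<star> k)"
  using pentagon[of f g h k] assms by (simp add: composable_def vassoc)

text \<open>Vertical composites are kept nested to the right, so the left side of a local equation
  is usually not a subterm. With a tail \<xi> attached it is; \<open>THEN vcomp_extend\<close> turns
  a local equation into a rewrite rule for long composites.\<close>

lemma vcomp_extend:
  assumes "\<alpha> \<cdot> \<beta> = \<gamma>" "\<alpha> \<in> Cell B" "\<beta> \<in> Cell B" "\<xi> \<in> Cell B"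
    "cod2 B \<alpha> = dom2 B \<beta>" "cod2 B \<beta> = dom2 B \<xi>"
  shows "\<alpha> \<cdot> (\<beta> \<cdot> \<xi>) = \<gamma> \<cdot> \<xi>"
  using assms vassoc[of \<alpha> \<beta> \<xi>] by simp

lemma inverse_cellsI:
  assumes "\<alpha> \<in> Cell B" "\<beta> \<in> Cell B" "dom2 B \<beta> = cod2 B \<alpha>" "cod2 B \<beta> = dom2 B \<alpha>"
    "\<alpha> \<cdot> \<beta> = id2 B (dom2 B \<alpha>)" "\<beta> \<cdot> \<alpha> = id2 B (cod2 B \<alpha>)"
  shows "inverse_cells B \<alpha> \<beta>"
  using assms by (simp add: inverse_cells_def hom2_def)

text \<open>\<open>inv2\<close> is a definite description and gets its meaning from the uniqueness
  of inverses.\<close>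

lemma inv2_eqI: "inverse_cells B \<alpha> \<beta> \<Longrightarrow> inv2 B \<alpha> = \<beta>"
  unfolding inv2_def using inverse_cells_unique[OF bicategory_axioms] by blast

lemma inverse_cells_inv2: "invertible2 B \<alpha> \<Longrightarrow> inverse_cells B \<alpha> (inv2 B \<alpha>)"
  using inv2_eqI invertible2_def by metis

lemma invertible_cell: "invertible2 B \<alpha> \<Longrightarrow> \<alpha> \<in> Cell B"
  by (auto simp: invertible2_def inverse_cells_def)

lemma inv2_typing [simp]:
  assumes "invertible2 B \<alpha>"
  shows "inv2 B \<alpha> \<in> Cell B" "dom2 B (inv2 B \<alpha>) = cod2 B \<alpha>" "cod2 B (inv2 B \<alpha>) = dom2 B \<alpha>"
    "\<alpha> \<cdot> inv2 B \<alpha> = id2 B (dom2 B \<alpha>)" "inv2 B \<alpha> \<cdot> \<alpha> = id2 B (cod2 B \<alpha>)"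
  using inverse_cells_inv2[OF assms] by (auto simp: inverse_cells_def hom2_def)

lemma inv2_cancel [simp]:
  assumes "invertible2 B \<alpha>" "\<xi> \<in> Cell B"
  shows "dom2 B \<xi> = dom2 B \<alpha> \<Longrightarrow> \<alpha> \<cdot> (inv2 B \<alpha> \<cdot> \<xi>) = \<xi>"
    "dom2 B \<xi> = cod2 B \<alpha> \<Longrightarrow> inv2 B \<alpha> \<cdot> (\<alpha> \<cdot> \<xi>) = \<xi>"
  using assms invertible_cell[OF assms(1)] by (simp_all flip: vassoc)

lemma inverse_cells_sym: "inverse_cells B \<alpha> \<beta> \<Longrightarrow> inverse_cells B \<beta> \<alpha>"
  by (auto simp: inverse_cells_def hom2_def)

lemma inverse_cells_vcomp:
  assumes "inverse_cells B \<alpha> \<alpha>'" "inverse_cells B \<beta> \<beta>'" "cod2 B \<alpha> = dom2 B \<beta>"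
  shows "inverse_cells B (\<alpha> \<cdot> \<beta>) (\<beta>' \<cdot> \<alpha>')"
proof -
  have [simp]: "\<alpha> \<in> Cell B" "\<beta> \<in> Cell B" "\<alpha>' \<in> Cell B" "\<beta>' \<in> Cell B"
    "dom2 B \<alpha>' = cod2 B \<alpha>" "cod2 B \<alpha>' = dom2 B \<alpha>" "dom2 B \<beta>' = cod2 B \<beta>" "cod2 B \<beta>' = dom2 B \<beta>"
    "\<alpha> \<cdot> \<alpha>' = id2 B (dom2 B \<alpha>)" "\<beta>' \<cdot> \<beta> = id2 B (cod2 B \<beta>)"
    "\<alpha>' \<cdot> \<alpha> = id2 B (cod2 B \<alpha>)" "\<beta> \<cdot> \<beta>' = id2 B (dom2 B \<beta>)"
    using assms by (auto simp: inverse_cells_def hom2_def)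
  show ?thesis
    by (rule inverse_cellsI)
      (simp_all add: assms(3) vassoc vcomp_extend[OF \<open>\<alpha>' \<cdot> \<alpha> = _\<close>] vcomp_extend[OF \<open>\<beta> \<cdot> \<beta>' = _\<close>])
qed

lemma inverse_cells_hcomp:
  assumes "inverse_cells B \<alpha> \<alpha>'" "inverse_cells B \<beta> \<beta>'" "tgt B (dom2 B \<alpha>) = src B (dom2 B \<beta>)"
  shows "inverse_cells B (\<alpha> \<ast> \<beta>) (\<alpha>' \<ast> \<beta>')"
proof -
  have [simp]: "\<alpha> \<in> Cell B" "\<beta> \<in> Cell B" "\<alpha>' \<in> Cell B" "\<beta>' \<in> Cell B"
    "dom2 B \<alpha>' = cod2 B \<alpha>" "cod2 B \<alpha>' = dom2 B \<alpha>" "dom2 B \<beta>' = cod2 B \<beta>" "cod2 B \<beta>' = dom2 B \<beta>"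
    "\<alpha> \<cdot> \<alpha>' = id2 B (dom2 B \<alpha>)" "\<beta>' \<cdot> \<beta> = id2 B (cod2 B \<beta>)"
    "\<alpha>' \<cdot> \<alpha> = id2 B (cod2 B \<alpha>)" "\<beta> \<cdot> \<beta>' = id2 B (dom2 B \<beta>)"
    using assms by (auto simp: inverse_cells_def hom2_def)
  show ?thesis
    by (rule inverse_cellsI) (simp_all add: assms(3) hcomp_vcomp)
qed

lemma invertible_vcomp [simp]:
  "invertible2 B \<alpha> \<Longrightarrow> invertible2 B \<beta> \<Longrightarrow> cod2 B \<alpha> = dom2 B \<beta> \<Longrightarrow> invertible2 B (\<alpha> \<cdot> \<beta>)"
  using inverse_cells_vcomp invertible2_def by metis

lemma invertible_hcomp [simp]:
  "invertible2 B \<alpha> \<Longrightarrow> invertible2 B \<beta> \<Longrightarrow> tgt B (dom2 B \<alpha>) = src B (dom2 B \<beta>)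
    \<Longrightarrow> invertible2 B (\<alpha> \<ast> \<beta>)"
  using inverse_cells_hcomp invertible2_def by metis

lemma inverse_cells_id2: "f \<in> Arr B \<Longrightarrow> inverse_cells B (id2 B f) (id2 B f)"
  by (rule inverse_cellsI) simp_all

lemma invertible_id2 [simp]: "f \<in> Arr B \<Longrightarrow> invertible2 B (id2 B f)"
  using inverse_cells_id2 invertible2_def by metis

lemma inv2_id2 [simp]: "f \<in> Arr B \<Longrightarrow> inv2 B (id2 B f) = id2 B f"
  by (intro inv2_eqI inverse_cells_id2)

lemma invertible_inv2 [simp]: "invertible2 B \<alpha> \<Longrightarrow> invertible2 B (inv2 B \<alpha>)"
  using inverse_cells_sym inverse_cells_inv2 invertible2_def by metis

lemma inv2_inv2 [simp]: "invertible2 B \<alpha> \<Longrightarrow> inv2 B (inv2 B \<alpha>) = \<alpha>"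
  using inverse_cells_sym inverse_cells_inv2 inv2_eqI by metis

lemma inv2_vcomp:
  "invertible2 B \<alpha> \<Longrightarrow> invertible2 B \<beta> \<Longrightarrow> cod2 B \<alpha> = dom2 B \<beta>
    \<Longrightarrow> inv2 B (\<alpha> \<cdot> \<beta>) = inv2 B \<beta> \<cdot> inv2 B \<alpha>"
  by (intro inv2_eqI inverse_cells_vcomp inverse_cells_inv2)

lemma inv2_hcomp:
  "invertible2 B \<alpha> \<Longrightarrow> invertible2 B \<beta> \<Longrightarrow> tgt B (dom2 B \<alpha>) = src B (dom2 B \<beta>)
    \<Longrightarrow> inv2 B (\<alpha> \<ast> \<beta>) = inv2 B \<alpha> \<ast> inv2 B \<beta>"
  by (intro inv2_eqI inverse_cells_hcomp inverse_cells_inv2)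

lemma move_inv_left:
  assumes "invertible2 B \<alpha>" "\<beta> \<in> Cell B" "\<gamma> \<in> Cell B" "dom2 B \<beta> = cod2 B \<alpha>"
  shows "\<alpha> \<cdot> \<beta> = \<gamma> \<Longrightarrow> \<beta> = inv2 B \<alpha> \<cdot> \<gamma>"
  using assms by auto

text \<open>Lets an equation be verified after composing with an invertible cell, typically one that
  completes a side to a pentagon or to a coherence axiom.\<close>

lemma cancel_inv_right:
  assumes "invertible2 B \<gamma>" "\<alpha> \<in> Cell B" "\<beta> \<in> Cell B" "cod2 B \<alpha> = dom2 B \<gamma>" "cod2 B \<beta> = dom2 B \<gamma>"
    "\<alpha> \<cdot> \<gamma> = \<beta> \<cdot> \<gamma>"
  shows "\<alpha> = \<beta>"
proof -
  have "(\<alpha> \<cdot> \<gamma>) \<cdot> inv2 B \<gamma> = (\<beta> \<cdot> \<gamma>) \<cdot> inv2 B \<gamma>" using assms(6) by simp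
  then show ?thesis using assms(1-5) invertible_cell[OF assms(1)] by (simp add: vassoc)
qed

end

section \<open>Words of 1-cells\<close>

text \<open>The empty word is rejected, since a list without letters does not determine the object
  whose identity it would denote.\<close>

fun chain :: "('o, 'a, 'c) bicat \<Rightarrow> 'a list \<Rightarrow> bool" where
  "chain B [] = False"
| "chain B [f] = (f \<in> Arr B)"
| "chain B (f # g # fs) = (f \<in> Arr B \<and> tgt B f = src B g \<and> chain B (g # fs))"

text \<open>The case of \<open>paste\<close> with empty head and nonempty tail, composed to the
  right. Conjugation with \<open>path_split\<close> keeps both boundaries bracketed to the right,
  which is what makes iterated whiskering strictly associative.\<close>

definition rwhisk :: "('o, 'a, 'c) bicat \<Rightarrow> 'a list \<Rightarrow> 'a list \<Rightarrow> 'a list \<Rightarrow> 'c \<Rightarrow> 'c" where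
  "rwhisk B us vs ys \<alpha> = inv2 B (path_split B us ys)
     \<cdot>\<^bsub>B\<^esub> ((\<alpha> \<ast>\<^bsub>B\<^esub> id2 B (path B ys)) \<cdot>\<^bsub>B\<^esub> path_split B vs ys)"

lemma chain_nonempty: "chain B us \<Longrightarrow> us \<noteq> []"
  by auto

lemma chain_Cons: "us \<noteq> [] \<Longrightarrow> chain B (f # us) = (f \<in> Arr B \<and> tgt B f = src B (hd us) \<and> chain B us)"
  by (cases us) auto

lemma path_Cons: "us \<noteq> [] \<Longrightarrow> path B (f # us) = f \<star>\<^bsub>B\<^esub> path B us"
  by (cases us) auto

lemma path_split_Cons: "us \<noteq> [] \<Longrightarrow> path_split B (f # us) ys =
    associator B f (path B us) (path B ys) \<cdot>\<^bsub>B\<^esub> (id2 B f \<ast>\<^bsub>B\<^esub> path_split B us ys)"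
  by (cases us) auto

lemma chain_append:
  "us \<noteq> [] \<Longrightarrow> vs \<noteq> [] \<Longrightarrow>
    chain B (us @ vs) = (chain B us \<and> chain B vs \<and> tgt B (last us) = src B (hd vs))"
  by (induct B us rule: chain.induct) (auto simp: chain_Cons)

context bicategory
begin

lemma path_typing [simp]:
  assumes "chain B us"
  shows "path B us \<in> Arr B" "src B (path B us) = src B (hd us)" "tgt B (path B us) = tgt B (last us)"
proof -
  have "path B us \<in> Arr B \<and> src B (path B us) = src B (hd us) \<and> tgt B (path B us) = tgt B (last us)"
    using assms
  proof (induct us)
    case (Cons f us)
    then show ?case by (cases us) auto
  qed simp
  then show "path B us \<in> Arr B" "src B (path B us) = src B (hd us)"
    "tgt B (path B us) = tgt B (last us)" by auto
qed

lemma path_split_typing [simp]: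
  assumes "chain B us" "chain B ys" "tgt B (last us) = src B (hd ys)"
  shows "path_split B us ys \<in> Cell B" "dom2 B (path_split B us ys) = path B us \<star> path B ys"
    "cod2 B (path_split B us ys) = path B (us @ ys)" "invertible2 B (path_split B us ys)"
proof -
  have "path_split B us ys \<in> Cell B \<and> dom2 B (path_split B us ys) = path B us \<star> path B ys \<and>
    cod2 B (path_split B us ys) = path B (us @ ys) \<and> invertible2 B (path_split B us ys)"
    using assms
  proof (induct us)
    case (Cons f us)
    show ?case
    proof (cases "us = []")
      case True
      with Cons show ?thesis using chain_nonempty[OF Cons(3)] by (simp add: path_Cons)
    next
      case False
      with Cons show ?thesis by (simp add: path_Cons path_split_Cons chain_Cons)
    qed
  qed simp
  then show "path_split B us ys \<in> Cell B" "dom2 B (path_split B us ys) = path B us \<star> path B ys"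
    "cod2 B (path_split B us ys) = path B (us @ ys)" "invertible2 B (path_split B us ys)" by auto
qed

text \<open>Coherence for merging three words, by induction on the first. In the step, naturality
  moves the two inner splittings across an associator, and what remains is the pentagon for the head
  letter and the three path composites.\<close>

lemma path_split_assoc:
  assumes "chain B us" "chain B vs" "chain B ws" "tgt B (last us) = src B (hd vs)"
    "tgt B (last vs) = src B (hd ws)"
  shows "(path_split B us vs \<ast> id2 B (path B ws)) \<cdot> path_split B (us @ vs) ws
    = associator B (path B us) (path B vs) (path B ws)
      \<cdot> ((id2 B (path B us) \<ast> path_split B vs ws) \<cdot> path_split B us (vs @ ws))"
  using assms
proof (induct us)
  case (Cons f us)
  note ne = chain_nonempty[OF Cons(3)] chain_nonempty[OF Cons(4)]
  show ?case
  proof (cases "us = []")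
    case True
    with Cons ne show ?thesis
      by (simp add: path_Cons path_split_Cons chain_Cons chain_append)
  next
    case False
    let ?U = "path B us" and ?V = "path B vs" and ?W = "path B ws"
    have [simp]: "f \<in> Arr B" "tgt B f = src B (hd us)" "chain B us" "chain B vs" "chain B ws"
      "tgt B (last us) = src B (hd vs)" "tgt B (last vs) = src B (hd ws)" "chain B (us @ vs)"
      "chain B (vs @ ws)"
      "hd (us @ vs) = hd us" "last (us @ vs) = last vs" "hd (vs @ ws) = hd vs"
      "last (vs @ ws) = last ws" "us \<noteq> []" "vs \<noteq> []"
      using Cons False ne by (auto simp: chain_Cons chain_append)
    note IH = Cons(1)[simplified]
    have 1: "((id2 B f \<ast> path_split B us vs) \<ast> id2 B ?W) \<cdot> associator B f (path B (us @ vs)) ?W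
      = associator B f (?U \<star> ?V) ?W \<cdot> (id2 B f \<ast> (path_split B us vs \<ast> id2 B ?W))"
      by (subst associator_natural) simp_all
    have 2: "((id2 B (f \<star> ?U)) \<ast> path_split B vs ws) \<cdot> associator B f ?U (path B (vs @ ws))
      = associator B f ?U (?V \<star> ?W) \<cdot> (id2 B f \<ast> (id2 B ?U \<ast> path_split B vs ws))"
      using associator_natural[of "id2 B f" "id2 B ?U" "path_split B vs ws" f ?U "path B (vs @ ws)"] by simp
    have 3: "(id2 B f \<ast> (path_split B us vs \<ast> id2 B ?W)) \<cdot> (id2 B f \<ast> path_split B (us @ vs) ws)
      = (id2 B f \<ast> associator B ?U ?V ?W) \<cdot> ((id2 B f \<ast> (id2 B ?U \<ast> path_split B vs ws))
        \<cdot> (id2 B f \<ast> path_split B us (vs @ ws)))"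
      using IH by (simp flip: whisk_left_vcomp)
    have "(path_split B (f # us) vs \<ast> id2 B ?W) \<cdot> path_split B ((f # us) @ vs) ws
      = (associator B f ?U ?V \<ast> id2 B ?W) \<cdot> (((id2 B f \<ast> path_split B us vs) \<ast> id2 B ?W)
        \<cdot> (associator B f (path B (us @ vs)) ?W \<cdot> (id2 B f \<ast> path_split B (us @ vs) ws)))"
      by (simp add: path_split_Cons whisk_right_vcomp vassoc)
    also have "\<dots> = (associator B f ?U ?V \<ast> id2 B ?W) \<cdot> (associator B f (?U \<star> ?V) ?W
        \<cdot> ((id2 B f \<ast> (path_split B us vs \<ast> id2 B ?W)) \<cdot> (id2 B f \<ast> path_split B (us @ vs) ws)))"
      by (simp add: 1[THEN vcomp_extend] vassoc)
    also have "\<dots> = ((associator B f ?U ?V \<ast> id2 B ?W) \<cdot> (associator B f (?U \<star> ?V) ?W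
        \<cdot> (id2 B f \<ast> associator B ?U ?V ?W))) \<cdot> ((id2 B f \<ast> (id2 B ?U \<ast> path_split B vs ws))
        \<cdot> (id2 B f \<ast> path_split B us (vs @ ws)))"
      by (simp add: 3 vassoc)
    also have "\<dots> = associator B (f \<star> ?U) ?V ?W \<cdot> (associator B f ?U (?V \<star> ?W)
        \<cdot> ((id2 B f \<ast> (id2 B ?U \<ast> path_split B vs ws)) \<cdot> (id2 B f \<ast> path_split B us (vs @ ws))))"
      by (subst pentagon_right) (simp_all add: vassoc)
    also have "\<dots> = associator B (f \<star> ?U) ?V ?W \<cdot> ((id2 B (f \<star> ?U) \<ast> path_split B vs ws)
      \<cdot> (associator B f ?U (path B (vs @ ws)) \<cdot> (id2 B f \<ast> path_split B us (vs @ ws))))"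
      by (simp add: 2[THEN vcomp_extend] vassoc)
    finally show ?thesis by (simp add: path_split_Cons path_Cons)
  qed
qed simp

end

text \<open>A cell is typed by words and not merely by their composites, since \<open>path\<close>
  forgets where a 1-cell is to be cut into letters.\<close>

definition wcell :: "('o, 'a, 'c) bicat \<Rightarrow> 'a list \<Rightarrow> 'a list \<Rightarrow> 'c \<Rightarrow> bool" where
  "wcell B us vs \<alpha> \<longleftrightarrow> chain B us \<and> chain B vs \<and> \<alpha> \<in> hom2 B (path B us) (path B vs)"

text \<open>No associator occurs: with brackets to the right, letters added in front are already in
  the right place.\<close>

definition lwhisk :: "('o, 'a, 'c) bicat \<Rightarrow> 'a list \<Rightarrow> 'c \<Rightarrow> 'c" where
  "lwhisk B xs \<alpha> = foldr (\<lambda>f \<gamma>. id2 B f \<ast>\<^bsub>B\<^esub> \<gamma>) xs \<alpha>"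

lemma chain_hd [simp]: "chain B us \<Longrightarrow> hd us \<in> Arr B"
  by (induct B us rule: chain.induct) auto

lemma chain_last [simp]: "chain B us \<Longrightarrow> last us \<in> Arr B"
  by (induct B us rule: chain.induct) auto

context bicategory
begin

lemma wcellI:
  "chain B us \<Longrightarrow> chain B vs \<Longrightarrow> \<alpha> \<in> Cell B \<Longrightarrow> dom2 B \<alpha> = path B us \<Longrightarrow> cod2 B \<alpha> = path B vs
    \<Longrightarrow> wcell B us vs \<alpha>"
  by (simp add: wcell_def hom2_def)

lemma wcellD:
  assumes "wcell B us vs \<alpha>"
  shows "chain B us" "chain B vs" "\<alpha> \<in> Cell B" "dom2 B \<alpha> = path B us" "cod2 B \<alpha> = path B vs"
    "us \<noteq> []" "vs \<noteq> []" "src B (hd vs) = src B (hd us)" "tgt B (last vs) = tgt B (last us)"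
proof -
  show *: "chain B us" "chain B vs" "\<alpha> \<in> Cell B" "dom2 B \<alpha> = path B us" "cod2 B \<alpha> = path B vs"
    using assms by (auto simp: wcell_def hom2_def)
  then show "us \<noteq> []" "vs \<noteq> []" by auto
  show "src B (hd vs) = src B (hd us)" "tgt B (last vs) = tgt B (last us)"
    using src_cod2[OF *(3)] tgt_cod2[OF *(3)] *(1,2) by (simp_all add: *(4,5))
qed

lemma lwhisk_simps [simp]:
  "lwhisk B [] \<alpha> = \<alpha>" "lwhisk B (x # xs) \<alpha> = id2 B x \<ast> lwhisk B xs \<alpha>"
  by (simp_all add: lwhisk_def)

lemma wcell_lwhisk:
  assumes "wcell B us vs \<alpha>" "chain B xs" "tgt B (last xs) = src B (hd us)"
  shows "wcell B (xs @ us) (xs @ vs) (lwhisk B xs \<alpha>)"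
  using assms(2,3)
proof (induct xs)
  case (Cons x xs)
  note w = wcellD[OF assms(1)]
  show ?case
  proof (cases "xs = []")
    case True
    then show ?thesis using Cons w by (auto intro!: wcellI simp: chain_Cons path_Cons)
  next
    case False
    then have "wcell B (xs @ us) (xs @ vs) (lwhisk B xs \<alpha>)" using Cons by (simp add: chain_Cons)
    from wcellD[OF this] show ?thesis using False Cons w
      by (auto intro!: wcellI simp: chain_Cons path_Cons)
  qed
qed simp

lemma rwhisk_typing [simp]:
  assumes "wcell B us vs \<alpha>" "chain B ys" "tgt B (last us) = src B (hd ys)"
  shows "rwhisk B us vs ys \<alpha> \<in> Cell B" "dom2 B (rwhisk B us vs ys \<alpha>) = path B (us @ ys)"
    "cod2 B (rwhisk B us vs ys \<alpha>) = path B (vs @ ys)"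
  using wcellD[OF assms(1)] assms(2,3) by (simp_all add: rwhisk_def)

lemma wcell_rwhisk [simp]:
  assumes "wcell B us vs \<alpha>" "chain B ys" "tgt B (last us) = src B (hd ys)"
  shows "wcell B (us @ ys) (vs @ ys) (rwhisk B us vs ys \<alpha>)"
  using wcellD[OF assms(1)] assms(2,3) chain_nonempty[OF assms(2)]
  by (intro wcellI) (simp_all add: assms chain_append)

lemma rwhisk_vcomp:
  assumes "wcell B us vs \<alpha>" "wcell B vs ws \<beta>" "chain B ys" "tgt B (last us) = src B (hd ys)"
  shows "rwhisk B us ws ys (\<alpha> \<cdot> \<beta>) = rwhisk B us vs ys \<alpha> \<cdot> rwhisk B vs ws ys \<beta>"
  using wcellD[OF assms(1)] wcellD[OF assms(2)] assms(3,4)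
  by (simp add: rwhisk_def vassoc whisk_right_vcomp)

text \<open>Left and right whiskering commute: both splittings begin with an associator for x, and
  naturality carries the cell from one to the other, where they cancel.\<close>

lemma rwhisk_Cons:
  assumes "wcell B us vs \<alpha>" "chain B ys" "tgt B (last us) = src B (hd ys)"
    "x \<in> Arr B" "tgt B x = src B (hd us)"
  shows "rwhisk B (x # us) (x # vs) ys (id2 B x \<ast> \<alpha>) = id2 B x \<ast> rwhisk B us vs ys \<alpha>"
proof -
  let ?Y = "path B ys"
  note w [simp] = wcellD[OF assms(1)] and [simp] = assms(2-5)
  have [simp]: "ys \<noteq> []" using chain_nonempty[OF assms(2)] by auto
  have [simp]: "chain B (us @ ys)" "chain B (vs @ ys)" by (simp_all add: chain_append)
  have 1: "((id2 B x \<ast> \<alpha>) \<ast> id2 B ?Y) \<cdot> associator B x (path B vs) ?Y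
    = associator B x (path B us) ?Y \<cdot> (id2 B x \<ast> (\<alpha> \<ast> id2 B ?Y))"
    by (subst associator_natural) simp_all
  show ?thesis
    by (simp add: rwhisk_def path_split_Cons inv2_vcomp inv2_hcomp vassoc 1[THEN vcomp_extend]
        whisk_left_vcomp)
qed

text \<open>Strict associativity of whiskering, the reason for working with words. The splittings on
  both boundaries are merged by \<open>path_split_assoc\<close>, and the associators that this
  produces cancel by naturality.\<close>

lemma rwhisk_rwhisk:
  assumes "wcell B us vs \<alpha>" "chain B ys" "tgt B (last us) = src B (hd ys)"
    "chain B zs" "tgt B (last ys) = src B (hd zs)"
  shows "rwhisk B (us @ ys) (vs @ ys) zs (rwhisk B us vs ys \<alpha>) = rwhisk B us vs (ys @ zs) \<alpha>"
proof -
  let ?Y = "path B ys" and ?Z = "path B zs" and ?U = "path B us" and ?V = "path B vs"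
  note w [simp] = wcellD[OF assms(1)] and [simp] = assms(2-5)
  have [simp]: "ys \<noteq> []" "zs \<noteq> []" using chain_nonempty[OF assms(2)] chain_nonempty[OF assms(4)] by auto
  have [simp]: "chain B (us @ ys)" "chain B (vs @ ys)" "chain B (ys @ zs)"
    by (simp_all add: chain_append)
  let ?A = "path_split B us ys" and ?A' = "path_split B vs ys" and ?K = "path_split B ys zs"
  let ?E = "path_split B us (ys @ zs)" and ?E' = "path_split B vs (ys @ zs)"
  let ?D = "path_split B (us @ ys) zs" and ?D' = "path_split B (vs @ ys) zs"
  have 1: "(?A' \<ast> id2 B ?Z) \<cdot> ?D' = associator B ?V ?Y ?Z \<cdot> ((id2 B ?V \<ast> ?K) \<cdot> ?E')"
    by (rule path_split_assoc) simp_all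
  have 2: "(?A \<ast> id2 B ?Z) \<cdot> ?D = associator B ?U ?Y ?Z \<cdot> ((id2 B ?U \<ast> ?K) \<cdot> ?E)"
    by (rule path_split_assoc) simp_all
  have 3: "((\<alpha> \<ast> id2 B ?Y) \<ast> id2 B ?Z) \<cdot> associator B ?V ?Y ?Z
      = associator B ?U ?Y ?Z \<cdot> (\<alpha> \<ast> id2 B (?Y \<star> ?Z))"
    by (subst associator_natural) simp_all
  have 4: "(\<alpha> \<ast> id2 B (?Y \<star> ?Z)) \<cdot> (id2 B ?V \<ast> ?K) = (id2 B ?U \<ast> ?K) \<cdot> (\<alpha> \<ast> id2 B (path B (ys @ zs)))"
    by (simp add: hcomp_vcomp)
  have "rwhisk B (us @ ys) (vs @ ys) zs (rwhisk B us vs ys \<alpha>) = inv2 B ?D \<cdot> ((inv2 B ?A \<ast> id2 B ?Z)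
    \<cdot> (((\<alpha> \<ast> id2 B ?Y) \<ast> id2 B ?Z) \<cdot> ((?A' \<ast> id2 B ?Z) \<cdot> ?D')))"
    by (simp add: rwhisk_def whisk_right_vcomp vassoc)
  also have "\<dots> = inv2 B ?D \<cdot> ((inv2 B ?A \<ast> id2 B ?Z)
    \<cdot> (associator B ?U ?Y ?Z \<cdot> ((\<alpha> \<ast> id2 B (?Y \<star> ?Z)) \<cdot> ((id2 B ?V \<ast> ?K) \<cdot> ?E'))))"
    by (simp add: 1 3[THEN vcomp_extend] vassoc)
  also have "\<dots> = inv2 B ?D \<cdot> (inv2 B (?A \<ast> id2 B ?Z)
    \<cdot> (associator B ?U ?Y ?Z \<cdot> ((id2 B ?U \<ast> ?K) \<cdot> ((\<alpha> \<ast> id2 B (path B (ys @ zs))) \<cdot> ?E'))))"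
    by (simp add: 4[THEN vcomp_extend] vassoc inv2_hcomp)
  \<comment> \<open>\<open>?E\<close> and its inverse are inserted so that equation 2 can be read
    backwards; the first bracket then cancels to an identity.\<close>
  also have "\<dots> = (inv2 B ?D \<cdot> (inv2 B (?A \<ast> id2 B ?Z) \<cdot> ((?A \<ast> id2 B ?Z) \<cdot> ?D)))
     \<cdot> (inv2 B ?E \<cdot> ((\<alpha> \<ast> id2 B (path B (ys @ zs))) \<cdot> ?E'))"
    by (simp only: 2) (simp add: vassoc)
  also have "\<dots> = rwhisk B us vs (ys @ zs) \<alpha>"
    by (simp add: rwhisk_def)
  finally show ?thesis .
qed

text \<open>Naturality of \<open>path_split\<close> in its second word, by induction on the first.
  It identifies \<open>lwhisk\<close>, which mentions no associator, with horizontal composition by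
  a whole path.\<close>

lemma path_split_lwhisk:
  assumes "wcell B ws zs \<beta>" "chain B us" "tgt B (last us) = src B (hd ws)"
  shows "path_split B us ws \<cdot> lwhisk B us \<beta> = (id2 B (path B us) \<ast> \<beta>) \<cdot> path_split B us zs"
  using assms(2,3)
proof (induct us)
  case (Cons x us)
  note w [simp] = wcellD[OF assms(1)]
  show ?case
  proof (cases "us = []")
    case True
    then show ?thesis using Cons by (simp add: path_Cons chain_Cons)
  next
    case False
    let ?U = "path B us"
    have [simp]: "chain B us" "tgt B (last us) = src B (hd ws)" "x \<in> Arr B" "tgt B x = src B (hd us)"
      using False Cons by (simp_all add: chain_Cons)
    have [simp]: "us \<noteq> []" by fact
    have wl: "wcell B (us @ ws) (us @ zs) (lwhisk B us \<beta>)"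
      by (rule wcell_lwhisk) (simp_all add: assms(1))
    note [simp] = wcellD[OF wl]
    have 2: "(id2 B (x \<star> ?U) \<ast> \<beta>) \<cdot> associator B x ?U (path B zs)
      = associator B x ?U (path B ws) \<cdot> (id2 B x \<ast> (id2 B ?U \<ast> \<beta>))"
      using associator_natural[of "id2 B x" "id2 B ?U" \<beta> x ?U "path B zs"] by simp
    have "path_split B (x # us) ws \<cdot> lwhisk B (x # us) \<beta>
      = associator B x ?U (path B ws) \<cdot> (id2 B x \<ast> (path_split B us ws \<cdot> lwhisk B us \<beta>))"
      by (simp add: path_split_Cons vassoc whisk_left_vcomp)
    also have "\<dots> = associator B x ?U (path B ws)
        \<cdot> ((id2 B x \<ast> (id2 B ?U \<ast> \<beta>)) \<cdot> (id2 B x \<ast> path_split B us zs))"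
      by (simp add: Cons(1) whisk_left_vcomp)
    also have "\<dots> = (id2 B (x \<star> ?U) \<ast> \<beta>) \<cdot> path_split B (x # us) zs"
      by (simp add: path_split_Cons 2[THEN vcomp_extend] vassoc)
    finally show ?thesis by (simp add: path_Cons)
  qed
qed simp

text \<open>After both whiskerings are expressed through the splittings, this is the interchange law
  of the bicategory for the composites of the words.\<close>

lemma word_interchange:
  assumes "wcell B us vs \<alpha>" "wcell B ws zs \<beta>" "tgt B (last us) = src B (hd ws)"
  shows "rwhisk B us vs ws \<alpha> \<cdot> lwhisk B vs \<beta> = lwhisk B us \<beta> \<cdot> rwhisk B us vs zs \<alpha>"
proof -
  note w [simp] = wcellD[OF assms(1)] wcellD[OF assms(2)] and [simp] = assms(3)
  have wl: "wcell B (us @ ws) (us @ zs) (lwhisk B us \<beta>)" "wcell B (vs @ ws) (vs @ zs) (lwhisk B vs \<beta>)"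
    by (rule wcell_lwhisk; simp add: assms)+
  note [simp] = wcellD[OF wl(1)] wcellD[OF wl(2)]
  have *: "lwhisk B us \<beta> = inv2 B (path_split B us ws) \<cdot> ((id2 B (path B us) \<ast> \<beta>) \<cdot> path_split B us zs)"
    by (rule move_inv_left) (simp_all add: path_split_lwhisk assms)
  show ?thesis
    by (subst *) (simp add: rwhisk_def vassoc path_split_lwhisk[OF assms(2)] hcomp_vcomp[THEN vcomp_extend] hcomp_vcomp)
qed

end

section \<open>Pseudofunctors and words\<close>

context pseudofunctor
begin

declare ps_obj_in [simp]

lemma arr_typing [simp]:
  assumes "f \<in> Arr B"
  shows "ps_arr F f \<in> Arr C" "src C (ps_arr F f) = ps_obj F (src B f)"
    "tgt C (ps_arr F f) = ps_obj F (tgt B f)"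
  using ps_arr_hom[of f "src B f" "tgt B f"] assms by (auto simp: hom1_def)

lemma cell_typing [simp]:
  assumes "\<alpha> \<in> Cell B"
  shows "ps_cell F \<alpha> \<in> Cell C" "dom2 C (ps_cell F \<alpha>) = ps_arr F (dom2 B \<alpha>)"
    "cod2 C (ps_cell F \<alpha>) = ps_arr F (cod2 B \<alpha>)"
  using ps_cell_hom[of \<alpha> "dom2 B \<alpha>" "cod2 B \<alpha>"] assms by (auto simp: hom2_def)

lemma comp_typing [simp]:
  assumes "f \<in> Arr B" "g \<in> Arr B" "tgt B f = src B g"
  shows "ps_comp F (f, g) \<in> Cell C" "dom2 C (ps_comp F (f, g)) = ps_arr F f \<star>\<^bsub>C\<^esub> ps_arr F g"
    "cod2 C (ps_comp F (f, g)) = ps_arr F (f \<star>\<^bsub>B\<^esub> g)" "invertible2 C (ps_comp F (f, g))"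
  using ps_comp_hom[of f g] ps_comp_inv[of f g] assms by (auto simp: hom2_def composable_def)

lemma unit_typing [simp]:
  assumes "X \<in> Obj B"
  shows "ps_unit F X \<in> Cell C" "dom2 C (ps_unit F X) = id1 C (ps_obj F X)"
    "cod2 C (ps_unit F X) = ps_arr F (id1 B X)"
  using ps_unit_hom[of X] assms by (auto simp: hom2_def)

lemma cell_vcomp:
  "\<alpha> \<in> Cell B \<Longrightarrow> \<beta> \<in> Cell B \<Longrightarrow> cod2 B \<alpha> = dom2 B \<beta>
    \<Longrightarrow> ps_cell F (\<alpha> \<cdot>\<^bsub>B\<^esub> \<beta>) = ps_cell F \<alpha> \<cdot>\<^bsub>C\<^esub> ps_cell F \<beta>"
  by (rule ps_cell_vcomp) (auto simp: hom2_def)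

declare ps_cell_id2 [simp]

lemma comp_nat:
  assumes "\<alpha> \<in> Cell B" "\<beta> \<in> Cell B" "tgt B (dom2 B \<alpha>) = src B (dom2 B \<beta>)"
  shows "ps_comp F (dom2 B \<alpha>, dom2 B \<beta>) \<cdot>\<^bsub>C\<^esub> ps_cell F (\<alpha> \<ast>\<^bsub>B\<^esub> \<beta>)
    = (ps_cell F \<alpha> \<ast>\<^bsub>C\<^esub> ps_cell F \<beta>) \<cdot>\<^bsub>C\<^esub> ps_comp F (cod2 B \<alpha>, cod2 B \<beta>)"
  by (rule ps_comp_nat[symmetric]) (use assms in \<open>auto simp: hom2_def\<close>)

lemma coh_assoc:
  assumes "f \<in> Arr B" "g \<in> Arr B" "h \<in> Arr B" "tgt B f = src B g" "tgt B g = src B h"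
  shows "(ps_comp F (f, g) \<ast>\<^bsub>C\<^esub> id2 C (ps_arr F h)) \<cdot>\<^bsub>C\<^esub> (ps_comp F (f \<star>\<^bsub>B\<^esub> g, h)
      \<cdot>\<^bsub>C\<^esub> ps_cell F (associator B f g h))
    = associator C (ps_arr F f) (ps_arr F g) (ps_arr F h)
      \<cdot>\<^bsub>C\<^esub> ((id2 C (ps_arr F f) \<ast>\<^bsub>C\<^esub> ps_comp F (g, h)) \<cdot>\<^bsub>C\<^esub> ps_comp F (f, g \<star>\<^bsub>B\<^esub> h))"
proof -
  have "(f, g) \<in> composable B" "(g, h) \<in> composable B"
    using assms by (auto simp: composable_def)
  from ps_coh_assoc[OF this] show ?thesis using assms by (simp add: T.vassoc)
qed

lemma cell_inverse:
  assumes "inverse_cells B \<alpha> \<beta>"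
  shows "inverse_cells C (ps_cell F \<alpha>) (ps_cell F \<beta>)"
proof -
  have *: "\<alpha> \<in> Cell B" "\<beta> \<in> Cell B" "dom2 B \<beta> = cod2 B \<alpha>" "cod2 B \<beta> = dom2 B \<alpha>"
    "\<alpha> \<cdot>\<^bsub>B\<^esub> \<beta> = id2 B (dom2 B \<alpha>)" "\<beta> \<cdot>\<^bsub>B\<^esub> \<alpha> = id2 B (cod2 B \<alpha>)"
    using assms by (auto simp: inverse_cells_def hom2_def)
  show ?thesis
    by (rule T.inverse_cellsI) (simp_all add: * flip: cell_vcomp)
qed

lemma cell_invertible [simp]: "invertible2 B \<alpha> \<Longrightarrow> invertible2 C (ps_cell F \<alpha>)"
  using cell_inverse invertible2_def by metis

lemma cell_inv2: "invertible2 B \<alpha> \<Longrightarrow> ps_cell F (inv2 B \<alpha>) = inv2 C (ps_cell F \<alpha>)"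
  by (rule sym) (intro T.inv2_eqI cell_inverse S.inverse_cells_inv2)

lemma ps_path_Cons: "us \<noteq> [] \<Longrightarrow> ps_path B C F (f # us) =
    (id2 C (ps_arr F f) \<ast>\<^bsub>C\<^esub> ps_path B C F us) \<cdot>\<^bsub>C\<^esub> ps_comp F (f, path B us)"
  by (cases us) auto

lemma chain_map_hd_last [simp]:
  "chain B us \<Longrightarrow> hd (map g us) = g (hd us)" "chain B us \<Longrightarrow> last (map g us) = g (last us)"
  by (drule chain_nonempty, simp add: hd_map last_map)+

lemma chain_map [simp]: "chain B us \<Longrightarrow> chain C (map (ps_arr F) us)"
proof (induct us)
  case (Cons f us)
  then show ?case by (cases us rule: list.exhaust; cases "tl us" rule: list.exhaust) auto
qed simp

lemma ps_path_typing [simp]: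
  assumes "chain B us"
  shows "ps_path B C F us \<in> Cell C" "dom2 C (ps_path B C F us) = path C (map (ps_arr F) us)"
    "cod2 C (ps_path B C F us) = ps_arr F (path B us)" "invertible2 C (ps_path B C F us)"
proof -
  have "ps_path B C F us \<in> Cell C \<and> dom2 C (ps_path B C F us) = path C (map (ps_arr F) us) \<and>
    cod2 C (ps_path B C F us) = ps_arr F (path B us) \<and> invertible2 C (ps_path B C F us)"
    using assms
  proof (induct us)
    case (Cons f us)
    show ?case
    proof (cases "us = []")
      case False
      then have [simp]: "f \<in> Arr B" "tgt B f = src B (hd us)" "chain B us"
        using Cons.prems by (simp_all add: chain_Cons)
      have [simp]: "ps_path B C F us \<in> Cell C"
        "dom2 C (ps_path B C F us) = path C (map (ps_arr F) us)"
        "cod2 C (ps_path B C F us) = ps_arr F (path B us)" "invertible2 C (ps_path B C F us)"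
        using Cons.hyps by simp_all
      from False show ?thesis by (simp add: ps_path_Cons path_Cons hd_map)
    qed (use Cons in simp)
  qed simp
  then show "ps_path B C F us \<in> Cell C" "dom2 C (ps_path B C F us) = path C (map (ps_arr F) us)"
    "cod2 C (ps_path B C F us) = ps_arr F (path B us)" "invertible2 C (ps_path B C F us)" by auto
qed

end

section \<open>Pseudofunctors preserve pastings of word cells\<close>

context pseudofunctor
begin

text \<open>Iterated associativity coherence. The induction step applies \<open>coh_assoc\<close> to
  the first letter and the two remaining paths, after \<open>path_split\<close> has passed through
  the compositor by naturality.\<close>

lemma path_split_map:
  assumes "chain B us" "chain B ys" "tgt B (last us) = src B (hd ys)"
  shows "path_split C (map (ps_arr F) us) (map (ps_arr F) ys) \<cdot>\<^bsub>C\<^esub> ps_path B C F (us @ ys)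
    = (ps_path B C F us \<ast>\<^bsub>C\<^esub> ps_path B C F ys)
      \<cdot>\<^bsub>C\<^esub> (ps_comp F (path B us, path B ys) \<cdot>\<^bsub>C\<^esub> ps_cell F (path_split B us ys))"
  using assms
proof (induct us)
  case (Cons f us)
  have ys [simp]: "ys \<noteq> []" using chain_nonempty[OF Cons.prems(2)] by auto
  have last_us: "us \<noteq> [] \<Longrightarrow> tgt B (last us) = src B (hd ys)" using Cons.prems by simp
  show ?case
  proof (cases "us = []")
    case True
    then show ?thesis using Cons.prems
      by (simp add: ps_path_Cons path_Cons)
  next
    case False
    then have [simp]: "f \<in> Arr B" "tgt B f = src B (hd us)" "chain B us" "chain B ys"
      "tgt B (last us) = src B (hd ys)" "us \<noteq> []"
      using Cons.prems by (simp_all add: chain_Cons)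
    have [simp]: "chain B (us @ ys)" by (simp add: chain_append)
    note IH = Cons.hyps[simplified]
    let ?P = "ps_arr F" let ?f = "?P f" and ?U = "path B us" and ?Y = "path B ys"
    let ?pu = "ps_path B C F us" and ?py = "ps_path B C F ys" and ?S = "path_split B us ys"
    note map_append [simp del] map_append [symmetric, simp]
    have [simp]: "path_split C (map ?P us) (map ?P ys) \<in> Cell C"
      "dom2 C (path_split C (map ?P us) (map ?P ys)) = path C (map ?P us) \<star>\<^bsub>C\<^esub> path C (map ?P ys)"
      "cod2 C (path_split C (map ?P us) (map ?P ys)) = path C (map ?P (us @ ys))"
      "invertible2 C (path_split C (map ?P us) (map ?P ys))"
      by (simp_all)
    have 1: "(id2 C ?f \<ast>\<^bsub>C\<^esub> ps_cell F ?S) \<cdot>\<^bsub>C\<^esub> ps_comp F (f, path B (us @ ys))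
       = ps_comp F (f, ?U \<star>\<^bsub>B\<^esub> ?Y) \<cdot>\<^bsub>C\<^esub> ps_cell F (id2 B f \<ast>\<^bsub>B\<^esub> ?S)"
      using comp_nat[of "id2 B f" ?S] by simp
    have 2: "associator C ?f (path C (map ?P us)) (path C (map ?P ys))
        \<cdot>\<^bsub>C\<^esub> (id2 C ?f \<ast>\<^bsub>C\<^esub> (?pu \<ast>\<^bsub>C\<^esub> ?py))
      = ((id2 C ?f \<ast>\<^bsub>C\<^esub> ?pu) \<ast>\<^bsub>C\<^esub> ?py) \<cdot>\<^bsub>C\<^esub> associator C ?f (?P ?U) (?P ?Y)"
      by (subst T.associator_natural) simp_all
    have "path_split C (map ?P (f # us)) (map ?P ys) \<cdot>\<^bsub>C\<^esub> ps_path B C F ((f # us) @ ys)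
      = associator C ?f (path C (map ?P us)) (path C (map ?P ys))
        \<cdot>\<^bsub>C\<^esub> ((id2 C ?f \<ast>\<^bsub>C\<^esub> (path_split C (map ?P us) (map ?P ys) \<cdot>\<^bsub>C\<^esub> ps_path B C F (us @ ys)))
        \<cdot>\<^bsub>C\<^esub> ps_comp F (f, path B (us @ ys)))"
      by (simp add: path_split_Cons ps_path_Cons T.vassoc T.whisk_left_vcomp)
    also have "\<dots> = associator C ?f (path C (map ?P us)) (path C (map ?P ys))
        \<cdot>\<^bsub>C\<^esub> ((id2 C ?f \<ast>\<^bsub>C\<^esub> (?pu \<ast>\<^bsub>C\<^esub> ?py)) \<cdot>\<^bsub>C\<^esub> ((id2 C ?f \<ast>\<^bsub>C\<^esub> ps_comp F (?U, ?Y))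
        \<cdot>\<^bsub>C\<^esub> ((id2 C ?f \<ast>\<^bsub>C\<^esub> ps_cell F ?S) \<cdot>\<^bsub>C\<^esub> ps_comp F (f, path B (us @ ys)))))"
      by (simp add: IH T.vassoc T.whisk_left_vcomp)
    also have "\<dots> = ((id2 C ?f \<ast>\<^bsub>C\<^esub> ?pu) \<ast>\<^bsub>C\<^esub> ?py) \<cdot>\<^bsub>C\<^esub> ((associator C ?f (?P ?U) (?P ?Y)
        \<cdot>\<^bsub>C\<^esub> ((id2 C ?f \<ast>\<^bsub>C\<^esub> ps_comp F (?U, ?Y)) \<cdot>\<^bsub>C\<^esub> ps_comp F (f, ?U \<star>\<^bsub>B\<^esub> ?Y)))
        \<cdot>\<^bsub>C\<^esub> ps_cell F (id2 B f \<ast>\<^bsub>B\<^esub> ?S))"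
      by (simp add: 1 2[THEN T.vcomp_extend] T.vassoc)
    also have "\<dots> = ((id2 C ?f \<ast>\<^bsub>C\<^esub> ?pu) \<ast>\<^bsub>C\<^esub> ?py)
        \<cdot>\<^bsub>C\<^esub> ((ps_comp F (f, ?U) \<ast>\<^bsub>C\<^esub> id2 C (?P ?Y)) \<cdot>\<^bsub>C\<^esub> (ps_comp F (f \<star>\<^bsub>B\<^esub> ?U, ?Y)
        \<cdot>\<^bsub>C\<^esub> ps_cell F (associator B f ?U ?Y \<cdot>\<^bsub>B\<^esub> (id2 B f \<ast>\<^bsub>B\<^esub> ?S))))"
      by (subst coh_assoc[symmetric]) (simp_all add: T.vassoc cell_vcomp)
    also have "\<dots> = (((id2 C ?f \<ast>\<^bsub>C\<^esub> ?pu) \<cdot>\<^bsub>C\<^esub> ps_comp F (f, ?U)) \<ast>\<^bsub>C\<^esub> ?py)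
        \<cdot>\<^bsub>C\<^esub> (ps_comp F (f \<star>\<^bsub>B\<^esub> ?U, ?Y)
        \<cdot>\<^bsub>C\<^esub> ps_cell F (associator B f ?U ?Y \<cdot>\<^bsub>B\<^esub> (id2 B f \<ast>\<^bsub>B\<^esub> ?S)))"
      by (simp add: T.hcomp_vcomp[THEN T.vcomp_extend])
    finally show ?thesis by (simp add: path_split_Cons ps_path_Cons path_Cons)
  qed
qed simp

lemma ps_on_paths_typing [simp]:
  assumes "wcell B us vs \<alpha>"
  shows "wcell C (map (ps_arr F) us) (map (ps_arr F) vs) (ps_on_paths B C F us vs \<alpha>)"
  using S.wcellD[OF assms] by (intro T.wcellI) (simp_all add: ps_on_paths_def)

lemma ps_on_paths_vcomp:
  assumes "wcell B us vs \<alpha>" "wcell B vs ws \<beta>"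
  shows "ps_on_paths B C F us ws (\<alpha> \<cdot>\<^bsub>B\<^esub> \<beta>)
    = ps_on_paths B C F us vs \<alpha> \<cdot>\<^bsub>C\<^esub> ps_on_paths B C F vs ws \<beta>"
  using S.wcellD[OF assms(1)] S.wcellD[OF assms(2)]
  by (simp add: ps_on_paths_def T.vassoc cell_vcomp)

lemma ps_on_paths_Cons:
  assumes "wcell B us vs \<alpha>" "x \<in> Arr B" "tgt B x = src B (hd us)"
  shows "ps_on_paths B C F (x # us) (x # vs) (id2 B x \<ast>\<^bsub>B\<^esub> \<alpha>)
    = id2 C (ps_arr F x) \<ast>\<^bsub>C\<^esub> ps_on_paths B C F us vs \<alpha>"
proof -
  note [simp] = S.wcellD[OF assms(1)] assms(2,3)
  have 1: "ps_comp F (x, path B us) \<cdot>\<^bsub>C\<^esub> ps_cell F (id2 B x \<ast>\<^bsub>B\<^esub> \<alpha>)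
    = (id2 C (ps_arr F x) \<ast>\<^bsub>C\<^esub> ps_cell F \<alpha>) \<cdot>\<^bsub>C\<^esub> ps_comp F (x, path B vs)"
    using comp_nat[of "id2 B x" \<alpha>] by simp
  show ?thesis
    by (simp add: ps_on_paths_def ps_path_Cons T.inv2_vcomp T.inv2_hcomp T.vassoc 1[THEN T.vcomp_extend]
        T.whisk_left_vcomp)
qed

text \<open>With \<open>ps_on_paths_vcomp\<close> and \<open>ps_on_paths_Cons\<close> this lets an
  equation between pastings of words be transported along a pseudofunctor as it stands, compositors
  and associators being absorbed in \<open>ps_on_paths\<close> and \<open>rwhisk\<close>.\<close>

lemma ps_on_paths_rwhisk:
  assumes "wcell B us vs \<alpha>" "chain B ys" "tgt B (last us) = src B (hd ys)"
  shows "ps_on_paths B C F (us @ ys) (vs @ ys) (rwhisk B us vs ys \<alpha>)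
    = rwhisk C (map (ps_arr F) us) (map (ps_arr F) vs) (map (ps_arr F) ys) (ps_on_paths B C F us vs \<alpha>)"
proof -
  let ?P = "ps_arr F" let ?Y = "path B ys" and ?U = "path B us" and ?V = "path B vs"
  let ?pu = "ps_path B C F us" and ?pv = "ps_path B C F vs" and ?py = "ps_path B C F ys"
  let ?S = "path_split B us ys" and ?S' = "path_split B vs ys"
  let ?M = "path_split C (map ?P us) (map ?P ys)" and ?M' = "path_split C (map ?P vs) (map ?P ys)"
  note w [simp] = S.wcellD[OF assms(1)] and [simp] = assms
  have [simp]: "ys \<noteq> []" using chain_nonempty[OF assms(2)] by auto
  have [simp]: "chain B (us @ ys)" "chain B (vs @ ys)" by (simp_all add: chain_append)
  note map_append [simp del] map_append [symmetric, simp]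
  have [simp]: "?M \<in> Cell C" "?M' \<in> Cell C" "invertible2 C ?M" "invertible2 C ?M'"
    "dom2 C ?M = path C (map ?P us) \<star>\<^bsub>C\<^esub> path C (map ?P ys)"
    "cod2 C ?M = path C (map ?P (us @ ys))"
    "dom2 C ?M' = path C (map ?P vs) \<star>\<^bsub>C\<^esub> path C (map ?P ys)"
    "cod2 C ?M' = path C (map ?P (vs @ ys))"
    by (simp_all)
  have 1: "?M \<cdot>\<^bsub>C\<^esub> ps_path B C F (us @ ys)
    = (?pu \<ast>\<^bsub>C\<^esub> ?py) \<cdot>\<^bsub>C\<^esub> (ps_comp F (?U, ?Y) \<cdot>\<^bsub>C\<^esub> ps_cell F ?S)"
    "?M' \<cdot>\<^bsub>C\<^esub> ps_path B C F (vs @ ys)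
    = (?pv \<ast>\<^bsub>C\<^esub> ?py) \<cdot>\<^bsub>C\<^esub> (ps_comp F (?V, ?Y) \<cdot>\<^bsub>C\<^esub> ps_cell F ?S')"
    by (simp_all add: path_split_map)
  have 2: "ps_comp F (?U, ?Y) \<cdot>\<^bsub>C\<^esub> ps_cell F (\<alpha> \<ast>\<^bsub>B\<^esub> id2 B ?Y)
    = (ps_cell F \<alpha> \<ast>\<^bsub>C\<^esub> id2 C (?P ?Y)) \<cdot>\<^bsub>C\<^esub> ps_comp F (?V, ?Y)"
    using comp_nat[of \<alpha> "id2 B ?Y"] by simp
  let ?W = "rwhisk B us vs ys \<alpha>" and ?R = "((?pu \<cdot>\<^bsub>C\<^esub> (ps_cell F \<alpha> \<cdot>\<^bsub>C\<^esub> inv2 C ?pv))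
     \<ast>\<^bsub>C\<^esub> id2 C (path C (map ?P ys)))"
  \<comment> \<open>The equation is proved after composing with the splitting \<open>?M\<close>,
    where \<open>path_split_map\<close> applies at both ends; \<open>?M\<close> is cancelled
    afterwards.\<close>
  have "?M \<cdot>\<^bsub>C\<^esub> (ps_path B C F (us @ ys) \<cdot>\<^bsub>C\<^esub> ps_cell F ?W)
     = (?pu \<ast>\<^bsub>C\<^esub> ?py) \<cdot>\<^bsub>C\<^esub> (ps_comp F (?U, ?Y) \<cdot>\<^bsub>C\<^esub>
        ps_cell F (?S \<cdot>\<^bsub>B\<^esub> ?W))"
    by (simp add: 1[THEN T.vcomp_extend] T.vassoc cell_vcomp)
  also have "?S \<cdot>\<^bsub>B\<^esub> ?W = (\<alpha> \<ast>\<^bsub>B\<^esub> id2 B ?Y) \<cdot>\<^bsub>B\<^esub> ?S'"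
    by (simp add: rwhisk_def)
  also have "(?pu \<ast>\<^bsub>C\<^esub> ?py) \<cdot>\<^bsub>C\<^esub> (ps_comp F (?U, ?Y) \<cdot>\<^bsub>C\<^esub>
        ps_cell F ((\<alpha> \<ast>\<^bsub>B\<^esub> id2 B ?Y) \<cdot>\<^bsub>B\<^esub> ?S'))
     = ((?pu \<cdot>\<^bsub>C\<^esub> ps_cell F \<alpha>) \<ast>\<^bsub>C\<^esub> ?py) \<cdot>\<^bsub>C\<^esub> (ps_comp F (?V, ?Y) \<cdot>\<^bsub>C\<^esub> ps_cell F ?S')"
    by (simp add: cell_vcomp 2[THEN T.vcomp_extend] T.vassoc T.hcomp_vcomp[THEN T.vcomp_extend])
  also have "((?pu \<cdot>\<^bsub>C\<^esub> ps_cell F \<alpha>) \<ast>\<^bsub>C\<^esub> ?py) = ?R \<cdot>\<^bsub>C\<^esub> (?pv \<ast>\<^bsub>C\<^esub> ?py)"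
    by (simp add: T.hcomp_vcomp T.vassoc)
  also have "(?R \<cdot>\<^bsub>C\<^esub> (?pv \<ast>\<^bsub>C\<^esub> ?py)) \<cdot>\<^bsub>C\<^esub> (ps_comp F (?V, ?Y) \<cdot>\<^bsub>C\<^esub> ps_cell F ?S')
      = ?R \<cdot>\<^bsub>C\<^esub> (?M' \<cdot>\<^bsub>C\<^esub> ps_path B C F (vs @ ys))"
    by (simp add: 1 T.vassoc)
  finally have 3: "?M \<cdot>\<^bsub>C\<^esub> (ps_path B C F (us @ ys) \<cdot>\<^bsub>C\<^esub> ps_cell F ?W)
     = ?R \<cdot>\<^bsub>C\<^esub> (?M' \<cdot>\<^bsub>C\<^esub> ps_path B C F (vs @ ys))" .
  have 4: "ps_path B C F (us @ ys) \<cdot>\<^bsub>C\<^esub> ps_cell F ?W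
      = inv2 C ?M \<cdot>\<^bsub>C\<^esub> (?R \<cdot>\<^bsub>C\<^esub> (?M' \<cdot>\<^bsub>C\<^esub> ps_path B C F (vs @ ys)))"
    by (rule T.move_inv_left[OF _ _ _ _ 3]) (simp_all add:)
  show ?thesis
    unfolding ps_on_paths_def 4 by (simp add: rwhisk_def T.vassoc)
qed

end

section \<open>Bicategories with strict units\<close>

text \<open>Units are strict, but associators stay arbitrary, as \<open>TwoVect\<close> demands.
  That an associator with a unit argument is an identity is derived below from triangle and
  pentagon.\<close>

locale su_bicat = bicategory +
  assumes id1_left [simp]: "f \<in> Arr B \<Longrightarrow> src B f = X \<Longrightarrow> id1 B X \<star> f = f"
    and id1_right [simp]: "f \<in> Arr B \<Longrightarrow> tgt B f = X \<Longrightarrow> f \<star> id1 B X = f"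
    and lunitor_id2 [simp]: "f \<in> Arr B \<Longrightarrow> lunitor B f = id2 B f"
    and runitor_id2 [simp]: "f \<in> Arr B \<Longrightarrow> runitor B f = id2 B f"
begin

lemma hcomp_id_left [simp]:
  assumes "\<alpha> \<in> Cell B" "src B (dom2 B \<alpha>) = X"
  shows "id2 B (id1 B X) \<ast> \<alpha> = \<alpha>"
  using lunitor_nat[of \<alpha> "dom2 B \<alpha>" "cod2 B \<alpha>" X "tgt B (dom2 B \<alpha>)"] assms
  by (auto simp: hom2_def hom1_def)

lemma hcomp_id_right [simp]:
  assumes "\<alpha> \<in> Cell B" "tgt B (dom2 B \<alpha>) = X"
  shows "\<alpha> \<ast> id2 B (id1 B X) = \<alpha>"
  using runitor_nat[of \<alpha> "dom2 B \<alpha>" "cod2 B \<alpha>" "src B (dom2 B \<alpha>)" X] assms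
  by (auto simp: hom2_def hom1_def)

lemma associator_unit_mid [simp]:
  assumes "f \<in> Arr B" "g \<in> Arr B" "tgt B f = X" "src B g = X"
  shows "associator B f (id1 B X) g = id2 B (f \<star> g)"
  using triangle[of f "src B f" X g "tgt B g"] assms by (auto simp: hom1_def)

lemma idempotent_invertible:
  assumes "invertible2 B \<alpha>" "cod2 B \<alpha> = dom2 B \<alpha>" "\<alpha> \<cdot> \<alpha> = \<alpha>"
  shows "\<alpha> = id2 B (dom2 B \<alpha>)"
  using assms invertible_cell[OF assms(1)] inv2_cancel(2)[OF assms(1) invertible_cell[OF assms(1)]]
  by simp

text \<open>If the first two arguments of the pentagon are units, every other cell in it is an
  identity by \<open>associator_unit_mid\<close>, and it says that this associator is idempotent;
  being invertible, it is then an identity.\<close>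

lemma associator_unit_left [simp]:
  assumes "h \<in> Arr B" "k \<in> Arr B" "src B h = X" "tgt B h = src B k"
  shows "associator B (id1 B X) h k = id2 B (h \<star> k)"
proof -
  have [simp]: "X \<in> Obj B" using assms by auto
  have "associator B (id1 B X) h k \<cdot> associator B (id1 B X) h k = associator B (id1 B X) h k"
    using pentagon_right[of "id1 B X" "id1 B X" h k] assms by simp
  from idempotent_invertible[OF _ _ this] show ?thesis using assms by simp
qed

lemma associator_unit_right [simp]:
  assumes "f \<in> Arr B" "g \<in> Arr B" "tgt B g = X" "tgt B f = src B g"
  shows "associator B f g (id1 B X) = id2 B (f \<star> g)"
proof -
  have [simp]: "X \<in> Obj B" using assms by auto
  have "associator B f g (id1 B X) \<cdot> associator B f g (id1 B X) = associator B f g (id1 B X)"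
    using pentagon_right[of f g "id1 B X" "id1 B X"] assms by simp
  from idempotent_invertible[OF _ _ this] show ?thesis using assms by simp
qed

end

section \<open>Rebracketing of whiskered cells\<close>

context bicategory
begin

lemma associator_natural_inv:
  assumes "\<alpha> \<in> Cell B" "\<beta> \<in> Cell B" "\<gamma> \<in> Cell B"
    "tgt B (dom2 B \<alpha>) = src B (dom2 B \<beta>)" "tgt B (dom2 B \<beta>) = src B (dom2 B \<gamma>)"
  shows "(\<alpha> \<ast> (\<beta> \<ast> \<gamma>)) \<cdot> inv2 B (associator B (cod2 B \<alpha>) (cod2 B \<beta>) (cod2 B \<gamma>))
    = inv2 B (associator B (dom2 B \<alpha>) (dom2 B \<beta>) (dom2 B \<gamma>)) \<cdot> ((\<alpha> \<ast> \<beta>) \<ast> \<gamma>)"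
    (is "_ \<cdot> inv2 B ?a' = inv2 B ?a \<cdot> _")
proof -
  note [simp] = assms
  have "inv2 B ?a \<cdot> (?a \<cdot> ((\<alpha> \<ast> (\<beta> \<ast> \<gamma>)) \<cdot> inv2 B ?a'))
    = inv2 B ?a \<cdot> ((((\<alpha> \<ast> \<beta>) \<ast> \<gamma>) \<cdot> ?a') \<cdot> inv2 B ?a')"
    by (subst associator_natural) (simp_all add: vassoc)
  then show ?thesis by (simp add: vassoc)
qed

lemma rwhisk_2_2:
  "x \<in> Arr B \<Longrightarrow> y \<in> Arr B \<Longrightarrow> z \<in> Arr B \<Longrightarrow> tgt B x = src B y \<Longrightarrow> tgt B y = src B z \<Longrightarrow>
   x' \<in> Arr B \<Longrightarrow> y' \<in> Arr B \<Longrightarrow> tgt B x' = src B y' \<Longrightarrow> tgt B y' = src B z \<Longrightarrow>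
   rwhisk B [x, y] [x', y'] [z] \<alpha>
     = inv2 B (associator B x y z) \<cdot> ((\<alpha> \<ast> id2 B z) \<cdot> associator B x' y' z)"
  by (simp add: rwhisk_def)

lemma rwhisk_2_1:
  assumes "\<alpha> \<in> Cell B" "dom2 B \<alpha> = x \<star> y" "cod2 B \<alpha> = x'" "x \<in> Arr B" "y \<in> Arr B" "z \<in> Arr B"
    "tgt B x = src B y" "tgt B y = src B z" 
  shows "rwhisk B [x, y] [x'] [z] \<alpha> = inv2 B (associator B x y z) \<cdot> (\<alpha> \<ast> id2 B z)"
proof -
  have "x' \<in> Arr B" "tgt B x' = src B z" using assms tgt_cod2[OF assms(1)] by auto
  then show ?thesis using assms by (simp add: rwhisk_def)
qed

text \<open>Cutting the single letter p \<star> q into the two letters p and q costs an associator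
  at either boundary, and whiskering by z relates these associators by a pentagon.
  \<open>pt_then\<close> fuses two letters into one in this way, so its whiskerings are computed
  from those of the underlying word cell.\<close>

lemma rwhisk_regroup:
  assumes "wcell B [x, p, q] [p', q', y] N" "z \<in> Arr B" "tgt B y = src B z"
  shows "(id2 B x \<ast> inv2 B (associator B p q z))
      \<cdot> rwhisk B [x, p \<star> q] [p' \<star> q', y] [z] (N \<cdot> inv2 B (associator B p' q' y))
    = rwhisk B [x, p, q] [p', q', y] [z] N \<cdot> inv2 B (associator B p' q' (y \<star> z))"
proof -
  note [simp] = assms(2,3)
  have [simp]: "x \<in> Arr B" "p \<in> Arr B" "q \<in> Arr B" "y \<in> Arr B" "p' \<in> Arr B" "q' \<in> Arr B"
    "tgt B x = src B p" "tgt B p = src B q" "tgt B q = src B z" "tgt B p' = src B q'"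
    "tgt B q' = src B y" "N \<in> Cell B" "dom2 B N = x \<star> (p \<star> q)" "cod2 B N = p' \<star> (q' \<star> y)"
    using wcellD[OF assms(1)] by auto
  \<comment> \<open>The pentagon for p', q', y, z with its first associator moved to the other side;
    composing with the last one on the right allows the pentagon to be used before
    cancelling.\<close>
  have "(inv2 B (associator B p' q' y) \<ast> id2 B z) \<cdot> (associator B (p' \<star> q') y z \<cdot> associator B p' q' (y \<star> z))
    = associator B p' (q' \<star> y) z \<cdot> (id2 B p' \<ast> associator B q' y z)"
    by (subst pentagon_right[symmetric]) (simp_all add: hcomp_vcomp[THEN vcomp_extend])
  then have "((inv2 B (associator B p' q' y) \<ast> id2 B z) \<cdot> associator B (p' \<star> q') y z) \<cdot> associator B p' q' (y \<star> z)
    = ((associator B p' (q' \<star> y) z \<cdot> (id2 B p' \<ast> associator B q' y z)) \<cdot> inv2 B (associator B p' q' (y \<star> z)))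
      \<cdot> associator B p' q' (y \<star> z)"
    by (simp add: vassoc)
  then have 1: "(inv2 B (associator B p' q' y) \<ast> id2 B z) \<cdot> associator B (p' \<star> q') y z
    = (associator B p' (q' \<star> y) z \<cdot> (id2 B p' \<ast> associator B q' y z)) \<cdot> inv2 B (associator B p' q' (y \<star> z))"
    by (rule cancel_inv_right[rotated -1]) simp_all
  show ?thesis
    by (simp add: rwhisk_def whisk_right_vcomp vassoc 1 inv2_vcomp inv2_hcomp)
qed

end

section \<open>Pseudonatural transformations\<close>

locale su_pseudonatural = C: su_bicat C + pseudonatural B C \<sigma>
  for B :: "('o, 'a, 'c) bicat" and C :: "('p, 'b, 'd) bicat" and \<sigma>
begin

lemma map_typing [simp]:
  assumes "X \<in> Obj B"
  shows "pt_map \<sigma> X \<in> Arr C" "src C (pt_map \<sigma> X) = ps_obj (pt_src \<sigma>) X"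
    "tgt C (pt_map \<sigma> X) = ps_obj (pt_tgt \<sigma>) X"
  using pt_map_hom[OF assms] by (auto simp: hom1_def)

lemma nat_typing [simp]:
  assumes "f \<in> Arr B"
  shows "pt_nat \<sigma> f \<in> Cell C"
    "dom2 C (pt_nat \<sigma> f) = ps_arr (pt_src \<sigma>) f \<star>\<^bsub>C\<^esub> pt_map \<sigma> (tgt B f)"
    "cod2 C (pt_nat \<sigma> f) = pt_map \<sigma> (src B f) \<star>\<^bsub>C\<^esub> ps_arr (pt_tgt \<sigma>) f"
    "invertible2 C (pt_nat \<sigma> f)"
  using pt_nat_hom[of f "src B f" "tgt B f"] pt_nat_inv[of f] assms by (auto simp: hom1_def hom2_def)

lemma nat_nat:
  assumes "\<alpha> \<in> Cell B"
  shows "(ps_cell (pt_src \<sigma>) \<alpha> \<ast>\<^bsub>C\<^esub> id2 C (pt_map \<sigma> (tgt B (dom2 B \<alpha>)))) \<cdot>\<^bsub>C\<^esub> pt_nat \<sigma> (cod2 B \<alpha>)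
    = pt_nat \<sigma> (dom2 B \<alpha>) \<cdot>\<^bsub>C\<^esub> (id2 C (pt_map \<sigma> (src B (dom2 B \<alpha>))) \<ast>\<^bsub>C\<^esub> ps_cell (pt_tgt \<sigma>) \<alpha>)"
  by (rule pt_nat_nat) (use assms in \<open>auto simp: hom1_def hom2_def\<close>)

lemma nat_unit:
  assumes "X \<in> Obj B"
  shows "(ps_unit (pt_src \<sigma>) X \<ast>\<^bsub>C\<^esub> id2 C (pt_map \<sigma> X)) \<cdot>\<^bsub>C\<^esub> pt_nat \<sigma> (id1 B X)
    = id2 C (pt_map \<sigma> X) \<ast>\<^bsub>C\<^esub> ps_unit (pt_tgt \<sigma>) X"
  using pt_nat_unit[OF assms] assms by simp

lemma wcell_nat [simp]:
  assumes "f \<in> Arr B" "src B f = X" "tgt B f = Y"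
  shows "wcell C [ps_arr (pt_src \<sigma>) f, pt_map \<sigma> Y] [pt_map \<sigma> X, ps_arr (pt_tgt \<sigma>) f] (pt_nat \<sigma> f)"
  using assms by (intro C.wcellI) auto

text \<open>In word form the composition axiom of \<open>pseudonatural\<close> loses its
  associators. The leading one moves to the left side, and the remaining two surround the naturality
  cell at f exactly as in \<open>rwhisk\<close>.\<close>

lemma nat_comp:
  assumes "f \<in> Arr B" "g \<in> Arr B" "tgt B f = src B g"
  shows "rwhisk C [ps_arr (pt_src \<sigma>) f, ps_arr (pt_src \<sigma>) g] [ps_arr (pt_src \<sigma>) (f \<star>\<^bsub>B\<^esub> g)]
        [pt_map \<sigma> (tgt B g)] (ps_comp (pt_src \<sigma>) (f, g)) \<cdot>\<^bsub>C\<^esub> pt_nat \<sigma> (f \<star>\<^bsub>B\<^esub> g)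
    = (id2 C (ps_arr (pt_src \<sigma>) f) \<ast>\<^bsub>C\<^esub> pt_nat \<sigma> g)
      \<cdot>\<^bsub>C\<^esub> (rwhisk C [ps_arr (pt_src \<sigma>) f, pt_map \<sigma> (src B g)]
        [pt_map \<sigma> (src B f), ps_arr (pt_tgt \<sigma>) f] [ps_arr (pt_tgt \<sigma>) g] (pt_nat \<sigma> f)
      \<cdot>\<^bsub>C\<^esub> (id2 C (pt_map \<sigma> (src B f)) \<ast>\<^bsub>C\<^esub> ps_comp (pt_tgt \<sigma>) (f, g)))"
proof -
  have "f \<in> hom1 B (src B f) (src B g)" "g \<in> hom1 B (src B g) (tgt B g)"
    using assms by (auto simp: hom1_def)
  from pt_nat_comp[OF this] assms show ?thesis
    by (simp add: C.rwhisk_2_1 C.rwhisk_2_2 C.vassoc)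
qed

end

text \<open>The associator that separates the word form of the composition axiom from the original
  is invertible, so the word form is also sufficient; unitors disappear from the unit axiom by
  strictness.\<close>

lemma su_pseudonaturalI:
  assumes "su_bicat C" "pseudofunctor B C (pt_src \<sigma>)" "pseudofunctor B C (pt_tgt \<sigma>)"
    and "pt_map \<sigma> \<in> extensional (Obj B)" "pt_nat \<sigma> \<in> extensional (Arr B)"
    and map_typing: "\<And>X. X \<in> Obj B \<Longrightarrow> pt_map \<sigma> X \<in> Arr C"
      "\<And>X. X \<in> Obj B \<Longrightarrow> src C (pt_map \<sigma> X) = ps_obj (pt_src \<sigma>) X"
      "\<And>X. X \<in> Obj B \<Longrightarrow> tgt C (pt_map \<sigma> X) = ps_obj (pt_tgt \<sigma>) X"
    and nat_typing: "\<And>f. f \<in> Arr B \<Longrightarrow> pt_nat \<sigma> f \<in> Cell C"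
      "\<And>f. f \<in> Arr B \<Longrightarrow> dom2 C (pt_nat \<sigma> f) = ps_arr (pt_src \<sigma>) f \<star>\<^bsub>C\<^esub> pt_map \<sigma> (tgt B f)"
      "\<And>f. f \<in> Arr B \<Longrightarrow> cod2 C (pt_nat \<sigma> f) = pt_map \<sigma> (src B f) \<star>\<^bsub>C\<^esub> ps_arr (pt_tgt \<sigma>) f"
      "\<And>f. f \<in> Arr B \<Longrightarrow> invertible2 C (pt_nat \<sigma> f)"
    and nat_nat: "\<And>\<alpha>. \<alpha> \<in> Cell B \<Longrightarrow>
      (ps_cell (pt_src \<sigma>) \<alpha> \<ast>\<^bsub>C\<^esub> id2 C (pt_map \<sigma> (tgt B (dom2 B \<alpha>)))) \<cdot>\<^bsub>C\<^esub> pt_nat \<sigma> (cod2 B \<alpha>)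
      = pt_nat \<sigma> (dom2 B \<alpha>) \<cdot>\<^bsub>C\<^esub> (id2 C (pt_map \<sigma> (src B (dom2 B \<alpha>))) \<ast>\<^bsub>C\<^esub> ps_cell (pt_tgt \<sigma>) \<alpha>)"
    and nat_unit: "\<And>X. X \<in> Obj B \<Longrightarrow>
      (ps_unit (pt_src \<sigma>) X \<ast>\<^bsub>C\<^esub> id2 C (pt_map \<sigma> X)) \<cdot>\<^bsub>C\<^esub> pt_nat \<sigma> (id1 B X)
      = id2 C (pt_map \<sigma> X) \<ast>\<^bsub>C\<^esub> ps_unit (pt_tgt \<sigma>) X"
    and nat_comp: "\<And>f g. f \<in> Arr B \<Longrightarrow> g \<in> Arr B \<Longrightarrow> tgt B f = src B g \<Longrightarrow>
      rwhisk C [ps_arr (pt_src \<sigma>) f, ps_arr (pt_src \<sigma>) g] [ps_arr (pt_src \<sigma>) (f \<star>\<^bsub>B\<^esub> g)]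
        [pt_map \<sigma> (tgt B g)] (ps_comp (pt_src \<sigma>) (f, g)) \<cdot>\<^bsub>C\<^esub> pt_nat \<sigma> (f \<star>\<^bsub>B\<^esub> g)
      = (id2 C (ps_arr (pt_src \<sigma>) f) \<ast>\<^bsub>C\<^esub> pt_nat \<sigma> g)
        \<cdot>\<^bsub>C\<^esub> (rwhisk C [ps_arr (pt_src \<sigma>) f, pt_map \<sigma> (src B g)]
          [pt_map \<sigma> (src B f), ps_arr (pt_tgt \<sigma>) f] [ps_arr (pt_tgt \<sigma>) g] (pt_nat \<sigma> f)
        \<cdot>\<^bsub>C\<^esub> (id2 C (pt_map \<sigma> (src B f)) \<ast>\<^bsub>C\<^esub> ps_comp (pt_tgt \<sigma>) (f, g)))"
  shows "su_pseudonatural B C \<sigma>"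
proof -
  interpret C: su_bicat C by fact
  interpret F: pseudofunctor B C "pt_src \<sigma>" by fact
  interpret G: pseudofunctor B C "pt_tgt \<sigma>" by fact
  note [simp] = map_typing nat_typing
  show ?thesis
  proof (intro su_pseudonatural.intro pseudonatural.intro pseudonatural_axioms.intro, goal_cases)
    case (6 X) then show ?case by (simp add: hom1_def)
  next
    case (7 f X Y) then show ?case by (simp add: hom1_def hom2_def)
  next
    case (9 f X Y \<alpha> g) then show ?case using nat_nat[of \<alpha>] by (auto simp: hom1_def hom2_def)
  next
    case (10 X) then show ?case using nat_unit[of X] by simp
  next
    case (11 f X Y g Z)
    then have [simp]: "f \<in> Arr B" "g \<in> Arr B" "src B f = X" "tgt B f = Y" "src B g = Y" "tgt B g = Z"
      and obj: "X \<in> Obj B" "Y \<in> Obj B" "Z \<in> Obj B"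
      by (auto simp: hom1_def)
    note [simp] = obj
    let ?a = "associator C (ps_arr (pt_src \<sigma>) f) (ps_arr (pt_src \<sigma>) g) (pt_map \<sigma> Z)"
    have "inv2 C ?a \<cdot>\<^bsub>C\<^esub> ((ps_comp (pt_src \<sigma>) (f, g) \<ast>\<^bsub>C\<^esub> id2 C (pt_map \<sigma> Z)) \<cdot>\<^bsub>C\<^esub> pt_nat \<sigma> (f \<star>\<^bsub>B\<^esub> g))
      = (id2 C (ps_arr (pt_src \<sigma>) f) \<ast>\<^bsub>C\<^esub> pt_nat \<sigma> g)
        \<cdot>\<^bsub>C\<^esub> (rwhisk C [ps_arr (pt_src \<sigma>) f, pt_map \<sigma> Y]
          [pt_map \<sigma> X, ps_arr (pt_tgt \<sigma>) f] [ps_arr (pt_tgt \<sigma>) g] (pt_nat \<sigma> f)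
        \<cdot>\<^bsub>C\<^esub> (id2 C (pt_map \<sigma> X) \<ast>\<^bsub>C\<^esub> ps_comp (pt_tgt \<sigma>) (f, g)))" (is "_ = ?R")
      using nat_comp[of f g] by (simp add: C.rwhisk_2_1 C.vassoc)
    \<comment> \<open>Restores the leading associator that the word form had moved to the left
      side.\<close>
    then have "?a \<cdot>\<^bsub>C\<^esub> (inv2 C ?a \<cdot>\<^bsub>C\<^esub> ((ps_comp (pt_src \<sigma>) (f, g) \<ast>\<^bsub>C\<^esub> id2 C (pt_map \<sigma> Z)) \<cdot>\<^bsub>C\<^esub> pt_nat \<sigma> (f \<star>\<^bsub>B\<^esub> g)))
      = ?a \<cdot>\<^bsub>C\<^esub> ?R" by (rule arg_cong)
    then show ?case by (simp add: C.rwhisk_2_2 C.vassoc)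
  qed (use assms in auto)
qed

lemma pt_id_simps [simp]:
  "pt_src (pt_id B C F) = F" "pt_tgt (pt_id B C F) = F"
  by (simp_all add: pt_id_def)

lemma pt_then_simps [simp]:
  "pt_src (pt_then B C \<sigma> \<tau>) = pt_src \<sigma>" "pt_tgt (pt_then B C \<sigma> \<tau>) = pt_tgt \<tau>"
  "X \<in> Obj B \<Longrightarrow> pt_map (pt_then B C \<sigma> \<tau>) X = pt_map \<sigma> X \<star>\<^bsub>C\<^esub> pt_map \<tau> X"
  by (simp_all add: pt_then_def)

lemma pt_then_extensional [simp]:
  "pt_map (pt_then B C \<sigma> \<tau>) \<in> extensional (Obj B)" "pt_nat (pt_then B C \<sigma> \<tau>) \<in> extensional (Arr B)"
  by (simp_all add: pt_then_def)

locale su_bicats = B: bicategory B + C: su_bicat C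
  for B :: "('o, 'a, 'c) bicat" and C :: "('p, 'b, 'd) bicat"
begin

lemma pt_id_map [simp]: "X \<in> Obj B \<Longrightarrow> pt_map (pt_id B C F) X = id1 C (ps_obj F X)"
  by (simp add: pt_id_def)

lemma pt_id_nat [simp]:
  "pseudofunctor B C F \<Longrightarrow> f \<in> Arr B \<Longrightarrow> pt_nat (pt_id B C F) f = id2 C (ps_arr F f)"
proof -
  assume "pseudofunctor B C F" and [simp]: "f \<in> Arr B"
  then interpret F: pseudofunctor B C F by simp
  show ?thesis by (simp add: pt_id_def)
qed

lemma pseudonatural_pt_id:
  assumes "pseudofunctor B C F"
  shows "su_pseudonatural B C (pt_id B C F)"
proof -
  interpret F: pseudofunctor B C F by fact
  note [simp] = assms
  show ?thesis
    by (rule su_pseudonaturalI[OF C.su_bicat_axioms]) (auto simp: pt_id_def C.rwhisk_2_1 C.rwhisk_2_2)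
qed

end

locale su_pseudonatural_pair = \<sigma>: su_pseudonatural B C \<sigma> + \<tau>: su_pseudonatural B C \<tau>
  for B :: "('o, 'a, 'c) bicat" and C :: "('p, 'b, 'd) bicat" and \<sigma> \<tau> +
  assumes match [simp]: "pt_src \<tau> = pt_tgt \<sigma>"
begin

abbreviation "F \<equiv> ps_arr (pt_src \<sigma>)"
abbreviation "G \<equiv> ps_arr (pt_tgt \<sigma>)"
abbreviation "H \<equiv> ps_arr (pt_tgt \<tau>)"
abbreviation "s \<equiv> pt_map \<sigma>"
abbreviation "t \<equiv> pt_map \<tau>"

text \<open>The composite 2-cell as a cell of words; \<^const>\<open>pt_then\<close> only rebrackets its target.\<close>

definition then_nat :: "'a \<Rightarrow> 'd" where
  "then_nat f = rwhisk C [F f, s (tgt B f)] [s (src B f), G f] [t (tgt B f)] (pt_nat \<sigma> f)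
     \<cdot>\<^bsub>C\<^esub> (id2 C (s (src B f)) \<ast>\<^bsub>C\<^esub> pt_nat \<tau> f)"

declare \<tau>.map_typing [simplified, simp] \<tau>.nat_typing [simplified, simp]
  \<tau>.wcell_nat [simplified, simp]

lemma wcell_then_nat [simp]:
  assumes "f \<in> Arr B" "src B f = X" "tgt B f = Y"
  shows "wcell C [F f, s Y, t Y] [s X, t X, H f] (then_nat f)"
  using assms by (intro \<sigma>.C.wcellI) (auto simp: then_nat_def)

lemma then_nat_typing [simp]:
  assumes "f \<in> Arr B"
  shows "then_nat f \<in> Cell C"
    "dom2 C (then_nat f) = F f \<star>\<^bsub>C\<^esub> (s (tgt B f) \<star>\<^bsub>C\<^esub> t (tgt B f))"
    "cod2 C (then_nat f) = s (src B f) \<star>\<^bsub>C\<^esub> (t (src B f) \<star>\<^bsub>C\<^esub> H f)"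
  using \<sigma>.C.wcellD[OF wcell_then_nat[OF assms refl refl]] by simp_all

lemma then_nat_invertible [simp]: "f \<in> Arr B \<Longrightarrow> invertible2 C (then_nat f)"
  by (simp add: then_nat_def \<sigma>.C.rwhisk_2_2)

lemma pt_then_nat [simp]:
  assumes "f \<in> Arr B"
  shows "pt_nat (pt_then B C \<sigma> \<tau>) f
    = then_nat f \<cdot>\<^bsub>C\<^esub> inv2 C (associator C (s (src B f)) (t (src B f)) (H f))"
  using assms by (simp add: pt_then_def Let_def then_nat_def \<sigma>.C.rwhisk_2_2 \<sigma>.C.vassoc)

text \<open>Pasting of squares: the axiom of \<sigma> whiskered on the right by t, the axiom of
  \<tau> whiskered on the left by s, and one interchange between them. Since all terms are word
  cells, no associators have to be tracked.\<close>

lemma then_nat_comp: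
  assumes [simp]: "f \<in> Arr B" "g \<in> Arr B" "tgt B f = src B g"
  shows "rwhisk C [F f, F g] [F (f \<star>\<^bsub>B\<^esub> g)] [s (tgt B g), t (tgt B g)] (ps_comp (pt_src \<sigma>) (f, g))
      \<cdot>\<^bsub>C\<^esub> then_nat (f \<star>\<^bsub>B\<^esub> g)
    = (id2 C (F f) \<ast>\<^bsub>C\<^esub> then_nat g)
      \<cdot>\<^bsub>C\<^esub> (rwhisk C [F f, s (src B g), t (src B g)] [s (src B f), t (src B f), H f] [H g] (then_nat f)
      \<cdot>\<^bsub>C\<^esub> (id2 C (s (src B f)) \<ast>\<^bsub>C\<^esub> (id2 C (t (src B f)) \<ast>\<^bsub>C\<^esub> ps_comp (pt_tgt \<tau>) (f, g))))"
proof -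
  define X Y Z where "X = src B f" and "Y = src B g" and "Z = tgt B g"
  have [simp]: "src B f = X" "src B g = Y" "tgt B g = Z" "tgt B f = Y"
    "X \<in> Obj B" "Y \<in> Obj B" "Z \<in> Obj B"
    by (auto simp: X_def Y_def Z_def)
  let ?fg = "f \<star>\<^bsub>B\<^esub> g"
  let ?Fc = "ps_comp (pt_src \<sigma>) (f, g)" and ?Gc = "ps_comp (pt_tgt \<sigma>) (f, g)"
    and ?Hc = "ps_comp (pt_tgt \<tau>) (f, g)"
  let ?sf = "pt_nat \<sigma> f" and ?sg = "pt_nat \<sigma> g" and ?sfg = "pt_nat \<sigma> ?fg"
  let ?tf = "pt_nat \<tau> f" and ?tg = "pt_nat \<tau> g" and ?tfg = "pt_nat \<tau> ?fg"
  note r = \<sigma>.C.rwhisk_rwhisk[where ys = "[_]", simplified]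
    and wl = \<sigma>.C.wcell_lwhisk[where xs = "[_]", simplified]
  have w [simp]: "wcell C [F f, F g] [F ?fg] ?Fc" "wcell C [G f, G g] [G ?fg] ?Gc"
    "wcell C [H f, H g] [H ?fg] ?Hc"
    by (auto intro!: \<sigma>.C.wcellI)
  let ?Rsf = "rwhisk C [F f, s Y] [s X, G f] [G g] ?sf"
    and ?RFc = "rwhisk C [F f, F g] [F ?fg] [s Z] ?Fc"
  have w2 [simp]: "wcell C [F f, s Y, G g] [s X, G f, G g] ?Rsf"
    "wcell C [F f, F g, s Z] [F ?fg, s Z] ?RFc"
    "wcell C [F f, F g, s Z] [F f, s Y, G g] (id2 C (F f) \<ast>\<^bsub>C\<^esub> ?sg)"
    "wcell C [s X, G f, G g] [s X, G ?fg] (id2 C (s X) \<ast>\<^bsub>C\<^esub> ?Gc)"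
    by (auto intro!: \<sigma>.C.wcellI)
  have w3 [simp]: "wcell C [F f, s Y, G g] [s X, G ?fg] (?Rsf \<cdot>\<^bsub>C\<^esub> (id2 C (s X) \<ast>\<^bsub>C\<^esub> ?Gc))"
    by (auto intro!: \<sigma>.C.wcellI)
  have "rwhisk C [F f, F g] [F ?fg] [s Z, t Z] ?Fc \<cdot>\<^bsub>C\<^esub> rwhisk C [F ?fg, s Z] [s X, G ?fg] [t Z] ?sfg
      = rwhisk C [F f, F g, s Z] [s X, G ?fg] [t Z] (?RFc \<cdot>\<^bsub>C\<^esub> ?sfg)"
    using \<sigma>.C.rwhisk_rwhisk[OF w(1), of "[s Z]" "[t Z]"]
    by (subst \<sigma>.C.rwhisk_vcomp[where vs = "[F ?fg, s Z]"]) simp_all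
  also have "?RFc \<cdot>\<^bsub>C\<^esub> ?sfg = (id2 C (F f) \<ast>\<^bsub>C\<^esub> ?sg) \<cdot>\<^bsub>C\<^esub> (?Rsf \<cdot>\<^bsub>C\<^esub> (id2 C (s X) \<ast>\<^bsub>C\<^esub> ?Gc))"
    using \<sigma>.nat_comp[of f g] by simp
  also have "rwhisk C [F f, F g, s Z] [s X, G ?fg] [t Z] \<dots>
      = (id2 C (F f) \<ast>\<^bsub>C\<^esub> rwhisk C [F g, s Z] [s Y, G g] [t Z] ?sg)
      \<cdot>\<^bsub>C\<^esub> (rwhisk C [F f, s Y] [s X, G f] [G g, t Z] ?sf
      \<cdot>\<^bsub>C\<^esub> (id2 C (s X) \<ast>\<^bsub>C\<^esub> rwhisk C [G f, G g] [G ?fg] [t Z] ?Gc))"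
    using \<sigma>.C.rwhisk_rwhisk[of "[F f, s Y]" "[s X, G f]" ?sf "[G g]" "[t Z]"]
    by (simp add: \<sigma>.C.rwhisk_vcomp[where vs = "[F f, s Y, G g]"]
        \<sigma>.C.rwhisk_vcomp[where vs = "[s X, G f, G g]"] \<sigma>.C.rwhisk_Cons)
  finally have 1: "rwhisk C [F f, F g] [F ?fg] [s Z, t Z] ?Fc
      \<cdot>\<^bsub>C\<^esub> rwhisk C [F ?fg, s Z] [s X, G ?fg] [t Z] ?sfg = \<dots>" .
  have 2: "(id2 C (s X) \<ast>\<^bsub>C\<^esub> rwhisk C [G f, G g] [G ?fg] [t Z] ?Gc) \<cdot>\<^bsub>C\<^esub> (id2 C (s X) \<ast>\<^bsub>C\<^esub> ?tfg)
    = (id2 C (s X) \<ast>\<^bsub>C\<^esub> (id2 C (G f) \<ast>\<^bsub>C\<^esub> ?tg))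
      \<cdot>\<^bsub>C\<^esub> ((id2 C (s X) \<ast>\<^bsub>C\<^esub> rwhisk C [G f, t Y] [t X, H f] [H g] ?tf)
      \<cdot>\<^bsub>C\<^esub> (id2 C (s X) \<ast>\<^bsub>C\<^esub> (id2 C (t X) \<ast>\<^bsub>C\<^esub> ?Hc)))"
    using \<tau>.nat_comp[of f g] by (simp flip: \<sigma>.C.whisk_left_vcomp)
  \<comment> \<open>The only place where the two transformations meet: the square of \<sigma> at f
    and that of \<tau> at g act on disjoint letters and slide past each other.\<close>
  have 3: "rwhisk C [F f, s Y] [s X, G f] [G g, t Z] ?sf \<cdot>\<^bsub>C\<^esub> (id2 C (s X) \<ast>\<^bsub>C\<^esub> (id2 C (G f) \<ast>\<^bsub>C\<^esub> ?tg))
    = (id2 C (F f) \<ast>\<^bsub>C\<^esub> (id2 C (s Y) \<ast>\<^bsub>C\<^esub> ?tg)) \<cdot>\<^bsub>C\<^esub> rwhisk C [F f, s Y] [s X, G f] [t Y, H g] ?sf"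
    using \<sigma>.C.word_interchange[of "[F f, s Y]" "[s X, G f]" ?sf "[G g, t Z]" "[t Y, H g]" ?tg] by simp
  have w4 [simp]: "wcell C [F f, s Y, t Y] [s X, G f, t Y] (rwhisk C [F f, s Y] [s X, G f] [t Y] ?sf)"
    "wcell C [s X, G f, t Y] [s X, t X, H f] (id2 C (s X) \<ast>\<^bsub>C\<^esub> ?tf)"
    by (auto intro!: \<sigma>.C.wcellI)
  have 4: "rwhisk C [F f, s Y, t Y] [s X, t X, H f] [H g] (then_nat f)
    = rwhisk C [F f, s Y] [s X, G f] [t Y, H g] ?sf
      \<cdot>\<^bsub>C\<^esub> (id2 C (s X) \<ast>\<^bsub>C\<^esub> rwhisk C [G f, t Y] [t X, H f] [H g] ?tf)"
    using \<sigma>.C.rwhisk_rwhisk[of "[F f, s Y]" "[s X, G f]" ?sf "[t Y]" "[H g]"]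
    by (simp add: then_nat_def \<sigma>.C.rwhisk_vcomp[where vs = "[s X, G f, t Y]"] \<sigma>.C.rwhisk_Cons)
  show ?thesis
    by (simp add: then_nat_def[of "?fg"] then_nat_def[of g] 4 \<sigma>.C.vassoc 2 3[THEN \<sigma>.C.vcomp_extend]
        \<sigma>.C.whisk_left_vcomp 1[THEN \<sigma>.C.vcomp_extend])
qed

text \<open>For naturality and the unit axiom a cell is carried through the five factors of
  \<open>pt_then\<close>, alternately by naturality of associators and by the axioms of \<sigma> and
  \<tau>. The composition axiom is \<open>then_nat_comp\<close>, with the targets rebracketed by
  \<open>rwhisk_regroup\<close>.\<close>

lemma pseudonatural_pt_then: "su_pseudonatural B C (pt_then B C \<sigma> \<tau>)"
proof (rule su_pseudonaturalI)
  fix \<alpha> assume [simp]: "\<alpha> \<in> Cell B"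
  let ?f = "dom2 B \<alpha>" and ?g = "cod2 B \<alpha>"
  define X Y where "X = src B ?f" and "Y = tgt B ?f"
  have [simp]: "src B ?f = X" "tgt B ?f = Y" "src B ?g = X" "tgt B ?g = Y" "X \<in> Obj B" "Y \<in> Obj B"
    by (auto simp: X_def Y_def)
  let ?F = "ps_cell (pt_src \<sigma>) \<alpha>" and ?G = "ps_cell (pt_tgt \<sigma>) \<alpha>" and ?H = "ps_cell (pt_tgt \<tau>) \<alpha>"
  have 1: "(?F \<ast>\<^bsub>C\<^esub> id2 C (s Y \<star>\<^bsub>C\<^esub> t Y)) \<cdot>\<^bsub>C\<^esub> inv2 C (associator C (F ?g) (s Y) (t Y))
      = inv2 C (associator C (F ?f) (s Y) (t Y)) \<cdot>\<^bsub>C\<^esub> ((?F \<ast>\<^bsub>C\<^esub> id2 C (s Y)) \<ast>\<^bsub>C\<^esub> id2 C (t Y))"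
    using \<sigma>.C.associator_natural_inv[of ?F "id2 C (s Y)" "id2 C (t Y)"] by simp
  have 2: "((?F \<ast>\<^bsub>C\<^esub> id2 C (s Y)) \<ast>\<^bsub>C\<^esub> id2 C (t Y)) \<cdot>\<^bsub>C\<^esub> (pt_nat \<sigma> ?g \<ast>\<^bsub>C\<^esub> id2 C (t Y))
      = (pt_nat \<sigma> ?f \<ast>\<^bsub>C\<^esub> id2 C (t Y)) \<cdot>\<^bsub>C\<^esub> ((id2 C (s X) \<ast>\<^bsub>C\<^esub> ?G) \<ast>\<^bsub>C\<^esub> id2 C (t Y))"
    using \<sigma>.nat_nat[of \<alpha>] by (simp flip: \<sigma>.C.whisk_right_vcomp)
  have 3: "((id2 C (s X) \<ast>\<^bsub>C\<^esub> ?G) \<ast>\<^bsub>C\<^esub> id2 C (t Y)) \<cdot>\<^bsub>C\<^esub> associator C (s X) (G ?g) (t Y)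
      = associator C (s X) (G ?f) (t Y) \<cdot>\<^bsub>C\<^esub> (id2 C (s X) \<ast>\<^bsub>C\<^esub> (?G \<ast>\<^bsub>C\<^esub> id2 C (t Y)))"
    using \<sigma>.C.associator_natural[of "id2 C (s X)" ?G "id2 C (t Y)" "s X" "G ?g" "t Y"] by simp
  have 4: "(id2 C (s X) \<ast>\<^bsub>C\<^esub> (?G \<ast>\<^bsub>C\<^esub> id2 C (t Y))) \<cdot>\<^bsub>C\<^esub> (id2 C (s X) \<ast>\<^bsub>C\<^esub> pt_nat \<tau> ?g)
      = (id2 C (s X) \<ast>\<^bsub>C\<^esub> pt_nat \<tau> ?f) \<cdot>\<^bsub>C\<^esub> (id2 C (s X) \<ast>\<^bsub>C\<^esub> (id2 C (t X) \<ast>\<^bsub>C\<^esub> ?H))"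
    using \<tau>.nat_nat[of \<alpha>] by (simp flip: \<sigma>.C.whisk_left_vcomp)
  have 5: "(id2 C (s X) \<ast>\<^bsub>C\<^esub> (id2 C (t X) \<ast>\<^bsub>C\<^esub> ?H)) \<cdot>\<^bsub>C\<^esub> inv2 C (associator C (s X) (t X) (H ?g))
      = inv2 C (associator C (s X) (t X) (H ?f)) \<cdot>\<^bsub>C\<^esub> (id2 C (s X \<star>\<^bsub>C\<^esub> t X) \<ast>\<^bsub>C\<^esub> ?H)"
    using \<sigma>.C.associator_natural_inv[of "id2 C (s X)" "id2 C (t X)" ?H] by simp
  show "(ps_cell (pt_src (pt_then B C \<sigma> \<tau>)) \<alpha> \<ast>\<^bsub>C\<^esub> id2 C (pt_map (pt_then B C \<sigma> \<tau>) (tgt B ?f)))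
        \<cdot>\<^bsub>C\<^esub> pt_nat (pt_then B C \<sigma> \<tau>) ?g
      = pt_nat (pt_then B C \<sigma> \<tau>) ?f
        \<cdot>\<^bsub>C\<^esub> (id2 C (pt_map (pt_then B C \<sigma> \<tau>) (src B ?f)) \<ast>\<^bsub>C\<^esub> ps_cell (pt_tgt (pt_then B C \<sigma> \<tau>)) \<alpha>)"
    by (simp add: then_nat_def \<sigma>.C.rwhisk_2_2 \<sigma>.C.vassoc 1[THEN \<sigma>.C.vcomp_extend] 2[THEN \<sigma>.C.vcomp_extend]
      3[THEN \<sigma>.C.vcomp_extend] 4[THEN \<sigma>.C.vcomp_extend] 5 del: \<sigma>.C.id2_hcomp)
next
  fix X assume [simp]: "X \<in> Obj B"
  let ?F = "ps_unit (pt_src \<sigma>) X" and ?G = "ps_unit (pt_tgt \<sigma>) X" and ?H = "ps_unit (pt_tgt \<tau>) X"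
  let ?e = "id1 B X"
  have 1: "(?F \<ast>\<^bsub>C\<^esub> id2 C (s X \<star>\<^bsub>C\<^esub> t X)) \<cdot>\<^bsub>C\<^esub> inv2 C (associator C (F ?e) (s X) (t X))
      = ((?F \<ast>\<^bsub>C\<^esub> id2 C (s X)) \<ast>\<^bsub>C\<^esub> id2 C (t X))"
    using \<sigma>.C.associator_natural_inv[of ?F "id2 C (s X)" "id2 C (t X)"] by simp
  have 2: "((?F \<ast>\<^bsub>C\<^esub> id2 C (s X)) \<ast>\<^bsub>C\<^esub> id2 C (t X)) \<cdot>\<^bsub>C\<^esub> (pt_nat \<sigma> ?e \<ast>\<^bsub>C\<^esub> id2 C (t X))
      = (id2 C (s X) \<ast>\<^bsub>C\<^esub> ?G) \<ast>\<^bsub>C\<^esub> id2 C (t X)"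
    using \<sigma>.nat_unit[of X] by (simp flip: \<sigma>.C.whisk_right_vcomp)
  have 3: "((id2 C (s X) \<ast>\<^bsub>C\<^esub> ?G) \<ast>\<^bsub>C\<^esub> id2 C (t X)) \<cdot>\<^bsub>C\<^esub> associator C (s X) (G ?e) (t X)
      = id2 C (s X) \<ast>\<^bsub>C\<^esub> (?G \<ast>\<^bsub>C\<^esub> id2 C (t X))"
    using \<sigma>.C.associator_natural[of "id2 C (s X)" ?G "id2 C (t X)" "s X" "G ?e" "t X"] by simp
  have 4: "(id2 C (s X) \<ast>\<^bsub>C\<^esub> (?G \<ast>\<^bsub>C\<^esub> id2 C (t X))) \<cdot>\<^bsub>C\<^esub> (id2 C (s X) \<ast>\<^bsub>C\<^esub> pt_nat \<tau> ?e)
      = id2 C (s X) \<ast>\<^bsub>C\<^esub> (id2 C (t X) \<ast>\<^bsub>C\<^esub> ?H)"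
    using \<tau>.nat_unit[of X] by (simp flip: \<sigma>.C.whisk_left_vcomp)
  have 5: "(id2 C (s X) \<ast>\<^bsub>C\<^esub> (id2 C (t X) \<ast>\<^bsub>C\<^esub> ?H)) \<cdot>\<^bsub>C\<^esub> inv2 C (associator C (s X) (t X) (H ?e))
      = id2 C (s X \<star>\<^bsub>C\<^esub> t X) \<ast>\<^bsub>C\<^esub> ?H"
    using \<sigma>.C.associator_natural_inv[of "id2 C (s X)" "id2 C (t X)" ?H] by simp
  show "(ps_unit (pt_src (pt_then B C \<sigma> \<tau>)) X \<ast>\<^bsub>C\<^esub> id2 C (pt_map (pt_then B C \<sigma> \<tau>) X))
        \<cdot>\<^bsub>C\<^esub> pt_nat (pt_then B C \<sigma> \<tau>) ?e
      = id2 C (pt_map (pt_then B C \<sigma> \<tau>) X) \<ast>\<^bsub>C\<^esub> ps_unit (pt_tgt (pt_then B C \<sigma> \<tau>)) X"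
    by (simp add: then_nat_def \<sigma>.C.rwhisk_2_2 \<sigma>.C.vassoc 1[THEN \<sigma>.C.vcomp_extend] 2[THEN \<sigma>.C.vcomp_extend]
      3[THEN \<sigma>.C.vcomp_extend] 4[THEN \<sigma>.C.vcomp_extend] 5 del: \<sigma>.C.id2_hcomp)
next
  fix f g assume [simp]: "f \<in> Arr B" "g \<in> Arr B" "tgt B f = src B g"
  define X Y Z where "X = src B f" and "Y = src B g" and "Z = tgt B g"
  have [simp]: "src B f = X" "src B g = Y" "tgt B g = Z" "tgt B f = Y"
    "X \<in> Obj B" "Y \<in> Obj B" "Z \<in> Obj B"
    by (auto simp: X_def Y_def Z_def)
  let ?fg = "f \<star>\<^bsub>B\<^esub> g"
  let ?st = "\<lambda>X. s X \<star>\<^bsub>C\<^esub> t X" let ?a = "\<lambda>f. inv2 C (associator C (s (src B f)) (t (src B f)) (H f))"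
  have w: "wcell C [F f, s Y, t Y] [s X, t X, H f] (then_nat f)" by simp
  have 1: "inv2 C (associator C (s X) (t X) (H f \<star>\<^bsub>C\<^esub> H g))
        \<cdot>\<^bsub>C\<^esub> (id2 C (?st X) \<ast>\<^bsub>C\<^esub> ps_comp (pt_tgt \<tau>) (f, g))
    = (id2 C (s X) \<ast>\<^bsub>C\<^esub> (id2 C (t X) \<ast>\<^bsub>C\<^esub> ps_comp (pt_tgt \<tau>) (f, g)))
      \<cdot>\<^bsub>C\<^esub> inv2 C (associator C (s X) (t X) (H ?fg))"
    using \<sigma>.C.associator_natural_inv[of "id2 C (s X)" "id2 C (t X)" "ps_comp (pt_tgt \<tau>) (f, g)"] by simp
  have [simp]: "wcell C [F f, ?st Y] [?st X, H f] (then_nat f \<cdot>\<^bsub>C\<^esub> inv2 C (associator C (s X) (t X) (H f)))"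
    by (rule \<sigma>.C.wcellI) simp_all
  have [simp]: "wcell C [F f, F g] [F ?fg] (ps_comp (pt_src \<sigma>) (f, g))"
    by (rule \<sigma>.C.wcellI) simp_all
  \<comment> \<open>\<open>path_split\<close> sees its second word only through \<open>path\<close>,
    so fusing the two letters there changes nothing.\<close>
  have 2: "rwhisk C [F f, F g] [F ?fg] [?st Z] (ps_comp (pt_src \<sigma>) (f, g))
    = rwhisk C [F f, F g] [F ?fg] [s Z, t Z] (ps_comp (pt_src \<sigma>) (f, g))"
    by (simp add: rwhisk_def)
  have 3: "rwhisk C [F f, F g] [F ?fg] [s Z, t Z] (ps_comp (pt_src \<sigma>) (f, g)) \<cdot>\<^bsub>C\<^esub> then_nat ?fg
    = (id2 C (F f) \<ast>\<^bsub>C\<^esub> then_nat g)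
      \<cdot>\<^bsub>C\<^esub> (rwhisk C [F f, s Y, t Y] [s X, t X, H f] [H g] (then_nat f)
      \<cdot>\<^bsub>C\<^esub> (id2 C (s X) \<ast>\<^bsub>C\<^esub> (id2 C (t X) \<ast>\<^bsub>C\<^esub> ps_comp (pt_tgt \<tau>) (f, g))))"
    using then_nat_comp[of f g] by simp
  show "rwhisk C [ps_arr (pt_src (pt_then B C \<sigma> \<tau>)) f, ps_arr (pt_src (pt_then B C \<sigma> \<tau>)) g]
        [ps_arr (pt_src (pt_then B C \<sigma> \<tau>)) ?fg] [pt_map (pt_then B C \<sigma> \<tau>) (tgt B g)]
        (ps_comp (pt_src (pt_then B C \<sigma> \<tau>)) (f, g)) \<cdot>\<^bsub>C\<^esub> pt_nat (pt_then B C \<sigma> \<tau>) ?fg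
    = (id2 C (ps_arr (pt_src (pt_then B C \<sigma> \<tau>)) f) \<ast>\<^bsub>C\<^esub> pt_nat (pt_then B C \<sigma> \<tau>) g)
      \<cdot>\<^bsub>C\<^esub> (rwhisk C [ps_arr (pt_src (pt_then B C \<sigma> \<tau>)) f, pt_map (pt_then B C \<sigma> \<tau>) (src B g)]
        [pt_map (pt_then B C \<sigma> \<tau>) (src B f), ps_arr (pt_tgt (pt_then B C \<sigma> \<tau>)) f]
        [ps_arr (pt_tgt (pt_then B C \<sigma> \<tau>)) g] (pt_nat (pt_then B C \<sigma> \<tau>) f)
      \<cdot>\<^bsub>C\<^esub> (id2 C (pt_map (pt_then B C \<sigma> \<tau>) (src B f))
        \<ast>\<^bsub>C\<^esub> ps_comp (pt_tgt (pt_then B C \<sigma> \<tau>)) (f, g)))"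
    by (simp add: 2 3[THEN \<sigma>.C.vcomp_extend] \<sigma>.C.whisk_left_vcomp \<sigma>.C.vassoc
        \<sigma>.C.rwhisk_regroup[OF w, THEN \<sigma>.C.vcomp_extend] 1)
qed (auto simp: \<sigma>.C.su_bicat_axioms \<sigma>.F.pseudofunctor_axioms \<tau>.G.pseudofunctor_axioms)

end

section \<open>The bicategory of pseudofunctors\<close>

lemma modif_eqI:
  "md_src m = md_src n \<Longrightarrow> md_tgt m = md_tgt n \<Longrightarrow> md_map m = md_map n \<Longrightarrow>
    m = (n :: ('o, 'a, 'c, 'p, 'b, 'd) modif)"
  by simp

lemma pseudonat_eqI:
  "pt_src s = pt_src t \<Longrightarrow> pt_tgt s = pt_tgt t \<Longrightarrow> pt_map s = pt_map t \<Longrightarrow> pt_nat s = pt_nat t \<Longrightarrow>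
    s = (t :: ('o, 'a, 'c, 'p, 'b, 'd) pseudonat)"
  by simp

lemma ps_bicat_simps [simp]:
  "Obj (ps_bicat B C) = {F. pseudofunctor B C F}"
  "Arr (ps_bicat B C) = {\<sigma>. pseudonatural B C \<sigma>}"
  "src (ps_bicat B C) = pt_src" "tgt (ps_bicat B C) = pt_tgt"
  "dom2 (ps_bicat B C) = md_src" "cod2 (ps_bicat B C) = md_tgt"
  "id1 (ps_bicat B C) = pt_id B C"
  "hcomp1 (ps_bicat B C) = pt_then B C"
  by (simp_all add: ps_bicat_def)

lemma ps_bicat_cell_simps:
  "md_src (id2 (ps_bicat B C) \<sigma>) = \<sigma>" "md_tgt (id2 (ps_bicat B C) \<sigma>) = \<sigma>"
  "md_map (id2 (ps_bicat B C) \<sigma>) = (\<lambda>X\<in>Obj B. id2 C (pt_map \<sigma> X))"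
  "md_src (m \<cdot>\<^bsub>ps_bicat B C\<^esub> n) = md_src m" "md_tgt (m \<cdot>\<^bsub>ps_bicat B C\<^esub> n) = md_tgt n"
  "md_map (m \<cdot>\<^bsub>ps_bicat B C\<^esub> n) = (\<lambda>X\<in>Obj B. md_map m X \<cdot>\<^bsub>C\<^esub> md_map n X)"
  "md_src (m \<ast>\<^bsub>ps_bicat B C\<^esub> n) = pt_then B C (md_src m) (md_src n)"
  "md_tgt (m \<ast>\<^bsub>ps_bicat B C\<^esub> n) = pt_then B C (md_tgt m) (md_tgt n)"
  "md_map (m \<ast>\<^bsub>ps_bicat B C\<^esub> n) = (\<lambda>X\<in>Obj B. md_map m X \<ast>\<^bsub>C\<^esub> md_map n X)"
  "md_src (associator (ps_bicat B C) \<sigma> \<tau> \<upsilon>) = pt_then B C (pt_then B C \<sigma> \<tau>) \<upsilon>"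
  "md_tgt (associator (ps_bicat B C) \<sigma> \<tau> \<upsilon>) = pt_then B C \<sigma> (pt_then B C \<tau> \<upsilon>)"
  "md_map (associator (ps_bicat B C) \<sigma> \<tau> \<upsilon>)
    = (\<lambda>X\<in>Obj B. associator C (pt_map \<sigma> X) (pt_map \<tau> X) (pt_map \<upsilon> X))"
  by (simp_all add: ps_bicat_def)

declare ps_bicat_cell_simps [simp]

locale su_modification = S: su_pseudonatural B C "md_src m" + T: su_pseudonatural B C "md_tgt m"
  for B :: "('o, 'a, 'c) bicat" and C :: "('p, 'b, 'd) bicat"
    and m :: "('o, 'a, 'c, 'p, 'b, 'd) modif" +
  assumes md_match [simp]: "pt_src (md_tgt m) = pt_src (md_src m)" "pt_tgt (md_tgt m) = pt_tgt (md_src m)"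
    and md_typing [simp]: "X \<in> Obj B \<Longrightarrow> md_map m X \<in> Cell C"
      "X \<in> Obj B \<Longrightarrow> dom2 C (md_map m X) = pt_map (md_src m) X"
      "X \<in> Obj B \<Longrightarrow> cod2 C (md_map m X) = pt_map (md_tgt m) X"
    and md_ext: "md_map m \<in> extensional (Obj B)"
    and md_nat: "f \<in> Arr B \<Longrightarrow>
      pt_nat (md_src m) f \<cdot>\<^bsub>C\<^esub> (md_map m (src B f) \<ast>\<^bsub>C\<^esub> id2 C (ps_arr (pt_tgt (md_src m)) f))
      = (id2 C (ps_arr (pt_src (md_src m)) f) \<ast>\<^bsub>C\<^esub> md_map m (tgt B f)) \<cdot>\<^bsub>C\<^esub> pt_nat (md_tgt m) f"

section \<open>Vertical composition and inverses of modifications\<close>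

context su_bicats
begin

lemma su_pseudonatural_iff: "su_pseudonatural B C \<sigma> \<longleftrightarrow> pseudonatural B C \<sigma>"
  using C.su_bicat_axioms by (auto simp: su_pseudonatural_def)

lemma ps_bicat_Cell [simp]: "m \<in> Cell (ps_bicat B C) \<longleftrightarrow> su_modification B C m"
  unfolding su_modification_def su_modification_axioms_def su_pseudonatural_iff
  by (auto simp: ps_bicat_def modification_def hom2_def)

lemma su_modificationI:
  assumes "su_pseudonatural B C (md_src m)" "su_pseudonatural B C (md_tgt m)"
    "pt_src (md_tgt m) = pt_src (md_src m)" "pt_tgt (md_tgt m) = pt_tgt (md_src m)"
    and "\<And>X. X \<in> Obj B \<Longrightarrow> md_map m X \<in> Cell C \<and> dom2 C (md_map m X) = pt_map (md_src m) X \<and>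
      cod2 C (md_map m X) = pt_map (md_tgt m) X"
    "md_map m \<in> extensional (Obj B)"
    "\<And>f. f \<in> Arr B \<Longrightarrow>
      pt_nat (md_src m) f \<cdot>\<^bsub>C\<^esub> (md_map m (src B f) \<ast>\<^bsub>C\<^esub> id2 C (ps_arr (pt_tgt (md_src m)) f))
      = (id2 C (ps_arr (pt_src (md_src m)) f) \<ast>\<^bsub>C\<^esub> md_map m (tgt B f)) \<cdot>\<^bsub>C\<^esub> pt_nat (md_tgt m) f"
  shows "su_modification B C m"
  using assms by (auto simp: su_modification_def su_modification_axioms_def)

lemma su_modification_id2:
  assumes "su_pseudonatural B C \<sigma>"
  shows "su_modification B C (id2 (ps_bicat B C) \<sigma>)"
proof -
  interpret \<sigma>: su_pseudonatural B C \<sigma> by fact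
  show ?thesis by (rule su_modificationI) (use assms in auto)
qed

lemma su_modification_vcomp:
  assumes "su_modification B C m" "su_modification B C n" "md_tgt m = md_src n"
  shows "su_modification B C (m \<cdot>\<^bsub>ps_bicat B C\<^esub> n)"
proof -
  interpret m: su_modification B C m by fact
  interpret n: su_modification B C n by fact
  have [simp]: "md_tgt m = md_src n" "pt_src (md_src n) = pt_src (md_src m)"
    "pt_tgt (md_src n) = pt_tgt (md_src m)"
    using assms(3) m.md_match by auto
  have [simp]: "X \<in> Obj B \<Longrightarrow> cod2 C (md_map m X) = pt_map (md_src n) X" for X
    using m.md_typing(3) by simp
  show ?thesis
  proof (rule su_modificationI)
    fix f assume [simp]: "f \<in> Arr B"
    let ?F = "id2 C (ps_arr (pt_src (md_src m)) f)" and ?G = "id2 C (ps_arr (pt_tgt (md_src m)) f)"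
    have 1: "pt_nat (md_src m) f \<cdot>\<^bsub>C\<^esub> (md_map m (src B f) \<ast>\<^bsub>C\<^esub> ?G)
      = (?F \<ast>\<^bsub>C\<^esub> md_map m (tgt B f)) \<cdot>\<^bsub>C\<^esub> pt_nat (md_src n) f"
      using m.md_nat[of f] by simp
    have 2: "pt_nat (md_src n) f \<cdot>\<^bsub>C\<^esub> (md_map n (src B f) \<ast>\<^bsub>C\<^esub> ?G)
      = (?F \<ast>\<^bsub>C\<^esub> md_map n (tgt B f)) \<cdot>\<^bsub>C\<^esub> pt_nat (md_tgt n) f"
      using n.md_nat[of f] by simp
    show "pt_nat (md_src (m \<cdot>\<^bsub>ps_bicat B C\<^esub> n)) f \<cdot>\<^bsub>C\<^esub>
         (md_map (m \<cdot>\<^bsub>ps_bicat B C\<^esub> n) (src B f) \<ast>\<^bsub>C\<^esub>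
          id2 C (ps_arr (pt_tgt (md_src (m \<cdot>\<^bsub>ps_bicat B C\<^esub> n))) f)) =
         (id2 C (ps_arr (pt_src (md_src (m \<cdot>\<^bsub>ps_bicat B C\<^esub> n))) f) \<ast>\<^bsub>C\<^esub>
          md_map (m \<cdot>\<^bsub>ps_bicat B C\<^esub> n) (tgt B f)) \<cdot>\<^bsub>C\<^esub>
         pt_nat (md_tgt (m \<cdot>\<^bsub>ps_bicat B C\<^esub> n)) f"
      by (simp add: C.whisk_left_vcomp C.whisk_right_vcomp 1[THEN C.vcomp_extend] 2 C.vassoc)
  qed (use m.S.su_pseudonatural_axioms n.T.su_pseudonatural_axioms in auto)
qed

text \<open>Composing the modification equation with the inverse components at both ends yields the
  equation for the inverses. Invertibility of a modification is thus decided componentwise.\<close>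

lemma su_modification_inverse:
  assumes "su_modification B C m" "\<And>X. X \<in> Obj B \<Longrightarrow> invertible2 C (md_map m X)"
  shows "inverse_cells (ps_bicat B C) m
    \<lparr>md_src = md_tgt m, md_tgt = md_src m, md_map = (\<lambda>X\<in>Obj B. inv2 C (md_map m X))\<rparr>"
    (is "inverse_cells _ m ?n")
proof -
  interpret m: su_modification B C m by fact
  note [simp] = assms(2)
  have "su_modification B C ?n"
  proof (rule su_modificationI)
    fix f assume [simp]: "f \<in> Arr B"
    let ?F = "id2 C (ps_arr (pt_src (md_src m)) f)" and ?G = "id2 C (ps_arr (pt_tgt (md_src m)) f)"
    let ?m = "md_map m (src B f)" and ?m' = "md_map m (tgt B f)"
    have "(?F \<ast>\<^bsub>C\<^esub> inv2 C ?m') \<cdot>\<^bsub>C\<^esub> ((pt_nat (md_src m) f \<cdot>\<^bsub>C\<^esub> (?m \<ast>\<^bsub>C\<^esub> ?G)) \<cdot>\<^bsub>C\<^esub> (inv2 C ?m \<ast>\<^bsub>C\<^esub> ?G))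
      = (?F \<ast>\<^bsub>C\<^esub> inv2 C ?m') \<cdot>\<^bsub>C\<^esub> (((?F \<ast>\<^bsub>C\<^esub> ?m') \<cdot>\<^bsub>C\<^esub> pt_nat (md_tgt m) f) \<cdot>\<^bsub>C\<^esub> (inv2 C ?m \<ast>\<^bsub>C\<^esub> ?G))"
      by (simp only: m.md_nat \<open>f \<in> Arr B\<close>)
    then show "pt_nat (md_src ?n) f \<cdot>\<^bsub>C\<^esub> (md_map ?n (src B f) \<ast>\<^bsub>C\<^esub> id2 C (ps_arr (pt_tgt (md_src ?n)) f)) =
         (id2 C (ps_arr (pt_src (md_src ?n)) f) \<ast>\<^bsub>C\<^esub> md_map ?n (tgt B f)) \<cdot>\<^bsub>C\<^esub> pt_nat (md_tgt ?n) f"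
      by (simp add: C.vassoc C.hcomp_vcomp C.hcomp_vcomp[THEN C.vcomp_extend])
  qed (use m.S.su_pseudonatural_axioms m.T.su_pseudonatural_axioms in auto)
  then show ?thesis using assms(1)
    by (auto simp: inverse_cells_def hom2_def intro!: modif_eqI restrict_ext)
qed

end

section \<open>Horizontal composition of modifications\<close>

locale su_modification_pair = su_bicats B C + m: su_modification B C m + n: su_modification B C n
  for B :: "('o, 'a, 'c) bicat" and C :: "('p, 'b, 'd) bicat" and m n +
  assumes match [simp]: "pt_src (md_src n) = pt_tgt (md_src m)"
begin

sublocale S: su_pseudonatural_pair B C "md_src m" "md_src n"
  by unfold_locales simp

sublocale T: su_pseudonatural_pair B C "md_tgt m" "md_tgt n"
  by unfold_locales simp

text \<open>The composite component passes through the five factors of the composite transformation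
  one at a time: equations 1, 3 and 5 are naturality of associators, 2 and 4 the modification
  equations of n and m.\<close>

lemma su_modification_hcomp: "su_modification B C (m \<ast>\<^bsub>ps_bicat B C\<^esub> n)"
proof (rule su_modificationI)
  fix f assume [simp]: "f \<in> Arr B"
  define X Y where "X = src B f" and "Y = tgt B f"
  have [simp]: "src B f = X" "tgt B f = Y" "X \<in> Obj B" "Y \<in> Obj B"
    by (auto simp: X_def Y_def)
  let ?F = "ps_arr (pt_src (md_src m)) f" and ?G = "ps_arr (pt_tgt (md_src m)) f"
    and ?H = "ps_arr (pt_tgt (md_src n)) f"
  let ?s = "pt_map (md_src m)" and ?s' = "pt_map (md_tgt m)"
    and ?t = "pt_map (md_src n)" and ?t' = "pt_map (md_tgt n)"
  let ?m = "md_map m" and ?n = "md_map n"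
  let ?sf = "pt_nat (md_src m) f" and ?sf' = "pt_nat (md_tgt m) f"
    and ?tf = "pt_nat (md_src n) f" and ?tf' = "pt_nat (md_tgt n) f"
  \<comment> \<open>Typing of the target transformations, restated after \<open>md_match\<close> has
    replaced their endpoints by those of \<open>md_src\<close>.\<close>
  have [simp]: "?t' X \<in> Arr C" "?t' Y \<in> Arr C" "src C (?t' X) = ps_obj (pt_tgt (md_src m)) X"
    "src C (?t' Y) = ps_obj (pt_tgt (md_src m)) Y"
    "tgt C (?t' X) = ps_obj (pt_tgt (md_src n)) X" "tgt C (?t' Y) = ps_obj (pt_tgt (md_src n)) Y"
    "?s' X \<in> Arr C" "?s' Y \<in> Arr C" "tgt C (?s' X) = ps_obj (pt_tgt (md_src m)) X"
    "tgt C (?s' Y) = ps_obj (pt_tgt (md_src m)) Y"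
    "src C (?s' X) = ps_obj (pt_src (md_src m)) X" "src C (?s' Y) = ps_obj (pt_src (md_src m)) Y"
    "?sf' \<in> Cell C" "?tf' \<in> Cell C" "dom2 C ?sf' = ?F \<star>\<^bsub>C\<^esub> ?s' Y" "cod2 C ?sf' = ?s' X \<star>\<^bsub>C\<^esub> ?G"
    "dom2 C ?tf' = ?G \<star>\<^bsub>C\<^esub> ?t' Y" "cod2 C ?tf' = ?t' X \<star>\<^bsub>C\<^esub> ?H"
    using m.T.map_typing n.T.map_typing m.T.nat_typing[of f] n.T.nat_typing[of f] by simp_all
  have 1: "inv2 C (associator C (?s X) (?t X) ?H) \<cdot>\<^bsub>C\<^esub> ((?m X \<ast>\<^bsub>C\<^esub> ?n X) \<ast>\<^bsub>C\<^esub> id2 C ?H)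
     = (?m X \<ast>\<^bsub>C\<^esub> (?n X \<ast>\<^bsub>C\<^esub> id2 C ?H)) \<cdot>\<^bsub>C\<^esub> inv2 C (associator C (?s' X) (?t' X) ?H)"
    using C.associator_natural_inv[of "?m X" "?n X" "id2 C ?H"] by simp
  have 2: "(id2 C (?s X) \<ast>\<^bsub>C\<^esub> ?tf) \<cdot>\<^bsub>C\<^esub> (?m X \<ast>\<^bsub>C\<^esub> (?n X \<ast>\<^bsub>C\<^esub> id2 C ?H))
     = (?m X \<ast>\<^bsub>C\<^esub> (id2 C ?G \<ast>\<^bsub>C\<^esub> ?n Y)) \<cdot>\<^bsub>C\<^esub> (id2 C (?s' X) \<ast>\<^bsub>C\<^esub> ?tf')"
    using n.md_nat[of f] by (simp add: C.hcomp_vcomp)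
  have 3: "associator C (?s X) ?G (?t Y) \<cdot>\<^bsub>C\<^esub> (?m X \<ast>\<^bsub>C\<^esub> (id2 C ?G \<ast>\<^bsub>C\<^esub> ?n Y))
     = ((?m X \<ast>\<^bsub>C\<^esub> id2 C ?G) \<ast>\<^bsub>C\<^esub> ?n Y) \<cdot>\<^bsub>C\<^esub> associator C (?s' X) ?G (?t' Y)"
    using C.associator_natural[of "?m X" "id2 C ?G" "?n Y" "?s' X" ?G "?t' Y"] by simp
  have 4: "(?sf \<ast>\<^bsub>C\<^esub> id2 C (?t Y)) \<cdot>\<^bsub>C\<^esub> ((?m X \<ast>\<^bsub>C\<^esub> id2 C ?G) \<ast>\<^bsub>C\<^esub> ?n Y)
     = ((id2 C ?F \<ast>\<^bsub>C\<^esub> ?m Y) \<ast>\<^bsub>C\<^esub> ?n Y) \<cdot>\<^bsub>C\<^esub> (?sf' \<ast>\<^bsub>C\<^esub> id2 C (?t' Y))"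
    using m.md_nat[of f] by (simp add: C.hcomp_vcomp)
  have 5: "inv2 C (associator C ?F (?s Y) (?t Y)) \<cdot>\<^bsub>C\<^esub> ((id2 C ?F \<ast>\<^bsub>C\<^esub> ?m Y) \<ast>\<^bsub>C\<^esub> ?n Y)
     = (id2 C ?F \<ast>\<^bsub>C\<^esub> (?m Y \<ast>\<^bsub>C\<^esub> ?n Y)) \<cdot>\<^bsub>C\<^esub> inv2 C (associator C ?F (?s' Y) (?t' Y))"
    using C.associator_natural_inv[of "id2 C ?F" "?m Y" "?n Y"] by simp
  have L: "pt_nat (pt_then B C (md_src m) (md_src n)) f
    = inv2 C (associator C ?F (?s Y) (?t Y)) \<cdot>\<^bsub>C\<^esub> ((?sf \<ast>\<^bsub>C\<^esub> id2 C (?t Y))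
      \<cdot>\<^bsub>C\<^esub> (associator C (?s X) ?G (?t Y) \<cdot>\<^bsub>C\<^esub> ((id2 C (?s X) \<ast>\<^bsub>C\<^esub> ?tf)
      \<cdot>\<^bsub>C\<^esub> inv2 C (associator C (?s X) (?t X) ?H))))"
    by (simp add: pt_then_def C.vassoc del: S.pt_then_nat)
  have R: "pt_nat (pt_then B C (md_tgt m) (md_tgt n)) f
    = inv2 C (associator C ?F (?s' Y) (?t' Y)) \<cdot>\<^bsub>C\<^esub> ((?sf' \<ast>\<^bsub>C\<^esub> id2 C (?t' Y))
      \<cdot>\<^bsub>C\<^esub> (associator C (?s' X) ?G (?t' Y) \<cdot>\<^bsub>C\<^esub> ((id2 C (?s' X) \<ast>\<^bsub>C\<^esub> ?tf')
      \<cdot>\<^bsub>C\<^esub> inv2 C (associator C (?s' X) (?t' X) ?H))))"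
    by (simp add: pt_then_def C.vassoc del: T.pt_then_nat)
  show "pt_nat (md_src (m \<ast>\<^bsub>ps_bicat B C\<^esub> n)) f \<cdot>\<^bsub>C\<^esub>
         (md_map (m \<ast>\<^bsub>ps_bicat B C\<^esub> n) (src B f) \<ast>\<^bsub>C\<^esub>
          id2 C (ps_arr (pt_tgt (md_src (m \<ast>\<^bsub>ps_bicat B C\<^esub> n))) f)) =
         (id2 C (ps_arr (pt_src (md_src (m \<ast>\<^bsub>ps_bicat B C\<^esub> n))) f) \<ast>\<^bsub>C\<^esub>
          md_map (m \<ast>\<^bsub>ps_bicat B C\<^esub> n) (tgt B f)) \<cdot>\<^bsub>C\<^esub>
         pt_nat (md_tgt (m \<ast>\<^bsub>ps_bicat B C\<^esub> n)) f"
    by (simp add: L R C.vassoc 1 2[THEN C.vcomp_extend] 3[THEN C.vcomp_extend] 4[THEN C.vcomp_extend] 5[THEN C.vcomp_extend]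
        del: S.pt_then_nat T.pt_then_nat)
qed (use S.pseudonatural_pt_then T.pseudonatural_pt_then m.T.map_typing n.T.map_typing in auto)

end

section \<open>Unit laws for transformations\<close>

context su_bicats
begin

text \<open>An equality of records and not merely an isomorphism: all associators in the composite
  have a unit argument, and extensionality fixes the maps outside their domains. Consequently the
  unitors of \<open>ps_bicat\<close> are identities between equal 1-cells.\<close>

lemma pt_then_id_left:
  assumes "su_pseudonatural B C \<sigma>" "pt_src \<sigma> = F"
  shows "pt_then B C (pt_id B C F) \<sigma> = \<sigma>"
proof -
  interpret \<sigma>: su_pseudonatural B C \<sigma> by fact
  have [simp]: "pt_src \<sigma> = F" by fact
  interpret F: pseudofunctor B C F using \<sigma>.F.pseudofunctor_axioms by simp
  interpret I: su_pseudonatural B C "pt_id B C F"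
    by (rule pseudonatural_pt_id) (rule F.pseudofunctor_axioms)
  interpret P: su_pseudonatural_pair B C "pt_id B C F" \<sigma>
    by unfold_locales simp
  note [simp] = F.pseudofunctor_axioms
  show ?thesis
  proof (rule pseudonat_eqI)
    show "pt_map (pt_then B C (pt_id B C F) \<sigma>) = pt_map \<sigma>"
      by (rule extensionalityI[OF _ \<sigma>.pt_ext(1)]) simp_all
    show "pt_nat (pt_then B C (pt_id B C F) \<sigma>) = pt_nat \<sigma>"
      by (rule extensionalityI[OF _ \<sigma>.pt_ext(2)]) (simp_all add: P.then_nat_def C.rwhisk_2_2)
  qed simp_all
qed

lemma pt_then_id_right:
  assumes "su_pseudonatural B C \<sigma>" "pt_tgt \<sigma> = F"
  shows "pt_then B C \<sigma> (pt_id B C F) = \<sigma>"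
proof -
  interpret \<sigma>: su_pseudonatural B C \<sigma> by fact
  have [simp]: "pt_tgt \<sigma> = F" by fact
  interpret F: pseudofunctor B C F using \<sigma>.G.pseudofunctor_axioms by simp
  interpret I: su_pseudonatural B C "pt_id B C F"
    by (rule pseudonatural_pt_id) (rule F.pseudofunctor_axioms)
  interpret P: su_pseudonatural_pair B C \<sigma> "pt_id B C F"
    by unfold_locales simp
  note [simp] = F.pseudofunctor_axioms
  show ?thesis
  proof (rule pseudonat_eqI)
    show "pt_map (pt_then B C \<sigma> (pt_id B C F)) = pt_map \<sigma>"
      by (rule extensionalityI[OF _ \<sigma>.pt_ext(1)]) simp_all
    show "pt_nat (pt_then B C \<sigma> (pt_id B C F)) = pt_nat \<sigma>"
      by (rule extensionalityI[OF _ \<sigma>.pt_ext(2)]) (simp_all add: P.then_nat_def C.rwhisk_2_2)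
  qed simp_all
qed

end

text \<open>The pentagon in the shape in which it meets triple composites of transformations, each
  of which ends in inverse associators.\<close>

lemma (in bicategory) pentagon_inv:
  assumes "f \<in> Arr B" "g \<in> Arr B" "h \<in> Arr B" "k \<in> Arr B"
    "tgt B f = src B g" "tgt B g = src B h" "tgt B h = src B k"
  shows "inv2 B (associator B f g (h \<star> k)) \<cdot> (inv2 B (associator B (f \<star> g) h k)
      \<cdot> (associator B f g h \<ast> id2 B k))
    = inv2 B (id2 B f \<ast> associator B g h k) \<cdot> inv2 B (associator B f (g \<star> h) k)" (is "?L = ?R")
proof -
  note [simp] = assms
  let ?N = "associator B f (g \<star> h) k \<cdot> (id2 B f \<ast> associator B g h k)"
  have "?L \<cdot> ?N = inv2 B (associator B f g (h \<star> k)) \<cdot> (inv2 B (associator B (f \<star> g) h k)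
      \<cdot> (associator B (f \<star> g) h k \<cdot> associator B f g (h \<star> k)))"
    by (subst pentagon_right[symmetric]) (simp_all add: vassoc)
  then have "?L \<cdot> ?N = ?R \<cdot> ?N" by (simp add: vassoc)
  then show ?thesis by (rule cancel_inv_right[rotated -1]) simp_all
qed

context su_bicats
begin

text \<open>As a cell of words, the triple composite does not depend on the bracketing; the two
  records differ by associators at the source and at the target. Those at the source are collected
  by \<open>rwhisk_regroup\<close>, those at the target by \<open>pentagon_inv\<close>.\<close>

lemma su_modification_associator:
  assumes "su_pseudonatural B C \<sigma>" "su_pseudonatural B C \<tau>" "su_pseudonatural B C \<upsilon>"
    "pt_src \<tau> = pt_tgt \<sigma>" "pt_src \<upsilon> = pt_tgt \<tau>"
  shows "su_modification B C (associator (ps_bicat B C) \<sigma> \<tau> \<upsilon>)"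
proof -
  interpret \<sigma>: su_pseudonatural B C \<sigma> by fact
  interpret \<tau>: su_pseudonatural B C \<tau> by fact
  interpret \<upsilon>: su_pseudonatural B C \<upsilon> by fact
  interpret st: su_pseudonatural_pair B C \<sigma> \<tau> by unfold_locales fact
  interpret tu: su_pseudonatural_pair B C \<tau> \<upsilon> by unfold_locales fact
  interpret ST: su_pseudonatural B C "pt_then B C \<sigma> \<tau>" by (rule st.pseudonatural_pt_then)
  interpret TU: su_pseudonatural B C "pt_then B C \<tau> \<upsilon>" by (rule tu.pseudonatural_pt_then)
  interpret l: su_pseudonatural_pair B C "pt_then B C \<sigma> \<tau>" \<upsilon> by unfold_locales simp
  interpret r: su_pseudonatural_pair B C \<sigma> "pt_then B C \<tau> \<upsilon>" by unfold_locales simp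
  let ?l = "pt_then B C (pt_then B C \<sigma> \<tau>) \<upsilon>" and ?r = "pt_then B C \<sigma> (pt_then B C \<tau> \<upsilon>)"
  let ?a = "associator (ps_bicat B C) \<sigma> \<tau> \<upsilon>"
  let ?F = "ps_arr (pt_src \<sigma>)" and ?G = "ps_arr (pt_tgt \<sigma>)" and ?H = "ps_arr (pt_tgt \<tau>)"
    and ?K = "ps_arr (pt_tgt \<upsilon>)" and ?s = "pt_map \<sigma>" and ?t = "pt_map \<tau>" and ?u = "pt_map \<upsilon>"
  show ?thesis
  proof (rule su_modificationI)
    fix f assume [simp]: "f \<in> Arr B"
    define X Y where "X = src B f" and "Y = tgt B f"
    have [simp]: "src B f = X" "tgt B f = Y" "X \<in> Obj B" "Y \<in> Obj B"
      by (auto simp: X_def Y_def)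
    let ?sf = "pt_nat \<sigma> f" and ?tf = "pt_nat \<tau> f" and ?uf = "pt_nat \<upsilon> f"
    let ?N = "st.then_nat f" and ?M = "tu.then_nat f"
    have [simp]: "?u X \<in> Arr C" "?u Y \<in> Arr C"
      "src C (?u X) = ps_obj (pt_tgt \<tau>) X" "src C (?u Y) = ps_obj (pt_tgt \<tau>) Y"
      "tgt C (?u X) = ps_obj (pt_tgt \<upsilon>) X" "tgt C (?u Y) = ps_obj (pt_tgt \<upsilon>) Y"
      "?t X \<in> Arr C" "?t Y \<in> Arr C"
      "src C (?t X) = ps_obj (pt_tgt \<sigma>) X" "src C (?t Y) = ps_obj (pt_tgt \<sigma>) Y"
      "?uf \<in> Cell C" "dom2 C ?uf = ?H f \<star>\<^bsub>C\<^esub> ?u Y" "cod2 C ?uf = ?u X \<star>\<^bsub>C\<^esub> ?K f"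
      "?tf \<in> Cell C" "dom2 C ?tf = ?G f \<star>\<^bsub>C\<^esub> ?t Y" "cod2 C ?tf = ?t X \<star>\<^bsub>C\<^esub> ?H f"
      by simp_all
    have w1: "wcell C [?F f, ?s Y, ?t Y] [?s X, ?t X, ?H f] ?N"
      "wcell C [?G f, ?t Y, ?u Y] [?t X, ?u X, ?K f] ?M"
      by (rule C.wcellI; simp)+
    have w2 [simp]: "wcell C [?F f, ?s Y, ?t Y] [?s X, ?G f, ?t Y] (rwhisk C [?F f, ?s Y] [?s X, ?G f] [?t Y] ?sf)"
      "wcell C [?s X, ?G f, ?t Y] [?s X, ?t X, ?H f] (id2 C (?s X) \<ast>\<^bsub>C\<^esub> ?tf)"
      "wcell C [?F f, ?s Y] [?s X, ?G f] ?sf" "wcell C [?G f, ?t Y] [?t X, ?H f] ?tf"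
      by (auto intro!: C.wcellI)
    let ?R3 = "rwhisk C [?F f, ?s Y, ?t Y] [?s X, ?t X, ?H f] [?u Y] ?N"
    have 1: "?R3 = rwhisk C [?F f, ?s Y] [?s X, ?G f] [?t Y, ?u Y] ?sf
      \<cdot>\<^bsub>C\<^esub> (id2 C (?s X) \<ast>\<^bsub>C\<^esub> rwhisk C [?G f, ?t Y] [?t X, ?H f] [?u Y] ?tf)"
      using C.rwhisk_rwhisk[of "[?F f, ?s Y]" "[?s X, ?G f]" ?sf "[?t Y]" "[?u Y]"]
      by (simp add: st.then_nat_def C.rwhisk_vcomp[where vs = "[?s X, ?G f, ?t Y]"] C.rwhisk_Cons)
    \<comment> \<open>\<open>rwhisk_regroup\<close>, solved for the whiskering of the fused word.
      The associator released on the left is the source component of the modification.\<close>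
    have 2: "rwhisk C [?F f, ?s Y \<star>\<^bsub>C\<^esub> ?t Y] [?s X \<star>\<^bsub>C\<^esub> ?t X, ?H f] [?u Y]
        (?N \<cdot>\<^bsub>C\<^esub> inv2 C (associator C (?s X) (?t X) (?H f)))
      = (id2 C (?F f) \<ast>\<^bsub>C\<^esub> associator C (?s Y) (?t Y) (?u Y))
        \<cdot>\<^bsub>C\<^esub> (?R3 \<cdot>\<^bsub>C\<^esub> inv2 C (associator C (?s X) (?t X) (?H f \<star>\<^bsub>C\<^esub> ?u Y)))"
    proof -
      have [simp]: "wcell C [?F f, ?s Y \<star>\<^bsub>C\<^esub> ?t Y] [?s X \<star>\<^bsub>C\<^esub> ?t X, ?H f]
         (?N \<cdot>\<^bsub>C\<^esub> inv2 C (associator C (?s X) (?t X) (?H f)))"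
        by (rule C.wcellI) simp_all
      show ?thesis
        using C.rwhisk_regroup[OF w1(1), of "?u Y"] w1(1)
          C.move_inv_left[of "id2 C (?F f) \<ast>\<^bsub>C\<^esub> inv2 C (associator C (?s Y) (?t Y) (?u Y))"
          "rwhisk C [?F f, ?s Y \<star>\<^bsub>C\<^esub> ?t Y] [?s X \<star>\<^bsub>C\<^esub> ?t X, ?H f] [?u Y]
        (?N \<cdot>\<^bsub>C\<^esub> inv2 C (associator C (?s X) (?t X) (?H f)))"
          "?R3 \<cdot>\<^bsub>C\<^esub> inv2 C (associator C (?s X) (?t X) (?H f \<star>\<^bsub>C\<^esub> ?u Y))"]
        by (simp add: C.inv2_hcomp)
    qed
    have 3: "inv2 C (associator C (?s X) (?t X) (?H f \<star>\<^bsub>C\<^esub> ?u Y))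
        \<cdot>\<^bsub>C\<^esub> (id2 C (?s X \<star>\<^bsub>C\<^esub> ?t X) \<ast>\<^bsub>C\<^esub> ?uf)
      = (id2 C (?s X) \<ast>\<^bsub>C\<^esub> (id2 C (?t X) \<ast>\<^bsub>C\<^esub> ?uf))
        \<cdot>\<^bsub>C\<^esub> inv2 C (associator C (?s X) (?t X) (?u X \<star>\<^bsub>C\<^esub> ?K f))"
      using C.associator_natural_inv[of "id2 C (?s X)" "id2 C (?t X)" ?uf] by simp
    have [simp]: "wcell C [?F f, ?s Y, ?t Y] [?s X, ?t X, ?H f] ?N" by (rule w1)
    \<comment> \<open>Fusing letters in the tail is invisible to \<open>rwhisk\<close>, which
      depends on the tail only through its \<open>path\<close>.\<close>
    have [simp]: "rwhisk C [?F f, ?s Y] [?s X, ?G f] [?t Y \<star>\<^bsub>C\<^esub> ?u Y] ?sf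
       = rwhisk C [?F f, ?s Y] [?s X, ?G f] [?t Y, ?u Y] ?sf"
      by (simp add: rwhisk_def)
    have "pt_nat ?l f \<cdot>\<^bsub>C\<^esub> (associator C (?s X) (?t X) (?u X) \<ast>\<^bsub>C\<^esub> id2 C (?K f))
      = (id2 C (?F f) \<ast>\<^bsub>C\<^esub> associator C (?s Y) (?t Y) (?u Y)) \<cdot>\<^bsub>C\<^esub> (?R3
        \<cdot>\<^bsub>C\<^esub> ((id2 C (?s X) \<ast>\<^bsub>C\<^esub> (id2 C (?t X) \<ast>\<^bsub>C\<^esub> ?uf))
        \<cdot>\<^bsub>C\<^esub> (inv2 C (associator C (?s X) (?t X) (?u X \<star>\<^bsub>C\<^esub> ?K f))
        \<cdot>\<^bsub>C\<^esub> (inv2 C (associator C (?s X \<star>\<^bsub>C\<^esub> ?t X) (?u X) (?K f))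
        \<cdot>\<^bsub>C\<^esub> (associator C (?s X) (?t X) (?u X) \<ast>\<^bsub>C\<^esub> id2 C (?K f))))))"
      by (simp add: l.then_nat_def 2 3[THEN C.vcomp_extend] C.vassoc)
    also have "\<dots> = (id2 C (?F f) \<ast>\<^bsub>C\<^esub> associator C (?s Y) (?t Y) (?u Y)) \<cdot>\<^bsub>C\<^esub> pt_nat ?r f"
      by (simp add: C.pentagon_inv 1 r.then_nat_def tu.then_nat_def C.vassoc C.whisk_left_vcomp
          C.inv2_hcomp)
    finally show "pt_nat (md_src ?a) f \<cdot>\<^bsub>C\<^esub>
         (md_map ?a (src B f) \<ast>\<^bsub>C\<^esub> id2 C (ps_arr (pt_tgt (md_src ?a)) f)) =
         (id2 C (ps_arr (pt_src (md_src ?a)) f) \<ast>\<^bsub>C\<^esub> md_map ?a (tgt B f)) \<cdot>\<^bsub>C\<^esub> pt_nat (md_tgt ?a) f"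
      by (simp del: l.pt_then_nat r.pt_then_nat)
  qed (use l.pseudonatural_pt_then r.pseudonatural_pt_then in auto)
qed

end

lemma inverse_cells_invertible: "inverse_cells A \<alpha> \<beta> \<Longrightarrow> invertible2 A \<alpha>"
  by (auto simp: invertible2_def)

context su_bicats
begin

lemma su_modificationD [simp]:
  assumes "su_modification B C m"
  shows "su_pseudonatural B C (md_src m)" "su_pseudonatural B C (md_tgt m)"
    "pt_src (md_tgt m) = pt_src (md_src m)" "pt_tgt (md_tgt m) = pt_tgt (md_src m)"
    "md_map m \<in> extensional (Obj B)"
    "X \<in> Obj B \<Longrightarrow> md_map m X \<in> Cell C"
    "X \<in> Obj B \<Longrightarrow> dom2 C (md_map m X) = pt_map (md_src m) X"
    "X \<in> Obj B \<Longrightarrow> cod2 C (md_map m X) = pt_map (md_tgt m) X"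
proof -
  interpret su_modification B C m by fact
  show "su_pseudonatural B C (md_src m)" "su_pseudonatural B C (md_tgt m)"
    by (rule S.su_pseudonatural_axioms T.su_pseudonatural_axioms)+
qed (use assms in \<open>auto simp: su_modification_def su_modification_axioms_def\<close>)

lemma su_pseudonaturalD [simp]:
  assumes "su_pseudonatural B C \<sigma>"
  shows "pseudofunctor B C (pt_src \<sigma>)" "pseudofunctor B C (pt_tgt \<sigma>)"
    "X \<in> Obj B \<Longrightarrow> pt_map \<sigma> X \<in> Arr C"
    "X \<in> Obj B \<Longrightarrow> src C (pt_map \<sigma> X) = ps_obj (pt_src \<sigma>) X"
    "X \<in> Obj B \<Longrightarrow> tgt C (pt_map \<sigma> X) = ps_obj (pt_tgt \<sigma>) X"
proof -
  interpret su_pseudonatural B C \<sigma> by fact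
  show "pseudofunctor B C (pt_src \<sigma>)" "pseudofunctor B C (pt_tgt \<sigma>)"
    by (rule F.pseudofunctor_axioms G.pseudofunctor_axioms)+
qed (use assms in \<open>auto simp: su_pseudonatural.map_typing\<close>)

lemma pseudofunctorD [simp]:
  "pseudofunctor B C F \<Longrightarrow> X \<in> Obj B \<Longrightarrow> ps_obj F X \<in> Obj C"
  by (rule pseudofunctor.ps_obj_in)

lemma lunitor_ps_bicat [simp]:
  assumes "su_pseudonatural B C \<sigma>"
  shows "lunitor (ps_bicat B C) \<sigma> = id2 (ps_bicat B C) \<sigma>"
proof -
  have "lunitor (ps_bicat B C) \<sigma> = \<lparr>md_src = pt_then B C (pt_id B C (pt_src \<sigma>)) \<sigma>, md_tgt = \<sigma>,
       md_map = (\<lambda>X\<in>Obj B. lunitor C (pt_map \<sigma> X))\<rparr>"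
    by (simp add: ps_bicat_def)
  also have "\<dots> = id2 (ps_bicat B C) \<sigma>"
    by (rule modif_eqI) (auto simp: pt_then_id_left assms intro!: restrict_ext)
  finally show ?thesis .
qed

lemma runitor_ps_bicat [simp]:
  assumes "su_pseudonatural B C \<sigma>"
  shows "runitor (ps_bicat B C) \<sigma> = id2 (ps_bicat B C) \<sigma>"
proof -
  have "runitor (ps_bicat B C) \<sigma> = \<lparr>md_src = pt_then B C \<sigma> (pt_id B C (pt_tgt \<sigma>)), md_tgt = \<sigma>,
       md_map = (\<lambda>X\<in>Obj B. runitor C (pt_map \<sigma> X))\<rparr>"
    by (simp add: ps_bicat_def)
  also have "\<dots> = id2 (ps_bicat B C) \<sigma>"
    by (rule modif_eqI) (auto simp: pt_then_id_right assms intro!: restrict_ext)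
  finally show ?thesis .
qed

lemma pt_then_pseudonatural [simp]:
  assumes "su_pseudonatural B C \<sigma>" "su_pseudonatural B C \<tau>" "pt_src \<tau> = pt_tgt \<sigma>"
  shows "su_pseudonatural B C (pt_then B C \<sigma> \<tau>)"
proof -
  interpret su_pseudonatural_pair B C \<sigma> \<tau>
    by (intro su_pseudonatural_pair.intro su_pseudonatural_pair_axioms.intro assms)
  show ?thesis by (rule pseudonatural_pt_then)
qed

lemma su_modification_hcomp2 [simp]:
  assumes "su_modification B C m" "su_modification B C n" "pt_src (md_src n) = pt_tgt (md_src m)"
  shows "su_modification B C (m \<ast>\<^bsub>ps_bicat B C\<^esub> n)"
proof -
  interpret su_modification_pair B C m n
    by (intro su_modification_pair.intro su_modification_pair_axioms.intro assms su_bicats_axioms)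
  show ?thesis by (rule su_modification_hcomp)
qed

text \<open>Equations between modifications are equations between components, so they hold as in
  \<open>C\<close>; the content is that the structure cells are modifications at all, and that unit
  strictness is inherited, so that results on \<open>su_bicat\<close> apply to the new bicategory as
  well.\<close>

theorem su_bicat_ps_bicat: "su_bicat (ps_bicat B C)"
proof -
  note [simp] = hom1_def hom2_def composable_def su_modification_id2 su_modification_vcomp
    su_modification_associator pseudonatural_pt_id pt_then_id_left pt_then_id_right
    su_pseudonatural_iff[symmetric]
  show ?thesis
  proof (intro su_bicat.intro bicategory.intro su_bicat_axioms.intro, goal_cases)
    case (10 \<alpha> f g \<beta> h \<gamma> k)
    then show ?case by (auto intro!: modif_eqI restrict_ext simp: C.vassoc)
  next
    case (11 \<alpha> f g)
    then show ?case by (auto intro!: modif_eqI extensionalityI)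
  next
    case (12 \<alpha> f g)
    then show ?case by (auto intro!: modif_eqI extensionalityI)
  next
    case (15 f g)
    then show ?case by (auto intro!: modif_eqI restrict_ext)
  next
    case (16 \<alpha> f f' \<alpha>' f'' \<beta> g g' \<beta>' g'')
    then have "md_src \<alpha>' = md_tgt \<alpha>" "md_src \<beta>' = md_tgt \<beta>" by auto
    with 16 show ?case by (auto intro!: modif_eqI restrict_ext simp: C.hcomp_vcomp)
  next
    case (18 f g h)
    then show ?case
      by (intro inverse_cells_invertible[OF su_modification_inverse]) auto
  next
    case (19 \<alpha> f f' \<beta> g g' \<gamma> h h')
    then have "f = md_src \<alpha>" "g = md_src \<beta>" "h = md_src \<gamma>" "f' = md_tgt \<alpha>" "g' = md_tgt \<beta>" "h' = md_tgt \<gamma>"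
      by auto
    with 19 show ?case
      by (auto intro!: modif_eqI restrict_ext) (subst C.associator_natural; simp)
  next
    case (21 f)
    then show ?case
      by (auto intro!: inverse_cells_invertible[OF su_modification_inverse])
  next
    case (24 f)
    then show ?case
      by (auto intro!: inverse_cells_invertible[OF su_modification_inverse])
  next
    case (22 \<alpha> f g X Y)
    then have "f = md_src \<alpha>" "g = md_tgt \<alpha>" by auto
    with 22 show ?case by (auto intro!: modif_eqI restrict_ext)
  next
    case (25 \<alpha> f g X Y)
    then have "f = md_src \<alpha>" "g = md_tgt \<alpha>" by auto
    with 25 show ?case by (auto intro!: modif_eqI restrict_ext)
  next
    case (26 f g h k)
    then show ?case by (auto intro!: modif_eqI restrict_ext simp: C.vassoc C.pentagon_right)
  next
    case (27 f X Y g Z)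
    then show ?case by (auto intro!: modif_eqI restrict_ext)
  qed auto
qed

end

section \<open>Full sub-bicategories and products of bicategories\<close>

lemma full_sub_simps [simp]:
  "Obj (full_sub B P) = {X \<in> Obj B. P X}"
  "Arr (full_sub B P) = {f \<in> Arr B. P (src B f) \<and> P (tgt B f)}"
  "Cell (full_sub B P) = {\<alpha> \<in> Cell B. P (src B (dom2 B \<alpha>)) \<and> P (tgt B (dom2 B \<alpha>))}"
  "src (full_sub B P) = src B" "tgt (full_sub B P) = tgt B" "dom2 (full_sub B P) = dom2 B"
  "cod2 (full_sub B P) = cod2 B" "id1 (full_sub B P) = id1 B" "id2 (full_sub B P) = id2 B"
  "vcomp (full_sub B P) = vcomp B" "hcomp1 (full_sub B P) = hcomp1 B"
  "hcomp2 (full_sub B P) = hcomp2 B" "associator (full_sub B P) = associator B"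
  "lunitor (full_sub B P) = lunitor B" "runitor (full_sub B P) = runitor B"
  by (simp_all add: full_sub_def)

text \<open>An inverse has the same endpoints as the cell itself, so fullness keeps it in the
  sub-bicategory.\<close>

lemma (in bicategory) invertible_full_sub:
  assumes "invertible2 B \<alpha>" "P (src B (dom2 B \<alpha>))" "P (tgt B (dom2 B \<alpha>))"
  shows "invertible2 (full_sub B P) \<alpha>"
  using inverse_cells_inv2[OF assms(1)] assms(2,3)
  by (intro inverse_cells_invertible[where \<beta> = "inv2 B \<alpha>"])
    (auto simp: inverse_cells_def hom2_def)

lemma su_bicat_full_sub:
  assumes "su_bicat B"
  shows "su_bicat (full_sub B P)"
proof -
  interpret su_bicat B by fact
  note [simp] = hom1_def hom2_def composable_def
  show ?thesis
  proof (intro su_bicat.intro bicategory.intro su_bicat_axioms.intro, goal_cases)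
    case 10 then show ?case by (auto simp: vassoc)
  next
    case 16 then show ?case by (auto simp: hcomp_vcomp)
  next
    case 18 then show ?case by (auto intro!: invertible_full_sub)
  next
    case 19 then show ?case by (auto simp: associator_natural)
  next
    case 21 then show ?case by (auto intro!: invertible_full_sub)
  next
    case 24 then show ?case by (auto intro!: invertible_full_sub)
  next
    case 26 then show ?case by (auto simp: pentagon_right vassoc)
  qed auto
qed

lemma prod_bicat_simps [simp]:
  "Obj (prod_bicat B C) = Obj B \<times> Obj C" "Arr (prod_bicat B C) = Arr B \<times> Arr C"
  "Cell (prod_bicat B C) = Cell B \<times> Cell C"
  "src (prod_bicat B C) (f, g) = (src B f, src C g)" "tgt (prod_bicat B C) (f, g) = (tgt B f, tgt C g)"
  "dom2 (prod_bicat B C) (\<alpha>, \<beta>) = (dom2 B \<alpha>, dom2 C \<beta>)"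
  "cod2 (prod_bicat B C) (\<alpha>, \<beta>) = (cod2 B \<alpha>, cod2 C \<beta>)"
  "id1 (prod_bicat B C) (X, Y) = (id1 B X, id1 C Y)" "id2 (prod_bicat B C) (f, g) = (id2 B f, id2 C g)"
  "(\<alpha>, \<beta>) \<cdot>\<^bsub>prod_bicat B C\<^esub> (\<alpha>', \<beta>') = (\<alpha> \<cdot>\<^bsub>B\<^esub> \<alpha>', \<beta> \<cdot>\<^bsub>C\<^esub> \<beta>')"
  "(f, g) \<star>\<^bsub>prod_bicat B C\<^esub> (f', g') = (f \<star>\<^bsub>B\<^esub> f', g \<star>\<^bsub>C\<^esub> g')"
  "(\<alpha>, \<beta>) \<ast>\<^bsub>prod_bicat B C\<^esub> (\<alpha>', \<beta>') = (\<alpha> \<ast>\<^bsub>B\<^esub> \<alpha>', \<beta> \<ast>\<^bsub>C\<^esub> \<beta>')"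
  "associator (prod_bicat B C) (f, g) (f', g') (f'', g'') = (associator B f f' f'', associator C g g' g'')"
  "lunitor (prod_bicat B C) (f, g) = (lunitor B f, lunitor C g)"
  "runitor (prod_bicat B C) (f, g) = (runitor B f, runitor C g)"
  by (simp_all add: prod_bicat_def)

lemma inverse_cells_prod [simp]:
  "inverse_cells (prod_bicat B C) (\<alpha>, \<beta>) (\<alpha>', \<beta>') \<longleftrightarrow> inverse_cells B \<alpha> \<alpha>' \<and> inverse_cells C \<beta> \<beta>'"
  by (auto simp: inverse_cells_def hom2_def)

lemma invertible_prod [simp]:
  "invertible2 (prod_bicat B C) (\<alpha>, \<beta>) \<longleftrightarrow> invertible2 B \<alpha> \<and> invertible2 C \<beta>"
  by (auto simp: invertible2_def)

lemma bicategory_prod: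
  assumes "bicategory B" "bicategory C"
  shows "bicategory (prod_bicat B C)"
proof -
  interpret B: bicategory B by fact
  interpret C: bicategory C by fact
  note [simp] = hom1_def hom2_def composable_def
  show ?thesis
  proof (intro bicategory.intro, goal_cases)
    case 10 then show ?case by (auto simp: B.vassoc C.vassoc)
  next
    case 16 then show ?case by (auto simp: B.hcomp_vcomp C.hcomp_vcomp)
  next
    case 19 then show ?case by (auto simp: B.associator_natural C.associator_natural)
  next
    case (20 f X Y) then show ?case
      using B.lunitor_hom[of "fst f"] C.lunitor_hom[of "snd f"] by auto
  next
    case 21 then show ?case by (auto simp: B.lunitor_inv C.lunitor_inv)
  next
    case (22 \<alpha> f g X Y) then show ?case
      using B.lunitor_nat[of "fst \<alpha>" "fst f" "fst g"] C.lunitor_nat[of "snd \<alpha>" "snd f" "snd g"] by auto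
  next
    case (23 f X Y) then show ?case
      using B.runitor_hom[of "fst f"] C.runitor_hom[of "snd f"] by auto
  next
    case 24 then show ?case by (auto simp: B.runitor_inv C.runitor_inv)
  next
    case (25 \<alpha> f g X Y) then show ?case
      using B.runitor_nat[of "fst \<alpha>" "fst f" "fst g"] C.runitor_nat[of "snd \<alpha>" "snd f" "snd g"] by auto
  next
    case 26 then show ?case by (auto simp: B.vassoc C.vassoc B.pentagon_right C.pentagon_right)
  next
    case (27 f X Y g Z) then show ?case
      using B.triangle[of "fst f" _ _ "fst g"] C.triangle[of "snd f" _ _ "snd g"] by auto
  qed auto
qed

lemma inv2_prod:
  assumes "bicategory B" "bicategory C" "invertible2 B \<alpha>" "invertible2 C \<beta>"
  shows "inv2 (prod_bicat B C) (\<alpha>, \<beta>) = (inv2 B \<alpha>, inv2 C \<beta>)"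
proof -
  interpret B: bicategory B by fact
  interpret C: bicategory C by fact
  interpret bicategory "prod_bicat B C" by (rule bicategory_prod) fact+
  show ?thesis by (rule inv2_eqI) (simp add: B.inverse_cells_inv2 C.inverse_cells_inv2 assms)
qed

lemma su_bicat_prod:
  assumes "su_bicat B" "su_bicat C"
  shows "su_bicat (prod_bicat B C)"
proof -
  interpret B: su_bicat B by fact
  interpret C: su_bicat C by fact
  show ?thesis
    by (intro su_bicat.intro bicategory_prod su_bicat_axioms.intro B.bicategory_axioms C.bicategory_axioms)
      auto
qed

section \<open>Composition with a strictly unitary pseudofunctor\<close>

locale su_functor = D: su_bicat D + C: su_bicat C + P: pseudofunctor D C P
  for D :: "('p, 'b, 'd) bicat" and C :: "('q, 'e, 'f) bicat" and P +
  assumes su: "strictly_unitary D C P"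
begin

lemma arr_id1 [simp]: "X \<in> Obj D \<Longrightarrow> ps_arr P (id1 D X) = id1 C (ps_obj P X)"
  and unit_id2 [simp]: "X \<in> Obj D \<Longrightarrow> ps_unit P X = id2 C (id1 C (ps_obj P X))"
  using su by (auto simp: strictly_unitary_def)

text \<open>In the left unit coherence of \<open>P\<close> the unit constraint and both unitors are
  identities, so the compositor is what is left.\<close>

lemma comp_unit_left [simp]:
  assumes "f \<in> Arr D" "src D f = X"
  shows "ps_comp P (id1 D X, f) = id2 C (ps_arr P f)"
  using P.ps_coh_left[of f X "tgt D f"] assms P.comp_typing(1)[of "id1 D X" f]
  by (auto simp: hom1_def)

lemma comp_unit_right [simp]:
  assumes "f \<in> Arr D" "tgt D f = X"
  shows "ps_comp P (f, id1 D X) = id2 C (ps_arr P f)"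
  using P.ps_coh_right[of f "src D f" X] assms P.comp_typing(1)[of f "id1 D X"]
  by (auto simp: hom1_def)

end

lemma ps_then_simps [simp]:
  "X \<in> Obj B \<Longrightarrow> ps_obj (ps_then B C F P) X = ps_obj P (ps_obj F X)"
  "f \<in> Arr B \<Longrightarrow> ps_arr (ps_then B C F P) f = ps_arr P (ps_arr F f)"
  "\<alpha> \<in> Cell B \<Longrightarrow> ps_cell (ps_then B C F P) \<alpha> = ps_cell P (ps_cell F \<alpha>)"
  "X \<in> Obj B \<Longrightarrow> ps_unit (ps_then B C F P) X = ps_unit P (ps_obj F X) \<cdot>\<^bsub>C\<^esub> ps_cell P (ps_unit F X)"
  "f \<in> Arr B \<Longrightarrow> g \<in> Arr B \<Longrightarrow> tgt B f = src B g \<Longrightarrow> ps_comp (ps_then B C F P) (f, g)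
     = ps_comp P (ps_arr F f, ps_arr F g) \<cdot>\<^bsub>C\<^esub> ps_cell P (ps_comp F (f, g))"
  "ps_obj (ps_then B C F P) \<in> extensional (Obj B)" "ps_arr (ps_then B C F P) \<in> extensional (Arr B)"
  "ps_cell (ps_then B C F P) \<in> extensional (Cell B)"
  "ps_comp (ps_then B C F P) \<in> extensional (composable B)"
  "ps_unit (ps_then B C F P) \<in> extensional (Obj B)"
  by (simp_all add: ps_then_def composable_def)

locale su_functor_post = su_functor D C P + F: pseudofunctor B D F
  for B :: "('o, 'a, 'c) bicat" and D :: "('p, 'b, 'd) bicat" and C :: "('q, 'e, 'f) bicat" and P F
begin

text \<open>The compositor of a composite is the value of \<open>P\<close> on the compositor of F,
  seen as a cell from a two-letter word; this is what makes the rules for \<open>ps_on_paths\<close>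
  applicable to it.\<close>

lemma then_comp_word:
  assumes "f \<in> Arr B" "g \<in> Arr B" "tgt B f = src B g"
  shows "ps_comp (ps_then B C F P) (f, g)
    = ps_on_paths D C P [ps_arr F f, ps_arr F g] [ps_arr F (f \<star>\<^bsub>B\<^esub> g)] (ps_comp F (f, g))"
  using assms by (simp add: ps_on_paths_def)

lemma coh_assoc_word:
  assumes [simp]: "f \<in> Arr B" "g \<in> Arr B" "h \<in> Arr B" "tgt B f = src B g" "tgt B g = src B h"
  shows "rwhisk D [ps_arr F f, ps_arr F g] [ps_arr F (f \<star>\<^bsub>B\<^esub> g)] [ps_arr F h] (ps_comp F (f, g))
      \<cdot>\<^bsub>D\<^esub> (ps_comp F (f \<star>\<^bsub>B\<^esub> g, h) \<cdot>\<^bsub>D\<^esub> ps_cell F (associator B f g h))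
    = (id2 D (ps_arr F f) \<ast>\<^bsub>D\<^esub> ps_comp F (g, h)) \<cdot>\<^bsub>D\<^esub> ps_comp F (f, g \<star>\<^bsub>B\<^esub> h)"
  using F.coh_assoc[of f g h] by (simp add: D.rwhisk_2_1 D.vassoc)

text \<open>For associativity, the coherence of F in word form is an equation of pastings, and
  \<open>ps_on_paths\<close> maps it to the coherence of the composite in word form; the associator
  is restored at the end. The remaining axioms use naturality of the compositor of
  \<open>P\<close>.\<close>

lemma pseudofunctor_ps_then: "pseudofunctor B C (ps_then B C F P)"
proof (intro pseudofunctor.intro pseudofunctor_axioms.intro, goal_cases)
  case (9 f X Y) then show ?case by (auto simp: hom1_def)
next
  case (10 \<alpha> f g) then show ?case by (auto simp: hom2_def)
next
  case (11 \<alpha> f g \<beta> h) then show ?case by (auto simp: hom2_def F.cell_vcomp P.cell_vcomp)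
next
  case (13 f g) then show ?case by (auto simp: composable_def hom2_def)
next
  case (14 f g) then show ?case by (auto simp: composable_def)
next
  case (15 \<alpha> f f' \<beta> g g')
  then have [simp]: "\<alpha> \<in> Cell B" "\<beta> \<in> Cell B" "f = dom2 B \<alpha>" "f' = cod2 B \<alpha>" "g = dom2 B \<beta>"
    "g' = cod2 B \<beta>" "tgt B (dom2 B \<alpha>) = src B (dom2 B \<beta>)"
    by (auto simp: hom2_def)
  have 1: "(ps_cell P (ps_cell F \<alpha>) \<ast>\<^bsub>C\<^esub> ps_cell P (ps_cell F \<beta>)) \<cdot>\<^bsub>C\<^esub> ps_comp P (ps_arr F (cod2 B \<alpha>), ps_arr F (cod2 B \<beta>))
    = ps_comp P (ps_arr F (dom2 B \<alpha>), ps_arr F (dom2 B \<beta>)) \<cdot>\<^bsub>C\<^esub> ps_cell P (ps_cell F \<alpha> \<ast>\<^bsub>D\<^esub> ps_cell F \<beta>)"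
    using P.comp_nat[of "ps_cell F \<alpha>" "ps_cell F \<beta>"] by simp
  show ?case using F.comp_nat[of \<alpha> \<beta>]
    by (simp add: 1[THEN C.vcomp_extend] C.vassoc flip: P.cell_vcomp)
next
  case (16 X) then show ?case by (auto simp: hom2_def)
next
  case (17 X) then show ?case by (simp add: F.ps_unit_inv)
next
  case (18 f g h)
  then have [simp]: "f \<in> Arr B" "g \<in> Arr B" "h \<in> Arr B" "tgt B f = src B g" "tgt B g = src B h"
    by (auto simp: composable_def)
  let ?F = "ps_arr F" let ?P = "\<lambda>f. ps_arr P (?F f)" and ?a = "associator B f g h"
  have [simp]: "wcell D [?F f, ?F g] [?F (f \<star>\<^bsub>B\<^esub> g)] (ps_comp F (f, g))"
    by (rule D.wcellI) simp_all
  have [simp]: "wcell D [?F f, ?F g, ?F h] [?F (f \<star>\<^bsub>B\<^esub> g), ?F h]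
     (rwhisk D [?F f, ?F g] [?F (f \<star>\<^bsub>B\<^esub> g)] [?F h] (ps_comp F (f, g)))"
    "wcell D [?F (f \<star>\<^bsub>B\<^esub> g), ?F h] [?F (f \<star>\<^bsub>B\<^esub> (g \<star>\<^bsub>B\<^esub> h))]
       (ps_comp F (f \<star>\<^bsub>B\<^esub> g, h) \<cdot>\<^bsub>D\<^esub> ps_cell F ?a)"
    "wcell D [?F f, ?F g, ?F h] [?F f, ?F (g \<star>\<^bsub>B\<^esub> h)] (id2 D (?F f) \<ast>\<^bsub>D\<^esub> ps_comp F (g, h))"
    "wcell D [?F f, ?F (g \<star>\<^bsub>B\<^esub> h)] [?F (f \<star>\<^bsub>B\<^esub> (g \<star>\<^bsub>B\<^esub> h))] (ps_comp F (f, g \<star>\<^bsub>B\<^esub> h))"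
    "wcell D [?F g, ?F h] [?F (g \<star>\<^bsub>B\<^esub> h)] (ps_comp F (g, h))"
    by (auto intro!: D.wcellI)
  have 1: "ps_on_paths D C P [?F (f \<star>\<^bsub>B\<^esub> g), ?F h] [?F (f \<star>\<^bsub>B\<^esub> (g \<star>\<^bsub>B\<^esub> h))]
       (ps_comp F (f \<star>\<^bsub>B\<^esub> g, h) \<cdot>\<^bsub>D\<^esub> ps_cell F ?a)
     = ps_comp (ps_then B C F P) (f \<star>\<^bsub>B\<^esub> g, h) \<cdot>\<^bsub>C\<^esub> ps_cell (ps_then B C F P) ?a"
    by (simp add: ps_on_paths_def P.cell_vcomp C.vassoc)
  have 2: "ps_on_paths D C P [?F f, ?F g, ?F h] [?F (f \<star>\<^bsub>B\<^esub> g), ?F h]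
      (rwhisk D [?F f, ?F g] [?F (f \<star>\<^bsub>B\<^esub> g)] [?F h] (ps_comp F (f, g)))
    = rwhisk C [?P f, ?P g] [?P (f \<star>\<^bsub>B\<^esub> g)] [?P h] (ps_comp (ps_then B C F P) (f, g))"
    using P.ps_on_paths_rwhisk[of "[?F f, ?F g]" "[?F (f \<star>\<^bsub>B\<^esub> g)]" "ps_comp F (f, g)" "[?F h]"]
    by (simp add: then_comp_word del: ps_then_simps)
  have 3: "ps_on_paths D C P [?F f, ?F g, ?F h] [?F f, ?F (g \<star>\<^bsub>B\<^esub> h)] (id2 D (?F f) \<ast>\<^bsub>D\<^esub> ps_comp F (g, h))
     = id2 C (?P f) \<ast>\<^bsub>C\<^esub> ps_comp (ps_then B C F P) (g, h)"
    by (subst P.ps_on_paths_Cons) (simp_all add: then_comp_word del: ps_then_simps)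
  have "ps_on_paths D C P [?F f, ?F g, ?F h] [?F (f \<star>\<^bsub>B\<^esub> (g \<star>\<^bsub>B\<^esub> h))]
      (rwhisk D [?F f, ?F g] [?F (f \<star>\<^bsub>B\<^esub> g)] [?F h] (ps_comp F (f, g))
      \<cdot>\<^bsub>D\<^esub> (ps_comp F (f \<star>\<^bsub>B\<^esub> g, h) \<cdot>\<^bsub>D\<^esub> ps_cell F ?a))
    = ps_on_paths D C P [?F f, ?F g, ?F h] [?F (f \<star>\<^bsub>B\<^esub> (g \<star>\<^bsub>B\<^esub> h))]
      ((id2 D (?F f) \<ast>\<^bsub>D\<^esub> ps_comp F (g, h)) \<cdot>\<^bsub>D\<^esub> ps_comp F (f, g \<star>\<^bsub>B\<^esub> h))"
    by (simp add: coh_assoc_word)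
  then have "rwhisk C [?P f, ?P g] [?P (f \<star>\<^bsub>B\<^esub> g)] [?P h] (ps_comp (ps_then B C F P) (f, g))
      \<cdot>\<^bsub>C\<^esub> (ps_comp (ps_then B C F P) (f \<star>\<^bsub>B\<^esub> g, h) \<cdot>\<^bsub>C\<^esub> ps_cell (ps_then B C F P) ?a)
    = (id2 C (?P f) \<ast>\<^bsub>C\<^esub> ps_comp (ps_then B C F P) (g, h)) \<cdot>\<^bsub>C\<^esub> ps_comp (ps_then B C F P) (f, g \<star>\<^bsub>B\<^esub> h)"
    (is "?l = ?r")
    by (simp add: P.ps_on_paths_vcomp[where vs = "[?F (f \<star>\<^bsub>B\<^esub> g), ?F h]"]
        P.ps_on_paths_vcomp[where vs = "[?F f, ?F (g \<star>\<^bsub>B\<^esub> h)]"] 1 2 3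
        then_comp_word[of f "g \<star>\<^bsub>B\<^esub> h"] del: ps_then_simps)
  then have "associator C (?P f) (?P g) (?P h) \<cdot>\<^bsub>C\<^esub> ?l = associator C (?P f) (?P g) (?P h) \<cdot>\<^bsub>C\<^esub> ?r"
    by (rule arg_cong)
  then show ?case by (simp add: C.rwhisk_2_1 C.vassoc)
next
  case (19 f X Y)
  then have [simp]: "f \<in> Arr B" "src B f = X" "X \<in> Obj B" by (auto simp: hom1_def)
  have [simp]: "lunitor B f \<in> Cell B" "dom2 B (lunitor B f) = id1 B X \<star>\<^bsub>B\<^esub> f" "cod2 B (lunitor B f) = f"
    using F.S.lunitor_hom[of f X Y] 19 by (auto simp: hom2_def)
  have 1: "(ps_cell P (ps_unit F X) \<ast>\<^bsub>C\<^esub> id2 C (ps_arr P (ps_arr F f)))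
       \<cdot>\<^bsub>C\<^esub> ps_comp P (ps_arr F (id1 B X), ps_arr F f)
     = ps_cell P (ps_unit F X \<ast>\<^bsub>D\<^esub> id2 D (ps_arr F f))"
    using P.comp_nat[of "ps_unit F X" "id2 D (ps_arr F f)"] by simp
  show ?case using F.ps_coh_left[of f X Y] 19
    by (simp add: C.vassoc D.vassoc 1[THEN C.vcomp_extend] flip: P.cell_vcomp)
next
  case (20 f X Y)
  then have [simp]: "f \<in> Arr B" "tgt B f = Y" "Y \<in> Obj B" by (auto simp: hom1_def)
  have [simp]: "runitor B f \<in> Cell B" "dom2 B (runitor B f) = f \<star>\<^bsub>B\<^esub> id1 B Y" "cod2 B (runitor B f) = f"
    using F.S.runitor_hom[of f X Y] 20 by (auto simp: hom2_def)
  have 1: "(id2 C (ps_arr P (ps_arr F f)) \<ast>\<^bsub>C\<^esub> ps_cell P (ps_unit F Y))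
       \<cdot>\<^bsub>C\<^esub> ps_comp P (ps_arr F f, ps_arr F (id1 B Y))
     = ps_cell P (id2 D (ps_arr F f) \<ast>\<^bsub>D\<^esub> ps_unit F Y)"
    using P.comp_nat[of "id2 D (ps_arr F f)" "ps_unit F Y"] by simp
  show ?case using F.ps_coh_right[of f X Y] 20
    by (simp add: C.vassoc D.vassoc 1[THEN C.vcomp_extend] flip: P.cell_vcomp)
qed (auto simp: F.S.bicategory_axioms C.bicategory_axioms)

lemma strictly_unitary_ps_then: "strictly_unitary B D F \<Longrightarrow> strictly_unitary B C (ps_then B C F P)"
  by (auto simp: strictly_unitary_def)

end

lemma pt_post_simps [simp]:
  "pt_src (pt_post B C \<sigma> P) = ps_then B C (pt_src \<sigma>) P" "pt_tgt (pt_post B C \<sigma> P) = ps_then B C (pt_tgt \<sigma>) P"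
  "X \<in> Obj B \<Longrightarrow> pt_map (pt_post B C \<sigma> P) X = ps_arr P (pt_map \<sigma> X)"
  "pt_map (pt_post B C \<sigma> P) \<in> extensional (Obj B)" "pt_nat (pt_post B C \<sigma> P) \<in> extensional (Arr B)"
  by (simp_all add: pt_post_def)

locale su_functor_post_nat = su_functor D C P + \<sigma>: su_pseudonatural B D \<sigma>
  for B :: "('o, 'a, 'c) bicat" and D :: "('p, 'b, 'd) bicat" and C :: "('q, 'e, 'f) bicat" and P \<sigma>
begin

sublocale F: su_functor_post B D C P "pt_src \<sigma>" ..
sublocale G: su_functor_post B D C P "pt_tgt \<sigma>" ..

lemma pt_post_nat:
  "f \<in> Arr B \<Longrightarrow> pt_nat (pt_post B C \<sigma> P) f
    = ps_comp P (ps_arr (pt_src \<sigma>) f, pt_map \<sigma> (tgt B f)) \<cdot>\<^bsub>C\<^esub> (ps_cell P (pt_nat \<sigma> f)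
       \<cdot>\<^bsub>C\<^esub> inv2 C (ps_comp P (pt_map \<sigma> (src B f), ps_arr (pt_tgt \<sigma>) f)))"
  by (simp add: pt_post_def C.vassoc)

text \<open>The conjugation by compositors in \<open>pt_post\<close> is exactly the action of
  \<open>P\<close> on a cell between two-letter words.\<close>

lemma pt_post_nat_word:
  "f \<in> Arr B \<Longrightarrow> src B f = X \<Longrightarrow> tgt B f = Y \<Longrightarrow> pt_nat (pt_post B C \<sigma> P) f
    = ps_on_paths D C P [ps_arr (pt_src \<sigma>) f, pt_map \<sigma> Y] [pt_map \<sigma> X, ps_arr (pt_tgt \<sigma>) f]
      (pt_nat \<sigma> f)"
  by (auto simp add: pt_post_nat ps_on_paths_def C.vassoc)

text \<open>The composition axiom is the image under \<open>ps_on_paths\<close> of the word form for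
  \<sigma>, whose terms are translated one by one in equations 1 to 4. Naturality and the unit axiom
  follow from naturality of the compositor of \<open>P\<close>.\<close>

lemma pseudonatural_pt_post: "su_pseudonatural B C (pt_post B C \<sigma> P)"
proof (rule su_pseudonaturalI)
  fix \<alpha> assume [simp]: "\<alpha> \<in> Cell B"
  let ?f = "dom2 B \<alpha>" and ?g = "cod2 B \<alpha>"
  define X Y where "X = src B ?f" and "Y = tgt B ?f"
  have [simp]: "src B ?f = X" "tgt B ?f = Y" "src B ?g = X" "tgt B ?g = Y" "X \<in> Obj B" "Y \<in> Obj B"
    by (auto simp: X_def Y_def)
  let ?F = "ps_cell (pt_src \<sigma>) \<alpha>" and ?G = "ps_cell (pt_tgt \<sigma>) \<alpha>" and ?s = "pt_map \<sigma>"
  have 1: "(ps_cell P ?F \<ast>\<^bsub>C\<^esub> id2 C (ps_arr P (?s Y))) \<cdot>\<^bsub>C\<^esub> ps_comp P (ps_arr (pt_src \<sigma>) ?g, ?s Y)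
     = ps_comp P (ps_arr (pt_src \<sigma>) ?f, ?s Y) \<cdot>\<^bsub>C\<^esub> ps_cell P (?F \<ast>\<^bsub>D\<^esub> id2 D (?s Y))"
    using P.comp_nat[of ?F "id2 D (?s Y)"] by simp
  have 2: "(id2 C (ps_arr P (?s X)) \<ast>\<^bsub>C\<^esub> ps_cell P ?G) \<cdot>\<^bsub>C\<^esub> ps_comp P (?s X, ps_arr (pt_tgt \<sigma>) ?g)
     = ps_comp P (?s X, ps_arr (pt_tgt \<sigma>) ?f) \<cdot>\<^bsub>C\<^esub> ps_cell P (id2 D (?s X) \<ast>\<^bsub>D\<^esub> ?G)"
    using P.comp_nat[of "id2 D (?s X)" ?G] by simp
  have "inv2 C (ps_comp P (?s X, ps_arr (pt_tgt \<sigma>) ?f)) \<cdot>\<^bsub>C\<^esub>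
      (((id2 C (ps_arr P (?s X)) \<ast>\<^bsub>C\<^esub> ps_cell P ?G) \<cdot>\<^bsub>C\<^esub> ps_comp P (?s X, ps_arr (pt_tgt \<sigma>) ?g))
       \<cdot>\<^bsub>C\<^esub> inv2 C (ps_comp P (?s X, ps_arr (pt_tgt \<sigma>) ?g)))
     = ps_cell P (id2 D (?s X) \<ast>\<^bsub>D\<^esub> ?G) \<cdot>\<^bsub>C\<^esub> inv2 C (ps_comp P (?s X, ps_arr (pt_tgt \<sigma>) ?g))"
    by (subst 2) (simp add: C.vassoc)
  then have 3: "inv2 C (ps_comp P (?s X, ps_arr (pt_tgt \<sigma>) ?f)) \<cdot>\<^bsub>C\<^esub> (id2 C (ps_arr P (?s X)) \<ast>\<^bsub>C\<^esub> ps_cell P ?G)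
     = ps_cell P (id2 D (?s X) \<ast>\<^bsub>D\<^esub> ?G) \<cdot>\<^bsub>C\<^esub> inv2 C (ps_comp P (?s X, ps_arr (pt_tgt \<sigma>) ?g))"
    by (simp add: C.vassoc)
  have 4: "ps_cell P (?F \<ast>\<^bsub>D\<^esub> id2 D (?s Y)) \<cdot>\<^bsub>C\<^esub> ps_cell P (pt_nat \<sigma> ?g)
     = ps_cell P (pt_nat \<sigma> ?f) \<cdot>\<^bsub>C\<^esub> ps_cell P (id2 D (?s X) \<ast>\<^bsub>D\<^esub> ?G)"
    using \<sigma>.nat_nat[of \<alpha>] by (simp flip: P.cell_vcomp)
  show "(ps_cell (pt_src (pt_post B C \<sigma> P)) \<alpha> \<ast>\<^bsub>C\<^esub> id2 C (pt_map (pt_post B C \<sigma> P) (tgt B ?f)))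
      \<cdot>\<^bsub>C\<^esub> pt_nat (pt_post B C \<sigma> P) ?g
    = pt_nat (pt_post B C \<sigma> P) ?f
      \<cdot>\<^bsub>C\<^esub> (id2 C (pt_map (pt_post B C \<sigma> P) (src B ?f)) \<ast>\<^bsub>C\<^esub> ps_cell (pt_tgt (pt_post B C \<sigma> P)) \<alpha>)"
    by (simp add: pt_post_nat C.vassoc 1[THEN C.vcomp_extend] 3 4[THEN C.vcomp_extend])
next
  fix X assume [simp]: "X \<in> Obj B"
  let ?F = "ps_unit (pt_src \<sigma>) X" and ?G = "ps_unit (pt_tgt \<sigma>) X" and ?s = "pt_map \<sigma> X"
  let ?e = "id1 B X"
  have 1: "(ps_cell P ?F \<ast>\<^bsub>C\<^esub> id2 C (ps_arr P ?s)) \<cdot>\<^bsub>C\<^esub> ps_comp P (ps_arr (pt_src \<sigma>) ?e, ?s)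
     = ps_cell P (?F \<ast>\<^bsub>D\<^esub> id2 D ?s)"
    using P.comp_nat[of ?F "id2 D ?s"] by simp
  have 2: "ps_cell P (id2 D ?s \<ast>\<^bsub>D\<^esub> ?G)
    = (id2 C (ps_arr P ?s) \<ast>\<^bsub>C\<^esub> ps_cell P ?G) \<cdot>\<^bsub>C\<^esub> ps_comp P (?s, ps_arr (pt_tgt \<sigma>) ?e)"
    using P.comp_nat[of "id2 D ?s" ?G] by simp
  have 3: "ps_cell P (?F \<ast>\<^bsub>D\<^esub> id2 D ?s) \<cdot>\<^bsub>C\<^esub> ps_cell P (pt_nat \<sigma> ?e)
     = (id2 C (ps_arr P ?s) \<ast>\<^bsub>C\<^esub> ps_cell P ?G) \<cdot>\<^bsub>C\<^esub> ps_comp P (?s, ps_arr (pt_tgt \<sigma>) ?e)"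
    using \<sigma>.nat_unit[of X] 2 by (simp flip: P.cell_vcomp)
  show "(ps_unit (pt_src (pt_post B C \<sigma> P)) X \<ast>\<^bsub>C\<^esub> id2 C (pt_map (pt_post B C \<sigma> P) X))
      \<cdot>\<^bsub>C\<^esub> pt_nat (pt_post B C \<sigma> P) ?e
    = id2 C (pt_map (pt_post B C \<sigma> P) X) \<ast>\<^bsub>C\<^esub> ps_unit (pt_tgt (pt_post B C \<sigma> P)) X"
    by (simp add: pt_post_nat C.vassoc 1[THEN C.vcomp_extend] 3[THEN C.vcomp_extend])
next
  fix f g assume [simp]: "f \<in> Arr B" "g \<in> Arr B" "tgt B f = src B g"
  define X Y Z where "X = src B f" and "Y = src B g" and "Z = tgt B g"
  have [simp]: "src B f = X" "src B g = Y" "tgt B g = Z" "tgt B f = Y"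
    "X \<in> Obj B" "Y \<in> Obj B" "Z \<in> Obj B"
    by (auto simp: X_def Y_def Z_def)
  let ?fg = "f \<star>\<^bsub>B\<^esub> g" let ?F = "ps_arr (pt_src \<sigma>)" and ?G = "ps_arr (pt_tgt \<sigma>)" and ?s = "pt_map \<sigma>"
  let ?Fc = "ps_comp (pt_src \<sigma>) (f, g)" and ?Gc = "ps_comp (pt_tgt \<sigma>) (f, g)"
  let ?W = "\<lambda>us vs. ps_on_paths D C P us vs" and ?P = "ps_arr P"
  have [simp]: "wcell D [?F f, ?F g] [?F ?fg] ?Fc" "wcell D [?G f, ?G g] [?G ?fg] ?Gc"
    "wcell D [?F f, ?F g, ?s Z] [?F f, ?s Y, ?G g] (id2 D (?F f) \<ast>\<^bsub>D\<^esub> pt_nat \<sigma> g)"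
    "wcell D [?s X, ?G f, ?G g] [?s X, ?G ?fg] (id2 D (?s X) \<ast>\<^bsub>D\<^esub> ?Gc)"
    by (rule D.wcellI; simp)+
  have [simp]: "wcell D [?F f, ?s Y, ?G g] [?s X, ?G f, ?G g]
      (rwhisk D [?F f, ?s Y] [?s X, ?G f] [?G g] (pt_nat \<sigma> f))"
    "wcell D [?F f, ?F g, ?s Z] [?F ?fg, ?s Z] (rwhisk D [?F f, ?F g] [?F ?fg] [?s Z] ?Fc)"
    by (rule D.wcellI; simp)+
  have [simp]: "wcell D [?F f, ?s Y, ?G g] [?s X, ?G ?fg]
      (rwhisk D [?F f, ?s Y] [?s X, ?G f] [?G g] (pt_nat \<sigma> f) \<cdot>\<^bsub>D\<^esub> (id2 D (?s X) \<ast>\<^bsub>D\<^esub> ?Gc))"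
    by (rule D.wcellI; simp)+
  have 1: "?W [?F f, ?F g, ?s Z] [?F ?fg, ?s Z] (rwhisk D [?F f, ?F g] [?F ?fg] [?s Z] ?Fc)
    = rwhisk C [?P (?F f), ?P (?F g)] [?P (?F ?fg)] [?P (?s Z)] (ps_comp (ps_then B C (pt_src \<sigma>) P) (f, g))"
    using P.ps_on_paths_rwhisk[of "[?F f, ?F g]" "[?F ?fg]" ?Fc "[?s Z]"]
    by (simp add: F.then_comp_word del: ps_then_simps)
  have 2: "?W [?F f, ?s Y, ?G g] [?s X, ?G f, ?G g]
      (rwhisk D [?F f, ?s Y] [?s X, ?G f] [?G g] (pt_nat \<sigma> f))
    = rwhisk C [?P (?F f), ?P (?s Y)] [?P (?s X), ?P (?G f)] [?P (?G g)] (pt_nat (pt_post B C \<sigma> P) f)"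
    using P.ps_on_paths_rwhisk[of "[?F f, ?s Y]" "[?s X, ?G f]" "pt_nat \<sigma> f" "[?G g]"]
    by (simp add: pt_post_nat_word)
  have 3: "?W [?F f, ?F g, ?s Z] [?F f, ?s Y, ?G g] (id2 D (?F f) \<ast>\<^bsub>D\<^esub> pt_nat \<sigma> g)
    = id2 C (?P (?F f)) \<ast>\<^bsub>C\<^esub> pt_nat (pt_post B C \<sigma> P) g"
    by (subst P.ps_on_paths_Cons) (simp_all add: pt_post_nat_word)
  have 4: "?W [?s X, ?G f, ?G g] [?s X, ?G ?fg] (id2 D (?s X) \<ast>\<^bsub>D\<^esub> ?Gc)
    = id2 C (?P (?s X)) \<ast>\<^bsub>C\<^esub> ps_comp (ps_then B C (pt_tgt \<sigma>) P) (f, g)"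
    by (subst P.ps_on_paths_Cons) (simp_all add: G.then_comp_word del: ps_then_simps)
  have 5: "rwhisk D [?F f, ?F g] [?F ?fg] [?s Z] ?Fc \<cdot>\<^bsub>D\<^esub> pt_nat \<sigma> ?fg
    = (id2 D (?F f) \<ast>\<^bsub>D\<^esub> pt_nat \<sigma> g) \<cdot>\<^bsub>D\<^esub> (rwhisk D [?F f, ?s Y] [?s X, ?G f] [?G g] (pt_nat \<sigma> f)
      \<cdot>\<^bsub>D\<^esub> (id2 D (?s X) \<ast>\<^bsub>D\<^esub> ?Gc))"
    using \<sigma>.nat_comp[of f g] by simp
  have "?W [?F f, ?F g, ?s Z] [?s X, ?G ?fg] (rwhisk D [?F f, ?F g] [?F ?fg] [?s Z] ?Fc \<cdot>\<^bsub>D\<^esub> pt_nat \<sigma> ?fg)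
    = rwhisk C [?P (?F f), ?P (?F g)] [?P (?F ?fg)] [?P (?s Z)] (ps_comp (ps_then B C (pt_src \<sigma>) P) (f, g))
      \<cdot>\<^bsub>C\<^esub> pt_nat (pt_post B C \<sigma> P) ?fg"
    by (simp add: P.ps_on_paths_vcomp[where vs = "[?F ?fg, ?s Z]"] 1 pt_post_nat_word del: ps_then_simps)
  moreover have "?W [?F f, ?F g, ?s Z] [?s X, ?G ?fg]
      ((id2 D (?F f) \<ast>\<^bsub>D\<^esub> pt_nat \<sigma> g) \<cdot>\<^bsub>D\<^esub> (rwhisk D [?F f, ?s Y] [?s X, ?G f] [?G g] (pt_nat \<sigma> f)
      \<cdot>\<^bsub>D\<^esub> (id2 D (?s X) \<ast>\<^bsub>D\<^esub> ?Gc)))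
    = (id2 C (?P (?F f)) \<ast>\<^bsub>C\<^esub> pt_nat (pt_post B C \<sigma> P) g) \<cdot>\<^bsub>C\<^esub> (rwhisk C [?P (?F f), ?P (?s Y)]
      [?P (?s X), ?P (?G f)] [?P (?G g)] (pt_nat (pt_post B C \<sigma> P) f)
      \<cdot>\<^bsub>C\<^esub> (id2 C (?P (?s X)) \<ast>\<^bsub>C\<^esub> ps_comp (ps_then B C (pt_tgt \<sigma>) P) (f, g)))"
    by (simp add: P.ps_on_paths_vcomp[where vs = "[?F f, ?s Y, ?G g]"]
        P.ps_on_paths_vcomp[where vs = "[?s X, ?G f, ?G g]"] 2 3 4 del: ps_then_simps)
  ultimately show "rwhisk C [ps_arr (pt_src (pt_post B C \<sigma> P)) f, ps_arr (pt_src (pt_post B C \<sigma> P)) g]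
        [ps_arr (pt_src (pt_post B C \<sigma> P)) ?fg] [pt_map (pt_post B C \<sigma> P) (tgt B g)]
        (ps_comp (pt_src (pt_post B C \<sigma> P)) (f, g)) \<cdot>\<^bsub>C\<^esub> pt_nat (pt_post B C \<sigma> P) ?fg
    = (id2 C (ps_arr (pt_src (pt_post B C \<sigma> P)) f) \<ast>\<^bsub>C\<^esub> pt_nat (pt_post B C \<sigma> P) g)
      \<cdot>\<^bsub>C\<^esub> (rwhisk C [ps_arr (pt_src (pt_post B C \<sigma> P)) f, pt_map (pt_post B C \<sigma> P) (src B g)]
        [pt_map (pt_post B C \<sigma> P) (src B f), ps_arr (pt_tgt (pt_post B C \<sigma> P)) f]
        [ps_arr (pt_tgt (pt_post B C \<sigma> P)) g] (pt_nat (pt_post B C \<sigma> P) f)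
      \<cdot>\<^bsub>C\<^esub> (id2 C (pt_map (pt_post B C \<sigma> P) (src B f))
        \<ast>\<^bsub>C\<^esub> ps_comp (pt_tgt (pt_post B C \<sigma> P)) (f, g)))"
    unfolding 5 by simp
qed (auto simp: pt_post_nat C.su_bicat_axioms intro: F.pseudofunctor_ps_then G.pseudofunctor_ps_then)

end

section \<open>Postcomposition on modifications, and its compositor\<close>

context pseudofunctor
begin

lemma comp_nat_inv:
  assumes "\<alpha> \<in> Cell B" "\<beta> \<in> Cell B" "tgt B (dom2 B \<alpha>) = src B (dom2 B \<beta>)"
  shows "inv2 C (ps_comp F (dom2 B \<alpha>, dom2 B \<beta>)) \<cdot>\<^bsub>C\<^esub> (ps_cell F \<alpha> \<ast>\<^bsub>C\<^esub> ps_cell F \<beta>)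
    = ps_cell F (\<alpha> \<ast>\<^bsub>B\<^esub> \<beta>) \<cdot>\<^bsub>C\<^esub> inv2 C (ps_comp F (cod2 B \<alpha>, cod2 B \<beta>))"
proof -
  note [simp] = assms
  let ?c = "ps_comp F (dom2 B \<alpha>, dom2 B \<beta>)" and ?d = "ps_comp F (cod2 B \<alpha>, cod2 B \<beta>)"
  have "inv2 C ?c \<cdot>\<^bsub>C\<^esub> (((ps_cell F \<alpha> \<ast>\<^bsub>C\<^esub> ps_cell F \<beta>) \<cdot>\<^bsub>C\<^esub> ?d) \<cdot>\<^bsub>C\<^esub> inv2 C ?d)
     = ps_cell F (\<alpha> \<ast>\<^bsub>B\<^esub> \<beta>) \<cdot>\<^bsub>C\<^esub> inv2 C ?d"
    by (subst comp_nat[symmetric]) (simp_all add: T.vassoc)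
  then show ?thesis by (simp add: T.vassoc)
qed

text \<open>Associativity coherence solved for the inverse associator, the form in which it occurs
  at the target end of \<open>pt_then\<close>.\<close>

lemma coh_assoc_inv:
  assumes "f \<in> Arr B" "g \<in> Arr B" "h \<in> Arr B" "tgt B f = src B g" "tgt B g = src B h"
  shows "inv2 C (ps_comp F (f, g \<star>\<^bsub>B\<^esub> h))
      \<cdot>\<^bsub>C\<^esub> (inv2 C (id2 C (ps_arr F f) \<ast>\<^bsub>C\<^esub> ps_comp F (g, h))
      \<cdot>\<^bsub>C\<^esub> (inv2 C (associator C (ps_arr F f) (ps_arr F g) (ps_arr F h))
      \<cdot>\<^bsub>C\<^esub> (ps_comp F (f, g) \<ast>\<^bsub>C\<^esub> id2 C (ps_arr F h))))
    = ps_cell F (inv2 B (associator B f g h)) \<cdot>\<^bsub>C\<^esub> inv2 C (ps_comp F (f \<star>\<^bsub>B\<^esub> g, h))" (is "?L = ?R")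
proof -
  note [simp] = assms
  let ?N = "ps_comp F (f \<star>\<^bsub>B\<^esub> g, h) \<cdot>\<^bsub>C\<^esub> ps_cell F (associator B f g h)"
  have "?L \<cdot>\<^bsub>C\<^esub> ?N = ?R \<cdot>\<^bsub>C\<^esub> ?N"
    by (simp add: coh_assoc T.vassoc cell_inv2)
  then show ?thesis by (rule T.cancel_inv_right[rotated -1]) simp_all
qed

end

definition md_post :: "('o, 'a, 'c) bicat \<Rightarrow> ('q, 'e, 'f) bicat \<Rightarrow> ('o, 'a, 'c, 'p, 'b, 'd) modif
    \<Rightarrow> ('p, 'b, 'd, 'q, 'e, 'f) pseudofun \<Rightarrow> ('o, 'a, 'c, 'q, 'e, 'f) modif" where
  "md_post B C m P = \<lparr>md_src = pt_post B C (md_src m) P, md_tgt = pt_post B C (md_tgt m) P,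
     md_map = (\<lambda>X\<in>Obj B. ps_cell P (md_map m X))\<rparr>"

lemma md_post_simps [simp]:
  "md_src (md_post B C m P) = pt_post B C (md_src m) P" "md_tgt (md_post B C m P) = pt_post B C (md_tgt m) P"
  "md_map (md_post B C m P) = (\<lambda>X\<in>Obj B. ps_cell P (md_map m X))"
  by (simp_all add: md_post_def)

context su_functor
begin

lemma pt_post_pseudonatural:
  assumes "su_pseudonatural B D \<sigma>"
  shows "su_pseudonatural B C (pt_post B C \<sigma> P)"
proof -
  interpret \<sigma>: su_pseudonatural B D \<sigma> by fact
  interpret su_functor_post_nat B D C P \<sigma> ..
  show ?thesis by (rule pseudonatural_pt_post)
qed

lemma su_modification_post:
  assumes "bicategory B" "su_modification B D m"
  shows "su_modification B C (md_post B C m P)"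
proof -
  interpret m: su_modification B D m by fact
  interpret B: bicategory B by fact
  interpret BC: su_bicats B C ..
  interpret S: su_functor_post_nat B D C P "md_src m" ..
  interpret T: su_functor_post_nat B D C P "md_tgt m" ..
  show ?thesis
  proof (rule BC.su_modificationI)
    fix f assume [simp]: "f \<in> Arr B"
    define X Y where "X = src B f" and "Y = tgt B f"
    have [simp]: "src B f = X" "tgt B f = Y" "X \<in> Obj B" "Y \<in> Obj B"
      by (auto simp: X_def Y_def)
    let ?F = "ps_arr (pt_src (md_src m)) f" and ?G = "ps_arr (pt_tgt (md_src m)) f"
    let ?s = "pt_map (md_src m)" and ?s' = "pt_map (md_tgt m)" and ?m = "md_map m"
    have [simp]: "?s' X \<in> Arr D" "?s' Y \<in> Arr D" "src D (?s' Y) = tgt D ?F" "tgt D (?s' X) = src D ?G"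
      "src D (?s' Y) = ps_obj (pt_src (md_src m)) Y" "tgt D (?s' X) = ps_obj (pt_tgt (md_src m)) X"
      "pt_nat (md_tgt m) f \<in> Cell D" "dom2 D (pt_nat (md_tgt m) f) = ?F \<star>\<^bsub>D\<^esub> ?s' Y"
      "cod2 D (pt_nat (md_tgt m) f) = ?s' X \<star>\<^bsub>D\<^esub> ?G"
      using m.T.map_typing[of X] m.T.map_typing[of Y] m.T.nat_typing[of f] by simp_all
    have 1: "inv2 C (ps_comp P (?s X, ?G)) \<cdot>\<^bsub>C\<^esub> (ps_cell P (?m X) \<ast>\<^bsub>C\<^esub> id2 C (ps_arr P ?G))
      = ps_cell P (?m X \<ast>\<^bsub>D\<^esub> id2 D ?G) \<cdot>\<^bsub>C\<^esub> inv2 C (ps_comp P (?s' X, ?G))"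
      using P.comp_nat_inv[of "?m X" "id2 D ?G"] by simp
    have 2: "(id2 C (ps_arr P ?F) \<ast>\<^bsub>C\<^esub> ps_cell P (?m Y)) \<cdot>\<^bsub>C\<^esub> ps_comp P (?F, ?s' Y)
      = ps_comp P (?F, ?s Y) \<cdot>\<^bsub>C\<^esub> ps_cell P (id2 D ?F \<ast>\<^bsub>D\<^esub> ?m Y)"
      using P.comp_nat[of "id2 D ?F" "?m Y"] by simp
    have 3: "ps_cell P (pt_nat (md_src m) f) \<cdot>\<^bsub>C\<^esub> ps_cell P (?m X \<ast>\<^bsub>D\<^esub> id2 D ?G)
      = ps_cell P (id2 D ?F \<ast>\<^bsub>D\<^esub> ?m Y) \<cdot>\<^bsub>C\<^esub> ps_cell P (pt_nat (md_tgt m) f)"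
      using m.md_nat[of f] by (simp flip: P.cell_vcomp)
    show "pt_nat (md_src (md_post B C m P)) f \<cdot>\<^bsub>C\<^esub> (md_map (md_post B C m P) (src B f)
        \<ast>\<^bsub>C\<^esub> id2 C (ps_arr (pt_tgt (md_src (md_post B C m P))) f))
      = (id2 C (ps_arr (pt_src (md_src (md_post B C m P))) f) \<ast>\<^bsub>C\<^esub> md_map (md_post B C m P) (tgt B f))
        \<cdot>\<^bsub>C\<^esub> pt_nat (md_tgt (md_post B C m P)) f"
      by (simp add: S.pt_post_nat T.pt_post_nat C.vassoc 1 2[THEN C.vcomp_extend] 3[THEN C.vcomp_extend])
  qed (use S.pseudonatural_pt_post T.pseudonatural_pt_post in auto)
qed

text \<open>Supplies the compositor of postcomposition. As word cells, the composite of the images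
  is the image of the composite; the brackets that \<open>pt_then\<close> adds on either side are
  then matched by the associativity coherence of \<open>P\<close> in the form
  \<open>coh_assoc_inv\<close>.\<close>

lemma su_modification_post_comp:
  assumes "bicategory B" "su_pseudonatural B D \<sigma>" "su_pseudonatural B D \<tau>" "pt_src \<tau> = pt_tgt \<sigma>"
  shows "su_modification B C \<lparr>md_src = pt_then B C (pt_post B C \<sigma> P) (pt_post B C \<tau> P),
    md_tgt = pt_post B C (pt_then B D \<sigma> \<tau>) P,
    md_map = (\<lambda>X\<in>Obj B. ps_comp P (pt_map \<sigma> X, pt_map \<tau> X))\<rparr>" (is "su_modification B C ?m")
proof -
  interpret \<sigma>: su_pseudonatural B D \<sigma> by fact
  interpret \<tau>: su_pseudonatural B D \<tau> by fact
  interpret B: bicategory B by fact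
  interpret BC: su_bicats B C ..
  interpret st: su_pseudonatural_pair B D \<sigma> \<tau> by unfold_locales fact
  interpret ST: su_pseudonatural B D "pt_then B D \<sigma> \<tau>" by (rule st.pseudonatural_pt_then)
  interpret Ps: su_functor_post_nat B D C P \<sigma> ..
  interpret Pt: su_functor_post_nat B D C P \<tau> ..
  interpret Pst: su_functor_post_nat B D C P "pt_then B D \<sigma> \<tau>" ..
  interpret ps: su_pseudonatural B C "pt_post B C \<sigma> P" by (rule Ps.pseudonatural_pt_post)
  interpret pt: su_pseudonatural B C "pt_post B C \<tau> P" by (rule Pt.pseudonatural_pt_post)
  interpret pp: su_pseudonatural_pair B C "pt_post B C \<sigma> P" "pt_post B C \<tau> P"
    by unfold_locales (simp add: assms(4))
  show ?thesis
  proof (rule BC.su_modificationI)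
    fix f assume [simp]: "f \<in> Arr B"
    define X Y where "X = src B f" and "Y = tgt B f"
    have [simp]: "src B f = X" "tgt B f = Y" "X \<in> Obj B" "Y \<in> Obj B"
      by (auto simp: X_def Y_def)
    let ?F = "ps_arr (pt_src \<sigma>) f" and ?G = "ps_arr (pt_tgt \<sigma>) f" and ?H = "ps_arr (pt_tgt \<tau>) f"
    let ?s = "pt_map \<sigma>" and ?t = "pt_map \<tau>" and ?P = "ps_arr P" and ?N = "st.then_nat f"
    have [simp]: "?t X \<in> Arr D" "?t Y \<in> Arr D" "src D (?t X) = ps_obj (pt_tgt \<sigma>) X"
      "src D (?t Y) = ps_obj (pt_tgt \<sigma>) Y" "pt_nat \<tau> f \<in> Cell D" "dom2 D (pt_nat \<tau> f) = ?G \<star>\<^bsub>D\<^esub> ?t Y"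
      "cod2 D (pt_nat \<tau> f) = ?t X \<star>\<^bsub>D\<^esub> ?H"
      by simp_all
    have [simp]: "wcell D [?F, ?s Y] [?s X, ?G] (pt_nat \<sigma> f)" "wcell D [?G, ?t Y] [?t X, ?H] (pt_nat \<tau> f)"
      by (rule D.wcellI; simp)+
    have [simp]: "wcell D [?F, ?s Y, ?t Y] [?s X, ?G, ?t Y] (rwhisk D [?F, ?s Y] [?s X, ?G] [?t Y] (pt_nat \<sigma> f))"
      "wcell D [?s X, ?G, ?t Y] [?s X, ?t X, ?H] (id2 D (?s X) \<ast>\<^bsub>D\<^esub> pt_nat \<tau> f)"
      by (rule D.wcellI; simp)+
    \<comment> \<open>Preservation of vertical composition and of whiskering splits the image of the
      word cell into the two images that make up \<open>pp.then_nat\<close>.\<close>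
    have "ps_on_paths D C P [?F, ?s Y, ?t Y] [?s X, ?t X, ?H] ?N
      = ps_on_paths D C P [?F, ?s Y, ?t Y] [?s X, ?G, ?t Y] (rwhisk D [?F, ?s Y] [?s X, ?G] [?t Y] (pt_nat \<sigma> f))
      \<cdot>\<^bsub>C\<^esub> ps_on_paths D C P [?s X, ?G, ?t Y] [?s X, ?t X, ?H] (id2 D (?s X) \<ast>\<^bsub>D\<^esub> pt_nat \<tau> f)"
      by (simp add: st.then_nat_def P.ps_on_paths_vcomp[where vs = "[?s X, ?G, ?t Y]"])
    also have "\<dots> = pp.then_nat f"
      using P.ps_on_paths_rwhisk[of "[?F, ?s Y]" "[?s X, ?G]" "pt_nat \<sigma> f" "[?t Y]"]
        Pt.pt_post_nat_word[of f X Y] assms(4)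
      by (simp add: pp.then_nat_def P.ps_on_paths_Cons Ps.pt_post_nat_word)
    finally have 1: "pp.then_nat f = ps_on_paths D C P [?F, ?s Y, ?t Y] [?s X, ?t X, ?H] ?N" ..
    have 2: "inv2 C (ps_comp P (?s X, ?t X \<star>\<^bsub>D\<^esub> ?H))
      \<cdot>\<^bsub>C\<^esub> (inv2 C (id2 C (?P (?s X)) \<ast>\<^bsub>C\<^esub> ps_comp P (?t X, ?H))
      \<cdot>\<^bsub>C\<^esub> (inv2 C (associator C (?P (?s X)) (?P (?t X)) (?P ?H))
      \<cdot>\<^bsub>C\<^esub> (ps_comp P (?s X, ?t X) \<ast>\<^bsub>C\<^esub> id2 C (?P ?H))))
    = ps_cell P (inv2 D (associator D (?s X) (?t X) ?H)) \<cdot>\<^bsub>C\<^esub> inv2 C (ps_comp P (?s X \<star>\<^bsub>D\<^esub> ?t X, ?H))"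
      by (rule P.coh_assoc_inv) simp_all
    have [simp]: "wcell D [?F, ?s Y, ?t Y] [?s X, ?t X, ?H] ?N"
      by (rule D.wcellI; simp)
    have 3: "pp.then_nat f = (id2 C (?P ?F) \<ast>\<^bsub>C\<^esub> ps_comp P (?s Y, ?t Y))
        \<cdot>\<^bsub>C\<^esub> (ps_comp P (?F, ?s Y \<star>\<^bsub>D\<^esub> ?t Y) \<cdot>\<^bsub>C\<^esub> (ps_cell P ?N \<cdot>\<^bsub>C\<^esub> (inv2 C (ps_comp P (?s X, ?t X \<star>\<^bsub>D\<^esub> ?H))
      \<cdot>\<^bsub>C\<^esub> inv2 C (id2 C (?P (?s X)) \<ast>\<^bsub>C\<^esub> ps_comp P (?t X, ?H)))))"
      unfolding 1 by (simp add: ps_on_paths_def C.inv2_vcomp C.vassoc)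
    have 4: "pt_nat (pt_post B C (pt_then B D \<sigma> \<tau>) P) f = ps_comp P (?F, ?s Y \<star>\<^bsub>D\<^esub> ?t Y)
      \<cdot>\<^bsub>C\<^esub> (ps_cell P ?N \<cdot>\<^bsub>C\<^esub> (ps_cell P (inv2 D (associator D (?s X) (?t X) ?H))
      \<cdot>\<^bsub>C\<^esub> inv2 C (ps_comp P (?s X \<star>\<^bsub>D\<^esub> ?t X, ?H))))"
      by (simp add: Pst.pt_post_nat P.cell_vcomp C.vassoc)
    have 5: "pt_nat (pt_then B C (pt_post B C \<sigma> P) (pt_post B C \<tau> P)) f = pp.then_nat f
      \<cdot>\<^bsub>C\<^esub> inv2 C (associator C (?P (?s X)) (?P (?t X)) (?P ?H))"
      by simp
    have [simp]: "?s X \<in> Arr D" "tgt D (?s X) = ps_obj (pt_tgt \<sigma>) X" by simp_all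
    show "pt_nat (md_src ?m) f \<cdot>\<^bsub>C\<^esub> (md_map ?m (src B f) \<ast>\<^bsub>C\<^esub> id2 C (ps_arr (pt_tgt (md_src ?m)) f))
      = (id2 C (ps_arr (pt_src (md_src ?m)) f) \<ast>\<^bsub>C\<^esub> md_map ?m (tgt B f)) \<cdot>\<^bsub>C\<^esub> pt_nat (md_tgt ?m) f"
      by (simp add: 3 4 5 2 C.vassoc del: pp.pt_then_nat)
  qed (use pp.pseudonatural_pt_then Pst.pseudonatural_pt_post assms(4) in auto)
qed

end

section \<open>The pointwise tensor product\<close>

lemma ps_pair_simps [simp]:
  "X \<in> Obj B \<Longrightarrow> ps_obj (ps_pair B F G) X = (ps_obj F X, ps_obj G X)"
  "f \<in> Arr B \<Longrightarrow> ps_arr (ps_pair B F G) f = (ps_arr F f, ps_arr G f)"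
  "\<alpha> \<in> Cell B \<Longrightarrow> ps_cell (ps_pair B F G) \<alpha> = (ps_cell F \<alpha>, ps_cell G \<alpha>)"
  "f \<in> Arr B \<Longrightarrow> g \<in> Arr B \<Longrightarrow> tgt B f = src B g \<Longrightarrow>
    ps_comp (ps_pair B F G) (f, g) = (ps_comp F (f, g), ps_comp G (f, g))"
  "X \<in> Obj B \<Longrightarrow> ps_unit (ps_pair B F G) X = (ps_unit F X, ps_unit G X)"
  "ps_obj (ps_pair B F G) \<in> extensional (Obj B)" "ps_arr (ps_pair B F G) \<in> extensional (Arr B)"
  "ps_cell (ps_pair B F G) \<in> extensional (Cell B)"
  "ps_comp (ps_pair B F G) \<in> extensional (composable B)"
  "ps_unit (ps_pair B F G) \<in> extensional (Obj B)"
  by (simp_all add: ps_pair_def composable_def)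

lemma pseudofunctor_ps_pair:
  assumes "pseudofunctor B C F" "pseudofunctor B C' G"
  shows "pseudofunctor B (prod_bicat C C') (ps_pair B F G)"
proof -
  interpret F: pseudofunctor B C F by fact
  interpret G: pseudofunctor B C' G by fact
  note [simp] = hom1_def hom2_def composable_def
  show ?thesis
  proof (intro pseudofunctor.intro pseudofunctor_axioms.intro, goal_cases)
    case 6 show ?case by (simp del: composable_def)
  next
    case 11 then show ?case by (auto simp: F.cell_vcomp G.cell_vcomp)
  next
    case (15 \<alpha> f f' \<beta> g g') then show ?case
      using F.comp_nat[of \<alpha> \<beta>] G.comp_nat[of \<alpha> \<beta>] by auto
  next
    case (17 X) then show ?case by (auto simp: F.ps_unit_inv G.ps_unit_inv)
  next
    case (18 f g h) then show ?case
      using F.ps_coh_assoc[of f g h] G.ps_coh_assoc[of f g h] by auto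
  next
    case (19 f X Y)
    then have "lunitor B f \<in> Cell B" using F.S.lunitor_hom[of f X Y] by auto
    then show ?case using 19 F.ps_coh_left[of f X Y] G.ps_coh_left[of f X Y] by auto
  next
    case (20 f X Y)
    then have "runitor B f \<in> Cell B" using F.S.runitor_hom[of f X Y] by auto
    then show ?case using 20 F.ps_coh_right[of f X Y] G.ps_coh_right[of f X Y] by auto
  qed (auto simp: bicategory_prod F.S.bicategory_axioms F.T.bicategory_axioms G.T.bicategory_axioms)
qed

lemma strictly_unitary_ps_pair:
  assumes "bicategory B" "strictly_unitary B C F" "strictly_unitary B C' G"
  shows "strictly_unitary B (prod_bicat C C') (ps_pair B F G)"
proof -
  interpret bicategory B by fact
  show ?thesis using assms(2,3) by (auto simp: strictly_unitary_def)
qed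

definition pt_pair :: "('o, 'a, 'c) bicat \<Rightarrow> ('o, 'a, 'c, 'p, 'b, 'd) pseudonat
    \<Rightarrow> ('o, 'a, 'c, 'q, 'e, 'f) pseudonat
    \<Rightarrow> ('o, 'a, 'c, 'p \<times> 'q, 'b \<times> 'e, 'd \<times> 'f) pseudonat" where
  "pt_pair B \<sigma> \<tau> = \<lparr>pt_src = ps_pair B (pt_src \<sigma>) (pt_src \<tau>),
     pt_tgt = ps_pair B (pt_tgt \<sigma>) (pt_tgt \<tau>),
     pt_map = (\<lambda>X\<in>Obj B. (pt_map \<sigma> X, pt_map \<tau> X)), pt_nat = (\<lambda>f\<in>Arr B. (pt_nat \<sigma> f, pt_nat \<tau> f))\<rparr>"

definition md_pair :: "('o, 'a, 'c) bicat \<Rightarrow> ('o, 'a, 'c, 'p, 'b, 'd) modif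
    \<Rightarrow> ('o, 'a, 'c, 'q, 'e, 'f) modif \<Rightarrow> ('o, 'a, 'c, 'p \<times> 'q, 'b \<times> 'e, 'd \<times> 'f) modif" where
  "md_pair B m n = \<lparr>md_src = pt_pair B (md_src m) (md_src n), md_tgt = pt_pair B (md_tgt m) (md_tgt n),
     md_map = (\<lambda>X\<in>Obj B. (md_map m X, md_map n X))\<rparr>"

lemma pt_pair_simps [simp]:
  "pt_src (pt_pair B \<sigma> \<tau>) = ps_pair B (pt_src \<sigma>) (pt_src \<tau>)"
  "pt_tgt (pt_pair B \<sigma> \<tau>) = ps_pair B (pt_tgt \<sigma>) (pt_tgt \<tau>)"
  "pt_map (pt_pair B \<sigma> \<tau>) = (\<lambda>X\<in>Obj B. (pt_map \<sigma> X, pt_map \<tau> X))"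
  "pt_nat (pt_pair B \<sigma> \<tau>) = (\<lambda>f\<in>Arr B. (pt_nat \<sigma> f, pt_nat \<tau> f))"
  by (simp_all add: pt_pair_def)

lemma md_pair_simps [simp]:
  "md_src (md_pair B m n) = pt_pair B (md_src m) (md_src n)"
  "md_tgt (md_pair B m n) = pt_pair B (md_tgt m) (md_tgt n)"
  "md_map (md_pair B m n) = (\<lambda>X\<in>Obj B. (md_map m X, md_map n X))"
  by (simp_all add: md_pair_def)

lemma pseudonatural_pt_pair:
  assumes "su_pseudonatural B C \<sigma>" "su_pseudonatural B C' \<tau>"
  shows "su_pseudonatural B (prod_bicat C C') (pt_pair B \<sigma> \<tau>)"
proof -
  interpret s: su_pseudonatural B C \<sigma> by fact
  interpret t: su_pseudonatural B C' \<tau> by fact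
  note [simp] = hom1_def hom2_def inv2_prod[OF s.C.bicategory_axioms t.C.bicategory_axioms]
  show ?thesis
  proof (intro su_pseudonatural.intro pseudonatural.intro pseudonatural_axioms.intro, goal_cases)
    case 1 show ?case by (rule su_bicat_prod) (rule s.C.su_bicat_axioms t.C.su_bicat_axioms)+
  next
    case 2 show ?case by (simp add: pseudofunctor_ps_pair s.F.pseudofunctor_axioms t.F.pseudofunctor_axioms)
  next
    case 3 show ?case by (simp add: pseudofunctor_ps_pair s.G.pseudofunctor_axioms t.G.pseudofunctor_axioms)
  next
    case (9 f X Y \<alpha> g) then show ?case
      using s.pt_nat_nat[of f X Y \<alpha> g] t.pt_nat_nat[of f X Y \<alpha> g] by auto
  next
    case (10 X) then show ?case using s.pt_nat_unit[of X] t.pt_nat_unit[of X] by simp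
  next
    case (11 f X Y g Z)
    then have "f \<in> Arr B" "g \<in> Arr B" "src B f = X" "tgt B f = Y" "src B g = Y" "tgt B g = Z"
      "X \<in> Obj B" "Y \<in> Obj B" "Z \<in> Obj B" by auto
    then show ?case
      using 11 s.pt_nat_comp[of f X Y g Z] t.pt_nat_comp[of f X Y g Z] by simp
  qed auto
qed

lemma su_modification_md_pair:
  assumes "bicategory B" "su_modification B C m" "su_modification B C' n"
  shows "su_modification B (prod_bicat C C') (md_pair B m n)"
proof -
  interpret m: su_modification B C m by fact
  interpret n: su_modification B C' n by fact
  interpret B: bicategory B by fact
  interpret P: su_bicat "prod_bicat C C'"
    by (rule su_bicat_prod) (rule m.S.C.su_bicat_axioms n.S.C.su_bicat_axioms)+
  interpret su_bicats B "prod_bicat C C'" ..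
  show ?thesis
    using m.md_nat n.md_nat
    by (intro su_modificationI)
      (auto intro!: pseudonatural_pt_pair m.S.su_pseudonatural_axioms m.T.su_pseudonatural_axioms
        n.S.su_pseudonatural_axioms n.T.su_pseudonatural_axioms)
qed

text \<open>Pairing is strict, since associators and inverses in a product are taken in each factor.
  The compositor of the pointwise product therefore comes from \<open>P\<close> alone.\<close>

lemma pt_pair_then:
  assumes "bicategory B" "su_pseudonatural B C \<sigma>" "su_pseudonatural B C \<sigma>'" "pt_src \<sigma>' = pt_tgt \<sigma>"
    "su_pseudonatural B C' \<tau>" "su_pseudonatural B C' \<tau>'" "pt_src \<tau>' = pt_tgt \<tau>"
  shows "pt_then B (prod_bicat C C') (pt_pair B \<sigma> \<tau>) (pt_pair B \<sigma>' \<tau>')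
    = pt_pair B (pt_then B C \<sigma> \<sigma>') (pt_then B C' \<tau> \<tau>')"
proof -
  interpret B: bicategory B by fact
  interpret s: su_pseudonatural_pair B C \<sigma> \<sigma>'
    by (intro su_pseudonatural_pair.intro su_pseudonatural_pair_axioms.intro assms)
  interpret t: su_pseudonatural_pair B C' \<tau> \<tau>'
    by (intro su_pseudonatural_pair.intro su_pseudonatural_pair_axioms.intro assms)
  note [simp] = inv2_prod[OF s.\<sigma>.C.bicategory_axioms t.\<sigma>.C.bicategory_axioms]
  show ?thesis
    by (rule pseudonat_eqI)
      (auto simp: pt_then_def Let_def intro!: restrict_ext simp del: s.pt_then_nat t.pt_then_nat)
qed

text \<open>Pairing followed by postcomposition with P, for arbitrary source and target;
  \<open>rep_tensor\<close> is the instance for \<open>TwoVect\<close>. The structure cells are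
  written out with their boundaries because a \<open>modif\<close> record carries its source and
  target.\<close>

definition pw_tensor :: "('o, 'a, 'c) bicat \<Rightarrow> ('p, 'b, 'd) bicat
    \<Rightarrow> ('p \<times> 'p, 'b \<times> 'b, 'd \<times> 'd, 'p, 'b, 'd) pseudofun
    \<Rightarrow> (('o, 'a, 'c, 'p, 'b, 'd) pseudofun \<times> ('o, 'a, 'c, 'p, 'b, 'd) pseudofun,
        ('o, 'a, 'c, 'p, 'b, 'd) pseudonat \<times> ('o, 'a, 'c, 'p, 'b, 'd) pseudonat,
        ('o, 'a, 'c, 'p, 'b, 'd) modif \<times> ('o, 'a, 'c, 'p, 'b, 'd) modif,
        ('o, 'a, 'c, 'p, 'b, 'd) pseudofun, ('o, 'a, 'c, 'p, 'b, 'd) pseudonat,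
        ('o, 'a, 'c, 'p, 'b, 'd) modif) pseudofun" where
  "pw_tensor B C P = (let A = full_sub (ps_bicat B C) (strictly_unitary B C); AA = prod_bicat A A in \<lparr>
     ps_obj = (\<lambda>(R, S)\<in>Obj AA. ps_then B C (ps_pair B R S) P),
     ps_arr = (\<lambda>(h, k)\<in>Arr AA. pt_post B C (pt_pair B h k) P),
     ps_cell = (\<lambda>(\<phi>, \<psi>)\<in>Cell AA. md_post B C (md_pair B \<phi> \<psi>) P),
     ps_comp = (\<lambda>((h, k), (h', k'))\<in>composable AA. \<lparr>
       md_src = pt_then B C (pt_post B C (pt_pair B h k) P) (pt_post B C (pt_pair B h' k') P),
       md_tgt = pt_post B C (pt_pair B (pt_then B C h h') (pt_then B C k k')) P,
       md_map = (\<lambda>x\<in>Obj B. ps_comp P ((pt_map h x, pt_map k x), (pt_map h' x, pt_map k' x)))\<rparr>),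
     ps_unit = (\<lambda>(R, S)\<in>Obj AA. \<lparr>
       md_src = pt_id B C (ps_then B C (ps_pair B R S) P),
       md_tgt = pt_post B C (pt_pair B (pt_id B C R) (pt_id B C S)) P,
       md_map = (\<lambda>x\<in>Obj B. id2 C (id1 C (ps_obj P (ps_obj R x, ps_obj S x))))\<rparr>)\<rparr>)"

locale pointwise_tensor = B: bicategory B + P: su_functor "prod_bicat C C" C P + C: su_bicat C
  for B :: "('o, 'a, 'c) bicat" and C :: "('p, 'b, 'd) bicat" and P
begin

sublocale BC: su_bicats B C ..

abbreviation "A \<equiv> full_sub (ps_bicat B C) (strictly_unitary B C)"

sublocale A: su_bicat A
  by (rule su_bicat_full_sub) (rule BC.su_bicat_ps_bicat)

sublocale AA: su_bicat "prod_bicat A A"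
  by (rule su_bicat_prod) (rule A.su_bicat_axioms)+

abbreviation "T \<equiv> pw_tensor B C P"

lemma T_obj [simp]:
  "pseudofunctor B C R \<Longrightarrow> pseudofunctor B C S \<Longrightarrow> strictly_unitary B C R \<Longrightarrow> strictly_unitary B C S
   \<Longrightarrow> ps_obj T (R, S) = ps_then B C (ps_pair B R S) P"
  by (simp add: pw_tensor_def Let_def)

lemma T_arr [simp]:
  "(h, k) \<in> Arr (prod_bicat A A) \<Longrightarrow> ps_arr T (h, k) = pt_post B C (pt_pair B h k) P"
  by (simp add: pw_tensor_def Let_def)

lemma T_cell [simp]:
  "(m, n) \<in> Cell (prod_bicat A A) \<Longrightarrow> ps_cell T (m, n) = md_post B C (md_pair B m n) P"
  by (simp add: pw_tensor_def Let_def)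

lemma T_comp:
  "(h, k) \<in> Arr (prod_bicat A A) \<Longrightarrow> (h', k') \<in> Arr (prod_bicat A A) \<Longrightarrow>
    pt_src h' = pt_tgt h \<Longrightarrow> pt_src k' = pt_tgt k \<Longrightarrow>
    ps_comp T ((h, k), (h', k')) = \<lparr>
       md_src = pt_then B C (pt_post B C (pt_pair B h k) P) (pt_post B C (pt_pair B h' k') P),
       md_tgt = pt_post B C (pt_pair B (pt_then B C h h') (pt_then B C k k')) P,
       md_map = (\<lambda>x\<in>Obj B. ps_comp P ((pt_map h x, pt_map k x), (pt_map h' x, pt_map k' x)))\<rparr>"
  by (simp add: pw_tensor_def Let_def composable_def)

lemma pseudofunctor_T0 [simp]:
  assumes "pseudofunctor B C R" "pseudofunctor B C S"
  shows "pseudofunctor B C (ps_then B C (ps_pair B R S) P)"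
proof -
  interpret RS: pseudofunctor B "prod_bicat C C" "ps_pair B R S"
    by (rule pseudofunctor_ps_pair) fact+
  interpret su_functor_post B "prod_bicat C C" C P "ps_pair B R S" ..
  show ?thesis by (rule pseudofunctor_ps_then)
qed

lemma strictly_unitary_T0 [simp]:
  assumes "strictly_unitary B C R" "strictly_unitary B C S" "pseudofunctor B C R" "pseudofunctor B C S"
  shows "strictly_unitary B C (ps_then B C (ps_pair B R S) P)"
proof -
  interpret RS: pseudofunctor B "prod_bicat C C" "ps_pair B R S"
    by (rule pseudofunctor_ps_pair) fact+
  interpret su_functor_post B "prod_bicat C C" C P "ps_pair B R S" ..
  show ?thesis
    by (intro strictly_unitary_ps_then strictly_unitary_ps_pair assms B.bicategory_axioms)
qed

lemma pseudonatural_T1 [simp]: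
  "su_pseudonatural B C h \<Longrightarrow> su_pseudonatural B C k
    \<Longrightarrow> su_pseudonatural B C (pt_post B C (pt_pair B h k) P)"
  by (intro P.pt_post_pseudonatural pseudonatural_pt_pair)

lemma su_modification_T2 [simp]:
  "su_modification B C m \<Longrightarrow> su_modification B C n
    \<Longrightarrow> su_modification B C (md_post B C (md_pair B m n) P)"
  by (intro P.su_modification_post su_modification_md_pair B.bicategory_axioms)

text \<open>Strict unitarity of P makes the compositors that surround the identity naturality cells
  trivial, so the product of two identity transformations is an identity as a record.\<close>

lemma T1_id:
  assumes "pseudofunctor B C R" "pseudofunctor B C S"
  shows "pt_post B C (pt_pair B (pt_id B C R) (pt_id B C S)) P = pt_id B C (ps_then B C (ps_pair B R S) P)"
proof -
  interpret R: pseudofunctor B C R by fact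
  interpret S: pseudofunctor B C S by fact
  interpret TT: pseudofunctor B C "ps_then B C (ps_pair B R S) P"
    by (rule pseudofunctor_T0) fact+
  have *: "ps_cell P (id2 C (ps_arr R f), id2 C (ps_arr S f)) = id2 C (ps_arr P (ps_arr R f, ps_arr S f))"
    "ps_comp P ((ps_arr R f, ps_arr S f), (id1 C (ps_obj R (tgt B f)), id1 C (ps_obj S (tgt B f))))
      = id2 C (ps_arr P (ps_arr R f, ps_arr S f))"
    "ps_comp P ((id1 C (ps_obj R (src B f)), id1 C (ps_obj S (src B f))), (ps_arr R f, ps_arr S f))
      = id2 C (ps_arr P (ps_arr R f, ps_arr S f))"
    "ps_arr P (ps_arr R f, ps_arr S f) \<in> Arr C" if "f \<in> Arr B" for f
    using that P.P.ps_cell_id2[of "(ps_arr R f, ps_arr S f)"]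
      P.comp_unit_right[of "(ps_arr R f, ps_arr S f)" "(ps_obj R (tgt B f), ps_obj S (tgt B f))"]
      P.comp_unit_left[of "(ps_arr R f, ps_arr S f)" "(ps_obj R (src B f), ps_obj S (src B f))"]
      P.P.arr_typing(1)[of "(ps_arr R f, ps_arr S f)"]
    by auto
  show ?thesis
  proof (rule pseudonat_eqI)
    show "pt_map (pt_post B C (pt_pair B (pt_id B C R) (pt_id B C S)) P)
        = pt_map (pt_id B C (ps_then B C (ps_pair B R S) P))"
      using P.arr_id1[of "(ps_obj R X, ps_obj S X)" for X]
      by (intro extensionalityI[where A = "Obj B"]) (auto simp: pt_id_def)
    show "pt_nat (pt_post B C (pt_pair B (pt_id B C R) (pt_id B C S)) P)
        = pt_nat (pt_id B C (ps_then B C (ps_pair B R S) P))"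
      using assms by (intro extensionalityI[where A = "Arr B"]) (auto simp: pt_post_def pt_id_def *)
  qed (simp_all add: assms)
qed

text \<open>The compositor of postcomposition at two paired transformations, its target rewritten by
  strictness of pairing.\<close>

lemma su_modification_T_comp:
  assumes "su_pseudonatural B C h" "su_pseudonatural B C k" "su_pseudonatural B C h'"
    "su_pseudonatural B C k'" "pt_src h' = pt_tgt h" "pt_src k' = pt_tgt k"
  shows "su_modification B C \<lparr>
       md_src = pt_then B C (pt_post B C (pt_pair B h k) P) (pt_post B C (pt_pair B h' k') P),
       md_tgt = pt_post B C (pt_pair B (pt_then B C h h') (pt_then B C k k')) P,
       md_map = (\<lambda>x\<in>Obj B. ps_comp P ((pt_map h x, pt_map k x), (pt_map h' x, pt_map k' x)))\<rparr>"
proof -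
  have "(\<lambda>x\<in>Obj B. ps_comp P (pt_map (pt_pair B h k) x, pt_map (pt_pair B h' k') x))
    = (\<lambda>x\<in>Obj B. ps_comp P ((pt_map h x, pt_map k x), (pt_map h' x, pt_map k' x)))"
    by (rule restrict_ext) simp
  then show ?thesis
    using P.su_modification_post_comp[OF B.bicategory_axioms pseudonatural_pt_pair[OF assms(1,2)]
        pseudonatural_pt_pair[OF assms(3,4)]] assms
    by (simp add: pt_pair_then[OF B.bicategory_axioms])
qed

end

section \<open>The pointwise product as a pseudofunctor\<close>

context pointwise_tensor
begin

lemma T_unit [simp]:
  assumes "(R, S) \<in> Obj (prod_bicat A A)"
  shows "ps_unit T (R, S) = id2 A (id1 A (ps_obj T (R, S)))"
proof -
  have [simp]: "pseudofunctor B C R" "pseudofunctor B C S" "strictly_unitary B C R" "strictly_unitary B C S"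
    using assms by auto
  have "ps_unit T (R, S) = \<lparr>
       md_src = pt_id B C (ps_then B C (ps_pair B R S) P),
       md_tgt = pt_post B C (pt_pair B (pt_id B C R) (pt_id B C S)) P,
       md_map = (\<lambda>x\<in>Obj B. id2 C (id1 C (ps_obj P (ps_obj R x, ps_obj S x))))\<rparr>"
    using assms by (simp add: pw_tensor_def Let_def)
  also have "\<dots> = id2 A (id1 A (ps_obj T (R, S)))"
    by (rule modif_eqI) (auto simp: T1_id intro!: restrict_ext)
  finally show ?thesis .
qed

lemma Obj_A: "R \<in> Obj A \<longleftrightarrow> pseudofunctor B C R \<and> strictly_unitary B C R"
  by simp

lemma Arr_A: "h \<in> Arr A \<longleftrightarrow>
    su_pseudonatural B C h \<and> strictly_unitary B C (pt_src h) \<and> strictly_unitary B C (pt_tgt h)"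
  by (simp add: BC.su_pseudonatural_iff)

lemma Cell_A: "m \<in> Cell A \<longleftrightarrow> su_modification B C m
    \<and> strictly_unitary B C (pt_src (md_src m)) \<and> strictly_unitary B C (pt_tgt (md_src m))"
  by simp

text \<open>Each equation between modifications is, over an object of B, the corresponding equation
  for \<open>P\<close> at the components. The boundaries agree because pairing is strict and
  products of identity transformations are identities.\<close>

lemma pseudofunctor_T: "pseudofunctor (prod_bicat A A) A T"
proof -
  let ?A2 = "prod_bicat A A"
  note [simp] = hom1_def hom2_def
  have T_arr' [simp]: "ps_arr T (h, k) = pt_post B C (pt_pair B h k) P" if "h \<in> Arr A" "k \<in> Arr A" for h k
    using that by simp
  have T_cell' [simp]: "ps_cell T (m, n) = md_post B C (md_pair B m n) P" if "m \<in> Cell A" "n \<in> Cell A" for m n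
    using that by simp
  \<comment> \<open>Typing and invertibility of the compositor are collected here in terms of
    membership in \<open>A\<close>; the cases on naturality, associativity and units all draw on
    them.\<close>
  have comp: "ps_comp T ((h, k), (h', k')) \<in> Cell A
      \<and> md_src (ps_comp T ((h, k), (h', k'))) = pt_then B C (ps_arr T (h, k)) (ps_arr T (h', k'))
      \<and> md_tgt (ps_comp T ((h, k), (h', k'))) = ps_arr T (pt_then B C h h', pt_then B C k k')
      \<and> invertible2 A (ps_comp T ((h, k), (h', k')))"
    if "h \<in> Arr A" "k \<in> Arr A" "h' \<in> Arr A" "k' \<in> Arr A" "pt_src h' = pt_tgt h" "pt_src k' = pt_tgt k"
    for h k h' k'
  proof -
    have p [simp]: "su_pseudonatural B C h" "su_pseudonatural B C k" "su_pseudonatural B C h'"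
      "su_pseudonatural B C k'"
      and u [simp]: "strictly_unitary B C (pt_src h)" "strictly_unitary B C (pt_tgt h)"
      "strictly_unitary B C (pt_src k)" "strictly_unitary B C (pt_tgt k)"
      "strictly_unitary B C (pt_tgt h')" "strictly_unitary B C (pt_tgt k')"
      "pt_src h' = pt_tgt h" "pt_src k' = pt_tgt k"
      using that unfolding Arr_A by simp_all
    have th [simp]: "pt_then B C h h' \<in> Arr A" "pt_then B C k k' \<in> Arr A"
      unfolding Arr_A by simp_all
    let ?m = "ps_comp T ((h, k), (h', k'))"
    have m: "?m = \<lparr>
       md_src = pt_then B C (pt_post B C (pt_pair B h k) P) (pt_post B C (pt_pair B h' k') P),
       md_tgt = pt_post B C (pt_pair B (pt_then B C h h') (pt_then B C k k')) P,
       md_map = (\<lambda>x\<in>Obj B. ps_comp P ((pt_map h x, pt_map k x), (pt_map h' x, pt_map k' x)))\<rparr>"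
      by (rule T_comp) (use that in simp_all)
    have mod: "su_modification B C ?m"
      unfolding m by (rule su_modification_T_comp) simp_all
    have inv: "invertible2 (ps_bicat B C) ?m"
      by (rule inverse_cells_invertible[OF BC.su_modification_inverse[OF mod]])
        (simp add: m P.P.comp_typing)
    interpret bc: su_bicat "ps_bicat B C" by (rule BC.su_bicat_ps_bicat)
    have "invertible2 A ?m"
      by (rule bc.invertible_full_sub[OF inv]) (simp_all add: m)
    then show ?thesis using mod by (simp add: m that th T_arr' del: full_sub_simps(2) T_arr)
  qed
  have comp_map: "md_map (ps_comp T ((h, k), (h', k')))
      = (\<lambda>x\<in>Obj B. ps_comp P ((pt_map h x, pt_map k x), (pt_map h' x, pt_map k' x)))"
    if "h \<in> Arr A" "k \<in> Arr A" "h' \<in> Arr A" "k' \<in> Arr A" "pt_src h' = pt_tgt h" "pt_src k' = pt_tgt k"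
    for h k h' k'
    by (subst T_comp) (use that in simp_all)
  note [simp del] = full_sub_simps(1-3)
  note [simp] = Obj_A Arr_A Cell_A
  show ?thesis
  proof (intro pseudofunctor.intro pseudofunctor_axioms.intro AA.bicategory_axioms A.bicategory_axioms,
      goal_cases)
    case 1 show ?case by (simp add: pw_tensor_def Let_def)
  next
    case 2 show ?case by (simp add: pw_tensor_def Let_def)
  next
    case 3 show ?case by (simp add: pw_tensor_def Let_def)
  next
    case 4 show ?case by (simp add: pw_tensor_def Let_def)
  next
    case 5 show ?case by (simp add: pw_tensor_def Let_def)
  next
    case (6 X) then show ?case by auto
  next
    case (7 f X Y) then show ?case by auto
  next
    case (8 \<alpha> f g) then show ?case by auto
  next
    case (9 \<alpha> f g \<beta> h)
    then show ?case
      by (auto intro!: modif_eqI restrict_ext simp: BC.su_modification_vcomp simp flip: P.P.cell_vcomp)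
  next
    case (10 f)
    have "ps_cell P (id2 C a, id2 C b) = id2 C (ps_arr P (a, b))" if "a \<in> Arr C" "b \<in> Arr C" for a b
      using P.P.ps_cell_id2[of "(a, b)"] that by simp
    then show ?case using 10
      by (auto intro!: modif_eqI restrict_ext simp: BC.su_modification_id2)
  next
    case (11 f g)
    obtain f1 f2 where [simp]: "f = (f1, f2)" by (cases f)
    obtain g1 g2 where [simp]: "g = (g1, g2)" by (cases g)
    have "f1 \<in> Arr A" "f2 \<in> Arr A" "g1 \<in> Arr A" "g2 \<in> Arr A" "pt_src g1 = pt_tgt f1" "pt_src g2 = pt_tgt f2"
      using 11 unfolding composable_def by (simp_all del: Arr_A)
    from comp[OF this] show ?case by (simp del: Cell_A)
  next
    case (12 f g)
    obtain f1 f2 where [simp]: "f = (f1, f2)" by (cases f)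
    obtain g1 g2 where [simp]: "g = (g1, g2)" by (cases g)
    have "f1 \<in> Arr A" "f2 \<in> Arr A" "g1 \<in> Arr A" "g2 \<in> Arr A" "pt_src g1 = pt_tgt f1" "pt_src g2 = pt_tgt f2"
      using 12 unfolding composable_def by (simp_all del: Arr_A)
    from comp[OF this] show ?case by (simp del: Cell_A)
  next
    case (13 \<alpha> f f' \<beta> g g')
    obtain a a' where [simp]: "\<alpha> = (a, a')" by (cases \<alpha>)
    obtain b b' where [simp]: "\<beta> = (b, b')" by (cases \<beta>)
    have *: "(ps_cell P (md_map a x, md_map a' x) \<ast>\<^bsub>C\<^esub> ps_cell P (md_map b x, md_map b' x)) \<cdot>\<^bsub>C\<^esub>
      ps_comp P ((pt_map (md_tgt a) x, pt_map (md_tgt a') x), (pt_map (md_tgt b) x, pt_map (md_tgt b') x))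
      = ps_comp P ((pt_map (md_src a) x, pt_map (md_src a') x), (pt_map (md_src b) x, pt_map (md_src b') x))
      \<cdot>\<^bsub>C\<^esub> ps_cell P (md_map a x \<ast>\<^bsub>C\<^esub> md_map b x, md_map a' x \<ast>\<^bsub>C\<^esub> md_map b' x)" if "x \<in> Obj B" for x
      using P.P.comp_nat[of "(md_map a x, md_map a' x)" "(md_map b x, md_map b' x)"] 13 that by auto
    show ?case using 13
      comp[of "md_src a" "md_src a'" "md_src b" "md_src b'"] comp[of "md_tgt a" "md_tgt a'" "md_tgt b" "md_tgt b'"]
      by (auto intro!: modif_eqI restrict_ext simp: comp_map *)
  next
    case (14 X) then show ?case by (auto simp: T1_id BC.pseudonatural_pt_id BC.su_modification_id2)
  next
    case (15 X) then show ?case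
      by (auto simp del: ps_bicat_simps full_sub_simps Arr_A)
  next
    case (16 f g h)
    obtain f1 f2 where [simp]: "f = (f1, f2)" by (cases f)
    obtain g1 g2 where [simp]: "g = (g1, g2)" by (cases g)
    obtain h1 h2 where [simp]: "h = (h1, h2)" by (cases h)
    have c [simp]: "f1 \<in> Arr A" "f2 \<in> Arr A" "g1 \<in> Arr A" "g2 \<in> Arr A" "h1 \<in> Arr A" "h2 \<in> Arr A"
      "pt_src g1 = pt_tgt f1" "pt_src g2 = pt_tgt f2" "pt_src h1 = pt_tgt g1" "pt_src h2 = pt_tgt g2"
      using 16 by (auto simp: composable_def)
    let ?f = "\<lambda>x. (pt_map f1 x, pt_map f2 x)" and ?g = "\<lambda>x. (pt_map g1 x, pt_map g2 x)"
      and ?h = "\<lambda>x. (pt_map h1 x, pt_map h2 x)"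
    have *: "(ps_comp P (?f x, ?g x) \<ast>\<^bsub>C\<^esub> id2 C (ps_arr P (?h x))) \<cdot>\<^bsub>C\<^esub>
        ps_comp P ((pt_map f1 x \<star>\<^bsub>C\<^esub> pt_map g1 x, pt_map f2 x \<star>\<^bsub>C\<^esub> pt_map g2 x), ?h x) \<cdot>\<^bsub>C\<^esub>
        ps_cell P (associator C (pt_map f1 x) (pt_map g1 x) (pt_map h1 x),
          associator C (pt_map f2 x) (pt_map g2 x) (pt_map h2 x))
      = associator C (ps_arr P (?f x)) (ps_arr P (?g x)) (ps_arr P (?h x)) \<cdot>\<^bsub>C\<^esub>
        (id2 C (ps_arr P (?f x)) \<ast>\<^bsub>C\<^esub> ps_comp P (?g x, ?h x)) \<cdot>\<^bsub>C\<^esub>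
        ps_comp P (?f x, (pt_map g1 x \<star>\<^bsub>C\<^esub> pt_map h1 x, pt_map g2 x \<star>\<^bsub>C\<^esub> pt_map h2 x))"
      if "x \<in> Obj B" for x
      using P.P.ps_coh_assoc[of "?f x" "?g x" "?h x"] c that by (simp add: composable_def)
    show ?case
      using c comp[of f1 f2 g1 g2] comp[of g1 g2 h1 h2] comp[of "pt_then B C f1 g1" "pt_then B C f2 g2" h1 h2]
        comp[of f1 f2 "pt_then B C g1 h1" "pt_then B C g2 h2"]
      by (auto intro!: modif_eqI restrict_ext simp: comp_map * BC.su_modification_associator)
  next
    case (17 f X Y)
    obtain f1 f2 where [simp]: "f = (f1, f2)" by (cases f)
    have c: "f1 \<in> Arr A" "f2 \<in> Arr A" "X = (pt_src f1, pt_src f2)" using 17 by auto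
    then have [simp]: "su_pseudonatural B C f1" "su_pseudonatural B C f2" by auto
    have *: "ps_comp P ((id1 C (ps_obj (pt_src f1) x), id1 C (ps_obj (pt_src f2) x)), (pt_map f1 x, pt_map f2 x))
        = id2 C (ps_arr P (pt_map f1 x, pt_map f2 x))"
      "ps_cell P (id2 C (pt_map f1 x), id2 C (pt_map f2 x)) = id2 C (ps_arr P (pt_map f1 x, pt_map f2 x))"
      "ps_arr P (pt_map f1 x, pt_map f2 x) \<in> Arr C"
      "src C (ps_arr P (pt_map f1 x, pt_map f2 x)) = ps_obj P (ps_obj (pt_src f1) x, ps_obj (pt_src f2) x)"
      if "x \<in> Obj B" for x
      using P.comp_unit_left[of "(pt_map f1 x, pt_map f2 x)" "(ps_obj (pt_src f1) x, ps_obj (pt_src f2) x)"]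
        P.P.ps_cell_id2[of "(pt_map f1 x, pt_map f2 x)"] P.P.arr_typing[of "(pt_map f1 x, pt_map f2 x)"]
        that by auto
    show ?case
      using c comp[of "pt_id B C (pt_src f1)" "pt_id B C (pt_src f2)" f1 f2]
      by (auto intro!: modif_eqI restrict_ext simp: comp_map * BC.pseudonatural_pt_id
          BC.pt_then_id_left BC.su_modification_id2)
  next
    case (18 f X Y)
    obtain f1 f2 where [simp]: "f = (f1, f2)" by (cases f)
    have c: "f1 \<in> Arr A" "f2 \<in> Arr A" "Y = (pt_tgt f1, pt_tgt f2)" using 18 by auto
    then have [simp]: "su_pseudonatural B C f1" "su_pseudonatural B C f2" by auto
    have *: "ps_comp P ((pt_map f1 x, pt_map f2 x), (id1 C (ps_obj (pt_tgt f1) x), id1 C (ps_obj (pt_tgt f2) x)))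
        = id2 C (ps_arr P (pt_map f1 x, pt_map f2 x))"
      "ps_cell P (id2 C (pt_map f1 x), id2 C (pt_map f2 x)) = id2 C (ps_arr P (pt_map f1 x, pt_map f2 x))"
      "ps_arr P (pt_map f1 x, pt_map f2 x) \<in> Arr C"
      "tgt C (ps_arr P (pt_map f1 x, pt_map f2 x)) = ps_obj P (ps_obj (pt_tgt f1) x, ps_obj (pt_tgt f2) x)"
      if "x \<in> Obj B" for x
      using P.comp_unit_right[of "(pt_map f1 x, pt_map f2 x)" "(ps_obj (pt_tgt f1) x, ps_obj (pt_tgt f2) x)"]
        P.P.ps_cell_id2[of "(pt_map f1 x, pt_map f2 x)"] P.P.arr_typing[of "(pt_map f1 x, pt_map f2 x)"]
        that by auto
    show ?case
      using c comp[of f1 f2 "pt_id B C (pt_tgt f1)" "pt_id B C (pt_tgt f2)"]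
      by (auto intro!: modif_eqI restrict_ext simp: comp_map * BC.pseudonatural_pt_id
          BC.pt_then_id_right BC.su_modification_id2)
  qed
qed

lemma strictly_unitary_T: "strictly_unitary (prod_bicat A A) A T"
proof (rule strictly_unitary_def[THEN iffD2], rule ballI)
  fix X assume "X \<in> Obj (prod_bicat A A)"
  then obtain R S where X: "X = (R, S)" and RS: "(R, S) \<in> Obj (prod_bicat A A)" by (cases X) blast
  then have "(pt_id B C R, pt_id B C S) \<in> Arr (prod_bicat A A)"
    by (simp add: BC.pseudonatural_pt_id flip: BC.su_pseudonatural_iff)
  with RS show "ps_arr T (id1 (prod_bicat A A) X) = id1 A (ps_obj T X) \<and>
    ps_unit T X = id2 A (id1 A (ps_obj T X))"
    by (simp_all add: X T1_id)
qed

text \<open>The pointwise product thereby satisfies the hypotheses that were imposed on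
  \<open>P\<close> itself.\<close>

sublocale T: su_functor "prod_bicat A A" A T
  by (intro su_functor.intro su_functor_axioms.intro pseudofunctor_T strictly_unitary_T
      A.su_bicat_axioms AA.su_bicat_axioms)

end

section \<open>Strictly associative and unital tensor products\<close>

lemma pseudofun_eqI:
  "ps_obj F = ps_obj G \<Longrightarrow> ps_arr F = ps_arr G \<Longrightarrow> ps_cell F = ps_cell G \<Longrightarrow> ps_comp F = ps_comp G \<Longrightarrow>
    ps_unit F = ps_unit G \<Longrightarrow> F = (G :: ('o, 'a, 'c, 'p, 'b, 'd) pseudofun)"
  by simp

lemma ps_const_simps [simp]:
  "X \<in> Obj B \<Longrightarrow> ps_obj (ps_const B C Z) X = Z" "f \<in> Arr B \<Longrightarrow> ps_arr (ps_const B C Z) f = id1 C Z"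
  "\<alpha> \<in> Cell B \<Longrightarrow> ps_cell (ps_const B C Z) \<alpha> = id2 C (id1 C Z)"
  "f \<in> Arr B \<Longrightarrow> g \<in> Arr B \<Longrightarrow> tgt B f = src B g \<Longrightarrow>
    ps_comp (ps_const B C Z) (f, g) = lunitor C (id1 C Z)"
  "X \<in> Obj B \<Longrightarrow> ps_unit (ps_const B C Z) X = id2 C (id1 C Z)"
  by (simp_all add: ps_const_def composable_def)

lemma strictly_unitary_ps_const: "bicategory B \<Longrightarrow> strictly_unitary B C (ps_const B C Z)"
proof -
  assume "bicategory B"
  then interpret B: bicategory B .
  show ?thesis by (auto simp: strictly_unitary_def)
qed

lemma (in su_bicats) pseudofunctor_ps_const:
  assumes [simp]: "Z \<in> Obj C"
  shows "pseudofunctor B C (ps_const B C Z)"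
proof -
  have l: "lunitor B f \<in> Cell B" if "f \<in> Arr B" for f
    using B.lunitor_hom[of f "src B f" "tgt B f"] that by (auto simp: hom1_def hom2_def)
  have r: "runitor B f \<in> Cell B" if "f \<in> Arr B" for f
    using B.runitor_hom[of f "src B f" "tgt B f"] that by (auto simp: hom1_def hom2_def)
  show ?thesis
  proof (intro pseudofunctor.intro pseudofunctor_axioms.intro B.bicategory_axioms C.bicategory_axioms,
      goal_cases)
    case (11 f g) then show ?case by (auto simp: composable_def hom2_def)
  next
    case (12 f g) then show ?case by (auto simp: composable_def)
  next
    case (16 f g h) then show ?case by (auto simp: composable_def)
  qed (auto simp: hom1_def hom2_def l r, auto simp: ps_const_def)
qed

lemma composableE:
  assumes "fg \<in> composable B"
  obtains f g where "fg = (f, g)" "f \<in> Arr B" "g \<in> Arr B" "tgt B f = src B g"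
  using assms by (auto simp: composable_def)

text \<open>P need not preserve horizontal composition strictly. The conditions
  \<open>assoc_comp\<close> and \<open>unit_comp\<close> say that the compositors of rebracketed
  products coincide, and raise the equations on objects, 1-cells and 2-cells to equalities of
  pseudofunctors.\<close>

locale strict_tensor = C: su_bicat C + P: su_functor "prod_bicat C C" C P
  for C :: "('p, 'b, 'd) bicat" and P and I +
  assumes I_obj [simp]: "I \<in> Obj C"
    and assoc0: "x \<in> Obj C \<Longrightarrow> y \<in> Obj C \<Longrightarrow> z \<in> Obj C \<Longrightarrow>
      ps_obj P (ps_obj P (x, y), z) = ps_obj P (x, ps_obj P (y, z))"
    and assoc1: "f \<in> Arr C \<Longrightarrow> g \<in> Arr C \<Longrightarrow> h \<in> Arr C \<Longrightarrow>
      ps_arr P (ps_arr P (f, g), h) = ps_arr P (f, ps_arr P (g, h))"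
    and assoc2: "\<alpha> \<in> Cell C \<Longrightarrow> \<beta> \<in> Cell C \<Longrightarrow> \<gamma> \<in> Cell C \<Longrightarrow>
      ps_cell P (ps_cell P (\<alpha>, \<beta>), \<gamma>) = ps_cell P (\<alpha>, ps_cell P (\<beta>, \<gamma>))"
    and assoc_comp: "\<lbrakk>f \<in> Arr C; g \<in> Arr C; h \<in> Arr C; f' \<in> Arr C; g' \<in> Arr C; h' \<in> Arr C;
        tgt C f = src C f'; tgt C g = src C g'; tgt C h = src C h'\<rbrakk> \<Longrightarrow>
      ps_comp P ((ps_arr P (f, g), h), (ps_arr P (f', g'), h'))
        \<cdot>\<^bsub>C\<^esub> ps_cell P (ps_comp P ((f, g), (f', g')), id2 C (h \<star>\<^bsub>C\<^esub> h'))
      = ps_comp P ((f, ps_arr P (g, h)), (f', ps_arr P (g', h')))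
        \<cdot>\<^bsub>C\<^esub> ps_cell P (id2 C (f \<star>\<^bsub>C\<^esub> f'), ps_comp P ((g, h), (g', h')))"
    and unit0 [simp]: "x \<in> Obj C \<Longrightarrow> ps_obj P (I, x) = x" "x \<in> Obj C \<Longrightarrow> ps_obj P (x, I) = x"
    and unit1 [simp]: "f \<in> Arr C \<Longrightarrow> ps_arr P (id1 C I, f) = f" "f \<in> Arr C \<Longrightarrow> ps_arr P (f, id1 C I) = f"
    and unit2 [simp]: "\<alpha> \<in> Cell C \<Longrightarrow> ps_cell P (id2 C (id1 C I), \<alpha>) = \<alpha>"
      "\<alpha> \<in> Cell C \<Longrightarrow> ps_cell P (\<alpha>, id2 C (id1 C I)) = \<alpha>"
    and unit_comp [simp]: "f \<in> Arr C \<Longrightarrow> f' \<in> Arr C \<Longrightarrow> tgt C f = src C f' \<Longrightarrow>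
        ps_comp P ((id1 C I, f), (id1 C I, f')) = id2 C (f \<star>\<^bsub>C\<^esub> f')"
      "f \<in> Arr C \<Longrightarrow> f' \<in> Arr C \<Longrightarrow> tgt C f = src C f' \<Longrightarrow>
        ps_comp P ((f, id1 C I), (f', id1 C I)) = id2 C (f \<star>\<^bsub>C\<^esub> f')"
begin

lemma P_vcomp:
  "\<alpha> \<in> Cell C \<Longrightarrow> \<alpha>' \<in> Cell C \<Longrightarrow> \<beta> \<in> Cell C \<Longrightarrow> \<beta>' \<in> Cell C \<Longrightarrow> cod2 C \<alpha> = dom2 C \<alpha>' \<Longrightarrow>
    cod2 C \<beta> = dom2 C \<beta>' \<Longrightarrow>
    ps_cell P (\<alpha> \<cdot>\<^bsub>C\<^esub> \<alpha>', \<beta> \<cdot>\<^bsub>C\<^esub> \<beta>') = ps_cell P (\<alpha>, \<beta>) \<cdot>\<^bsub>C\<^esub> ps_cell P (\<alpha>', \<beta>')"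
  using P.P.cell_vcomp[of "(\<alpha>, \<beta>)" "(\<alpha>', \<beta>')"] by simp

lemma P_id2: "f \<in> Arr C \<Longrightarrow> g \<in> Arr C \<Longrightarrow> ps_cell P (id2 C f, id2 C g) = id2 C (ps_arr P (f, g))"
  using P.P.ps_cell_id2[of "(f, g)"] by simp

lemma P_id1: "x \<in> Obj C \<Longrightarrow> y \<in> Obj C \<Longrightarrow> ps_arr P (id1 C x, id1 C y) = id1 C (ps_obj P (x, y))"
  using P.arr_id1[of "(x, y)"] by simp

lemma P_left_vcomp:
  assumes "\<alpha> \<in> Cell C" "\<alpha>' \<in> Cell C" "\<beta> \<in> Cell C" "cod2 C \<alpha> = dom2 C \<alpha>'" "dom2 C \<beta> = g"
  shows "ps_cell P (\<alpha> \<cdot>\<^bsub>C\<^esub> \<alpha>', \<beta>) = ps_cell P (\<alpha>, id2 C g) \<cdot>\<^bsub>C\<^esub> ps_cell P (\<alpha>', \<beta>)"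
  using P_vcomp[of \<alpha> \<alpha>' "id2 C g" \<beta>] assms by auto

lemma P_right_vcomp:
  assumes "\<alpha> \<in> Cell C" "\<alpha>' \<in> Cell C" "\<beta> \<in> Cell C" "cod2 C \<alpha> = dom2 C \<alpha>'" "dom2 C \<beta> = g"
  shows "ps_cell P (\<beta>, \<alpha> \<cdot>\<^bsub>C\<^esub> \<alpha>') = ps_cell P (id2 C g, \<alpha>) \<cdot>\<^bsub>C\<^esub> ps_cell P (\<beta>, \<alpha>')"
  using P_vcomp[of "id2 C g" \<beta> \<alpha> \<alpha>'] assms by auto

lemma P_left_vcomp3:
  assumes "\<alpha> \<in> Cell C" "\<alpha>' \<in> Cell C" "\<alpha>'' \<in> Cell C" "\<beta> \<in> Cell C"
    "cod2 C \<alpha> = dom2 C \<alpha>'" "cod2 C \<alpha>' = dom2 C \<alpha>''" "dom2 C \<beta> = g" "cod2 C \<beta> = g'"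
  shows "ps_cell P (\<alpha> \<cdot>\<^bsub>C\<^esub> (\<alpha>' \<cdot>\<^bsub>C\<^esub> \<alpha>''), \<beta>)
    = ps_cell P (\<alpha>, id2 C g) \<cdot>\<^bsub>C\<^esub> (ps_cell P (\<alpha>', \<beta>) \<cdot>\<^bsub>C\<^esub> ps_cell P (\<alpha>'', id2 C g'))"
  using P_left_vcomp[of \<alpha> "\<alpha>' \<cdot>\<^bsub>C\<^esub> \<alpha>''" \<beta>] P_vcomp[of \<alpha>' \<alpha>'' \<beta> "id2 C g'"] assms by auto

lemma P_right_vcomp3:
  assumes "\<alpha> \<in> Cell C" "\<alpha>' \<in> Cell C" "\<alpha>'' \<in> Cell C" "\<beta> \<in> Cell C"
    "cod2 C \<alpha> = dom2 C \<alpha>'" "cod2 C \<alpha>' = dom2 C \<alpha>''" "dom2 C \<beta> = g" "cod2 C \<beta> = g'"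
  shows "ps_cell P (\<beta>, \<alpha> \<cdot>\<^bsub>C\<^esub> (\<alpha>' \<cdot>\<^bsub>C\<^esub> \<alpha>''))
    = ps_cell P (id2 C g, \<alpha>) \<cdot>\<^bsub>C\<^esub> (ps_cell P (\<beta>, \<alpha>') \<cdot>\<^bsub>C\<^esub> ps_cell P (id2 C g', \<alpha>''))"
  using P_right_vcomp[of \<alpha> "\<alpha>' \<cdot>\<^bsub>C\<^esub> \<alpha>''" \<beta>] P_vcomp[of \<beta> "id2 C g'" \<alpha>' \<alpha>''] assms by auto

lemma P_inv:
  assumes "invertible2 C \<alpha>" "invertible2 C \<beta>"
  shows "ps_cell P (inv2 C \<alpha>, inv2 C \<beta>) = inv2 C (ps_cell P (\<alpha>, \<beta>))"
  using P.P.cell_inv2[of "(\<alpha>, \<beta>)"] assms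
  by (simp add: inv2_prod[OF C.bicategory_axioms C.bicategory_axioms])

lemma P_invertible [simp]:
  "invertible2 C \<alpha> \<Longrightarrow> invertible2 C \<beta> \<Longrightarrow> invertible2 C (ps_cell P (\<alpha>, \<beta>))"
  using P.P.cell_invertible[of "(\<alpha>, \<beta>)"] by simp

end

section \<open>The pointwise product is again strict\<close>

locale strict_pointwise_tensor = B: bicategory B + C: strict_tensor C P I
  for B :: "('o, 'a, 'c) bicat" and C :: "('p, 'b, 'd) bicat" and P I
begin

sublocale pointwise_tensor B C P ..

abbreviation "J \<equiv> ps_const B C I"

lemma pseudofunctor_J [simp]: "pseudofunctor B C J"
  by (rule BC.pseudofunctor_ps_const) simp

lemma strictly_unitary_J [simp]: "strictly_unitary B C J"
  by (rule strictly_unitary_ps_const) (rule B.bicategory_axioms)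

text \<open>For the compositors, the inner one is pulled out of \<open>ps_cell P\<close> by
  functoriality, exchanged by \<open>assoc_comp\<close>, and the cells that remain are rebracketed
  by \<open>assoc2\<close>. Extensionality makes this an equality of whole records.\<close>

lemma T0_assoc:
  assumes "pseudofunctor B C R" "pseudofunctor B C S" "pseudofunctor B C Q"
  shows "ps_then B C (ps_pair B (ps_then B C (ps_pair B R S) P) Q) P
    = ps_then B C (ps_pair B R (ps_then B C (ps_pair B S Q) P)) P" (is "?L = ?R")
proof -
  interpret R: pseudofunctor B C R by fact
  interpret S: pseudofunctor B C S by fact
  interpret Q: pseudofunctor B C Q by fact
  show ?thesis
  proof (rule pseudofun_eqI)
    show "ps_obj ?L = ps_obj ?R"
      by (rule extensionalityI[where A = "Obj B"]) (simp_all add: C.assoc0)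
    show "ps_arr ?L = ps_arr ?R"
      by (rule extensionalityI[where A = "Arr B"]) (simp_all add: C.assoc1)
    show "ps_cell ?L = ps_cell ?R"
      by (rule extensionalityI[where A = "Cell B"]) (simp_all add: C.assoc2)
    show "ps_comp ?L = ps_comp ?R"
    proof (rule extensionalityI[where A = "composable B"])
      fix fg assume "fg \<in> composable B"
      then obtain f g where [simp]: "fg = (f, g)" "f \<in> Arr B" "g \<in> Arr B" "tgt B f = src B g"
        by (auto simp: composable_def)
      show "ps_comp ?L fg = ps_comp ?R fg"
        by (simp add: C.P_left_vcomp C.P_right_vcomp C.assoc_comp[THEN C.C.vcomp_extend] C.assoc2 C.assoc1
            C.C.vassoc)
    qed simp_all
    show "ps_unit ?L = ps_unit ?R"
      by (rule extensionalityI[where A = "Obj B"]) (simp_all add: C.assoc2 C.assoc0 C.P_id1)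
  qed
qed

lemma T0_unit:
  assumes "pseudofunctor B C R"
  shows "ps_then B C (ps_pair B J R) P = R" "ps_then B C (ps_pair B R J) P = R"
proof -
  interpret R: pseudofunctor B C R by fact
  note * = R.ps_ext[THEN extensionalityI[rotated]]
  show "ps_then B C (ps_pair B J R) P = R"
    by (rule pseudofun_eqI; rule *) (auto simp: C.P_id1 elim!: composableE)
  show "ps_then B C (ps_pair B R J) P = R"
    by (rule pseudofun_eqI; rule *) (auto simp: C.P_id1 elim!: composableE)
qed

text \<open>The naturality cell of a product is conjugated by compositors. \<open>assoc_comp\<close>
  exchanges those at the source, its inverse those at the target, and \<open>assoc2\<close>
  rebrackets the cell between them.\<close>

lemma T1_assoc:
  assumes "su_pseudonatural B C h" "su_pseudonatural B C k" "su_pseudonatural B C l"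
  shows "pt_post B C (pt_pair B (pt_post B C (pt_pair B h k) P) l) P
    = pt_post B C (pt_pair B h (pt_post B C (pt_pair B k l) P)) P" (is "?L = ?R")
proof -
  interpret h: su_pseudonatural B C h by fact
  interpret k: su_pseudonatural B C k by fact
  interpret l: su_pseudonatural B C l by fact
  show ?thesis
  proof (rule pseudonat_eqI)
    show "pt_map ?L = pt_map ?R"
      by (rule extensionalityI[where A = "Obj B"]) (simp_all add: C.assoc1)
    show "pt_nat ?L = pt_nat ?R"
    proof (rule extensionalityI[where A = "Arr B"])
      fix f assume [simp]: "f \<in> Arr B"
      define X Y where "X = src B f" and "Y = tgt B f"
      have [simp]: "src B f = X" "tgt B f = Y" "X \<in> Obj B" "Y \<in> Obj B" by (auto simp: X_def Y_def)
      let ?p = "ps_cell P" and ?c = "ps_comp P"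
      let ?h = "\<lambda>X. pt_map h X" and ?k = "\<lambda>X. pt_map k X" and ?l = "\<lambda>X. pt_map l X"
      let ?s = "\<lambda>h. ps_arr (pt_src h) f" and ?t = "\<lambda>h. ps_arr (pt_tgt h) f"
      let ?n = "\<lambda>h. pt_nat h f"
      note i = C.C.inv2_vcomp[symmetric]
      \<comment> \<open>The inverse of \<open>assoc_comp\<close>, for the compositors at the target
        end.\<close>
      have 1: "inv2 C (?p (?c ((?h X, ?k X), (?t h, ?t k)), id2 C (?l X \<star>\<^bsub>C\<^esub> ?t l)))
            \<cdot>\<^bsub>C\<^esub> inv2 C (?c ((ps_arr P (?h X, ?k X), ?l X), (ps_arr P (?t h, ?t k), ?t l)))
        = inv2 C (?p (id2 C (?h X \<star>\<^bsub>C\<^esub> ?t h), ?c ((?k X, ?l X), (?t k, ?t l))))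
            \<cdot>\<^bsub>C\<^esub> inv2 C (?c ((?h X, ps_arr P (?k X, ?l X)), (?t h, ps_arr P (?t k, ?t l))))"
        by (simp add: i C.assoc_comp C.assoc1)
      have 2: "?p (inv2 C a, id2 C g) = inv2 C (?p (a, id2 C g))"
        "?p (id2 C g, inv2 C a) = inv2 C (?p (id2 C g, a))" if "invertible2 C a" "g \<in> Arr C" for a g
        using C.P_inv[of a "id2 C g"] C.P_inv[of "id2 C g" a] that by simp_all
      have L: "pt_nat ?L f = ?c ((ps_arr P (?s h, ?s k), ?s l), (ps_arr P (?h Y, ?k Y), ?l Y))
          \<cdot>\<^bsub>C\<^esub> (?p (?c ((?s h, ?s k), (?h Y, ?k Y)), id2 C (?s l \<star>\<^bsub>C\<^esub> ?l Y))
          \<cdot>\<^bsub>C\<^esub> (?p (?p (?n h, ?n k), ?n l)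
          \<cdot>\<^bsub>C\<^esub> (inv2 C (?p (?c ((?h X, ?k X), (?t h, ?t k)), id2 C (?l X \<star>\<^bsub>C\<^esub> ?t l)))
          \<cdot>\<^bsub>C\<^esub> inv2 C (?c ((ps_arr P (?h X, ?k X), ?l X), (ps_arr P (?t h, ?t k), ?t l))))))"
        by (simp add: pt_post_def C.C.vassoc C.P_left_vcomp3 2)
      have R: "pt_nat ?R f = ?c ((?s h, ps_arr P (?s k, ?s l)), (?h Y, ps_arr P (?k Y, ?l Y)))
          \<cdot>\<^bsub>C\<^esub> (?p (id2 C (?s h \<star>\<^bsub>C\<^esub> ?h Y), ?c ((?s k, ?s l), (?k Y, ?l Y)))
          \<cdot>\<^bsub>C\<^esub> (?p (?n h, ?p (?n k, ?n l))
          \<cdot>\<^bsub>C\<^esub> (inv2 C (?p (id2 C (?h X \<star>\<^bsub>C\<^esub> ?t h), ?c ((?k X, ?l X), (?t k, ?t l))))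
          \<cdot>\<^bsub>C\<^esub> inv2 C (?c ((?h X, ps_arr P (?k X, ?l X)), (?t h, ps_arr P (?t k, ?t l)))))))"
        by (simp add: pt_post_def C.C.vassoc C.P_right_vcomp3 2)
      show "pt_nat ?L f = pt_nat ?R f"
        unfolding L R 1 by (simp add: C.assoc_comp[THEN C.C.vcomp_extend] C.assoc1 C.assoc2 C.C.vassoc)
    qed simp_all
  qed (simp_all add: T0_assoc h.F.pseudofunctor_axioms h.G.pseudofunctor_axioms k.F.pseudofunctor_axioms
      k.G.pseudofunctor_axioms l.F.pseudofunctor_axioms l.G.pseudofunctor_axioms)
qed

lemma T1_unit:
  assumes "su_pseudonatural B C h"
  shows "pt_post B C (pt_pair B (pt_id B C J) h) P = h" "pt_post B C (pt_pair B h (pt_id B C J)) P = h"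
proof -
  interpret h: su_pseudonatural B C h by fact
  note [simp] = h.F.pseudofunctor_axioms h.G.pseudofunctor_axioms
  show "pt_post B C (pt_pair B (pt_id B C J) h) P = h"
    by (rule pseudonat_eqI; (rule h.pt_ext[THEN extensionalityI[rotated]])?)
      (auto simp: T0_unit pt_post_def)
  show "pt_post B C (pt_pair B h (pt_id B C J)) P = h"
    by (rule pseudonat_eqI; (rule h.pt_ext[THEN extensionalityI[rotated]])?)
      (auto simp: T0_unit pt_post_def)
qed

lemma T2_assoc:
  assumes "su_modification B C m" "su_modification B C n" "su_modification B C p"
  shows "md_post B C (md_pair B (md_post B C (md_pair B m n) P) p) P
    = md_post B C (md_pair B m (md_post B C (md_pair B n p) P)) P"
  using assms by (intro modif_eqI) (auto simp: T1_assoc C.assoc2 intro!: restrict_ext)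

lemma T2_unit:
  assumes "su_modification B C m"
  shows "md_post B C (md_pair B (id2 (ps_bicat B C) (pt_id B C J)) m) P = m"
    "md_post B C (md_pair B m (id2 (ps_bicat B C) (pt_id B C J))) P = m"
  using assms by (auto intro!: modif_eqI extensionalityI[where A = "Obj B"] simp: T1_unit)

text \<open>On components this is \<open>assoc_comp\<close> of \<open>P\<close>; the boundary
  records on the two sides agree by \<open>T1_assoc\<close>.\<close>

lemma T_assoc_comp:
  assumes "f \<in> Arr A" "g \<in> Arr A" "h \<in> Arr A" "f' \<in> Arr A" "g' \<in> Arr A" "h' \<in> Arr A"
    "pt_tgt f = pt_src f'" "pt_tgt g = pt_src g'" "pt_tgt h = pt_src h'"
  shows "ps_comp T ((ps_arr T (f, g), h), (ps_arr T (f', g'), h'))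
        \<cdot>\<^bsub>A\<^esub> ps_cell T (ps_comp T ((f, g), (f', g')), id2 A (h \<star>\<^bsub>A\<^esub> h'))
      = ps_comp T ((f, ps_arr T (g, h)), (f', ps_arr T (g', h')))
        \<cdot>\<^bsub>A\<^esub> ps_cell T (id2 A (f \<star>\<^bsub>A\<^esub> f'), ps_comp T ((g, h), (g', h')))"
proof -
  have [simp]: "su_pseudonatural B C f" "su_pseudonatural B C g" "su_pseudonatural B C h"
    "su_pseudonatural B C f'" "su_pseudonatural B C g'" "su_pseudonatural B C h'"
    "strictly_unitary B C (pt_src f)" "strictly_unitary B C (pt_src g)" "strictly_unitary B C (pt_src h)"
    "strictly_unitary B C (pt_src f')" "strictly_unitary B C (pt_src g')" "strictly_unitary B C (pt_src h')"
    "strictly_unitary B C (pt_tgt f')" "strictly_unitary B C (pt_tgt g')" "strictly_unitary B C (pt_tgt h')"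
    "pt_tgt f = pt_src f'" "pt_tgt g = pt_src g'" "pt_tgt h = pt_src h'"
    using assms by (simp_all add: Arr_A del: full_sub_simps)
  note [simp del] = full_sub_simps(1-3)
  note [simp] = Obj_A Arr_A Cell_A su_modification_T_comp BC.su_modification_id2
  have *: "ps_comp P ((ps_arr P (a, b), c), (ps_arr P (a', b'), c'))
        \<cdot>\<^bsub>C\<^esub> ps_cell P (ps_comp P ((a, b), (a', b')), id2 C (c \<star>\<^bsub>C\<^esub> c'))
      = ps_comp P ((a, ps_arr P (b, c)), (a', ps_arr P (b', c')))
        \<cdot>\<^bsub>C\<^esub> ps_cell P (id2 C (a \<star>\<^bsub>C\<^esub> a'), ps_comp P ((b, c), (b', c')))"
    if "a = pt_map f x" "b = pt_map g x" "c = pt_map h x" "a' = pt_map f' x" "b' = pt_map g' x"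
      "c' = pt_map h' x" "x \<in> Obj B" for x a b c a' b' c'
    using that by (intro C.assoc_comp) simp_all
  show ?thesis
    by (auto intro!: modif_eqI restrict_ext simp: T_comp T1_assoc *)
qed

lemma T_unit_comp:
  assumes "f \<in> Arr A" "f' \<in> Arr A" "pt_tgt f = pt_src f'"
  shows "ps_comp T ((pt_id B C J, f), (pt_id B C J, f')) = id2 (ps_bicat B C) (pt_then B C f f')"
    "ps_comp T ((f, pt_id B C J), (f', pt_id B C J)) = id2 (ps_bicat B C) (pt_then B C f f')"
proof -
  have [simp]: "su_pseudonatural B C f" "su_pseudonatural B C f'" "strictly_unitary B C (pt_src f)"
    "strictly_unitary B C (pt_src f')" "strictly_unitary B C (pt_tgt f')" "pt_tgt f = pt_src f'"
    using assms by (simp_all add: Arr_A del: full_sub_simps)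
  note [simp del] = full_sub_simps(1-3)
  note [simp] = Arr_A BC.pseudonatural_pt_id T1_unit BC.pt_then_id_left
  show "ps_comp T ((pt_id B C J, f), (pt_id B C J, f')) = id2 (ps_bicat B C) (pt_then B C f f')"
    by (auto intro!: modif_eqI restrict_ext simp: T_comp)
  show "ps_comp T ((f, pt_id B C J), (f', pt_id B C J)) = id2 (ps_bicat B C) (pt_then B C f f')"
    by (auto intro!: modif_eqI restrict_ext simp: T_comp)
qed

text \<open>Each condition holds on components because it holds for \<open>P\<close>, and on
  boundaries by the preceding equalities of records. Results on strict tensors thus pass from the
  target to the bicategory of strictly unitary pseudofunctors.\<close>

lemma strict_tensor_T: "strict_tensor A T J"
proof (intro strict_tensor.intro strict_tensor_axioms.intro T.su_functor_axioms A.su_bicat_axioms,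
    goal_cases)
  case 1 show ?case by simp
next
  case (2 x y z) then show ?case by (simp add: T0_assoc)
next
  case (3 f g h)
  then have "f \<in> Arr A" "g \<in> Arr A" "h \<in> Arr A" "pt_post B C (pt_pair B f g) P \<in> Arr A"
    "pt_post B C (pt_pair B g h) P \<in> Arr A"
    by (auto simp flip: BC.su_pseudonatural_iff)
  then show ?case
    using T1_assoc[of f g h] by (simp del: full_sub_simps add: Arr_A)
next
  case (4 \<alpha> \<beta> \<gamma>) then show ?case by (simp add: T2_assoc)
next
  case (5 f g h f' g' h')
  then show ?case by (intro T_assoc_comp) simp_all
next
  case (6 x) then show ?case by (simp add: T0_unit)
next
  case (7 x) then show ?case by (simp add: T0_unit)
next
  case (8 f) then show ?case
    by (simp add: T1_unit BC.pseudonatural_pt_id flip: BC.su_pseudonatural_iff)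
next
  case (9 f) then show ?case
    by (simp add: T1_unit BC.pseudonatural_pt_id flip: BC.su_pseudonatural_iff)
next
  case (10 \<alpha>) then show ?case
    by (simp add: T2_unit BC.su_modification_id2 BC.pseudonatural_pt_id)
next
  case (11 \<alpha>) then show ?case
    by (simp add: T2_unit BC.su_modification_id2 BC.pseudonatural_pt_id)
next
  case (12 f f')
  then show ?case using T_unit_comp(1)[of f f'] by simp
next
  case (13 f f')
  then show ?case using T_unit_comp(2)[of f f'] by simp
qed

end

section \<open>The monoidal bicategory of a strict tensor product\<close>

context su_bicat
begin

lemma adjoint_equivalence_id1:
  "X \<in> Obj B \<Longrightarrow> adjoint_equivalence B (id1 B X) (id1 B X) (id2 B (id1 B X)) (id2 B (id1 B X))"
  by (simp add: adjoint_equivalence_def hom1_def hom2_def)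

context
  fixes X
  assumes X [simp]: "X \<in> Obj B"
begin

lemma path_id1 [simp]: "us \<noteq> [] \<Longrightarrow> set us \<subseteq> {id1 B X} \<Longrightarrow> path B us = id1 B X"
proof (induct us)
  case (Cons u us)
  then show ?case by (cases "us = []") (simp_all add: path_Cons)
qed simp

lemma path_split_id1 [simp]:
  "us \<noteq> [] \<Longrightarrow> ys \<noteq> [] \<Longrightarrow> set us \<subseteq> {id1 B X} \<Longrightarrow> set ys \<subseteq> {id1 B X} \<Longrightarrow>
    path_split B us ys = id2 B (id1 B X)"
proof (induct us)
  case (Cons u us)
  then show ?case by (cases "us = []") (simp_all add: path_split_Cons)
qed simp

lemma foldr_id1: "set xs \<subseteq> {id1 B X} \<Longrightarrow> foldr (\<lambda>f \<gamma>. id2 B f \<ast> \<gamma>) xs (id2 B (id1 B X)) = id2 B (id1 B X)"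
  by (induct xs) auto

text \<open>A word in copies of one identity composes to that identity, and its splittings are
  trivial. Once all structure cells are identities, every pasting in the axioms of a monoidal
  bicategory is of this kind.\<close>

lemma paste_id1 [simp]:
  assumes "us \<noteq> []" "vs \<noteq> []" "set xs \<subseteq> {id1 B X}" "set us \<subseteq> {id1 B X}" "set vs \<subseteq> {id1 B X}"
    "set ys \<subseteq> {id1 B X}"
  shows "paste B xs us vs ys (id2 B (id1 B X)) = id2 B (id1 B X)"
  using assms by (auto simp: paste_def foldr_id1)

end

end

lemma (in su_functor) ps_path_id1 [simp]:
  "X \<in> Obj D \<Longrightarrow> us \<noteq> [] \<Longrightarrow> set us \<subseteq> {id1 D X} \<Longrightarrow> ps_path D C P us = id2 C (id1 C (ps_obj P X))"
proof (induct us)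
  case (Cons u us)
  then show ?case by (cases "us = []") (simp_all add: P.ps_path_Cons)
qed simp

lemma (in su_functor) ps_on_paths_id1 [simp]:
  "X \<in> Obj D \<Longrightarrow> us \<noteq> [] \<Longrightarrow> set us \<subseteq> {id1 D X} \<Longrightarrow> vs \<noteq> [] \<Longrightarrow> set vs \<subseteq> {id1 D X} \<Longrightarrow>
    ps_on_paths D C P us vs (id2 D (id1 D X)) = id2 C (id1 C (ps_obj P X))"
  by (simp add: ps_on_paths_def)

text \<open>An identity is its own adjoint inverse, with identity unit and counit, because
  \<open>ps_bicat\<close> has strict units.\<close>

lemma (in su_bicats) pseudonatural_equivalence_pt_id:
  assumes "pseudofunctor B C F"
  shows "pseudonatural_equivalence B C F F (pt_id B C F)"
proof -
  interpret A: su_bicat "ps_bicat B C" by (rule su_bicat_ps_bicat)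
  have F: "F \<in> Obj (ps_bicat B C)" using assms by simp
  then show ?thesis
    using A.id1_hom[OF F] A.adjoint_equivalence_id1[OF F]
    unfolding pseudonatural_equivalence_def by auto
qed

lemma ps_prod_simps [simp]:
  "X \<in> Obj B \<Longrightarrow> Y \<in> Obj B' \<Longrightarrow> ps_obj (ps_prod B B' F G) (X, Y) = (ps_obj F X, ps_obj G Y)"
  "f \<in> Arr B \<Longrightarrow> g \<in> Arr B' \<Longrightarrow> ps_arr (ps_prod B B' F G) (f, g) = (ps_arr F f, ps_arr G g)"
  "\<alpha> \<in> Cell B \<Longrightarrow> \<beta> \<in> Cell B' \<Longrightarrow> ps_cell (ps_prod B B' F G) (\<alpha>, \<beta>) = (ps_cell F \<alpha>, ps_cell G \<beta>)"
  "f \<in> Arr B \<Longrightarrow> g \<in> Arr B' \<Longrightarrow> f' \<in> Arr B \<Longrightarrow> g' \<in> Arr B' \<Longrightarrow> tgt B f = src B f' \<Longrightarrow> tgt B' g = src B' g' \<Longrightarrow>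
    ps_comp (ps_prod B B' F G) ((f, g), (f', g')) = (ps_comp F (f, f'), ps_comp G (g, g'))"
  "X \<in> Obj B \<Longrightarrow> Y \<in> Obj B' \<Longrightarrow> ps_unit (ps_prod B B' F G) (X, Y) = (ps_unit F X, ps_unit G Y)"
  by (simp_all add: ps_prod_def composable_def)

lemma pseudofunctor_ps_prod:
  assumes "pseudofunctor B C F" "pseudofunctor B' C' G"
  shows "pseudofunctor (prod_bicat B B') (prod_bicat C C') (ps_prod B B' F G)"
proof -
  interpret F: pseudofunctor B C F by fact
  interpret G: pseudofunctor B' C' G by fact
  note [simp] = hom1_def hom2_def
  show ?thesis
  proof (intro pseudofunctor.intro pseudofunctor_axioms.intro, goal_cases)
    case 11 then show ?case by (auto simp: F.cell_vcomp G.cell_vcomp)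
  next
    case 13 then show ?case by (auto simp: composable_def)
  next
    case 14 then show ?case by (auto simp: composable_def)
  next
    case (15 \<alpha> f f' \<beta> g g') then show ?case
      using F.comp_nat[of "fst \<alpha>" "fst \<beta>"] G.comp_nat[of "snd \<alpha>" "snd \<beta>"] by auto
  next
    case (17 X) then show ?case by (auto simp: F.ps_unit_inv G.ps_unit_inv)
  next
    case (18 f g h) then show ?case
      using F.ps_coh_assoc[of "fst f" "fst g" "fst h"] G.ps_coh_assoc[of "snd f" "snd g" "snd h"]
      by (auto simp: composable_def)
  next
    case (19 f X Y)
    then have "lunitor B (fst f) \<in> Cell B" "lunitor B' (snd f) \<in> Cell B'"
      using F.S.lunitor_hom[of "fst f" "fst X" "fst Y"] G.S.lunitor_hom[of "snd f" "snd X" "snd Y"] by auto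
    then show ?case using 19 F.ps_coh_left[of "fst f" "fst X" "fst Y"] G.ps_coh_left[of "snd f" "snd X" "snd Y"]
      by auto
  next
    case (20 f X Y)
    then have "runitor B (fst f) \<in> Cell B" "runitor B' (snd f) \<in> Cell B'"
      using F.S.runitor_hom[of "fst f" "fst X" "fst Y"] G.S.runitor_hom[of "snd f" "snd X" "snd Y"] by auto
    then show ?case using 20 F.ps_coh_right[of "fst f" "fst X" "fst Y"] G.ps_coh_right[of "snd f" "snd X" "snd Y"]
      by auto
  qed (auto simp: bicategory_prod F.S.bicategory_axioms F.T.bicategory_axioms G.S.bicategory_axioms
      G.T.bicategory_axioms, auto simp: ps_prod_def)
qed

lemma ps_strict_simps [simp]:
  "X \<in> Obj B \<Longrightarrow> ps_obj (ps_strict B C u v w) X = u X" "f \<in> Arr B \<Longrightarrow> ps_arr (ps_strict B C u v w) f = v f"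
  "\<alpha> \<in> Cell B \<Longrightarrow> ps_cell (ps_strict B C u v w) \<alpha> = w \<alpha>"
  "f \<in> Arr B \<Longrightarrow> g \<in> Arr B \<Longrightarrow> tgt B f = src B g \<Longrightarrow>
    ps_comp (ps_strict B C u v w) (f, g) = id2 C (v f \<star>\<^bsub>C\<^esub> v g)"
  "X \<in> Obj B \<Longrightarrow> ps_unit (ps_strict B C u v w) X = id2 C (id1 C (u X))"
  by (simp_all add: ps_strict_def composable_def)

lemma (in su_bicat) pseudofunctor_ps_id: "pseudofunctor B B (ps_id B)"
proof (intro pseudofunctor.intro pseudofunctor_axioms.intro bicategory_axioms, goal_cases)
  case (11 f g) then show ?case by (auto simp: ps_id_def composable_def hom2_def)
next
  case (12 f g) then show ?case by (auto simp: ps_id_def composable_def)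
next
  case (13 \<alpha> f f' \<beta> g g')
  then have "f = dom2 B \<alpha>" "f' = cod2 B \<alpha>" "g = dom2 B \<beta>" "g' = cod2 B \<beta>" by (auto simp: hom2_def)
  with 13 show ?case by (auto simp: ps_id_def hom2_def)
next
  case (16 f g h) then show ?case by (auto simp: ps_id_def composable_def)
qed (auto simp: ps_id_def hom1_def hom2_def, auto simp: ps_strict_def)

lemma strictly_unitary_ps_id: "bicategory B \<Longrightarrow> strictly_unitary B B (ps_id B)"
proof -
  assume "bicategory B"
  then interpret bicategory B .
  show ?thesis by (auto simp: strictly_unitary_def ps_id_def)
qed

lemma ps_id_simps [simp]:
  "X \<in> Obj B \<Longrightarrow> ps_obj (ps_id B) X = X" "f \<in> Arr B \<Longrightarrow> ps_arr (ps_id B) f = f"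
  "\<alpha> \<in> Cell B \<Longrightarrow> ps_cell (ps_id B) \<alpha> = \<alpha>"
  "f \<in> Arr B \<Longrightarrow> g \<in> Arr B \<Longrightarrow> tgt B f = src B g \<Longrightarrow> ps_comp (ps_id B) (f, g) = id2 B (f \<star>\<^bsub>B\<^esub> g)"
  "X \<in> Obj B \<Longrightarrow> ps_unit (ps_id B) X = id2 B (id1 B X)"
  by (simp_all add: ps_id_def)

lemma bicategory_unit_bicat: "bicategory unit_bicat"
  by unfold_locales (auto simp: unit_bicat_def hom1_def hom2_def invertible2_def inverse_cells_def)

lemma unit_bicat_simps [simp]: "Obj unit_bicat = UNIV" "Arr unit_bicat = UNIV" "Cell unit_bicat = UNIV"
  by (simp_all add: unit_bicat_def)

section \<open>Structure cells and axioms of the monoidal bicategory\<close>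

context strict_tensor
begin

abbreviation "C2 \<equiv> prod_bicat C C"
abbreviation "C3 \<equiv> prod_bicat C2 C"
abbreviation "C4 \<equiv> prod_bicat C3 C"

abbreviation "left_tensor \<equiv> ps_then C3 C (ps_prod C2 C P (ps_id C)) P"

lemma su_bicat_C2: "su_bicat C2" and su_bicat_C3: "su_bicat C3" and su_bicat_C4: "su_bicat C4"
  by (intro su_bicat_prod C.su_bicat_axioms)+

lemma pseudofunctor_left_tensor: "pseudofunctor C3 C left_tensor"
proof -
  interpret F: pseudofunctor C3 C2 "ps_prod C2 C P (ps_id C)"
    by (intro pseudofunctor_ps_prod P.P.pseudofunctor_axioms C.pseudofunctor_ps_id)
  interpret su_functor_post C3 C2 C P "ps_prod C2 C P (ps_id C)" ..
  show ?thesis by (rule pseudofunctor_ps_then)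
qed

text \<open>All transformations are identities and all modifications have identity components. The
  right-nested product in the first family is one representative of the bracketings, which are equal
  by \<open>assoc0\<close>.\<close>

sublocale M: monoidal_bicategory_data C P "ps_const unit_bicat C I" "pt_id C3 C left_tensor"
  "pt_id C C (ps_id C)" "pt_id C C (ps_id C)"
  "\<lambda>(((W, X), Y), Z). id2 C (id1 C (ps_obj P (W, ps_obj P (X, ps_obj P (Y, Z)))))"
  "\<lambda>(X, Y). id2 C (id1 C (ps_obj P (X, Y)))" "\<lambda>(X, Y). id2 C (id1 C (ps_obj P (X, Y)))"
  "\<lambda>(X, Y). id2 C (id1 C (ps_obj P (X, Y)))" .

lemma ps_reassoc_simps [simp]:
  "X \<in> Obj A \<Longrightarrow> Y \<in> Obj B \<Longrightarrow> Z \<in> Obj D \<Longrightarrow> ps_obj (ps_reassoc A B D) ((X, Y), Z) = (X, (Y, Z))"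
  "f \<in> Arr A \<Longrightarrow> g \<in> Arr B \<Longrightarrow> h \<in> Arr D \<Longrightarrow> ps_arr (ps_reassoc A B D) ((f, g), h) = (f, (g, h))"
  "\<alpha> \<in> Cell A \<Longrightarrow> \<beta> \<in> Cell B \<Longrightarrow> \<gamma> \<in> Cell D \<Longrightarrow> ps_cell (ps_reassoc A B D) ((\<alpha>, \<beta>), \<gamma>) = (\<alpha>, (\<beta>, \<gamma>))"
  "f \<in> Arr A \<Longrightarrow> g \<in> Arr B \<Longrightarrow> h \<in> Arr D \<Longrightarrow> f' \<in> Arr A \<Longrightarrow> g' \<in> Arr B \<Longrightarrow> h' \<in> Arr D \<Longrightarrow>
    tgt A f = src A f' \<Longrightarrow> tgt B g = src B g' \<Longrightarrow> tgt D h = src D h' \<Longrightarrow>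
    ps_comp (ps_reassoc A B D) (((f, g), h), ((f', g'), h'))
      = (id2 A (f \<star>\<^bsub>A\<^esub> f'), (id2 B (g \<star>\<^bsub>B\<^esub> g'), id2 D (h \<star>\<^bsub>D\<^esub> h')))"
  "X \<in> Obj A \<Longrightarrow> Y \<in> Obj B \<Longrightarrow> Z \<in> Obj D \<Longrightarrow> ps_unit (ps_reassoc A B D) ((X, Y), Z)
    = (id2 A (id1 A X), (id2 B (id1 B Y), id2 D (id1 D Z)))"
  by (simp_all add: ps_reassoc_def)

lemma ps_bang_simps [simp]:
  "X \<in> Obj B \<Longrightarrow> ps_obj (ps_bang B) X = ()" "f \<in> Arr B \<Longrightarrow> ps_arr (ps_bang B) f = ()"
  "\<alpha> \<in> Cell B \<Longrightarrow> ps_cell (ps_bang B) \<alpha> = ()"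
  by (simp_all add: ps_bang_def)

lemma unit_on_simps [simp]:
  "X \<in> Obj B \<Longrightarrow> ps_obj (M.unit_on B) X = I" "f \<in> Arr B \<Longrightarrow> ps_arr (M.unit_on B) f = id1 C I"
  "\<alpha> \<in> Cell B \<Longrightarrow> ps_cell (M.unit_on B) \<alpha> = id2 C (id1 C I)"
  "f \<in> Arr B \<Longrightarrow> g \<in> Arr B \<Longrightarrow> tgt B f = src B g \<Longrightarrow> ps_comp (M.unit_on B) (f, g) = id2 C (id1 C I)"
  "X \<in> Obj B \<Longrightarrow> ps_unit (M.unit_on B) X = id2 C (id1 C I)"
  by (simp_all add: unit_bicat_def)

lemma tens_left: "M.tens_left = left_tensor"
  by (simp add: M.tens_left_def)

text \<open>Here \<open>assoc_comp\<close> is decisive: it equates the compositors, so the two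
  triple products are one pseudofunctor and an identity transformation can be the associativity
  equivalence.\<close>

lemma tens_right: "M.tens_right = left_tensor"
  unfolding M.tens_right_def
  by (rule pseudofun_eqI; (rule extensionalityI[where A = "Obj C3"] extensionalityI[where A = "Arr C3"]
      extensionalityI[where A = "Cell C3"] extensionalityI[where A = "composable C3"]);
      (rule ps_then_simps(6-10))?; (auto simp: assoc0 assoc1 assoc2 P_id1 P_id2 assoc_comp elim!: composableE)?)

lemma unit_tens: "M.unit_tens = ps_id C"
  unfolding M.unit_tens_def
  by (rule pseudofun_eqI; (rule extensionalityI[where A = "Obj C"] extensionalityI[where A = "Arr C"]
      extensionalityI[where A = "Cell C"] extensionalityI[where A = "composable C"]);
      (auto simp: P_id1 P_id2 elim!: composableE)?) (simp_all add: ps_id_def ps_strict_def)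

lemma tens_unit: "M.tens_unit = ps_id C"
  unfolding M.tens_unit_def
  by (rule pseudofun_eqI; (rule extensionalityI[where A = "Obj C"] extensionalityI[where A = "Arr C"]
      extensionalityI[where A = "Cell C"] extensionalityI[where A = "composable C"]);
      (auto simp: P_id1 P_id2 elim!: composableE)?) (simp_all add: ps_id_def ps_strict_def)

text \<open>Compares a transformation with an identity in exactly the data that
  \<open>modification\<close> inspects. This gives a uniform treatment of structure transformations
  whose sources and targets are composed in different ways.\<close>

definition trivial_transformation where
  "trivial_transformation B u v \<sigma> \<longleftrightarrow>
     (\<forall>X\<in>Obj B. pt_map \<sigma> X = id1 C (u X)) \<and>
     (\<forall>f\<in>Arr B. pt_nat \<sigma> f = id2 C (v f) \<and> ps_arr (pt_src \<sigma>) f = v f \<and> ps_arr (pt_tgt \<sigma>) f = v f)"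

definition compatible where
  "compatible B u v \<longleftrightarrow> bicategory B \<and> (\<forall>X\<in>Obj B. u X \<in> Obj C) \<and>
     (\<forall>f\<in>Arr B. v f \<in> Arr C \<and> src C (v f) = u (src B f) \<and> tgt C (v f) = u (tgt B f))"

text \<open>The associators that \<open>pt_then\<close> inserts have identity 1-cells among their
  arguments and are therefore identities.\<close>

lemma trivial_pt_then:
  assumes "compatible B u v" "trivial_transformation B u v \<sigma>" "trivial_transformation B u v \<tau>"
  shows "trivial_transformation B u v (pt_then B C \<sigma> \<tau>)"
proof -
  interpret B: bicategory B using assms(1) by (simp add: compatible_def)
  show ?thesis using assms by (auto simp: trivial_transformation_def compatible_def pt_then_def)
qed

text \<open>Both sides of the modification equation reduce to the identity cell of
  \<open>v f\<close>.\<close>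

lemma trivial_invertible_modification:
  assumes "compatible B u v" "trivial_transformation B u v \<sigma>" "trivial_transformation B u v \<tau>"
    "\<And>X. X \<in> Obj B \<Longrightarrow> m X = id2 C (id1 C (u X))"
  shows "invertible_modification B C \<sigma> \<tau> m"
proof -
  interpret B: bicategory B using assms(1) by (simp add: compatible_def)
  show ?thesis using assms
    by (auto simp: trivial_transformation_def compatible_def invertible_modification_def
        modification_def hom2_def)
qed

lemma trivial_pt_id:
  assumes "pseudofunctor B C F" "\<And>X. X \<in> Obj B \<Longrightarrow> ps_obj F X = u X" "\<And>f. f \<in> Arr B \<Longrightarrow> ps_arr F f = v f"
  shows "trivial_transformation B u v (pt_id B C F)"
proof -
  interpret F: pseudofunctor B C F by fact
  interpret su_bicats B C ..
  show ?thesis using assms by (auto simp: trivial_transformation_def)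
qed

text \<open>Right-nested normal forms, to which \<open>assoc0\<close> and \<open>assoc1\<close>
  rewrite every bracketing of four factors.\<close>

abbreviation "u4 \<equiv> \<lambda>(((W, X), Y), Z). ps_obj P (W, ps_obj P (X, ps_obj P (Y, Z)))"
abbreviation "v4 \<equiv> \<lambda>(((f, g), h), k). ps_arr P (f, ps_arr P (g, ps_arr P (h, k)))"

lemma compatible4: "compatible C4 u4 v4"
  using su_bicat_C4 by (auto simp: compatible_def su_bicat_def)

lemma compatible2: "compatible C2 (\<lambda>(X, Y). ps_obj P (X, Y)) (\<lambda>(f, g). ps_arr P (f, g))"
  using su_bicat_C2 by (auto simp: compatible_def su_bicat_def)

lemma pt_left_tensor:
  "X \<in> Obj C \<Longrightarrow> Y \<in> Obj C \<Longrightarrow> Z \<in> Obj C \<Longrightarrow>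
    pt_map (pt_id C3 C left_tensor) ((X, Y), Z) = id1 C (ps_obj P (X, ps_obj P (Y, Z)))"
  "f \<in> Arr C \<Longrightarrow> g \<in> Arr C \<Longrightarrow> h \<in> Arr C \<Longrightarrow>
    pt_nat (pt_id C3 C left_tensor) ((f, g), h) = id2 C (ps_arr P (f, ps_arr P (g, h)))"
  using pseudofunctor_left_tensor by (simp_all add: pt_id_def assoc0 assoc1)

lemma pt_ps_id:
  "X \<in> Obj C \<Longrightarrow> pt_map (pt_id C C (ps_id C)) X = id1 C X"
  "f \<in> Arr C \<Longrightarrow> pt_nat (pt_id C C (ps_id C)) f = id2 C f"
  by (simp_all add: pt_id_def)

lemma pt_prod_simps:
  "X \<in> Obj B \<Longrightarrow> Y \<in> Obj B' \<Longrightarrow> pt_map (pt_prod B B' \<sigma> \<tau>) (X, Y) = (pt_map \<sigma> X, pt_map \<tau> Y)"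
  "f \<in> Arr B \<Longrightarrow> g \<in> Arr B' \<Longrightarrow> pt_nat (pt_prod B B' \<sigma> \<tau>) (f, g) = (pt_nat \<sigma> f, pt_nat \<tau> g)"
  "pt_src (pt_prod B B' \<sigma> \<tau>) = ps_prod B B' (pt_src \<sigma>) (pt_src \<tau>)"
  "pt_tgt (pt_prod B B' \<sigma> \<tau>) = ps_prod B B' (pt_tgt \<sigma>) (pt_tgt \<tau>)"
  by (simp_all add: pt_prod_def)

lemma pt_pre_simps:
  "X \<in> Obj B \<Longrightarrow> pt_map (pt_pre B D H \<sigma>) X = pt_map \<sigma> (ps_obj H X)"
  "f \<in> Arr B \<Longrightarrow> pt_nat (pt_pre B D H \<sigma>) f = pt_nat \<sigma> (ps_arr H f)"
  "pt_src (pt_pre B D H \<sigma>) = ps_then B D H (pt_src \<sigma>)"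
  "pt_tgt (pt_pre B D H \<sigma>) = ps_then B D H (pt_tgt \<sigma>)"
  by (simp_all add: pt_pre_def)

lemma pt_post_nat_simp:
  "f \<in> Arr B \<Longrightarrow> pt_nat (pt_post B D \<sigma> H) f =
     ps_comp H (ps_arr (pt_src \<sigma>) f, pt_map \<sigma> (tgt B f)) \<cdot>\<^bsub>D\<^esub> ps_cell H (pt_nat \<sigma> f)
       \<cdot>\<^bsub>D\<^esub> inv2 D (ps_comp H (pt_map \<sigma> (src B f), ps_arr (pt_tgt \<sigma>) f))"
  by (simp add: pt_post_def)

lemma P_comp_id1:
  "f \<in> Arr C \<Longrightarrow> g \<in> Arr C \<Longrightarrow> tgt C f = X \<Longrightarrow> tgt C g = Y \<Longrightarrow>
    ps_comp P ((f, g), (id1 C X, id1 C Y)) = id2 C (ps_arr P (f, g))"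
  "f \<in> Arr C \<Longrightarrow> g \<in> Arr C \<Longrightarrow> src C f = X \<Longrightarrow> src C g = Y \<Longrightarrow>
    ps_comp P ((id1 C X, id1 C Y), (f, g)) = id2 C (ps_arr P (f, g))"
  using P.comp_unit_right[of "(f, g)" "(X, Y)"] P.comp_unit_left[of "(f, g)" "(X, Y)"] by simp_all

lemmas structure_simps = trivial_transformation_def pt_left_tensor pt_ps_id pt_prod_simps pt_pre_simps
  pt_post_nat_simp P_comp_id1 P_id1 P_id2 assoc0 assoc1

text \<open>Each factor of the two pastings is a product or a whiskering of identity
  transformations. Its compositors have identities on one side and are trivial because
  \<open>P\<close> is strictly unitary.\<close>

lemma pi_trivial: "trivial_transformation C4 u4 v4 M.pi_src" "trivial_transformation C4 u4 v4 M.pi_tgt"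
proof -
  show "trivial_transformation C4 u4 v4 M.pi_src"
    unfolding M.pi_src_def
    by (intro trivial_pt_then compatible4)
      (auto simp: structure_simps M.mid_tens_def M.split_fst_def)
  show "trivial_transformation C4 u4 v4 M.pi_tgt"
    unfolding M.pi_tgt_def
    by (intro trivial_pt_then compatible4)
      (auto simp: structure_simps M.fst_tens_def M.lst_tens_def)
qed

lemma mu_trivial:
  "trivial_transformation C2 (\<lambda>(X, Y). ps_obj P (X, Y)) (\<lambda>(f, g). ps_arr P (f, g)) M.mu_src"
  "trivial_transformation C2 (\<lambda>(X, Y). ps_obj P (X, Y)) (\<lambda>(f, g). ps_arr P (f, g)) M.mu_tgt"
proof -
  show "trivial_transformation C2 (\<lambda>(X, Y). ps_obj P (X, Y)) (\<lambda>(f, g). ps_arr P (f, g)) M.mu_src"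
    unfolding M.mu_src_def
    by (intro trivial_pt_then compatible2) (auto simp: structure_simps M.ins_mid_def)
  show "trivial_transformation C2 (\<lambda>(X, Y). ps_obj P (X, Y)) (\<lambda>(f, g). ps_arr P (f, g)) M.mu_tgt"
    unfolding M.mu_tgt_def by (rule trivial_pt_id) (auto intro: P.P.pseudofunctor_axioms)
qed

lemma lam_trivial:
  "trivial_transformation C2 (\<lambda>(X, Y). ps_obj P (X, Y)) (\<lambda>(f, g). ps_arr P (f, g)) M.lam_src"
  "trivial_transformation C2 (\<lambda>(X, Y). ps_obj P (X, Y)) (\<lambda>(f, g). ps_arr P (f, g)) M.lam_tgt"
proof -
  show "trivial_transformation C2 (\<lambda>(X, Y). ps_obj P (X, Y)) (\<lambda>(f, g). ps_arr P (f, g)) M.lam_src"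
    unfolding M.lam_src_def by (auto simp: structure_simps)
  show "trivial_transformation C2 (\<lambda>(X, Y). ps_obj P (X, Y)) (\<lambda>(f, g). ps_arr P (f, g)) M.lam_tgt"
    unfolding M.lam_tgt_def
    by (intro trivial_pt_then compatible2) (auto simp: structure_simps M.ins_fst_def)
qed

lemma rho_trivial:
  "trivial_transformation C2 (\<lambda>(X, Y). ps_obj P (X, Y)) (\<lambda>(f, g). ps_arr P (f, g)) M.rho_src"
  "trivial_transformation C2 (\<lambda>(X, Y). ps_obj P (X, Y)) (\<lambda>(f, g). ps_arr P (f, g)) M.rho_tgt"
proof -
  show "trivial_transformation C2 (\<lambda>(X, Y). ps_obj P (X, Y)) (\<lambda>(f, g). ps_arr P (f, g)) M.rho_src"
    unfolding M.rho_src_def by (auto simp: structure_simps)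
  show "trivial_transformation C2 (\<lambda>(X, Y). ps_obj P (X, Y)) (\<lambda>(f, g). ps_arr P (f, g)) M.rho_tgt"
    unfolding M.rho_tgt_def
    by (intro trivial_pt_then compatible2) (auto simp: structure_simps M.ins_lst_def)
qed

text \<open>Constant and identity pseudofunctors are strictly unitary, and postcomposition with
  \<open>P\<close> preserves this. Hence tensoring an identity structure cell with an object, as the
  axioms do, gives an identity again.\<close>

lemma su_functor_tens:
  assumes [simp]: "W \<in> Obj C"
  shows "su_functor C C (M.tens_l W)" "su_functor C C (M.tens_r W)"
proof -
  interpret CC: su_bicats C C ..
  note const = CC.pseudofunctor_ps_const[OF assms] strictly_unitary_ps_const[OF C.bicategory_axioms]
  note id = C.pseudofunctor_ps_id strictly_unitary_ps_id[OF C.bicategory_axioms]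
  have l: "pseudofunctor C C2 (ps_pair C (ps_const C C W) (ps_id C))"
    "strictly_unitary C C2 (ps_pair C (ps_const C C W) (ps_id C))"
    by (intro pseudofunctor_ps_pair strictly_unitary_ps_pair const id C.bicategory_axioms)+
  interpret L: pseudofunctor C C2 "ps_pair C (ps_const C C W) (ps_id C)" by (rule l)
  interpret Lp: su_functor_post C C2 C P "ps_pair C (ps_const C C W) (ps_id C)" ..
  show "su_functor C C (M.tens_l W)"
    unfolding M.tens_l_def
    by (intro su_functor.intro su_functor_axioms.intro C.su_bicat_axioms Lp.pseudofunctor_ps_then
        Lp.strictly_unitary_ps_then l)
  have r: "pseudofunctor C C2 (ps_pair C (ps_id C) (ps_const C C W))"
    "strictly_unitary C C2 (ps_pair C (ps_id C) (ps_const C C W))"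
    by (intro pseudofunctor_ps_pair strictly_unitary_ps_pair const id C.bicategory_axioms)+
  interpret R: pseudofunctor C C2 "ps_pair C (ps_id C) (ps_const C C W)" by (rule r)
  interpret Rp: su_functor_post C C2 C P "ps_pair C (ps_id C) (ps_const C C W)" ..
  show "su_functor C C (M.tens_r W)"
    unfolding M.tens_r_def
    by (intro su_functor.intro su_functor_axioms.intro C.su_bicat_axioms Rp.pseudofunctor_ps_then
        Rp.strictly_unitary_ps_then r)
qed

lemma tens_obj [simp]:
  "W \<in> Obj C \<Longrightarrow> X \<in> Obj C \<Longrightarrow> ps_obj (M.tens_l W) X = ps_obj P (W, X)"
  "W \<in> Obj C \<Longrightarrow> X \<in> Obj C \<Longrightarrow> ps_obj (M.tens_r W) X = ps_obj P (X, W)"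
  by (simp_all add: M.tens_l_def M.tens_r_def)

lemma tu_id2: "X \<in> Obj C \<Longrightarrow> Y \<in> Obj C \<Longrightarrow> M.tu X Y = id2 C (id1 C (ps_obj P (X, Y)))"
  by (simp add: M.tu_def)

lemmas coherence_simps = pt_left_tensor pt_ps_id P_id1 P_id2 assoc0 tu_id2
  su_functor.ps_on_paths_id1[OF su_functor_tens(1)] su_functor.ps_on_paths_id1[OF su_functor_tens(2)]

text \<open>In each axiom \<open>assoc0\<close> gives all bracketings of the objects one normal
  form. Both sides are then pastings of the identity cell of a single identity 1-cell and collapse
  by \<open>paste_id1\<close>.\<close>

lemma monoidal_bicategory_strict:
  "monoidal_bicategory C P (ps_const unit_bicat C I) (pt_id C3 C left_tensor)
    (pt_id C C (ps_id C)) (pt_id C C (ps_id C))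
    (\<lambda>(((W, X), Y), Z). id2 C (id1 C (ps_obj P (W, ps_obj P (X, ps_obj P (Y, Z))))))
    (\<lambda>(X, Y). id2 C (id1 C (ps_obj P (X, Y)))) (\<lambda>(X, Y). id2 C (id1 C (ps_obj P (X, Y))))
    (\<lambda>(X, Y). id2 C (id1 C (ps_obj P (X, Y))))"
proof (intro monoidal_bicategory.intro monoidal_bicategory_axioms.intro C.bicategory_axioms
    P.P.pseudofunctor_axioms, goal_cases)
  case 1
  interpret su_bicats unit_bicat C
    by (intro su_bicats.intro bicategory_unit_bicat C.su_bicat_axioms)
  show ?case by (rule pseudofunctor_ps_const) simp
next
  case 2
  interpret C3: su_bicat C3 by (rule su_bicat_C3)
  interpret su_bicats C3 C ..
  show ?case
    unfolding tens_left tens_right by (rule pseudonatural_equivalence_pt_id) (rule pseudofunctor_left_tensor)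
next
  case 3
  interpret su_bicats C C ..
  show ?case
    unfolding unit_tens by (rule pseudonatural_equivalence_pt_id) (rule C.pseudofunctor_ps_id)
next
  case 4
  interpret su_bicats C C ..
  show ?case
    unfolding tens_unit by (rule pseudonatural_equivalence_pt_id) (rule C.pseudofunctor_ps_id)
next
  case 5 show ?case by (rule trivial_invertible_modification[OF compatible4 pi_trivial]) auto
next
  case 6 show ?case by (rule trivial_invertible_modification[OF compatible2 mu_trivial]) auto
next
  case 7 show ?case by (rule trivial_invertible_modification[OF compatible2 lam_trivial]) auto
next
  case 8 show ?case by (rule trivial_invertible_modification[OF compatible2 rho_trivial]) auto
next
  case (9 V W X Y Z)
  then show ?case by (simp add: M.cocycle_left_def M.cocycle_right_def coherence_simps)
next
  case (10 X Y Z)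
  then show ?case by (simp add: M.left_norm_left_def M.left_norm_right_def coherence_simps)
next
  case (11 X Y Z)
  then show ?case by (simp add: M.right_norm_left_def M.right_norm_right_def coherence_simps)
qed

end

section \<open>Coordinates for 2-vector spaces\<close>

text \<open>With blocks of lengths n 0, n 1, and so on laid end to end, a position is a block number
  together with an offset inside the block.\<close>

lemma sum_decomp:
  fixes n :: "nat \<Rightarrow> nat"
  assumes "x < (\<Sum>k<M. n k)"
  obtains k r where "k < M" "r < n k" "x = (\<Sum>k'<k. n k') + r"
proof -
  have "\<exists>k r. k < M \<and> r < n k \<and> x = (\<Sum>k'<k. n k') + r"
    using assms
  proof (induct M)
    case (Suc M)
    show ?case
    proof (cases "x < (\<Sum>k<M. n k)")
      case True
      with Suc.hyps show ?thesis using less_SucI by blast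
    next
      case False
      with Suc.prems show ?thesis
        by (intro exI[of _ M] exI[of _ "x - (\<Sum>k<M. n k)"]) auto
    qed
  qed simp
  then show thesis using that by blast
qed

lemma sum_decomp_unique:
  fixes n :: "nat \<Rightarrow> nat"
  assumes "(\<Sum>k'<k. n k') + r = (\<Sum>k'<l. n k') + s" "r < n k" "s < n l"
  shows "k = l \<and> r = s"
proof -
  have *: "(\<Sum>k'<k. n k') + r < (\<Sum>k'<l. n k') + s" if "k < l" "r < n k" for k l r s
  proof -
    have "(\<Sum>k'<k. n k') + r < (\<Sum>k'<Suc k. n k')" using that by simp
    also have "\<dots> \<le> (\<Sum>k'<l. n k')" using that by (intro sum_mono2) auto
    finally show ?thesis by simp
  qed
  have "k = l" using *[of k l r s] *[of l k s r] assms by (cases k l rule: linorder_cases) auto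
  with assms show ?thesis by simp
qed

lemma sum_decomp_less:
  fixes n :: "nat \<Rightarrow> nat"
  assumes "k < M" "r < n k"
  shows "(\<Sum>k'<k. n k') + r < (\<Sum>k<M. n k)"
proof -
  have "(\<Sum>k'<k. n k') + r < (\<Sum>k'<Suc k. n k')" using assms by simp
  also have "\<dots> \<le> (\<Sum>k'<M. n k')" using assms by (intro sum_mono2) auto
  finally show ?thesis .
qed

lemma pair_decomp:
  fixes x m n :: nat
  assumes "x < m * n"
  obtains p q where "p < m" "q < n" "x = p * n + q"
proof
  have "0 < n" using assms by (cases n) auto
  then show "x div n < m" "x mod n < n" "x = x div n * n + x mod n"
    using assms by (auto simp: less_mult_imp_div_less)
qed

lemma pair_less: "p < m \<Longrightarrow> q < n \<Longrightarrow> p * n + q < m * (n :: nat)"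
proof -
  assume "p < m" "q < n"
  then have "p * n + q < Suc p * n" "Suc p * n \<le> m * n" by (simp, intro mult_le_mono1) simp_all
  then show ?thesis by (rule less_le_trans)
qed

lemma pair_div_mod [simp]: "q < n \<Longrightarrow> (p * n + q) div n = (p :: nat)" "q < n \<Longrightarrow> (p * n + q) mod n = (q :: nat)"
  by auto

lemma pair_unique: "p * n + q = p' * n + q' \<Longrightarrow> q < n \<Longrightarrow> q' < n \<Longrightarrow> p = p' \<and> q = (q' :: nat)"
  by (metis pair_div_mod)

lemma mult_index:
  fixes a b :: "nat mat"
  assumes "i < dim_row a" "j < dim_col b" "dim_col a = dim_row b"
  shows "(a * b) $$ (i, j) = (\<Sum>k<dim_col a. a $$ (i, k) * b $$ (k, j))"
  using assms by (simp add: scalar_prod_def lessThan_atLeast0)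

lemma basis_pos_less:
  assumes "i < dim_row a" "j < dim_col b" "dim_col a = dim_row b" "k < dim_col a" "p < a $$ (i, k)"
    "q < b $$ (k, j)"
  shows "basis_pos a b i j k p q < (a * b) $$ (i, j)"
  unfolding mult_index[OF assms(1-3)] basis_pos_def
  by (intro sum_decomp_less pair_less assms)

lemma basis_pos_cases:
  assumes "x < (a * b) $$ (i, j)" "i < dim_row a" "j < dim_col b" "dim_col a = dim_row b"
  obtains k p q where "k < dim_col a" "p < a $$ (i, k)" "q < b $$ (k, j)" "x = basis_pos a b i j k p q"
proof -
  obtain k r where k: "k < dim_col a" "r < a $$ (i, k) * b $$ (k, j)"
    "x = (\<Sum>k'<k. a $$ (i, k') * b $$ (k', j)) + r"
    using assms(1) unfolding mult_index[OF assms(2-4)] by (rule sum_decomp)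
  obtain p q where "p < a $$ (i, k)" "q < b $$ (k, j)" "r = p * b $$ (k, j) + q"
    using k(2) by (rule pair_decomp)
  with k show thesis by (intro that[of k p q]) (auto simp: basis_pos_def)
qed

lemma basis_pos_unique:
  assumes "basis_pos a b i j k p q = basis_pos a b i j k' p' q'"
    "p < a $$ (i, k)" "q < b $$ (k, j)" "p' < a $$ (i, k')" "q' < b $$ (k', j)"
  shows "k = k' \<and> p = p' \<and> q = q'"
proof -
  have "k = k' \<and> p * b $$ (k, j) + q = p' * b $$ (k', j) + q'"
    using assms(1) unfolding basis_pos_def
    by (rule sum_decomp_unique) (use assms(2-) pair_less in blast)+
  then show ?thesis using pair_unique assms(2-) by metis
qed

lemma basis_pos_eq_iff:
  assumes "p < a $$ (i, k)" "q < b $$ (k, j)" "p' < a $$ (i, k')" "q' < b $$ (k', j)"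
  shows "basis_pos a b i j k p q = basis_pos a b i j k' p' q' \<longleftrightarrow> k = k' \<and> p = p' \<and> q = q'"
  using basis_pos_unique assms by blast

text \<open>The coordinates \<open>(k, p, q)\<close> of a basis element of the entry \<open>(i, j)\<close> of \<open>a * b\<close>.\<close>

definition basis_coords :: "nat mat \<Rightarrow> nat mat \<Rightarrow> nat \<Rightarrow> nat \<Rightarrow> nat \<Rightarrow> nat \<times> nat \<times> nat" where
  "basis_coords a b i j x = (SOME (k, p, q). k < dim_col a \<and> p < a $$ (i, k) \<and> q < b $$ (k, j) \<and>
     x = basis_pos a b i j k p q)"

lemma basis_coords_pos [simp]:
  assumes "k < dim_col a" "p < a $$ (i, k)" "q < b $$ (k, j)"
  shows "basis_coords a b i j (basis_pos a b i j k p q) = (k, p, q)"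
  unfolding basis_coords_def
proof (rule some_equality)
  fix y assume "case y of (k', p', q') \<Rightarrow> k' < dim_col a \<and> p' < a $$ (i, k') \<and> q' < b $$ (k', j) \<and>
    basis_pos a b i j k p q = basis_pos a b i j k' p' q'"
  then obtain k' p' q' where y: "y = (k', p', q')" "p' < a $$ (i, k')" "q' < b $$ (k', j)"
    "basis_pos a b i j k p q = basis_pos a b i j k' p' q'"
    by (cases y) auto
  from basis_pos_unique[OF y(4) assms(2,3) y(2,3)] show "y = (k, p, q)" using y(1) by simp
qed (use assms in simp)

text \<open>Reindexing along the bijection between coordinate triples and positions.\<close>

lemma sum_basis_pos:
  assumes "i < dim_row a" "j < dim_col b" "dim_col a = dim_row b"
  shows "(\<Sum>x<(a * b) $$ (i, j). f x)
    = (\<Sum>k<dim_col a. \<Sum>p<a $$ (i, k). \<Sum>q<b $$ (k, j). f (basis_pos a b i j k p q))"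
proof -
  let ?S = "Sigma {..<dim_col a} (\<lambda>k. {..<a $$ (i, k)} \<times> {..<b $$ (k, j)})"
  have "bij_betw (\<lambda>(k, p, q). basis_pos a b i j k p q) ?S {..<(a * b) $$ (i, j)}"
    unfolding bij_betw_def
  proof
    show "inj_on (\<lambda>(k, p, q). basis_pos a b i j k p q) ?S"
      by (auto simp: inj_on_def basis_pos_eq_iff)
    show "(\<lambda>(k, p, q). basis_pos a b i j k p q) ` ?S = {..<(a * b) $$ (i, j)}"
    proof
      show "(\<lambda>(k, p, q). basis_pos a b i j k p q) ` ?S \<subseteq> {..<(a * b) $$ (i, j)}"
        using basis_pos_less[OF assms] by (auto simp del: index_mult_mat)
      show "{..<(a * b) $$ (i, j)} \<subseteq> (\<lambda>(k, p, q). basis_pos a b i j k p q) ` ?S"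
      proof
        fix x assume "x \<in> {..<(a * b) $$ (i, j)}"
        then have "x < (a * b) $$ (i, j)" by (rule lessThan_iff[THEN iffD1])
        then show "x \<in> (\<lambda>(k, p, q). basis_pos a b i j k p q) ` ?S"
          by (rule basis_pos_cases[OF _ assms]) (auto simp: image_def)
      qed
    qed
  qed
  from sum.reindex_bij_betw[OF this, of f, symmetric] show ?thesis
    by (simp add: sum.Sigma sum.cartesian_product split_def del: index_mult_mat)
qed

text \<open>A block begins after the total size of its predecessors, and rows of one block meet
  columns of another only in zeros. The induction splits off the first block.\<close>

lemma diag_block_mat_index:
  assumes "k < length As" "x < dim_row (As ! k)" "k' < length As" "y < dim_col (As ! k')"
  shows "diag_block_mat As $$ (sum_list (map dim_row (take k As)) + x, sum_list (map dim_col (take k' As)) + y)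
    = (if k = k' then (As ! k) $$ (x, y) else 0)"
  using assms
proof (induct As arbitrary: k k')
  case (Cons A As)
  \<comment> \<open>A position addressed inside a block stays below the total size of the list, as
    needed to locate it in the lower right part once the first block is split off.\<close>
  have bound: "sum_list (map f (take k As)) + x < sum_list (map f As)"
    if "k < length As" "x < f (As ! k)" for f k and x :: nat
  proof -
    have "sum_list (map f (take k As)) + x < sum_list (map f (take (Suc k) As))"
      using that by (simp add: take_Suc_conv_app_nth)
    also have "\<dots> \<le> sum_list (map f (take (Suc k) As)) + sum_list (map f (drop (Suc k) As))" by simp
    also have "\<dots> = sum_list (map f As)"
      by (metis append_take_drop_id map_append sum_list_append)
    finally show ?thesis .
  qed
  have d: "dim_row (diag_block_mat As) = sum_list (map dim_row As)"
    "dim_col (diag_block_mat As) = sum_list (map dim_col As)"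
    by (simp_all add: dim_diag_block_mat)
  show ?case
  proof (cases k; cases k')
    fix l l' assume k: "k = Suc l" "k' = Suc l'"
    with Cons.prems have "l < length As" "x < dim_row (As ! l)" "l' < length As" "y < dim_col (As ! l')" by auto
    with Cons.hyps[of l l'] bound[of l x dim_row] bound[of l' y dim_col] show ?thesis
      by (simp add: Let_def k d add.assoc)
  next
    fix l' assume k: "k = 0" "k' = Suc l'"
    with Cons.prems have "x < dim_row A" "l' < length As" "y < dim_col (As ! l')" by auto
    with bound[of l' y dim_col] show ?thesis by (simp add: Let_def k d)
  next
    fix l assume k: "k = Suc l" "k' = 0"
    with Cons.prems have "l < length As" "x < dim_row (As ! l)" "y < dim_col A" by auto
    with bound[of l x dim_row] show ?thesis by (simp add: Let_def k d)
  next
    assume "k = 0" "k' = 0"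
    with Cons.prems show ?thesis by (simp add: Let_def)
  qed
qed simp

section \<open>2-cells of 2-vector spaces\<close>

text \<open>Every matrix of matrices is a cell of \<open>TwoVect\<close>, with its boundary read off
  from the dimensions, so typing amounts to two equations. The predicate is \<open>hom2\<close> for
  \<open>TwoVect\<close>, see \<open>hom2_TwoVect\<close>.\<close>

definition tvhom :: "nat mat \<Rightarrow> nat mat \<Rightarrow> complex mat mat \<Rightarrow> bool" where
  "tvhom a b \<alpha> \<longleftrightarrow> map_mat dim_row \<alpha> = a \<and> map_mat dim_col \<alpha> = b"

abbreviation ent :: "complex mat mat \<Rightarrow> nat \<Rightarrow> nat \<Rightarrow> nat \<Rightarrow> nat \<Rightarrow> complex" where
  "ent \<alpha> i j x y \<equiv> \<alpha> $$ (i, j) $$ (x, y)"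

lemma tvhomD:
  assumes "tvhom a b \<alpha>"
  shows "dim_row \<alpha> = dim_row a" "dim_col \<alpha> = dim_col a" "dim_row b = dim_row a" "dim_col b = dim_col a"
    "i < dim_row a \<Longrightarrow> j < dim_col a \<Longrightarrow> dim_row (\<alpha> $$ (i, j)) = a $$ (i, j)"
    "i < dim_row a \<Longrightarrow> j < dim_col a \<Longrightarrow> dim_col (\<alpha> $$ (i, j)) = b $$ (i, j)"
  using assms by (auto simp: tvhom_def)

lemma tvhomI:
  assumes "dim_row \<alpha> = dim_row a" "dim_col \<alpha> = dim_col a" "dim_row b = dim_row a" "dim_col b = dim_col a"
    "\<And>i j. i < dim_row a \<Longrightarrow> j < dim_col a \<Longrightarrow> dim_row (\<alpha> $$ (i, j)) = a $$ (i, j)"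
    "\<And>i j. i < dim_row a \<Longrightarrow> j < dim_col a \<Longrightarrow> dim_col (\<alpha> $$ (i, j)) = b $$ (i, j)"
  shows "tvhom a b \<alpha>"
  using assms by (auto simp: tvhom_def intro!: eq_matI)

lemma tv_eqI:
  assumes "tvhom a b \<alpha>" "tvhom a b \<beta>"
    "\<And>i j x y. i < dim_row a \<Longrightarrow> j < dim_col a \<Longrightarrow> x < a $$ (i, j) \<Longrightarrow> y < b $$ (i, j) \<Longrightarrow>
      ent \<alpha> i j x y = ent \<beta> i j x y"
  shows "\<alpha> = \<beta>"
  using assms(3) by (intro eq_matI) (simp_all add: tvhomD[OF assms(1)] tvhomD[OF assms(2)])

lemma tvhom_vcomp:
  assumes "tvhom a b \<alpha>" "tvhom b c \<beta>"
  shows "tvhom a c (tv_vcomp \<alpha> \<beta>)"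
  by (rule tvhomI) (use tvhomD[OF assms(1)] tvhomD[OF assms(2)] in \<open>simp_all add: tv_vcomp_def\<close>)

lemma ent_vcomp:
  assumes "tvhom a b \<alpha>" "tvhom b c \<beta>" "i < dim_row a" "j < dim_col a" "x < a $$ (i, j)" "y < c $$ (i, j)"
  shows "ent (tv_vcomp \<alpha> \<beta>) i j x y = (\<Sum>z<b $$ (i, j). ent \<alpha> i j x z * ent \<beta> i j z y)"
  using assms tvhomD[OF assms(1)] tvhomD[OF assms(2)]
  by (simp add: tv_vcomp_def scalar_prod_def lessThan_atLeast0)

lemma tvhom_hcomp:
  assumes "tvhom a b \<alpha>" "tvhom a' b' \<beta>" "dim_col a = dim_row a'"
  shows "tvhom (a * a') (b * b') (tv_hcomp \<alpha> \<beta>)"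
proof -
  note d = tvhomD[OF assms(1)] tvhomD[OF assms(2)]
  show ?thesis
    by (rule tvhomI) (use d assms(3) in \<open>simp_all add: tv_hcomp_def dim_diag_block_mat kron_by_def
      comp_def mult_index interv_sum_list_conv_sum_set_nat lessThan_atLeast0 scalar_prod_def\<close>)
qed

text \<open>In coordinates the direct sum contributes the condition k = k', and the Kronecker
  product the two factors.\<close>

lemma ent_hcomp:
  assumes "tvhom a b \<alpha>" "tvhom a' b' \<beta>" "dim_col a = dim_row a'"
    "i < dim_row a" "j < dim_col a'" "k < dim_col a" "p < a $$ (i, k)" "q < a' $$ (k, j)"
    "k' < dim_col a" "p' < b $$ (i, k')" "q' < b' $$ (k', j)"
  shows "ent (tv_hcomp \<alpha> \<beta>) i j (basis_pos a a' i j k p q) (basis_pos b b' i j k' p' q')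
    = (if k = k' then ent \<alpha> i k p p' * ent \<beta> k j q q' else 0)"
proof -
  note d = tvhomD[OF assms(1)] tvhomD[OF assms(2)]
  let ?D = "map (\<lambda>k. kron (\<alpha> $$ (i, k)) (\<beta> $$ (k, j))) [0..<dim_col a]"
  have 1: "sum_list (map dim_row (take k ?D)) = (\<Sum>l<k. a $$ (i, l) * a' $$ (l, j))"
    "sum_list (map dim_col (take k' ?D)) = (\<Sum>l<k'. b $$ (i, l) * b' $$ (l, j))"
    using assms(3-) d by (simp_all add: take_map comp_def kron_by_def interv_sum_list_conv_sum_set_nat
        lessThan_atLeast0)
  have "diag_block_mat ?D $$ (sum_list (map dim_row (take k ?D)) + (p * a' $$ (k, j) + q),
      sum_list (map dim_col (take k' ?D)) + (p' * b' $$ (k', j) + q'))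
    = (if k = k' then (?D ! k) $$ (p * a' $$ (k, j) + q, p' * b' $$ (k', j) + q') else 0)"
    by (rule diag_block_mat_index) (use assms(3-) d in \<open>simp_all add: kron_by_def pair_less\<close>)
  then have *: "ent (tv_hcomp \<alpha> \<beta>) i j (basis_pos a a' i j k p q) (basis_pos b b' i j k' p' q')
    = (if k = k' then (?D ! k) $$ (p * a' $$ (k, j) + q, p' * b' $$ (k', j) + q') else 0)"
    using assms(3-) d unfolding 1 by (simp add: tv_hcomp_def basis_pos_def)
  show ?thesis
  proof (cases "k = k'")
    case True
    then show ?thesis
      unfolding * using assms(3-) d by (simp add: kron_by_def pair_less)
  qed (simp add: *)
qed

declare index_mult_mat(1) [simp del]

section \<open>Permutation cells\<close>

text \<open>\<open>\<phi> i j\<close> sends a row to the column that holds its 1. Reading from rows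
  to columns agrees with diagrammatic order: a vertical composite applies the permutation of its
  first factor first.\<close>

definition perm_cell :: "complex mat mat \<Rightarrow> nat mat \<Rightarrow> nat mat \<Rightarrow> (nat \<Rightarrow> nat \<Rightarrow> nat \<Rightarrow> nat) \<Rightarrow> bool" where
  "perm_cell \<alpha> a b \<phi> \<longleftrightarrow> tvhom a b \<alpha> \<and> (\<forall>i<dim_row a. \<forall>j<dim_col a.
     bij_betw (\<phi> i j) {..<a $$ (i, j)} {..<b $$ (i, j)} \<and>
     (\<forall>x<a $$ (i, j). \<forall>y<b $$ (i, j). ent \<alpha> i j x y = (if y = \<phi> i j x then 1 else 0)))"

lemma perm_cellD:
  assumes "perm_cell \<alpha> a b \<phi>"
  shows "tvhom a b \<alpha>"
    "i < dim_row a \<Longrightarrow> j < dim_col a \<Longrightarrow> bij_betw (\<phi> i j) {..<a $$ (i, j)} {..<b $$ (i, j)}"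
    "i < dim_row a \<Longrightarrow> j < dim_col a \<Longrightarrow> x < a $$ (i, j) \<Longrightarrow> \<phi> i j x < b $$ (i, j)"
    "i < dim_row a \<Longrightarrow> j < dim_col a \<Longrightarrow> x < a $$ (i, j) \<Longrightarrow> y < b $$ (i, j) \<Longrightarrow>
      ent \<alpha> i j x y = (if y = \<phi> i j x then 1 else 0)"
    "i < dim_row a \<Longrightarrow> j < dim_col a \<Longrightarrow> x < a $$ (i, j) \<Longrightarrow> x' < a $$ (i, j) \<Longrightarrow>
      \<phi> i j x = \<phi> i j x' \<longleftrightarrow> x = x'"
proof -
  show bij: "bij_betw (\<phi> i j) {..<a $$ (i, j)} {..<b $$ (i, j)}" if "i < dim_row a" "j < dim_col a" for i j
    using assms that by (auto simp: perm_cell_def)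
  show "\<phi> i j x < b $$ (i, j)" if "i < dim_row a" "j < dim_col a" "x < a $$ (i, j)"
    using bij_betw_apply[OF bij[of i j]] that by auto
  show "\<phi> i j x = \<phi> i j x' \<longleftrightarrow> x = x'" if "i < dim_row a" "j < dim_col a" "x < a $$ (i, j)" "x' < a $$ (i, j)"
    using bij_betw_imp_inj_on[OF bij[of i j]] that by (auto dest: inj_onD)
qed (use assms in \<open>auto simp: perm_cell_def\<close>)

lemma perm_cell_surj:
  assumes "perm_cell \<alpha> a b \<phi>" "i < dim_row a" "j < dim_col a" "y < b $$ (i, j)"
  obtains x where "x < a $$ (i, j)" "y = \<phi> i j x"
  using bij_betw_imp_surj_on[OF perm_cellD(2)[OF assms(1-3)]] assms(4) by (auto simp: image_def set_eq_iff)

text \<open>A row of a permutation matrix has a single 1, so the sum over the middle basis collapses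
  to one term.\<close>

lemma perm_vcomp_left:
  assumes "perm_cell \<alpha> a b \<phi>" "tvhom b c \<beta>" "i < dim_row a" "j < dim_col a" "x < a $$ (i, j)" "y < c $$ (i, j)"
  shows "ent (tv_vcomp \<alpha> \<beta>) i j x y = ent \<beta> i j (\<phi> i j x) y"
proof -
  have "ent (tv_vcomp \<alpha> \<beta>) i j x y = (\<Sum>z<b $$ (i, j). if z = \<phi> i j x then ent \<beta> i j z y else 0)"
    unfolding ent_vcomp[OF perm_cellD(1)[OF assms(1)] assms(2-)]
    by (rule sum.cong) (use perm_cellD(4)[OF assms(1,3-5)] in auto)
  then show ?thesis using perm_cellD(3)[OF assms(1,3-5)] by simp
qed

text \<open>The target index is given as an image under \<phi>; by injectivity only its preimage
  contributes to the sum over the middle basis.\<close>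

lemma perm_vcomp_right:
  assumes "tvhom c a \<beta>" "perm_cell \<alpha> a b \<phi>" "i < dim_row a" "j < dim_col a" "x < c $$ (i, j)" "y < a $$ (i, j)"
  shows "ent (tv_vcomp \<beta> \<alpha>) i j x (\<phi> i j y) = ent \<beta> i j x y"
proof -
  note d = tvhomD(3,4)[OF assms(1)]
  have "ent (tv_vcomp \<beta> \<alpha>) i j x (\<phi> i j y) = (\<Sum>z<a $$ (i, j). ent \<beta> i j x z * ent \<alpha> i j z (\<phi> i j y))"
    by (rule ent_vcomp[OF assms(1) perm_cellD(1)[OF assms(2)]])
      (use d assms perm_cellD(3)[OF assms(2-4)] in simp_all)
  also have "\<dots> = (\<Sum>z<a $$ (i, j). if z = y then ent \<beta> i j x z else 0)"
    by (rule sum.cong) (use assms perm_cellD(3,4,5)[OF assms(2-4)] in auto)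
  finally show ?thesis using assms by simp
qed

lemma perm_cell_vcomp:
  assumes "perm_cell \<alpha> a b \<phi>" "perm_cell \<beta> b c \<psi>"
  shows "perm_cell (tv_vcomp \<alpha> \<beta>) a c (\<lambda>i j x. \<psi> i j (\<phi> i j x))"
proof -
  note d = tvhomD(3,4)[OF perm_cellD(1)[OF assms(1)]]
  have "bij_betw (\<lambda>x. \<psi> i j (\<phi> i j x)) {..<a $$ (i, j)} {..<c $$ (i, j)}" if "i < dim_row a" "j < dim_col a" for i j
    using bij_betw_trans[OF perm_cellD(2)[OF assms(1), of i j] perm_cellD(2)[OF assms(2), of i j]] that d
    by (simp add: comp_def)
  moreover have "ent (tv_vcomp \<alpha> \<beta>) i j x y = (if y = \<psi> i j (\<phi> i j x) then 1 else 0)"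
    if "i < dim_row a" "j < dim_col a" "x < a $$ (i, j)" "y < c $$ (i, j)" for i j x y
    using perm_vcomp_left[OF assms(1) perm_cellD(1)[OF assms(2)] that] perm_cellD(3)[OF assms(1), of i j x]
      perm_cellD(4)[OF assms(2), of i j "\<phi> i j x" y] that d by simp
  ultimately show ?thesis
    using tvhom_vcomp[OF perm_cellD(1)[OF assms(1)] perm_cellD(1)[OF assms(2)]] by (simp add: perm_cell_def)
qed

text \<open>Reduces coherence between structure cells to an equality of functions on basis
  positions, which is then evaluated on coordinates.\<close>

lemma perm_cell_eqI:
  assumes "perm_cell \<alpha> a b \<phi>" "perm_cell \<beta> a b \<psi>"
    "\<And>i j x. i < dim_row a \<Longrightarrow> j < dim_col a \<Longrightarrow> x < a $$ (i, j) \<Longrightarrow> \<phi> i j x = \<psi> i j x"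
  shows "\<alpha> = \<beta>"
  by (rule tv_eqI[OF perm_cellD(1)[OF assms(1)] perm_cellD(1)[OF assms(2)]])
    (simp add: perm_cellD(4)[OF assms(1)] perm_cellD(4)[OF assms(2)] assms(3))

abbreviation tv_id :: "nat mat \<Rightarrow> complex mat mat" where
  "tv_id \<equiv> map_mat 1\<^sub>m"

lemma perm_cell_id: "perm_cell (tv_id a) a a (\<lambda>i j x. x)"
  by (auto simp: perm_cell_def tvhom_def bij_betw_id[unfolded id_def] intro!: eq_matI)

definition hperm where
  "hperm a a' b b' \<phi> \<psi> i j x = (case basis_coords a a' i j x of (k, p, q) \<Rightarrow>
     basis_pos b b' i j k (\<phi> i k p) (\<psi> k j q))"

lemma hperm_pos [simp]:
  "k < dim_col a \<Longrightarrow> p < a $$ (i, k) \<Longrightarrow> q < a' $$ (k, j) \<Longrightarrow>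
    hperm a a' b b' \<phi> \<psi> i j (basis_pos a a' i j k p q) = basis_pos b b' i j k (\<phi> i k p) (\<psi> k j q)"
  by (simp add: hperm_def)

lemma perm_cell_hcomp:
  assumes "perm_cell \<alpha> a b \<phi>" "perm_cell \<beta> a' b' \<psi>" "dim_col a = dim_row a'"
  shows "perm_cell (tv_hcomp \<alpha> \<beta>) (a * a') (b * b') (hperm a a' b b' \<phi> \<psi>)"
  unfolding perm_cell_def
proof (intro conjI allI impI)
  note h = perm_cellD(1)[OF assms(1)] perm_cellD(1)[OF assms(2)]
  note d = tvhomD(3,4)[OF h(1)] tvhomD(3,4)[OF h(2)]
  show "tvhom (a * a') (b * b') (tv_hcomp \<alpha> \<beta>)" by (rule tvhom_hcomp[OF h assms(3)])
  fix i j assume "i < dim_row (a * a')" "j < dim_col (a * a')"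
  then have ij [simp]: "i < dim_row a" "j < dim_col a'" by simp_all
  show "bij_betw (hperm a a' b b' \<phi> \<psi> i j) {..<(a * a') $$ (i, j)} {..<(b * b') $$ (i, j)}"
    unfolding bij_betw_def
  proof
    show "inj_on (hperm a a' b b' \<phi> \<psi> i j) {..<(a * a') $$ (i, j)}"
    proof (rule inj_onI)
      fix x y assume "x \<in> {..<(a * a') $$ (i, j)}" "y \<in> {..<(a * a') $$ (i, j)}"
        and eq: "hperm a a' b b' \<phi> \<psi> i j x = hperm a a' b b' \<phi> \<psi> i j y"
      then have x: "x < (a * a') $$ (i, j)" and y: "y < (a * a') $$ (i, j)" by simp_all
      obtain k p q where 1: "k < dim_col a" "p < a $$ (i, k)" "q < a' $$ (k, j)" "x = basis_pos a a' i j k p q"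
        by (rule basis_pos_cases[OF x ij assms(3)])
      obtain l r s where 2: "l < dim_col a" "r < a $$ (i, l)" "s < a' $$ (l, j)" "y = basis_pos a a' i j l r s"
        by (rule basis_pos_cases[OF y ij assms(3)])
      have eq: "basis_pos b b' i j k (\<phi> i k p) (\<psi> k j q) = basis_pos b b' i j l (\<phi> i l r) (\<psi> l j s)"
        using eq 1 2 by simp
      have "k = l \<and> \<phi> i k p = \<phi> i l r \<and> \<psi> k j q = \<psi> l j s"
        by (rule basis_pos_unique[OF eq])
          (use 1 2 assms(3) perm_cellD(3)[OF assms(1)] perm_cellD(3)[OF assms(2)] in simp_all)
      then show "x = y"
        using 1 2 assms(3) perm_cellD(5)[OF assms(1), of i k p r] perm_cellD(5)[OF assms(2), of k j q s] by auto
    qed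
    show "hperm a a' b b' \<phi> \<psi> i j ` {..<(a * a') $$ (i, j)} = {..<(b * b') $$ (i, j)}"
    proof
      show "hperm a a' b b' \<phi> \<psi> i j ` {..<(a * a') $$ (i, j)} \<subseteq> {..<(b * b') $$ (i, j)}"
      proof
        fix y assume "y \<in> hperm a a' b b' \<phi> \<psi> i j ` {..<(a * a') $$ (i, j)}"
        then obtain x where x: "x < (a * a') $$ (i, j)" and y: "y = hperm a a' b b' \<phi> \<psi> i j x" by auto
        obtain k p q where 1: "k < dim_col a" "p < a $$ (i, k)" "q < a' $$ (k, j)" "x = basis_pos a a' i j k p q"
          by (rule basis_pos_cases[OF x ij assms(3)])
        then have "y < (b * b') $$ (i, j)"
          using assms(3) d perm_cellD(3)[OF assms(1)] perm_cellD(3)[OF assms(2)] y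
          by (simp add: basis_pos_less)
        then show "y \<in> {..<(b * b') $$ (i, j)}" by simp
      qed
      show "{..<(b * b') $$ (i, j)} \<subseteq> hperm a a' b b' \<phi> \<psi> i j ` {..<(a * a') $$ (i, j)}"
      proof
        fix y assume "y \<in> {..<(b * b') $$ (i, j)}"
        then have y: "y < (b * b') $$ (i, j)" by simp
        obtain k p' q' where 1: "k < dim_col b" "p' < b $$ (i, k)" "q' < b' $$ (k, j)"
          "y = basis_pos b b' i j k p' q'"
          by (rule basis_pos_cases[OF y]) (use d assms(3) in simp_all)
        obtain p where p: "p < a $$ (i, k)" "p' = \<phi> i k p"
          by (rule perm_cell_surj[OF assms(1) ij(1), of k p']) (use 1 d in simp_all)
        obtain q where q: "q < a' $$ (k, j)" "q' = \<psi> k j q"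
          by (rule perm_cell_surj[OF assms(2) _ ij(2), of k q']) (use 1 d assms(3) in simp_all)
        show "y \<in> hperm a a' b b' \<phi> \<psi> i j ` {..<(a * a') $$ (i, j)}"
          by (rule image_eqI[of _ _ "basis_pos a a' i j k p q"])
            (use 1 p q d assms(3) in \<open>simp_all add: basis_pos_less\<close>)
      qed
    qed
  qed
  fix x y assume x: "x < (a * a') $$ (i, j)" and y: "y < (b * b') $$ (i, j)"
  obtain k p q where 1: "k < dim_col a" "p < a $$ (i, k)" "q < a' $$ (k, j)" "x = basis_pos a a' i j k p q"
    by (rule basis_pos_cases[OF x ij assms(3)])
  obtain k' p' q' where 2: "k' < dim_col b" "p' < b $$ (i, k')" "q' < b' $$ (k', j)" "y = basis_pos b b' i j k' p' q'"
    by (rule basis_pos_cases[OF y]) (use d assms(3) in simp_all)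
  have lt: "\<phi> i k p < b $$ (i, k)" "\<psi> k j q < b' $$ (k, j)"
    using 1 assms(3) perm_cellD(3)[OF assms(1)] perm_cellD(3)[OF assms(2)] by simp_all
  have k': "k' < dim_col a" using 2 d by simp
  show "ent (tv_hcomp \<alpha> \<beta>) i j x y = (if y = hperm a a' b b' \<phi> \<psi> i j x then 1 else 0)"
    using ent_hcomp[OF h assms(3) ij 1(1-3) k' 2(2,3)] 1 2 lt assms(3) d
      perm_cellD(4)[OF assms(1), of i k p p'] perm_cellD(4)[OF assms(2), of k j q q']
    by (auto simp: basis_pos_eq_iff)
qed

lemma perm_cell_inverse:
  assumes "perm_cell \<alpha> a b \<phi>"
  obtains \<beta> where "tvhom b a \<beta>" "tv_vcomp \<alpha> \<beta> = tv_id a" "tv_vcomp \<beta> \<alpha> = tv_id b"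
proof
  \<comment> \<open>The transpose of each permutation matrix.\<close>
  let ?\<beta> = "mat (dim_row a) (dim_col a) (\<lambda>ij. mat (b $$ ij) (a $$ ij)
    (\<lambda>(y, x). if y = \<phi> (fst ij) (snd ij) x then (1 :: complex) else 0))"
  note h = perm_cellD(1)[OF assms] note d = tvhomD(3,4)[OF h]
  show b: "tvhom b a ?\<beta>" by (rule tvhomI) (simp_all add: d)
  show "tv_vcomp \<alpha> ?\<beta> = tv_id a"
  proof (rule tv_eqI[OF tvhom_vcomp[OF h b] perm_cellD(1)[OF perm_cell_id]])
    fix i j x y assume ij: "i < dim_row a" "j < dim_col a" "x < a $$ (i, j)" "y < a $$ (i, j)"
    then show "ent (tv_vcomp \<alpha> ?\<beta>) i j x y = ent (tv_id a) i j x y"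
      using perm_vcomp_left[OF assms b ij] perm_cellD(3,5)[OF assms] by simp
  qed
  show "tv_vcomp ?\<beta> \<alpha> = tv_id b"
  proof (rule tv_eqI[OF tvhom_vcomp[OF b h] perm_cellD(1)[OF perm_cell_id]])
    fix i j x y assume "i < dim_row b" "j < dim_col b" and xy: "x < b $$ (i, j)" "y < b $$ (i, j)"
    then have ij: "i < dim_row a" "j < dim_col a" by (simp_all add: d)
    obtain y' where y': "y' < a $$ (i, j)" "y = \<phi> i j y'"
      using perm_cell_surj[OF assms ij xy(2)] by blast
    show "ent (tv_vcomp ?\<beta> \<alpha>) i j x y = ent (tv_id b) i j x y"
      unfolding y'(2) using perm_vcomp_right[OF b assms ij xy(1) y'(1)] ij xy y' d
        perm_cellD(3)[OF assms ij y'(1)] by simp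
  qed
qed

section \<open>The bicategory of 2-vector spaces\<close>

text \<open>The coordinates j, k, p, q, s address a basis element in both bracketings; only the
  order in which they are encoded changes.\<close>

definition assoc_perm where
  "assoc_perm a b c i l x = (case basis_coords (a * b) c i l x of (k, z, s) \<Rightarrow>
     case basis_coords a b i k z of (j, p, q) \<Rightarrow> basis_pos a (b * c) i l j p (basis_pos b c j l k q s))"

lemma assoc_perm_pos [simp]:
  assumes "i < dim_row a" "dim_col a = dim_row b" "j < dim_col a" "k < dim_col b" "p < a $$ (i, j)"
    "q < b $$ (j, k)" "s < c $$ (k, l)"
  shows "assoc_perm a b c i l (basis_pos (a * b) c i l k (basis_pos a b i k j p q) s)
    = basis_pos a (b * c) i l j p (basis_pos b c j l k q s)"
  using assms by (simp add: assoc_perm_def basis_pos_less)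

lemma basis_pos_cases_left:
  assumes "x < ((a * b) * c) $$ (i, l)" "i < dim_row a" "l < dim_col c" "dim_col a = dim_row b"
    "dim_col b = dim_row c"
  obtains j k p q s where "j < dim_col a" "k < dim_col b" "p < a $$ (i, j)" "q < b $$ (j, k)"
    "s < c $$ (k, l)" "x = basis_pos (a * b) c i l k (basis_pos a b i k j p q) s"
proof -
  obtain k z s where 1: "k < dim_col (a * b)" "z < (a * b) $$ (i, k)" "s < c $$ (k, l)"
    "x = basis_pos (a * b) c i l k z s"
    by (rule basis_pos_cases[OF assms(1)]) (use assms in simp_all)
  obtain j p q where "j < dim_col a" "p < a $$ (i, j)" "q < b $$ (j, k)" "z = basis_pos a b i k j p q"
    by (rule basis_pos_cases[OF 1(2)]) (use assms 1 in simp_all)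
  with 1 show thesis by (intro that) auto
qed

lemma basis_pos_cases_right:
  assumes "x < (a * (b * c)) $$ (i, l)" "i < dim_row a" "l < dim_col c" "dim_col a = dim_row b"
    "dim_col b = dim_row c"
  obtains j k p q s where "j < dim_col a" "k < dim_col b" "p < a $$ (i, j)" "q < b $$ (j, k)"
    "s < c $$ (k, l)" "x = basis_pos a (b * c) i l j p (basis_pos b c j l k q s)"
proof -
  obtain j p z where 1: "j < dim_col a" "p < a $$ (i, j)" "z < (b * c) $$ (j, l)"
    "x = basis_pos a (b * c) i l j p z"
    by (rule basis_pos_cases[OF assms(1)]) (use assms in simp_all)
  obtain k q s where "k < dim_col b" "q < b $$ (j, k)" "s < c $$ (k, l)" "z = basis_pos b c j l k q s"
    by (rule basis_pos_cases[OF 1(3)]) (use assms 1 in simp_all)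
  with 1 show thesis by (intro that) auto
qed

text \<open>Both bracketings are parametrised by the same five coordinates, by
  \<open>basis_pos_cases_left\<close> and \<open>basis_pos_cases_right\<close>. This yields the
  bijection and identifies the condition in \<open>tv_assoc\<close> with the graph of
  \<open>assoc_perm\<close>.\<close>

lemma perm_cell_assoc:
  assumes [simp]: "dim_col a = dim_row b" "dim_col b = dim_row c"
  shows "perm_cell (tv_assoc a b c) ((a * b) * c) (a * (b * c)) (assoc_perm a b c)"
  unfolding perm_cell_def
proof (intro conjI allI impI)
  show "tvhom ((a * b) * c) (a * (b * c)) (tv_assoc a b c)"
    by (rule tvhomI) (simp_all add: tv_assoc_def)
  fix i l assume "i < dim_row (a * b * c)" "l < dim_col (a * b * c)"
  then have il [simp]: "i < dim_row a" "l < dim_col c" by simp_all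
  let ?X = "((a * b) * c) $$ (i, l)" and ?Y = "(a * (b * c)) $$ (i, l)"
  note left = basis_pos_cases_left[OF _ il assms] and right = basis_pos_cases_right[OF _ il assms]
  have less: "basis_pos a (b * c) i l j p (basis_pos b c j l k q s) < ?Y"
    "basis_pos (a * b) c i l k (basis_pos a b i k j p q) s < ?X"
    if "j < dim_row b" "k < dim_row c" "p < a $$ (i, j)" "q < b $$ (j, k)" "s < c $$ (k, l)" for j k p q s
    using that by (simp_all add: basis_pos_less)
  show "bij_betw (assoc_perm a b c i l) {..<?X} {..<?Y}"
    unfolding bij_betw_def
  proof
    show "inj_on (assoc_perm a b c i l) {..<?X}"
    proof (rule inj_onI)
      fix x y assume "x \<in> {..<?X}" "y \<in> {..<?X}" and eq: "assoc_perm a b c i l x = assoc_perm a b c i l y"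
      then have x: "x < ?X" and y: "y < ?X" by simp_all
      from x show "x = y"
      proof (rule left)
        fix j k p q s assume 1: "j < dim_col a" "k < dim_col b" "p < a $$ (i, j)" "q < b $$ (j, k)"
          "s < c $$ (k, l)" "x = basis_pos (a * b) c i l k (basis_pos a b i k j p q) s"
        from y show ?thesis
        proof (rule left)
          fix j' k' p' q' s' assume 2: "j' < dim_col a" "k' < dim_col b" "p' < a $$ (i, j')" "q' < b $$ (j', k')"
            "s' < c $$ (k', l)" "y = basis_pos (a * b) c i l k' (basis_pos a b i k' j' p' q') s'"
          show ?thesis using eq 1 2 by (auto simp: basis_pos_eq_iff basis_pos_less)
        qed
      qed
    qed
    show "assoc_perm a b c i l ` {..<?X} = {..<?Y}"
    proof
      show "assoc_perm a b c i l ` {..<?X} \<subseteq> {..<?Y}"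
        using less by (auto elim!: left)
      show "{..<?Y} \<subseteq> assoc_perm a b c i l ` {..<?X}"
      proof
        fix y assume "y \<in> {..<?Y}"
        then have y: "y < ?Y" by simp
        then show "y \<in> assoc_perm a b c i l ` {..<?X}"
        proof (rule right)
          fix j k p q s assume 1: "j < dim_col a" "k < dim_col b" "p < a $$ (i, j)" "q < b $$ (j, k)"
            "s < c $$ (k, l)" "y = basis_pos a (b * c) i l j p (basis_pos b c j l k q s)"
          show ?thesis
            by (rule image_eqI[of _ _ "basis_pos (a * b) c i l k (basis_pos a b i k j p q) s"])
              (use 1 less in simp_all)
        qed
      qed
    qed
  qed
  fix x y assume x: "x < ?X" and y: "y < ?Y"
  from x show "ent (tv_assoc a b c) i l x y = (if y = assoc_perm a b c i l x then 1 else 0)"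
  proof (rule left)
    fix j k p q s assume 1: "j < dim_col a" "k < dim_col b" "p < a $$ (i, j)" "q < b $$ (j, k)"
      "s < c $$ (k, l)" "x = basis_pos (a * b) c i l k (basis_pos a b i k j p q) s"
    have "(\<exists>j<dim_col a. \<exists>k<dim_col b. \<exists>p<a $$ (i, j). \<exists>q<b $$ (j, k). \<exists>s<c $$ (k, l).
            x = basis_pos (a * b) c i l k (basis_pos a b i k j p q) s \<and>
            y = basis_pos a (b * c) i l j p (basis_pos b c j l k q s))
       \<longleftrightarrow> y = assoc_perm a b c i l x"
    proof
      assume "y = assoc_perm a b c i l x"
      with 1 show "\<exists>j<dim_col a. \<exists>k<dim_col b. \<exists>p<a $$ (i, j). \<exists>q<b $$ (j, k). \<exists>s<c $$ (k, l).
            x = basis_pos (a * b) c i l k (basis_pos a b i k j p q) s \<and>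
            y = basis_pos a (b * c) i l j p (basis_pos b c j l k q s)"
        by (intro exI[of _ j] exI[of _ k] exI[of _ p] exI[of _ q] exI[of _ s] conjI) simp_all
    qed auto
    then show ?thesis using x y by (simp add: tv_assoc_def)
  qed
qed

section \<open>Bicategory axioms for 2-vector spaces\<close>

lemma TwoVect_simps [simp]:
  "Obj TwoVect = UNIV" "Arr TwoVect = UNIV" "Cell TwoVect = UNIV" "src TwoVect = dim_row"
  "tgt TwoVect = dim_col" "dom2 TwoVect = map_mat dim_row" "cod2 TwoVect = map_mat dim_col"
  "id1 TwoVect = 1\<^sub>m" "id2 TwoVect = tv_id" "vcomp TwoVect = tv_vcomp" "hcomp1 TwoVect = (*)"
  "hcomp2 TwoVect = tv_hcomp" "associator TwoVect = tv_assoc" "lunitor TwoVect = tv_id"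
  "runitor TwoVect = tv_id"
  by (simp_all add: TwoVect_def)

lemma hom2_TwoVect: "\<alpha> \<in> hom2 TwoVect a b \<longleftrightarrow> tvhom a b \<alpha>"
  by (auto simp: hom2_def tvhom_def)

lemma tvhom_id: "tvhom a a (tv_id a)"
  by (rule perm_cellD(1)[OF perm_cell_id])

lemma perm_cell_invertible:
  assumes "perm_cell \<alpha> a b \<phi>"
  shows "invertible2 TwoVect \<alpha>"
proof -
  obtain \<beta> where "tvhom b a \<beta>" "tv_vcomp \<alpha> \<beta> = tv_id a" "tv_vcomp \<beta> \<alpha> = tv_id b"
    by (rule perm_cell_inverse[OF assms])
  with perm_cellD(1)[OF assms] have "inverse_cells TwoVect \<alpha> \<beta>"
    by (simp add: inverse_cells_def hom2_TwoVect tvhom_def)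
  then show ?thesis by (rule inverse_cells_invertible)
qed

lemma tv_vcomp_assoc:
  assumes "tvhom a b \<alpha>" "tvhom b c \<beta>" "tvhom c d \<gamma>"
  shows "tv_vcomp (tv_vcomp \<alpha> \<beta>) \<gamma> = tv_vcomp \<alpha> (tv_vcomp \<beta> \<gamma>)"
proof -
  note d = tvhomD[OF assms(1)] tvhomD[OF assms(2)] tvhomD[OF assms(3)]
  show ?thesis
    unfolding tv_vcomp_def
    by (rule eq_matI)
      (use d in \<open>auto intro!: assoc_mult_mat[where ?n\<^sub>1.0 = "dim_row _" and ?n\<^sub>2.0 = "dim_row _" and ?n\<^sub>3.0 = "dim_row _" and ?n\<^sub>4.0 = "dim_col _"]
        carrier_matI\<close>)
qed

lemma tv_vcomp_id:
  assumes "tvhom a b \<alpha>"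
  shows "tv_vcomp (tv_id a) \<alpha> = \<alpha>" "tv_vcomp \<alpha> (tv_id b) = \<alpha>"
proof -
  note d = tvhomD[OF assms]
  show "tv_vcomp (tv_id a) \<alpha> = \<alpha>"
    by (rule tv_eqI[OF tvhom_vcomp[OF tvhom_id assms] assms])
      (simp add: perm_vcomp_left[OF perm_cell_id assms])
  show "tv_vcomp \<alpha> (tv_id b) = \<alpha>"
    by (rule tv_eqI[OF tvhom_vcomp[OF assms tvhom_id] assms])
      (use perm_vcomp_right[OF assms perm_cell_id] d in simp)
qed

lemma tv_hcomp_id:
  assumes "dim_col a = dim_row b"
  shows "tv_hcomp (tv_id a) (tv_id b) = tv_id (a * b)"
  by (rule perm_cell_eqI[OF perm_cell_hcomp[OF perm_cell_id perm_cell_id assms] perm_cell_id])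
    (auto elim!: basis_pos_cases simp: assms)

lemma sum_single:
  fixes f :: "nat \<Rightarrow> complex"
  assumes "k < M" "\<And>l. l < M \<Longrightarrow> l \<noteq> k \<Longrightarrow> f l = 0"
  shows "(\<Sum>l<M. f l) = f k"
proof -
  have "(\<Sum>l<M. f l) = (\<Sum>l<M. if l = k then f k else 0)"
    by (rule sum.cong) (use assms in auto)
  then show ?thesis using assms(1) by simp
qed

text \<open>The sum over the middle basis runs over an intermediate index and two coordinates. The
  conditions in \<open>ent_hcomp\<close> leave one intermediate index, and the rest factors into the
  sums of the two vertical composites.\<close>

lemma tv_interchange:
  assumes "tvhom a b \<alpha>" "tvhom b c \<alpha>'" "tvhom a' b' \<beta>" "tvhom b' c' \<beta>'" "dim_col a = dim_row a'"
  shows "tv_hcomp (tv_vcomp \<alpha> \<alpha>') (tv_vcomp \<beta> \<beta>') = tv_vcomp (tv_hcomp \<alpha> \<beta>) (tv_hcomp \<alpha>' \<beta>')"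
proof -
  note d = tvhomD(3,4)[OF assms(1)] tvhomD(3,4)[OF assms(2)] tvhomD(3,4)[OF assms(3)]
    tvhomD(3,4)[OF assms(4)] assms(5)
  have m: "dim_col b = dim_row b'" using d by simp
  note v = tvhom_vcomp[OF assms(1,2)] tvhom_vcomp[OF assms(3,4)]
  note h = tvhom_hcomp[OF assms(1,3,5)] tvhom_hcomp[OF assms(2,4) m]
  show ?thesis
  proof (rule tv_eqI[OF tvhom_hcomp[OF v assms(5)] tvhom_vcomp[OF h]])
    fix i j x y assume "i < dim_row (a * a')" "j < dim_col (a * a')"
      and x: "x < (a * a') $$ (i, j)" and y: "y < (c * c') $$ (i, j)"
    then have ij: "i < dim_row a" "j < dim_col a'" by simp_all
    then have ijb: "i < dim_row b" "j < dim_col b'" using d by simp_all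
    obtain k p q where 1: "k < dim_col a" "p < a $$ (i, k)" "q < a' $$ (k, j)" "x = basis_pos a a' i j k p q"
      by (rule basis_pos_cases[OF x ij assms(5)])
    obtain l r s where 2: "l < dim_col a" "r < c $$ (i, l)" "s < c' $$ (l, j)" "y = basis_pos c c' i j l r s"
      by (rule basis_pos_cases[OF y]) (use d ij in simp_all)
    have l: "l < dim_col b" using 2 d by simp
    let ?f = "\<lambda>m p' q'. (if k = m then ent \<alpha> i k p p' * ent \<beta> k j q q' else 0) *
        (if m = l then ent \<alpha>' i m p' r * ent \<beta>' m j q' s else 0)"
    have e1: "ent (tv_hcomp \<alpha> \<beta>) i j x (basis_pos b b' i j m p' q')
        = (if k = m then ent \<alpha> i k p p' * ent \<beta> k j q q' else 0)"
      if "m < dim_col b" "p' < b $$ (i, m)" "q' < b' $$ (m, j)" for m p' q'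
      unfolding 1(4) by (rule ent_hcomp[OF assms(1,3,5)]) (use that ij 1 d in simp_all)
    have e2: "ent (tv_hcomp \<alpha>' \<beta>') i j (basis_pos b b' i j m p' q') y
        = (if m = l then ent \<alpha>' i m p' r * ent \<beta>' m j q' s else 0)"
      if "m < dim_col b" "p' < b $$ (i, m)" "q' < b' $$ (m, j)" for m p' q'
      unfolding 2(4) by (rule ent_hcomp[OF assms(2,4) m]) (use that ijb l 2 d in simp_all)
    have "ent (tv_vcomp (tv_hcomp \<alpha> \<beta>) (tv_hcomp \<alpha>' \<beta>')) i j x y
      = (\<Sum>z<(b * b') $$ (i, j). ent (tv_hcomp \<alpha> \<beta>) i j x z * ent (tv_hcomp \<alpha>' \<beta>') i j z y)"
      by (rule ent_vcomp[OF h]) (use ij x y in simp_all)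
    also have "\<dots> = (\<Sum>m<dim_col b. \<Sum>p'<b $$ (i, m). \<Sum>q'<b' $$ (m, j). ?f m p' q')"
      unfolding sum_basis_pos[OF ijb m] by (intro sum.cong refl) (simp add: e1 e2)
    also have "\<dots> = (\<Sum>p'<b $$ (i, k). \<Sum>q'<b' $$ (k, j). ?f k p' q')"
      by (rule sum_single) (use 1 d in auto)
    also have "\<dots> = (if k = l then (\<Sum>p'<b $$ (i, k). ent \<alpha> i k p p' * ent \<alpha>' i k p' r)
        * (\<Sum>q'<b' $$ (k, j). ent \<beta> k j q q' * ent \<beta>' k j q' s) else 0)"
      by (simp add: sum_product mult.commute mult.left_commute)
    also have "\<dots> = (if k = l then ent (tv_vcomp \<alpha> \<alpha>') i k p r * ent (tv_vcomp \<beta> \<beta>') k j q s else 0)"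
      using ent_vcomp[OF assms(1,2), of i k p r] ent_vcomp[OF assms(3,4), of k j q s] 1 2 d ij by auto
    also have "\<dots> = ent (tv_hcomp (tv_vcomp \<alpha> \<alpha>') (tv_vcomp \<beta> \<beta>')) i j x y"
      unfolding 1(4) 2(4) by (rule ent_hcomp[OF v assms(5), symmetric]) (use ij 1 2 in simp_all)
    finally show "ent (tv_hcomp (tv_vcomp \<alpha> \<alpha>') (tv_vcomp \<beta> \<beta>')) i j x y
      = ent (tv_vcomp (tv_hcomp \<alpha> \<beta>) (tv_hcomp \<alpha>' \<beta>')) i j x y" ..
  qed
qed

text \<open>The associator is moved out by \<open>perm_vcomp_right\<close> on one side and by
  \<open>perm_vcomp_left\<close> on the other. In coordinates, what remains is on both sides the
  same product of three entries under the same conditions on j and k.\<close>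

lemma tv_assoc_nat:
  assumes "tvhom a a' \<alpha>" "tvhom b b' \<beta>" "tvhom c c' \<gamma>" "dim_col a = dim_row b" "dim_col b = dim_row c"
  shows "tv_vcomp (tv_hcomp (tv_hcomp \<alpha> \<beta>) \<gamma>) (tv_assoc a' b' c')
    = tv_vcomp (tv_assoc a b c) (tv_hcomp \<alpha> (tv_hcomp \<beta> \<gamma>))"
proof -
  note d = tvhomD(3,4)[OF assms(1)] tvhomD(3,4)[OF assms(2)] tvhomD(3,4)[OF assms(3)] assms(4,5)
  have m: "dim_col a' = dim_row b'" "dim_col b' = dim_row c'" "dim_col (a * b) = dim_row c"
    "dim_col a = dim_row (b * c)"
    using d by simp_all
  note ab = tvhom_hcomp[OF assms(1,2,4)] and bc = tvhom_hcomp[OF assms(2,3,5)]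
  note L = tvhom_hcomp[OF ab assms(3) m(3)] and R = tvhom_hcomp[OF assms(1) bc m(4)]
  note p = perm_cell_assoc[OF assms(4,5)] and p' = perm_cell_assoc[OF m(1,2)]
  show ?thesis
  proof (rule tv_eqI[OF tvhom_vcomp[OF L perm_cellD(1)[OF p']] tvhom_vcomp[OF perm_cellD(1)[OF p] R]])
    fix i l x y assume "i < dim_row (a * b * c)" "l < dim_col (a * b * c)"
      and x: "x < (a * b * c) $$ (i, l)" and y: "y < (a' * (b' * c')) $$ (i, l)"
    then have il: "i < dim_row a" "l < dim_col c" "i < dim_row a'" "l < dim_col c'" using d by simp_all
    obtain j k r q s where 1: "j < dim_col a" "k < dim_col b" "r < a $$ (i, j)" "q < b $$ (j, k)"
      "s < c $$ (k, l)" "x = basis_pos (a * b) c i l k (basis_pos a b i k j r q) s"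
      by (rule basis_pos_cases_left[OF x]) (use il d in simp_all)
    obtain j' k' r' q' s' where 2: "j' < dim_col a" "k' < dim_col b" "r' < a' $$ (i, j')" "q' < b' $$ (j', k')"
      "s' < c' $$ (k', l)" "y = basis_pos a' (b' * c') i l j' r' (basis_pos b' c' j' l k' q' s')"
      by (rule basis_pos_cases_right[OF y]) (use il d in simp_all)
    let ?y = "basis_pos (a' * b') c' i l k' (basis_pos a' b' i k' j' r' q') s'"
    let ?x = "basis_pos a (b * c) i l j r (basis_pos b c j l k q s)"
    have y': "y = assoc_perm a' b' c' i l ?y" "?y < (a' * b' * c') $$ (i, l)"
      and x': "assoc_perm a b c i l x = ?x"
      using 1 2 d il by (simp_all add: basis_pos_less)
    have bd: "basis_pos a b i k j r q < (a * b) $$ (i, k)" "basis_pos b c j l k q s < (b * c) $$ (j, l)"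
      "basis_pos a' b' i k' j' r' q' < (a' * b') $$ (i, k')" "basis_pos b' c' j' l k' q' s' < (b' * c') $$ (j', l)"
      using 1 2 d il by (simp_all add: basis_pos_less)
    have "ent (tv_vcomp (tv_hcomp (tv_hcomp \<alpha> \<beta>) \<gamma>) (tv_assoc a' b' c')) i l x y
      = ent (tv_hcomp (tv_hcomp \<alpha> \<beta>) \<gamma>) i l x ?y"
      unfolding y'(1) by (rule perm_vcomp_right[OF L p']) (use il x y' in simp_all)
    also have "\<dots> = (if k = k' then ent (tv_hcomp \<alpha> \<beta>) i k (basis_pos a b i k j r q) (basis_pos a' b' i k' j' r' q')
        * ent \<gamma> k l s s' else 0)"
      unfolding 1(6) by (rule ent_hcomp[OF ab assms(3) m(3)]) (use il 1 2 bd in simp_all)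
    also have "\<dots> = (if k = k' \<and> j = j' then ent \<alpha> i j r r' * (ent \<beta> j k q q' * ent \<gamma> k l s s') else 0)"
      using ent_hcomp[OF assms(1,2,4), of i k j r q j' r' q'] 1 2 il d by auto
    also have "\<dots> = (if j = j' then ent \<alpha> i j r r'
        * ent (tv_hcomp \<beta> \<gamma>) j l (basis_pos b c j l k q s) (basis_pos b' c' j' l k' q' s') else 0)"
      using ent_hcomp[OF assms(2,3,5), of j l k q s k' q' s'] 1 2 il d by auto
    also have "\<dots> = ent (tv_hcomp \<alpha> (tv_hcomp \<beta> \<gamma>)) i l ?x y"
      unfolding 2(6) by (rule ent_hcomp[OF assms(1) bc m(4), symmetric]) (use il 1 2 bd in simp_all)
    also have "\<dots> = ent (tv_vcomp (tv_assoc a b c) (tv_hcomp \<alpha> (tv_hcomp \<beta> \<gamma>))) i l x y"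
      unfolding x'[symmetric] by (rule perm_vcomp_left[OF p R, symmetric]) (use il x y in simp_all)
    finally show "ent (tv_vcomp (tv_hcomp (tv_hcomp \<alpha> \<beta>) \<gamma>) (tv_assoc a' b' c')) i l x y
      = ent (tv_vcomp (tv_assoc a b c) (tv_hcomp \<alpha> (tv_hcomp \<beta> \<gamma>))) i l x y" .
  qed
qed

text \<open>Both sides re-encode the same seven coordinates of a basis element of the fourfold
  composite, namely j, k, l and p, q, s, t, into the fully right-nested position.\<close>

lemma tv_pentagon:
  assumes [simp]: "dim_col a = dim_row b" "dim_col b = dim_row c" "dim_col c = dim_row d"
  shows "tv_vcomp (tv_vcomp (tv_hcomp (tv_assoc a b c) (tv_id d)) (tv_assoc a (b * c) d))
      (tv_hcomp (tv_id a) (tv_assoc b c d))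
    = tv_vcomp (tv_assoc (a * b) c d) (tv_assoc a b (c * d))"
proof -
  have L: "perm_cell (tv_hcomp (tv_assoc a b c) (tv_id d)) (a * b * c * d) (a * (b * c) * d)
      (hperm (a * b * c) d (a * (b * c)) d (assoc_perm a b c) (\<lambda>i j x. x))"
    "perm_cell (tv_assoc a (b * c) d) (a * (b * c) * d) (a * (b * c * d)) (assoc_perm a (b * c) d)"
    "perm_cell (tv_hcomp (tv_id a) (tv_assoc b c d)) (a * (b * c * d)) (a * (b * (c * d)))
      (hperm a (b * c * d) a (b * (c * d)) (\<lambda>i j x. x) (assoc_perm b c d))"
    by (intro perm_cell_hcomp perm_cell_assoc perm_cell_id; simp)+
  have R: "perm_cell (tv_assoc (a * b) c d) (a * b * c * d) (a * b * (c * d)) (assoc_perm (a * b) c d)"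
    "perm_cell (tv_assoc a b (c * d)) (a * b * (c * d)) (a * (b * (c * d))) (assoc_perm a b (c * d))"
    by (intro perm_cell_assoc; simp)+
  show ?thesis
  proof (rule perm_cell_eqI[OF perm_cell_vcomp[OF perm_cell_vcomp[OF L(1,2)] L(3)] perm_cell_vcomp[OF R]])
    fix i m x assume "i < dim_row (a * b * c * d)" "m < dim_col (a * b * c * d)"
      and x: "x < (a * b * c * d) $$ (i, m)"
    then have im [simp]: "i < dim_row a" "m < dim_col d" by simp_all
    obtain l z t where 1: "l < dim_col (a * b * c)" "z < (a * b * c) $$ (i, l)" "t < d $$ (l, m)"
      "x = basis_pos (a * b * c) d i m l z t"
      by (rule basis_pos_cases[OF x]) simp_all
    obtain j k p q s where 2: "j < dim_col a" "k < dim_col b" "p < a $$ (i, j)" "q < b $$ (j, k)"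
      "s < c $$ (k, l)" "z = basis_pos (a * b) c i l k (basis_pos a b i k j p q) s"
      by (rule basis_pos_cases_left[OF 1(2)]) (use 1 in simp_all)
    show "hperm a (b * c * d) a (b * (c * d)) (\<lambda>i j x. x) (assoc_perm b c d) i m
         (assoc_perm a (b * c) d i m
           (hperm (a * b * c) d (a * (b * c)) d (assoc_perm a b c) (\<lambda>i j x. x) i m x))
      = assoc_perm a b (c * d) i m (assoc_perm (a * b) c d i m x)"
      using 1 2 by (simp add: basis_pos_less)
  qed
qed

text \<open>The entries of the identity matrix before the diagonal vanish, so no offset precedes the
  block of the intermediate index i, and that block has the size of the remaining factor. This is
  why units are strict.\<close>

lemma basis_pos_unit_left: "i < N \<Longrightarrow> basis_pos (1\<^sub>m N) a i j i 0 x = x"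
  by (simp add: basis_pos_def)

lemma basis_pos_unit_right:
  assumes "j < dim_col a"
  shows "basis_pos a (1\<^sub>m (dim_col a)) i j j p 0 = p"
proof -
  have "(\<Sum>k<j. a $$ (i, k) * 1\<^sub>m (dim_col a) $$ (k, j)) = 0"
    using assms by (intro sum.neutral) auto
  then show ?thesis using assms by (simp add: basis_pos_def)
qed

lemma tv_mult_unit [simp]: "dim_row a = N \<Longrightarrow> 1\<^sub>m N * a = a" "dim_col a = N \<Longrightarrow> a * 1\<^sub>m N = (a :: nat mat)"
  by (auto intro: left_mult_one_mat' right_mult_one_mat')

lemma tv_hcomp_unit_left:
  assumes "tvhom a b \<alpha>" "dim_row a = N"
  shows "tv_hcomp (tv_id (1\<^sub>m N)) \<alpha> = \<alpha>"
proof (rule tv_eqI[OF _ assms(1)])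
  note d = tvhomD(3,4)[OF assms(1)]
  show "tvhom a b (tv_hcomp (tv_id (1\<^sub>m N)) \<alpha>)"
    using tvhom_hcomp[OF tvhom_id[of "1\<^sub>m N"] assms(1)] assms(2) d by simp
  fix i j x y assume *: "i < dim_row a" "j < dim_col a" "x < a $$ (i, j)" "y < b $$ (i, j)"
  then show "ent (tv_hcomp (tv_id (1\<^sub>m N)) \<alpha>) i j x y = ent \<alpha> i j x y"
    using ent_hcomp[OF tvhom_id[of "1\<^sub>m N"] assms(1), of i j i 0 x i 0 y] assms(2)
    by (simp add: basis_pos_unit_left)
qed

lemma tv_hcomp_unit_right:
  assumes "tvhom a b \<alpha>" "dim_col a = N"
  shows "tv_hcomp \<alpha> (tv_id (1\<^sub>m N)) = \<alpha>"
proof (rule tv_eqI[OF _ assms(1)])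
  note d = tvhomD(3,4)[OF assms(1)]
  show "tvhom a b (tv_hcomp \<alpha> (tv_id (1\<^sub>m N)))"
    using tvhom_hcomp[OF assms(1) tvhom_id[of "1\<^sub>m N"]] assms(2) d by simp
  fix i j x y assume *: "i < dim_row a" "j < dim_col a" "x < a $$ (i, j)" "y < b $$ (i, j)"
  then show "ent (tv_hcomp \<alpha> (tv_id (1\<^sub>m N))) i j x y = ent \<alpha> i j x y"
    using ent_hcomp[OF assms(1) tvhom_id[of "1\<^sub>m N"], of i j j x 0 j y 0] assms(2)
      basis_pos_unit_right[of j a i x] basis_pos_unit_right[of j b i y] d
    by simp
qed

text \<open>The middle unit contributes one admissible intermediate index with a one-element basis,
  so both encodings give the position in the twofold composite.\<close>

lemma tv_triangle:
  assumes [simp]: "dim_row b = dim_col a"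
  shows "tv_assoc a (1\<^sub>m (dim_col a)) b = tv_id (a * b)"
proof -
  have p: "perm_cell (tv_assoc a (1\<^sub>m (dim_col a)) b) (a * b) (a * b) (assoc_perm a (1\<^sub>m (dim_col a)) b)"
    using perm_cell_assoc[of a "1\<^sub>m (dim_col a)" b] by simp
  show ?thesis
  proof (rule perm_cell_eqI[OF p perm_cell_id])
    fix i l x assume "i < dim_row (a * b)" "l < dim_col (a * b)" and x: "x < (a * b) $$ (i, l)"
    then have il: "i < dim_row a" "l < dim_col b" by simp_all
    obtain k r s where 1: "k < dim_col a" "r < a $$ (i, k)" "s < b $$ (k, l)" "x = basis_pos a b i l k r s"
      by (rule basis_pos_cases[OF x il]) simp_all
    then show "assoc_perm a (1\<^sub>m (dim_col a)) b i l x = x"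
      using assoc_perm_pos[of i a "1\<^sub>m (dim_col a)" k k r 0 s b l] il
      by (simp add: basis_pos_unit_left basis_pos_unit_right)
  qed
qed

lemma su_bicat_TwoVect: "su_bicat TwoVect"
proof -
  note [simp] = hom1_def hom2_TwoVect composable_def tvhom_id tv_hcomp_id
  have t: "tvhom (map_mat dim_row \<alpha>) (map_mat dim_col \<alpha>) \<alpha>" for \<alpha> by (simp add: tvhom_def)
  show ?thesis
  proof (intro su_bicat.intro bicategory.intro su_bicat_axioms.intro, goal_cases)
    case 9 then show ?case by (auto intro: tvhom_vcomp)
  next
    case 10 then show ?case by (auto intro: tv_vcomp_assoc)
  next
    case 11 then show ?case by (auto intro: tv_vcomp_id)
  next
    case 12 then show ?case by (auto intro: tv_vcomp_id)
  next
    case 14 then show ?case by (auto intro: tvhom_hcomp)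
  next
    case 16 then show ?case by (auto intro: tv_interchange)
  next
    case 17 then show ?case by (auto intro: perm_cellD(1)[OF perm_cell_assoc])
  next
    case 18 then show ?case by (auto intro: perm_cell_invertible[OF perm_cell_assoc])
  next
    case 19 then show ?case by (auto intro: tv_assoc_nat)
  next
    case 21 then show ?case by (auto intro: perm_cell_invertible[OF perm_cell_id])
  next
    case 22 then show ?case by (auto simp: tv_hcomp_unit_left tv_vcomp_id)
  next
    case 24 then show ?case by (auto intro: perm_cell_invertible[OF perm_cell_id])
  next
    case (25 \<alpha> f g X Y) then show ?case
      using tv_hcomp_unit_right[of f g \<alpha> Y] by (auto simp: tv_vcomp_id)
  next
    case 26 then show ?case by (auto simp: tv_pentagon)
  next
    case 27 then show ?case by (auto simp: tv_triangle tv_vcomp_id[OF tvhom_id])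
  qed auto
qed

section \<open>The monoidal product of 2-vector spaces\<close>

text \<open>The lexicographic encoding of a triple of indices is the same number for both
  bracketings, as \<open>x'\<close> and \<open>y'\<close> record; hence Kronecker products associate
  on the nose.\<close>

lemma kron_by_assoc:
  assumes "\<And>x y z. f (f x y) z = f x (f y z)"
  shows "kron_by f (kron_by f A B) C = kron_by f A (kron_by f B C)"
proof (rule eq_matI)
  fix x y assume "x < dim_row (kron_by f A (kron_by f B C))" "y < dim_col (kron_by f A (kron_by f B C))"
  then have x: "x < dim_row A * (dim_row B * dim_row C)" and y: "y < dim_col A * (dim_col B * dim_col C)"
    by (simp_all add: kron_by_def)
  obtain i jk where i: "i < dim_row A" "jk < dim_row B * dim_row C" "x = i * (dim_row B * dim_row C) + jk"
    by (rule pair_decomp[OF x])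
  obtain j k where j: "j < dim_row B" "k < dim_row C" "jk = j * dim_row C + k"
    by (rule pair_decomp[OF i(2)])
  obtain i' jk' where i': "i' < dim_col A" "jk' < dim_col B * dim_col C" "y = i' * (dim_col B * dim_col C) + jk'"
    by (rule pair_decomp[OF y])
  obtain j' k' where j': "j' < dim_col B" "k' < dim_col C" "jk' = j' * dim_col C + k'"
    by (rule pair_decomp[OF i'(2)])
  have x': "x = (i * dim_row B + j) * dim_row C + k" and y': "y = (i' * dim_col B + j') * dim_col C + k'"
    by (simp_all add: i j i' j' algebra_simps)
  have "kron_by f A (kron_by f B C) $$ (x, y) = f (A $$ (i, i')) (f (B $$ (j, j')) (C $$ (k, k')))"
    unfolding i(3) i'(3) using i j i' j' pair_less by (simp add: kron_by_def)
  moreover have "kron_by f (kron_by f A B) C $$ (x, y) = f (f (A $$ (i, i')) (B $$ (j, j'))) (C $$ (k, k'))"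
    unfolding x' y' using i j i' j' by (simp add: kron_by_def pair_less)
  ultimately show "kron_by f (kron_by f A B) C $$ (x, y) = kron_by f A (kron_by f B C) $$ (x, y)"
    using assms by simp
qed (simp_all add: kron_by_def)

lemma kron_dims [simp]: "dim_row (kron_by f a b) = dim_row a * dim_row b"
  "dim_col (kron_by f a b) = dim_col a * dim_col b"
  by (simp_all add: kron_by_def)

text \<open>Dimensions enter through equations with R and C, so that the rule still matches after
  they have been simplified. \<open>kron_perm_pos\<close> and \<open>tens_perm_pos\<close> use the
  same device.\<close>

lemma kron_index [simp]:
  "i < dim_row a \<Longrightarrow> j < R \<Longrightarrow> k < dim_col a \<Longrightarrow> l < C \<Longrightarrow> dim_row b = R \<Longrightarrow> dim_col b = C \<Longrightarrow>
    kron_by f a b $$ (i * R + j, k * C + l) = f (a $$ (i, k)) (b $$ (j, l))"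
  by (auto simp: kron_by_def pair_less)

lemma kron_assoc: "kron (kron a b) c = kron a (kron b (c :: 'a :: semigroup_mult mat))"
  by (rule kron_by_assoc) (simp add: mult.assoc)

text \<open>Associativity is used at two levels: that of entries, as \<open>kron_assoc\<close>,
  feeds the general rule for the outer matrices.\<close>

lemma tv_tens2_assoc: "tv_tens2 (tv_tens2 \<alpha> \<beta>) \<gamma> = tv_tens2 \<alpha> (tv_tens2 \<beta> \<gamma>)"
  unfolding tv_tens2_def by (rule kron_by_assoc) (rule kron_assoc)

lemma kron_one: "kron (1\<^sub>m N) (1\<^sub>m M) = (1\<^sub>m (N * M) :: 'a :: semiring_1 mat)"
proof (rule eq_matI)
  fix x y assume "x < dim_row (1\<^sub>m (N * M) :: 'a mat)" "y < dim_col (1\<^sub>m (N * M) :: 'a mat)"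
  then have "x < N * M" "y < N * M" by simp_all
  then obtain i j k l where "i < N" "j < M" "x = i * M + j" "k < N" "l < M" "y = k * M + l"
    by (metis pair_decomp)
  then show "kron (1\<^sub>m N) (1\<^sub>m M) $$ (x, y) = (1\<^sub>m (N * M) :: 'a mat) $$ (x, y)"
    using pair_unique[of i M j k l] by (auto simp: pair_less)
qed simp_all

lemma kron_unit: "kron (1\<^sub>m 1) a = (a :: 'a :: semiring_1 mat)" "kron a (1\<^sub>m 1) = a"
  by (rule eq_matI; simp add: kron_by_def)+

text \<open>Entries \<open>(u, v)\<close> of \<^const>\<open>tv_tens2\<close> are indexed by \<open>u = i * R + j\<close> and \<open>v = k * C + l\<close>.\<close>

lemma tvhom_tens2:
  assumes "tvhom a a' \<alpha>" "tvhom b b' \<beta>"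
  shows "tvhom (kron a b) (kron a' b') (tv_tens2 \<alpha> \<beta>)"
proof -
  note d = tvhomD[OF assms(1)] tvhomD[OF assms(2)]
  show ?thesis
  proof (rule tvhomI)
    fix u v assume "u < dim_row (kron a b)" "v < dim_col (kron a b)"
    then have "u < dim_row a * dim_row b" "v < dim_col a * dim_col b" by simp_all
    then obtain i j k l where uv: "i < dim_row a" "j < dim_row b" "u = i * dim_row b + j"
      "k < dim_col a" "l < dim_col b" "v = k * dim_col b + l"
      by (metis pair_decomp)
    show "dim_row (tv_tens2 \<alpha> \<beta> $$ (u, v)) = kron a b $$ (u, v)"
      unfolding uv tv_tens2_def using uv d by simp
    show "dim_col (tv_tens2 \<alpha> \<beta> $$ (u, v)) = kron a' b' $$ (u, v)"
      unfolding uv tv_tens2_def using uv d by simp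
  qed (use d in \<open>simp_all add: tv_tens2_def\<close>)
qed

lemma ent_tens2:
  assumes "tvhom a a' \<alpha>" "tvhom b b' \<beta>" "i < dim_row a" "j < dim_row b" "k < dim_col a" "l < dim_col b"
    "p < a $$ (i, k)" "q < b $$ (j, l)" "p' < a' $$ (i, k)" "q' < b' $$ (j, l)"
  shows "ent (tv_tens2 \<alpha> \<beta>) (i * dim_row b + j) (k * dim_col b + l) (p * b $$ (j, l) + q) (p' * b' $$ (j, l) + q')
    = ent \<alpha> i k p p' * ent \<beta> j l q q'"
  using tvhomD[OF assms(1)] tvhomD[OF assms(2)] assms(3-) by (simp add: tv_tens2_def)

lemma sum_pair:
  fixes f :: "nat \<Rightarrow> 'a :: comm_monoid_add"
  shows "(\<Sum>z<m * n. f z) = (\<Sum>p<m. \<Sum>q<n. f (p * n + q))"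
proof (induct m)
  case (Suc m)
  have "(\<Sum>z<a + n. f z) = (\<Sum>z<a. f z) + (\<Sum>q<n. f (a + q))" for a
    by (induct n) (simp_all add: add.assoc)
  from this[of "m * n"] Suc show ?case by (simp add: add.commute)
qed simp

text \<open>The mixed-product rule for Kronecker products in each entry: the sum over the middle
  pair of indices factors into two sums.\<close>

lemma tv_tens2_vcomp:
  assumes "tvhom a b \<alpha>" "tvhom b c \<alpha>'" "tvhom a' b' \<beta>" "tvhom b' c' \<beta>'"
  shows "tv_tens2 (tv_vcomp \<alpha> \<alpha>') (tv_vcomp \<beta> \<beta>') = tv_vcomp (tv_tens2 \<alpha> \<beta>) (tv_tens2 \<alpha>' \<beta>')"
proof -
  note d = tvhomD(3,4)[OF assms(1)] tvhomD(3,4)[OF assms(2)] tvhomD(3,4)[OF assms(3)] tvhomD(3,4)[OF assms(4)]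
  note v = tvhom_vcomp[OF assms(1,2)] tvhom_vcomp[OF assms(3,4)]
  note h = tvhom_tens2[OF assms(1,3)] tvhom_tens2[OF assms(2,4)]
  show ?thesis
  proof (rule tv_eqI[OF tvhom_tens2[OF v] tvhom_vcomp[OF h]])
    fix u w x y assume "u < dim_row (kron a a')" "w < dim_col (kron a a')"
      and x: "x < kron a a' $$ (u, w)" and y: "y < kron c c' $$ (u, w)"
    then have "u < dim_row a * dim_row a'" "w < dim_col a * dim_col a'" by simp_all
    then obtain i j k l where uw: "i < dim_row a" "j < dim_row a'" "u = i * dim_row a' + j"
      "k < dim_col a" "l < dim_col a'" "w = k * dim_col a' + l"
      by (metis pair_decomp)
    have kr: "kron a a' $$ (u, w) = a $$ (i, k) * a' $$ (j, l)" "kron b b' $$ (u, w) = b $$ (i, k) * b' $$ (j, l)"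
      "kron c c' $$ (u, w) = c $$ (i, k) * c' $$ (j, l)"
      unfolding uw using uw d by simp_all
    obtain p q where x': "p < a $$ (i, k)" "q < a' $$ (j, l)" "x = p * a' $$ (j, l) + q"
      by (rule pair_decomp) (use x kr in simp)
    obtain r s where y': "r < c $$ (i, k)" "s < c' $$ (j, l)" "y = r * c' $$ (j, l) + s"
      by (rule pair_decomp) (use y kr in simp)
    have e1: "ent (tv_tens2 \<alpha> \<beta>) u w x (p' * b' $$ (j, l) + q') = ent \<alpha> i k p p' * ent \<beta> j l q q'"
      if "p' < b $$ (i, k)" "q' < b' $$ (j, l)" for p' q'
      unfolding uw x' by (rule ent_tens2[OF assms(1,3)]) (use that uw x' in simp_all)
    have e2: "ent (tv_tens2 \<alpha>' \<beta>') u w (p' * b' $$ (j, l) + q') y = ent \<alpha>' i k p' r * ent \<beta>' j l q' s"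
      if "p' < b $$ (i, k)" "q' < b' $$ (j, l)" for p' q'
      using ent_tens2[OF assms(2,4), of i j k l p' q' r s] that uw y' d by simp
    have "ent (tv_vcomp (tv_tens2 \<alpha> \<beta>) (tv_tens2 \<alpha>' \<beta>')) u w x y
      = (\<Sum>z<kron b b' $$ (u, w). ent (tv_tens2 \<alpha> \<beta>) u w x z * ent (tv_tens2 \<alpha>' \<beta>') u w z y)"
      by (rule ent_vcomp[OF h]) (use uw x y pair_less in simp_all)
    also have "\<dots> = (\<Sum>p'<b $$ (i, k). \<Sum>q'<b' $$ (j, l).
        (ent \<alpha> i k p p' * ent \<beta> j l q q') * (ent \<alpha>' i k p' r * ent \<beta>' j l q' s))"
      unfolding kr sum_pair by (intro sum.cong refl) (simp add: e1 e2)
    also have "\<dots> = (\<Sum>p'<b $$ (i, k). ent \<alpha> i k p p' * ent \<alpha>' i k p' r)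
        * (\<Sum>q'<b' $$ (j, l). ent \<beta> j l q q' * ent \<beta>' j l q' s)"
      by (simp add: sum_product mult.commute mult.left_commute)
    also have "\<dots> = ent (tv_vcomp \<alpha> \<alpha>') i k p r * ent (tv_vcomp \<beta> \<beta>') j l q s"
      using ent_vcomp[OF assms(1,2), of i k p r] ent_vcomp[OF assms(3,4), of j l q s] uw x' y' by simp
    also have "\<dots> = ent (tv_tens2 (tv_vcomp \<alpha> \<alpha>') (tv_vcomp \<beta> \<beta>')) u w x y"
      unfolding uw x' y' by (rule ent_tens2[OF v, symmetric]) (use uw x' y' in simp_all)
    finally show "ent (tv_tens2 (tv_vcomp \<alpha> \<alpha>') (tv_vcomp \<beta> \<beta>')) u w x y
      = ent (tv_vcomp (tv_tens2 \<alpha> \<beta>) (tv_tens2 \<alpha>' \<beta>')) u w x y" ..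
  qed
qed

lemma tv_tens2_id: "tv_tens2 (tv_id a) (tv_id b) = tv_id (kron a b)"
proof (rule eq_matI)
  fix u v assume "u < dim_row (tv_id (kron a b))" "v < dim_col (tv_id (kron a b))"
  then have "u < dim_row a * dim_row b" "v < dim_col a * dim_col b" by simp_all
  then obtain i j k l where "i < dim_row a" "j < dim_row b" "u = i * dim_row b + j"
    "k < dim_col a" "l < dim_col b" "v = k * dim_col b + l"
    by (metis pair_decomp)
  then show "tv_tens2 (tv_id a) (tv_id b) $$ (u, v) = tv_id (kron a b) $$ (u, v)"
    by (simp add: tv_tens2_def kron_one pair_less)
qed (simp_all add: tv_tens2_def)

lemma tv_tens2_unit: "tv_tens2 (tv_id (1\<^sub>m 1)) \<alpha> = \<alpha>" "tv_tens2 \<alpha> (tv_id (1\<^sub>m 1)) = \<alpha>"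
proof -
  have *: "tv_id (1\<^sub>m 1) $$ (0, 0) = 1\<^sub>m 1" by simp
  show "tv_tens2 (tv_id (1\<^sub>m 1)) \<alpha> = \<alpha>" "tv_tens2 \<alpha> (tv_id (1\<^sub>m 1)) = \<alpha>"
    by (rule eq_matI; simp add: tv_tens2_def kron_by_def[of kron] kron_unit[unfolded One_nat_def])+
qed

text \<open>In the pair encoding \<phi> acts on the leading digit and \<psi> on the trailing one;
  div and mod only recover the digits.\<close>

definition kron_perm :: "nat mat \<Rightarrow> nat mat \<Rightarrow> (nat \<Rightarrow> nat \<Rightarrow> nat \<Rightarrow> nat) \<Rightarrow> (nat \<Rightarrow> nat \<Rightarrow> nat \<Rightarrow> nat)
    \<Rightarrow> nat \<Rightarrow> nat \<Rightarrow> nat \<Rightarrow> nat" where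
  "kron_perm b b' \<phi> \<psi> u v x = (let i = u div dim_row b; j = u mod dim_row b; k = v div dim_col b;
     l = v mod dim_col b in \<phi> i k (x div b $$ (j, l)) * b' $$ (j, l) + \<psi> j l (x mod b $$ (j, l)))"

lemma kron_perm_pos [simp]:
  "j < R \<Longrightarrow> l < C \<Longrightarrow> q < n \<Longrightarrow> dim_row b = R \<Longrightarrow> dim_col b = C \<Longrightarrow> b $$ (j, l) = n \<Longrightarrow>
    kron_perm b b' \<phi> \<psi> (i * R + j) (k * C + l) (p * n + q) = \<phi> i k p * b' $$ (j, l) + \<psi> j l q"
  by (auto simp: kron_perm_def)

lemma bij_betw_lessThanI:
  fixes f :: "nat \<Rightarrow> nat"
  assumes "\<And>x. x < m \<Longrightarrow> f x < n" "\<And>x y. x < m \<Longrightarrow> y < m \<Longrightarrow> f x = f y \<Longrightarrow> x = y"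
    "\<And>y. y < n \<Longrightarrow> \<exists>x<m. f x = y"
  shows "bij_betw f {..<m} {..<n}"
  unfolding bij_betw_def inj_on_def using assms by (auto simp: image_def) (metis lessThan_iff)

lemma perm_cell_tens2:
  assumes "perm_cell \<alpha> a a' \<phi>" "perm_cell \<beta> b b' \<psi>"
  shows "perm_cell (tv_tens2 \<alpha> \<beta>) (kron a b) (kron a' b') (kron_perm b b' \<phi> \<psi>)"
  unfolding perm_cell_def
proof (intro conjI allI impI)
  note h = perm_cellD(1)[OF assms(1)] perm_cellD(1)[OF assms(2)]
  note d = tvhomD(3,4)[OF h(1)] tvhomD(3,4)[OF h(2)]
  show "tvhom (kron a b) (kron a' b') (tv_tens2 \<alpha> \<beta>)" by (rule tvhom_tens2[OF h])
  fix u v assume "u < dim_row (kron a b)" "v < dim_col (kron a b)"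
  then have "u < dim_row a * dim_row b" "v < dim_col a * dim_col b" by simp_all
  then obtain i j k l where uv: "i < dim_row a" "j < dim_row b" "u = i * dim_row b + j"
    "k < dim_col a" "l < dim_col b" "v = k * dim_col b + l"
    by (metis pair_decomp)
  have kr: "kron a b $$ (u, v) = a $$ (i, k) * b $$ (j, l)" "kron a' b' $$ (u, v) = a' $$ (i, k) * b' $$ (j, l)"
    unfolding uv using uv d by simp_all
  have less: "\<phi> i k p < a' $$ (i, k)" "\<psi> j l q < b' $$ (j, l)" if "p < a $$ (i, k)" "q < b $$ (j, l)" for p q
    using perm_cellD(3)[OF assms(1)] perm_cellD(3)[OF assms(2)] that uv by simp_all
  have pos: "kron_perm b b' \<phi> \<psi> u v (p * b $$ (j, l) + q) = \<phi> i k p * b' $$ (j, l) + \<psi> j l q"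
    if "q < b $$ (j, l)" for p q
    unfolding uv using uv that by simp
  show "bij_betw (kron_perm b b' \<phi> \<psi> u v) {..<kron a b $$ (u, v)} {..<kron a' b' $$ (u, v)}"
    unfolding kr
  proof (rule bij_betw_lessThanI)
    fix x assume x: "x < a $$ (i, k) * b $$ (j, l)"
    obtain p q where 1: "p < a $$ (i, k)" "q < b $$ (j, l)" "x = p * b $$ (j, l) + q" by (rule pair_decomp[OF x])
    then show "kron_perm b b' \<phi> \<psi> u v x < a' $$ (i, k) * b' $$ (j, l)"
      by (simp add: pos less pair_less)
    fix y assume y: "y < a $$ (i, k) * b $$ (j, l)" and eq: "kron_perm b b' \<phi> \<psi> u v x = kron_perm b b' \<phi> \<psi> u v y"
    obtain r s where 2: "r < a $$ (i, k)" "s < b $$ (j, l)" "y = r * b $$ (j, l) + s" by (rule pair_decomp[OF y])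
    have "\<phi> i k p * b' $$ (j, l) + \<psi> j l q = \<phi> i k r * b' $$ (j, l) + \<psi> j l s"
      using eq 1 2 by (simp add: pos)
    then have "\<phi> i k p = \<phi> i k r \<and> \<psi> j l q = \<psi> j l s"
      by (rule pair_unique) (use less 1 2 in blast)+
    then show "x = y" using perm_cellD(5)[OF assms(1)] perm_cellD(5)[OF assms(2)] uv 1 2 by auto
  next
    fix y assume y: "y < a' $$ (i, k) * b' $$ (j, l)"
    obtain p' q' where 1: "p' < a' $$ (i, k)" "q' < b' $$ (j, l)" "y = p' * b' $$ (j, l) + q'"
      by (rule pair_decomp[OF y])
    obtain p where p: "p < a $$ (i, k)" "p' = \<phi> i k p"
      by (rule perm_cell_surj[OF assms(1) uv(1,4) 1(1)])
    obtain q where q: "q < b $$ (j, l)" "q' = \<psi> j l q"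
      by (rule perm_cell_surj[OF assms(2) uv(2,5) 1(2)])
    show "\<exists>x<a $$ (i, k) * b $$ (j, l). kron_perm b b' \<phi> \<psi> u v x = y"
      using 1 p q by (intro exI[of _ "p * b $$ (j, l) + q"]) (simp add: pos pair_less)
  qed
  fix x y assume x: "x < kron a b $$ (u, v)" and y: "y < kron a' b' $$ (u, v)"
  obtain p q where 1: "p < a $$ (i, k)" "q < b $$ (j, l)" "x = p * b $$ (j, l) + q"
    by (rule pair_decomp) (use x kr in simp)
  obtain r s where 2: "r < a' $$ (i, k)" "s < b' $$ (j, l)" "y = r * b' $$ (j, l) + s"
    by (rule pair_decomp) (use y kr in simp)
  have e: "ent (tv_tens2 \<alpha> \<beta>) u v x y = ent \<alpha> i k p r * ent \<beta> j l q s"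
    unfolding uv 1 2 by (rule ent_tens2[OF h]) (use uv 1 2 in simp_all)
  show "ent (tv_tens2 \<alpha> \<beta>) u v x y = (if y = kron_perm b b' \<phi> \<psi> u v x then 1 else 0)"
    unfolding e using 1 2 uv pos[of q p] less[of p q] perm_cellD(4)[OF assms(1), of i k p r]
      perm_cellD(4)[OF assms(2), of j l q s] pair_unique[of r "b' $$ (j, l)" s "\<phi> i k p" "\<psi> j l q"]
    by auto
qed

text \<open>The shuffle of the two middle tensor factors. The entry (u, v), the intermediate index
  and both positions are decoded into pairs and regrouped, with the digits of a and a' in front of
  those of b and b'.\<close>

definition tens_perm :: "nat mat \<Rightarrow> nat mat \<Rightarrow> nat mat \<Rightarrow> nat mat \<Rightarrow> nat \<Rightarrow> nat \<Rightarrow> nat \<Rightarrow> nat" where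
  "tens_perm a b a' b' u v x = (case basis_coords (kron a b) (kron a' b') u v x of (w, z, z') \<Rightarrow>
     let i = u div dim_row b; j = u mod dim_row b; k = v div dim_col b'; l = v mod dim_col b';
       m = w div dim_col b; n = w mod dim_col b in
     basis_pos a a' i k m (z div b $$ (j, n)) (z' div b' $$ (n, l)) * (b * b') $$ (j, l)
       + basis_pos b b' j l n (z mod b $$ (j, n)) (z' mod b' $$ (n, l)))"

lemma tens_perm_pos [simp]:
  assumes "i < dim_row a" "j < R" "k < dim_col a'" "l < C" "m < dim_col a" "n < D"
    "p < a $$ (i, m)" "q < e" "p' < a' $$ (m, k)" "q' < e'" "dim_row b = R" "dim_col b' = C" "dim_col b = D"
    "b $$ (j, n) = e" "b' $$ (n, l) = e'" "dim_col a = dim_row a'" "dim_row b' = D"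
  shows "tens_perm a b a' b' (i * R + j) (k * C + l)
      (basis_pos (kron a b) (kron a' b') (i * R + j) (k * C + l) (m * D + n) (p * e + q) (p' * e' + q'))
    = basis_pos a a' i k m p p' * (b * b') $$ (j, l) + basis_pos b b' j l n q q'"
proof -
  have "basis_coords (kron a b) (kron a' b') (i * R + j) (k * C + l)
      (basis_pos (kron a b) (kron a' b') (i * R + j) (k * C + l) (m * D + n) (p * e + q) (p' * e' + q'))
    = (m * D + n, p * e + q, p' * e' + q')"
    by (rule basis_coords_pos) (use assms in \<open>simp_all add: pair_less\<close>)
  with assms show ?thesis by (simp add: tens_perm_def)
qed

lemma kron_pos_less:
  assumes "i < dim_row a" "j < R" "k < dim_col a'" "l < C" "m < dim_col a" "n < D"
    "p < a $$ (i, m)" "q < e" "p' < a' $$ (m, k)" "q' < e'" "dim_row b = R" "dim_col b' = C" "dim_col b = D"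
    "b $$ (j, n) = e" "b' $$ (n, l) = e'" "dim_col a = dim_row a'" "dim_row b' = D"
  shows "basis_pos (kron a b) (kron a' b') (i * R + j) (k * C + l) (m * D + n) (p * e + q) (p' * e' + q')
    < (kron a b * kron a' b') $$ (i * R + j, k * C + l)"
  by (rule basis_pos_less) (use assms in \<open>simp_all add: pair_less\<close>)

lemma kron_pos_cases:
  assumes "x < (kron a b * kron a' b') $$ (i * dim_row b + j, k * dim_col b' + l)"
    "i < dim_row a" "j < dim_row b" "k < dim_col a'" "l < dim_col b'" "dim_col a = dim_row a'" "dim_col b = dim_row b'"
  obtains m n p q p' q' where "m < dim_col a" "n < dim_col b" "p < a $$ (i, m)" "q < b $$ (j, n)"
    "p' < a' $$ (m, k)" "q' < b' $$ (n, l)"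
    "x = basis_pos (kron a b) (kron a' b') (i * dim_row b + j) (k * dim_col b' + l) (m * dim_col b + n)
      (p * b $$ (j, n) + q) (p' * b' $$ (n, l) + q')"
proof -
  obtain w z z' where 1: "w < dim_col (kron a b)" "z < kron a b $$ (i * dim_row b + j, w)"
    "z' < kron a' b' $$ (w, k * dim_col b' + l)"
    "x = basis_pos (kron a b) (kron a' b') (i * dim_row b + j) (k * dim_col b' + l) w z z'"
    by (rule basis_pos_cases[OF assms(1)]) (use assms in \<open>simp_all add: pair_less\<close>)
  obtain m n where 2: "m < dim_col a" "n < dim_col b" "w = m * dim_col b + n"
    by (rule pair_decomp) (use 1 in simp)
  obtain p q where 3: "p < a $$ (i, m)" "q < b $$ (j, n)" "z = p * b $$ (j, n) + q"
    by (rule pair_decomp) (use 1 2 assms in simp)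
  obtain p' q' where 4: "p' < a' $$ (m, k)" "q' < b' $$ (n, l)" "z' = p' * b' $$ (n, l) + q'"
    by (rule pair_decomp) (use 1 2 assms in simp)
  show thesis by (rule that[OF 2(1,2) 3(1,2) 4(1,2)]) (simp add: 1 2 3 4)
qed

text \<open>Source and target bases have the same coordinates m, n, p, q, p', q', read in different
  orders; existence and uniqueness of the coordinates on either side give the bijection.\<close>

lemma perm_cell_tensorator:
  assumes [simp]: "dim_col a = dim_row a'" "dim_col b = dim_row b'"
  shows "perm_cell (tensorator a b a' b') (kron a b * kron a' b') (kron (a * a') (b * b')) (tens_perm a b a' b')"
  unfolding perm_cell_def
proof (intro conjI allI impI)
  show "tvhom (kron a b * kron a' b') (kron (a * a') (b * b')) (tensorator a b a' b')"
    by (rule tvhomI) (simp_all add: tensorator_def Let_def)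
  fix u v assume "u < dim_row (kron a b * kron a' b')" "v < dim_col (kron a b * kron a' b')"
  then have u: "u < dim_row a * dim_row b" and v: "v < dim_col a' * dim_col b'" by simp_all
  obtain i j where ij [simp]: "i < dim_row a" "j < dim_row b" "u = i * dim_row b + j"
    by (rule pair_decomp[OF u])
  obtain k l where kl [simp]: "k < dim_col a'" "l < dim_col b'" "v = k * dim_col b' + l"
    by (rule pair_decomp[OF v])
  let ?X = "(kron a b * kron a' b') $$ (u, v)" and ?Y = "kron (a * a') (b * b') $$ (u, v)"
  let ?e = "\<lambda>m n p q p' q'. basis_pos (kron a b) (kron a' b') u v (m * dim_col b + n)
      (p * b $$ (j, n) + q) (p' * b' $$ (n, l) + q')"
  let ?f = "\<lambda>m n p q p' q'. basis_pos a a' i k m p p' * (b * b') $$ (j, l) + basis_pos b b' j l n q q'"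
  let ?I = "\<lambda>m n p q p' q'. m < dim_col a \<and> n < dim_col b \<and> p < a $$ (i, m) \<and> q < b $$ (j, n) \<and>
    p' < a' $$ (m, k) \<and> q' < b' $$ (n, l)"
  have Y: "?Y = (a * a') $$ (i, k) * (b * b') $$ (j, l)" by simp
  have cases: thesis if "x < ?X" "\<And>m n p q p' q'. ?I m n p q p' q' \<Longrightarrow> x = ?e m n p q p' q' \<Longrightarrow> thesis" for x thesis
    using that(1) unfolding ij(3) kl(3)
    by (rule kron_pos_cases) (simp_all, rule that(2), simp_all)
  have pos: "tens_perm a b a' b' u v (?e m n p q p' q') = ?f m n p q p' q'" if "?I m n p q p' q'" for m n p q p' q'
    unfolding ij(3) kl(3) by (rule tens_perm_pos) (use that in simp_all)
  have less: "?e m n p q p' q' < ?X" "?f m n p q p' q' < ?Y" if "?I m n p q p' q'" for m n p q p' q'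
    unfolding Y using that
    by (auto intro!: pair_less basis_pos_less simp: kron_pos_less[where R = "dim_row b" and C = "dim_col b'"])
  \<comment> \<open>Digits are compared at two levels: the outer pair is separated first, then each
    \<open>basis_pos\<close>.\<close>
  have inj: "m = m2 \<and> n = n2 \<and> p = p2 \<and> q = q2 \<and> p' = p2' \<and> q' = q2'"
    if "?I m n p q p' q'" "?I m2 n2 p2 q2 p2' q2'" "?f m n p q p' q' = ?f m2 n2 p2 q2 p2' q2'"
    for m n p q p' q' m2 n2 p2 q2 p2' q2'
  proof -
    have "basis_pos a a' i k m p p' = basis_pos a a' i k m2 p2 p2' \<and> basis_pos b b' j l n q q' = basis_pos b b' j l n2 q2 q2'"
      by (rule pair_unique[OF that(3)]) (use that in \<open>simp_all add: basis_pos_less\<close>)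
    then show ?thesis using that by (simp add: basis_pos_eq_iff)
  qed
  show "bij_betw (tens_perm a b a' b' u v) {..<?X} {..<?Y}"
  proof (rule bij_betw_lessThanI)
    fix x assume x: "x < ?X"
    then show "tens_perm a b a' b' u v x < ?Y"
      by (rule cases) (simp only: pos less)
    fix y assume y: "y < ?X" and eq: "tens_perm a b a' b' u v x = tens_perm a b a' b' u v y"
    from x show "x = y"
    proof (rule cases)
      fix m n p q p' q' assume 1: "?I m n p q p' q'" "x = ?e m n p q p' q'"
      from y show ?thesis
      proof (rule cases)
        fix m2 n2 p2 q2 p2' q2' assume 2: "?I m2 n2 p2 q2 p2' q2'" "y = ?e m2 n2 p2 q2 p2' q2'"
        have "?f m n p q p' q' = ?f m2 n2 p2 q2 p2' q2'"
          using eq unfolding 1(2) 2(2) pos[OF 1(1)] pos[OF 2(1)] .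
        from inj[OF 1(1) 2(1) this] show "x = y" unfolding 1(2) 2(2) by simp
      qed
    qed
  next
    fix y assume "y < ?Y"
    then have y: "y < (a * a') $$ (i, k) * (b * b') $$ (j, l)" unfolding Y .
    obtain r s where 1: "r < (a * a') $$ (i, k)" "s < (b * b') $$ (j, l)" "y = r * (b * b') $$ (j, l) + s"
      by (rule pair_decomp[OF y])
    obtain m p p' where 2: "m < dim_col a" "p < a $$ (i, m)" "p' < a' $$ (m, k)" "r = basis_pos a a' i k m p p'"
      by (rule basis_pos_cases[OF 1(1)]) simp_all
    obtain n q q' where 3: "n < dim_col b" "q < b $$ (j, n)" "q' < b' $$ (n, l)" "s = basis_pos b b' j l n q q'"
      by (rule basis_pos_cases[OF 1(2)]) simp_all
    have I: "?I m n p q p' q'" using 2 3 by blast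
    show "\<exists>x<?X. tens_perm a b a' b' u v x = y"
      using less(1)[OF I] pos[OF I] 1 2 3 by blast
  qed
  fix x y assume x: "x < ?X" and y: "y < ?Y"
  have x': "x < (kron a b * kron a' b') $$ (i * dim_row b + j, k * dim_col b' + l)"
    using x by simp
  have y': "y < kron (a * a') (b * b') $$ (i * dim_row b + j, k * dim_col b' + l)"
    using y by simp
  from x show "ent (tensorator a b a' b') u v x y = (if y = tens_perm a b a' b' u v x then 1 else 0)"
  proof (rule cases)
    fix m n p q p' q' assume 1: "?I m n p q p' q'" "x = ?e m n p q p' q'"
    have "(\<exists>m<dim_col a. \<exists>n<dim_col b. \<exists>p<a $$ (i, m). \<exists>q<b $$ (j, n). \<exists>p'<a' $$ (m, k). \<exists>q'<b' $$ (n, l).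
        x = ?e m n p q p' q' \<and> y = ?f m n p q p' q') \<longleftrightarrow> y = tens_perm a b a' b' u v x" (is "?ex \<longleftrightarrow> _")
    proof
      assume ?ex
      then obtain m n p q p' q' where 2: "?I m n p q p' q'" "x = ?e m n p q p' q'" "y = ?f m n p q p' q'" by blast
      show "y = tens_perm a b a' b' u v x" unfolding 2(2) pos[OF 2(1)] by (rule 2(3))
    next
      assume "y = tens_perm a b a' b' u v x"
      then have "y = ?f m n p q p' q'" unfolding 1(2) pos[OF 1(1)] .
      with 1 show ?ex by blast
    qed
    then show ?thesis using x' y' u v by (simp add: tensorator_def Let_def pair_less)
  qed
qed

text \<open>Once the two permutations are evaluated, each side is a product of four entries, one for
  each cell, under the condition that the intermediate indices m and n agree with m2 and n2.\<close>

lemma tensorator_nat: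
  assumes "tvhom a c \<alpha>" "tvhom b d \<beta>" "tvhom a' c' \<alpha>'" "tvhom b' d' \<beta>'"
    "dim_col a = dim_row a'" "dim_col b = dim_row b'"
  shows "tv_vcomp (tv_hcomp (tv_tens2 \<alpha> \<beta>) (tv_tens2 \<alpha>' \<beta>')) (tensorator c d c' d')
    = tv_vcomp (tensorator a b a' b') (tv_tens2 (tv_hcomp \<alpha> \<alpha>') (tv_hcomp \<beta> \<beta>'))"
proof -
  note D = tvhomD(3,4)[OF assms(1)] tvhomD(3,4)[OF assms(2)] tvhomD(3,4)[OF assms(3)] tvhomD(3,4)[OF assms(4)] assms(5,6)
  have m: "dim_col c = dim_row c'" "dim_col d = dim_row d'" "dim_col (kron a b) = dim_row (kron a' b')"
    using D by simp_all
  note t = tvhom_tens2[OF assms(1,2)] tvhom_tens2[OF assms(3,4)]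
  note h = tvhom_hcomp[OF assms(1,3,5)] tvhom_hcomp[OF assms(2,4,6)]
  note L = tvhom_hcomp[OF t m(3)] and R = tvhom_tens2[OF h]
  note p = perm_cell_tensorator[OF assms(5,6)] and p' = perm_cell_tensorator[OF m(1,2)]
  show ?thesis
  proof (rule tv_eqI[OF tvhom_vcomp[OF L perm_cellD(1)[OF p']] tvhom_vcomp[OF perm_cellD(1)[OF p] R]])
    fix u v x y assume uv: "u < dim_row (kron a b * kron a' b')" "v < dim_col (kron a b * kron a' b')"
      and x: "x < (kron a b * kron a' b') $$ (u, v)" and y: "y < kron (c * c') (d * d') $$ (u, v)"
    have u: "u < dim_row a * dim_row b" and v: "v < dim_col a' * dim_col b'" using uv by simp_all
    obtain i j where ij: "i < dim_row a" "j < dim_row b" "u = i * dim_row b + j"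
      by (rule pair_decomp[OF u])
    obtain k l where kl: "k < dim_col a'" "l < dim_col b'" "v = k * dim_col b' + l"
      by (rule pair_decomp[OF v])
    have uv': "u = i * dim_row d + j" "v = k * dim_col d' + l" using ij kl D by simp_all
    obtain m n r s r' s' where 1: "m < dim_col a" "n < dim_col b" "r < a $$ (i, m)" "s < b $$ (j, n)"
      "r' < a' $$ (m, k)" "s' < b' $$ (n, l)"
      "x = basis_pos (kron a b) (kron a' b') u v (m * dim_col b + n) (r * b $$ (j, n) + s) (r' * b' $$ (n, l) + s')"
      using x unfolding ij(3) kl(3) by (rule kron_pos_cases) (use ij kl assms in simp_all)
    \<comment> \<open>The target position is pulled back through the tensorator, so that
      \<open>perm_vcomp_right\<close> can remove it.\<close>
    obtain y0 where y0: "y0 < (kron c d * kron c' d') $$ (u, v)" "y = tens_perm c d c' d' u v y0"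
      by (rule perm_cell_surj[OF p' _ _ y]) (use uv D in simp_all)
    obtain m2 n2 r2 s2 r2' s2' where 2: "m2 < dim_col c" "n2 < dim_col d" "r2 < c $$ (i, m2)" "s2 < d $$ (j, n2)"
      "r2' < c' $$ (m2, k)" "s2' < d' $$ (n2, l)"
      "y0 = basis_pos (kron c d) (kron c' d') u v (m2 * dim_col d + n2) (r2 * d $$ (j, n2) + s2) (r2' * d' $$ (n2, l) + s2')"
      using y0(1) unfolding uv' by (rule kron_pos_cases) (use ij kl D in simp_all)
    have px: "tens_perm a b a' b' u v x = basis_pos a a' i k m r r' * (b * b') $$ (j, l) + basis_pos b b' j l n s s'"
      unfolding 1 ij(3) kl(3) by (rule tens_perm_pos) (use 1 ij kl D in simp_all)
    have py: "y = basis_pos c c' i k m2 r2 r2' * (d * d') $$ (j, l) + basis_pos d d' j l n2 s2 s2'"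
      unfolding y0(2) 2 unfolding uv' by (rule tens_perm_pos) (use 2 ij kl D in simp_all)
    have "ent (tv_vcomp (tv_hcomp (tv_tens2 \<alpha> \<beta>) (tv_tens2 \<alpha>' \<beta>')) (tensorator c d c' d')) u v x y
      = ent (tv_hcomp (tv_tens2 \<alpha> \<beta>) (tv_tens2 \<alpha>' \<beta>')) u v x y0"
      unfolding y0(2) by (rule perm_vcomp_right[OF L p']) (use uv x y0 D in simp_all)
    also have "\<dots> = (if m * dim_col b + n = m2 * dim_col d + n2
        then ent (tv_tens2 \<alpha> \<beta>) u (m * dim_col b + n) (r * b $$ (j, n) + s) (r2 * d $$ (j, n2) + s2)
          * ent (tv_tens2 \<alpha>' \<beta>') (m * dim_col b + n) v (r' * b' $$ (n, l) + s') (r2' * d' $$ (n2, l) + s2') else 0)"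
      unfolding 1(7) 2(7) by (rule ent_hcomp[OF t m(3)]) (use ij kl 1 2 D in \<open>simp_all add: pair_less\<close>)
    also have "\<dots> = (if m = m2 \<and> n = n2 then (ent \<alpha> i m r r2 * ent \<beta> j n s s2)
          * (ent \<alpha>' m k r' r2' * ent \<beta>' n l s' s2') else 0)"
    proof (cases "m = m2 \<and> n = n2")
      case True
      then show ?thesis
        using ent_tens2[OF assms(1,2), of i j m n r s r2 s2] ent_tens2[OF assms(3,4), of m n k l r' s' r2' s2']
          1 2 ij kl D by simp
    next
      case False
      then show ?thesis using pair_unique[of m "dim_col b" n m2 n2] 1 2 D by auto
    qed
    also have "\<dots> = (if m = m2 then ent \<alpha> i m r r2 * ent \<alpha>' m k r' r2' else 0)
        * (if n = n2 then ent \<beta> j n s s2 * ent \<beta>' n l s' s2' else 0)"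
      by simp
    also have "\<dots> = ent (tv_hcomp \<alpha> \<alpha>') i k (basis_pos a a' i k m r r') (basis_pos c c' i k m2 r2 r2')
        * ent (tv_hcomp \<beta> \<beta>') j l (basis_pos b b' j l n s s') (basis_pos d d' j l n2 s2 s2')"
      using ent_hcomp[OF assms(1,3,5), of i k m r r' m2 r2 r2'] ent_hcomp[OF assms(2,4,6), of j l n s s' n2 s2 s2']
        1 2 ij kl D by simp
    also have "\<dots> = ent (tv_tens2 (tv_hcomp \<alpha> \<alpha>') (tv_hcomp \<beta> \<beta>')) u v (tens_perm a b a' b' u v x) y"
      unfolding px py using ent_tens2[OF h, of i j k l] 1 2 ij kl D by (simp add: basis_pos_less)
    also have "\<dots> = ent (tv_vcomp (tensorator a b a' b') (tv_tens2 (tv_hcomp \<alpha> \<alpha>') (tv_hcomp \<beta> \<beta>'))) u v x y"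
      by (rule perm_vcomp_left[OF p R, symmetric]) (use uv x y in simp_all)
    finally show "ent (tv_vcomp (tv_hcomp (tv_tens2 \<alpha> \<beta>) (tv_tens2 \<alpha>' \<beta>')) (tensorator c d c' d')) u v x y
      = ent (tv_vcomp (tensorator a b a' b') (tv_tens2 (tv_hcomp \<alpha> \<alpha>') (tv_hcomp \<beta> \<beta>'))) u v x y" .
  qed
qed

text \<open>Both sides are permutations, so it suffices to follow one basis element. Its digits for
  a, a', a'' and for b, b', b'' are separated and bracketed to the right along either route.\<close>

lemma tensorator_coh_assoc:
  assumes [simp]: "dim_col a = dim_row a'" "dim_col b = dim_row b'" "dim_col a' = dim_row a''" "dim_col b' = dim_row b''"
  shows "tv_vcomp (tv_vcomp (tv_hcomp (tensorator a b a' b') (tv_id (kron a'' b'')))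
      (tensorator (a * a') (b * b') a'' b'')) (tv_tens2 (tv_assoc a a' a'') (tv_assoc b b' b''))
    = tv_vcomp (tv_vcomp (tv_assoc (kron a b) (kron a' b') (kron a'' b''))
      (tv_hcomp (tv_id (kron a b)) (tensorator a' b' a'' b''))) (tensorator a b (a' * a'') (b' * b''))"
proof -
  let ?K = "kron a b" and ?K' = "kron a' b'" and ?K'' = "kron a'' b''"
  let ?L = "kron (a * a') (b * b')" and ?R = "kron (a' * a'') (b' * b'')"
  have L: "perm_cell (tv_hcomp (tensorator a b a' b') (tv_id ?K'')) (?K * ?K' * ?K'') (?L * ?K'')
      (hperm (?K * ?K') ?K'' ?L ?K'' (tens_perm a b a' b') (\<lambda>i j x. x))"
    "perm_cell (tensorator (a * a') (b * b') a'' b'') (?L * ?K'') (kron (a * a' * a'') (b * b' * b''))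
      (tens_perm (a * a') (b * b') a'' b'')"
    "perm_cell (tv_tens2 (tv_assoc a a' a'') (tv_assoc b b' b'')) (kron (a * a' * a'') (b * b' * b''))
      (kron (a * (a' * a'')) (b * (b' * b'')))
      (kron_perm (b * b' * b'') (b * (b' * b'')) (assoc_perm a a' a'') (assoc_perm b b' b''))"
    by (intro perm_cell_hcomp perm_cell_tensorator perm_cell_tens2 perm_cell_assoc perm_cell_id; simp)+
  have R: "perm_cell (tv_assoc ?K ?K' ?K'') (?K * ?K' * ?K'') (?K * (?K' * ?K'')) (assoc_perm ?K ?K' ?K'')"
    "perm_cell (tv_hcomp (tv_id ?K) (tensorator a' b' a'' b'')) (?K * (?K' * ?K'')) (?K * ?R)
      (hperm ?K (?K' * ?K'') ?K ?R (\<lambda>i j x. x) (tens_perm a' b' a'' b''))"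
    "perm_cell (tensorator a b (a' * a'') (b' * b'')) (?K * ?R) (kron (a * (a' * a'')) (b * (b' * b'')))
      (tens_perm a b (a' * a'') (b' * b''))"
    by (intro perm_cell_hcomp perm_cell_tensorator perm_cell_assoc perm_cell_id; simp)+
  show ?thesis
  proof (rule perm_cell_eqI[OF perm_cell_vcomp[OF perm_cell_vcomp[OF L(1,2)] L(3)]
        perm_cell_vcomp[OF perm_cell_vcomp[OF R(1,2)] R(3)]])
    fix u v x assume uv: "u < dim_row (?K * ?K' * ?K'')" "v < dim_col (?K * ?K' * ?K'')"
      and x: "x < (?K * ?K' * ?K'') $$ (u, v)"
    have u: "u < dim_row a * dim_row b" and v: "v < dim_col a'' * dim_col b''" using uv by simp_all
    obtain i j where ij [simp]: "i < dim_row a" "j < dim_row b" and ueq: "u = i * dim_row b + j"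
      by (rule pair_decomp[OF u])
    obtain k l where kl [simp]: "k < dim_col a''" "l < dim_col b''" and veq: "v = k * dim_col b'' + l"
      by (rule pair_decomp[OF v])
    obtain w z z'' where w: "w < dim_col (?K * ?K')" "z < (?K * ?K') $$ (u, w)" "z'' < ?K'' $$ (w, v)"
      and xeq: "x = basis_pos (?K * ?K') ?K'' u v w z z''"
      by (rule basis_pos_cases[OF x]) (use u v in simp_all)
    have wlt: "w < dim_col a' * dim_col b'" using w(1) by simp
    obtain m2 n2 where mn2 [simp]: "m2 < dim_col a'" "n2 < dim_col b'" and weq: "w = m2 * dim_col b' + n2"
      by (rule pair_decomp[OF wlt])
    have [simp]: "m2 < dim_row a''" "n2 < dim_row b''" using mn2 by simp_all
    have "z < (?K * ?K') $$ (i * dim_row b + j, m2 * dim_col b' + n2)" using w(2) by (simp add: ueq weq)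
    then obtain m n p q p' q' where mn [simp]: "m < dim_col a" "n < dim_col b" "p < a $$ (i, m)" "q < b $$ (j, n)"
      "p' < a' $$ (m, m2)" "q' < b' $$ (n, n2)"
      and zeq: "z = basis_pos ?K ?K' (i * dim_row b + j) (m2 * dim_col b' + n2) (m * dim_col b + n)
        (p * b $$ (j, n) + q) (p' * b' $$ (n, n2) + q')"
      by (rule kron_pos_cases) simp_all
    obtain p'' q'' where pq'' [simp]: "p'' < a'' $$ (m2, k)" "q'' < b'' $$ (n2, l)"
      and z''eq: "z'' = p'' * b'' $$ (n2, l) + q''"
      by (rule pair_decomp) (use w(3) in \<open>simp add: weq veq\<close>)
    have [simp]: "m < dim_row a'" "n < dim_row b'" using mn(1,2) by simp_all
    let ?A = "basis_pos a a' i m2 m p p'" and ?B = "basis_pos b b' j n2 n q q'"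
    let ?A' = "basis_pos a' a'' m k m2 p' p''" and ?B' = "basis_pos b' b'' n l n2 q' q''"
    have ABless [simp]: "?A < (a * a') $$ (i, m2)" "?B < (b * b') $$ (j, n2)" "?A' < (a' * a'') $$ (m, k)"
      "?B' < (b' * b'') $$ (n, l)"
      by (simp_all add: basis_pos_less)
    \<comment> \<open>The common image of the basis element: equations 1 to 4 lead to it along the
      left side, up to two evaluations of \<open>assoc_perm\<close>, and 5 to 8 along the right
      side.\<close>
    let ?out = "basis_pos a (a' * a'') i k m p ?A' * (b * (b' * b'')) $$ (j, l) + basis_pos b (b' * b'') j l n q ?B'"
    have 1: "hperm (?K * ?K') ?K'' ?L ?K'' (tens_perm a b a' b') (\<lambda>i j x. x) u v x
      = basis_pos ?L ?K'' u v w (tens_perm a b a' b' u w z) z''"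
      unfolding xeq by (rule hperm_pos) (use w in simp_all)
    have 2: "tens_perm a b a' b' u w z = ?A * (b * b') $$ (j, n2) + ?B"
      unfolding ueq weq zeq by (rule tens_perm_pos) simp_all
    have 3: "tens_perm (a * a') (b * b') a'' b'' u v (basis_pos ?L ?K'' u v w (?A * (b * b') $$ (j, n2) + ?B) z'')
      = basis_pos (a * a') a'' i k m2 ?A p'' * (b * b' * b'') $$ (j, l) + basis_pos (b * b') b'' j l n2 ?B q''"
      unfolding ueq veq weq z''eq by (rule tens_perm_pos) simp_all
    have 4: "kron_perm (b * b' * b'') (b * (b' * b'')) (assoc_perm a a' a'') (assoc_perm b b' b'') u v
       (basis_pos (a * a') a'' i k m2 ?A p'' * (b * b' * b'') $$ (j, l) + basis_pos (b * b') b'' j l n2 ?B q'')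
      = assoc_perm a a' a'' i k (basis_pos (a * a') a'' i k m2 ?A p'') * (b * (b' * b'')) $$ (j, l)
        + assoc_perm b b' b'' j l (basis_pos (b * b') b'' j l n2 ?B q'')"
      unfolding ueq veq by (rule kron_perm_pos) (simp_all add: basis_pos_less)
    have 5: "assoc_perm ?K ?K' ?K'' u v x = basis_pos ?K (?K' * ?K'') u v (m * dim_col b + n) (p * b $$ (j, n) + q)
       (basis_pos ?K' ?K'' (m * dim_col b + n) v w (p' * b' $$ (n, n2) + q') z'')"
      unfolding xeq zeq unfolding ueq weq
      by (rule assoc_perm_pos) (use w in \<open>simp_all add: pair_less weq\<close>)
    have z'less: "p' * b' $$ (n, n2) + q' < ?K' $$ (m * dim_col b + n, w)"
      unfolding weq by (simp add: pair_less)
    have 6: "hperm ?K (?K' * ?K'') ?K ?R (\<lambda>i j x. x) (tens_perm a' b' a'' b'') u v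
       (basis_pos ?K (?K' * ?K'') u v (m * dim_col b + n) (p * b $$ (j, n) + q)
       (basis_pos ?K' ?K'' (m * dim_col b + n) v w (p' * b' $$ (n, n2) + q') z''))
      = basis_pos ?K ?R u v (m * dim_col b + n) (p * b $$ (j, n) + q)
       (tens_perm a' b' a'' b'' (m * dim_col b + n) v (basis_pos ?K' ?K'' (m * dim_col b + n) v w (p' * b' $$ (n, n2) + q') z''))"
      by (rule hperm_pos) (use w z'less v in \<open>simp_all add: ueq pair_less basis_pos_less\<close>)
    have 7: "tens_perm a' b' a'' b'' (m * dim_col b + n) v (basis_pos ?K' ?K'' (m * dim_col b + n) v w (p' * b' $$ (n, n2) + q') z'')
      = ?A' * (b' * b'') $$ (n, l) + ?B'"
      unfolding veq weq z''eq by (rule tens_perm_pos) simp_all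
    have 8: "tens_perm a b (a' * a'') (b' * b'') u v (basis_pos ?K ?R u v (m * dim_col b + n) (p * b $$ (j, n) + q)
       (?A' * (b' * b'') $$ (n, l) + ?B')) = ?out"
      unfolding ueq veq by (rule tens_perm_pos) simp_all
    show "kron_perm (b * b' * b'') (b * (b' * b'')) (assoc_perm a a' a'') (assoc_perm b b' b'') u v
         (tens_perm (a * a') (b * b') a'' b'' u v
           (hperm (?K * ?K') ?K'' ?L ?K'' (tens_perm a b a' b') (\<lambda>i j x. x) u v x))
      = tens_perm a b (a' * a'') (b' * b'') u v
         (hperm ?K (?K' * ?K'') ?K ?R (\<lambda>i j x. x) (tens_perm a' b' a'' b'') u v (assoc_perm ?K ?K' ?K'' u v x))"
      unfolding 1 2 3 4 5 6 7 8 by simp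
  qed
qed

text \<open>Composition with identity 1-cells forces the intermediate pair to be (i, j), with
  trivial coordinates in the identity factors. This yields the left unit coherence of the
  product.\<close>

lemma tensorator_unit_left:
  "tensorator (1\<^sub>m (dim_row a)) (1\<^sub>m (dim_row b)) a b = tv_id (kron a b)"
proof -
  let ?e1 = "1\<^sub>m (dim_row a) :: nat mat" and ?e2 = "1\<^sub>m (dim_row b) :: nat mat"
  have p: "perm_cell (tensorator ?e1 ?e2 a b) (kron a b) (kron a b) (tens_perm ?e1 ?e2 a b)"
    using perm_cell_tensorator[of ?e1 a ?e2 b] by (simp add: kron_one)
  show ?thesis
  proof (rule perm_cell_eqI[OF p perm_cell_id])
    fix u v x assume "u < dim_row (kron a b)" "v < dim_col (kron a b)" and x: "x < kron a b $$ (u, v)"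
    then have "u < dim_row a * dim_row b" "v < dim_col a * dim_col b" by simp_all
    then obtain i j k l where uv: "i < dim_row a" "j < dim_row b" "u = i * dim_row b + j"
      "k < dim_col a" "l < dim_col b" "v = k * dim_col b + l"
      by (metis pair_decomp)
    obtain p q where 1: "p < a $$ (i, k)" "q < b $$ (j, l)" "x = p * b $$ (j, l) + q"
      by (rule pair_decomp) (use x uv in simp)
    have "basis_pos (kron ?e1 ?e2) (kron a b) u v u 0 x = x"
      using uv by (simp add: kron_one basis_pos_unit_left pair_less)
    then show "tens_perm ?e1 ?e2 a b u v x = x"
      using tens_perm_pos[of i ?e1 j "dim_row b" k a l "dim_col b" i j "dim_row b" 0 0 1 p q "b $$ (j, l)" ?e2 b] uv 1
      by (simp add: basis_pos_unit_left)
  qed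
qed

lemma tensorator_unit_right:
  "tensorator a b (1\<^sub>m (dim_col a)) (1\<^sub>m (dim_col b)) = tv_id (kron a b)"
proof -
  let ?e1 = "1\<^sub>m (dim_col a) :: nat mat" and ?e2 = "1\<^sub>m (dim_col b) :: nat mat"
  have p: "perm_cell (tensorator a b ?e1 ?e2) (kron a b) (kron a b) (tens_perm a b ?e1 ?e2)"
    using perm_cell_tensorator[of a ?e1 b ?e2] by (simp add: kron_one)
  show ?thesis
  proof (rule perm_cell_eqI[OF p perm_cell_id])
    fix u v x assume "u < dim_row (kron a b)" "v < dim_col (kron a b)" and x: "x < kron a b $$ (u, v)"
    then have "u < dim_row a * dim_row b" "v < dim_col a * dim_col b" by simp_all
    then obtain i j k l where uv: "i < dim_row a" "j < dim_row b" "u = i * dim_row b + j"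
      "k < dim_col a" "l < dim_col b" "v = k * dim_col b + l"
      by (metis pair_decomp)
    obtain p q where 1: "p < a $$ (i, k)" "q < b $$ (j, l)" "x = p * b $$ (j, l) + q"
      by (rule pair_decomp) (use x uv in simp)
    have "basis_pos (kron a b) (kron ?e1 ?e2) u v v x 0 = x"
      using uv basis_pos_unit_right[of v "kron a b" u x] by (simp add: kron_one pair_less)
    then show "tens_perm a b ?e1 ?e2 u v x = x"
      using tens_perm_pos[of i a j "dim_row b" k ?e1 l "dim_col b" k l "dim_col b" p q "b $$ (j, l)" 0 0 1 b ?e2] uv 1
      by (simp add: basis_pos_unit_right)
  qed
qed

lemma basis_pos_one: "basis_pos (1\<^sub>m 1) (1\<^sub>m 1) 0 0 0 0 0 = 0"
  by (rule basis_pos_unit_left) simp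

text \<open>The factor 1 is here the unit object of the product, not an identity to be composed
  with: the digits it contributes are all 0. This yields a case of \<open>unit_comp\<close>.\<close>

lemma tensorator_one_left:
  assumes [simp]: "dim_col a = dim_row b"
  shows "tensorator (1\<^sub>m 1) a (1\<^sub>m 1) b = tv_id (a * b)"
proof -
  have p: "perm_cell (tensorator (1\<^sub>m 1) a (1\<^sub>m 1) b) (a * b) (a * b) (tens_perm (1\<^sub>m 1) a (1\<^sub>m 1) b)"
    using perm_cell_tensorator[of "1\<^sub>m 1" "1\<^sub>m 1" a b] by (simp add: kron_unit[unfolded One_nat_def])
  show ?thesis
  proof (rule perm_cell_eqI[OF p perm_cell_id])
    fix j l x assume "j < dim_row (a * b)" "l < dim_col (a * b)" and x: "x < (a * b) $$ (j, l)"
    then have jl: "j < dim_row a" "l < dim_col b" by simp_all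
    obtain n q q' where 1: "n < dim_col a" "q < a $$ (j, n)" "q' < b $$ (n, l)" "x = basis_pos a b j l n q q'"
      by (rule basis_pos_cases[OF x jl]) simp
    show "tens_perm (1\<^sub>m 1) a (1\<^sub>m 1) b j l x = x"
    proof -
      \<comment> \<open>The zero digits of the unit factor are written out so that the indices have
        the shape required by \<open>tens_perm_pos\<close>.\<close>
      have "tens_perm (1\<^sub>m 1) a (1\<^sub>m 1) b (0 * dim_row a + j) (0 * dim_col b + l)
          (basis_pos (kron (1\<^sub>m 1) a) (kron (1\<^sub>m 1) b) (0 * dim_row a + j) (0 * dim_col b + l)
          (0 * dim_col a + n) (0 * a $$ (j, n) + q) (0 * b $$ (n, l) + q'))
        = basis_pos (1\<^sub>m 1) (1\<^sub>m 1) 0 0 0 0 0 * (a * b) $$ (j, l) + basis_pos a b j l n q q'"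
        by (rule tens_perm_pos) (use jl 1 in simp_all)
      then show ?thesis unfolding kron_unit basis_pos_one by (simp add: 1)
    qed
  qed
qed

lemma tensorator_one_right:
  assumes [simp]: "dim_col a = dim_row b"
  shows "tensorator a (1\<^sub>m 1) b (1\<^sub>m 1) = tv_id (a * b)"
proof -
  have p: "perm_cell (tensorator a (1\<^sub>m 1) b (1\<^sub>m 1)) (a * b) (a * b) (tens_perm a (1\<^sub>m 1) b (1\<^sub>m 1))"
    using perm_cell_tensorator[of a b "1\<^sub>m 1" "1\<^sub>m 1"] by (simp add: kron_unit[unfolded One_nat_def])
  show ?thesis
  proof (rule perm_cell_eqI[OF p perm_cell_id])
    fix j l x assume "j < dim_row (a * b)" "l < dim_col (a * b)" and x: "x < (a * b) $$ (j, l)"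
    then have jl: "j < dim_row a" "l < dim_col b" by simp_all
    obtain n q q' where 1: "n < dim_col a" "q < a $$ (j, n)" "q' < b $$ (n, l)" "x = basis_pos a b j l n q q'"
      by (rule basis_pos_cases[OF x jl]) simp
    show "tens_perm a (1\<^sub>m 1) b (1\<^sub>m 1) j l x = x"
    proof -
      have "tens_perm a (1\<^sub>m 1) b (1\<^sub>m 1) (j * 1 + 0) (l * 1 + 0)
          (basis_pos (kron a (1\<^sub>m 1)) (kron b (1\<^sub>m 1)) (j * 1 + 0) (l * 1 + 0) (n * 1 + 0) (q * 1 + 0) (q' * 1 + 0))
        = basis_pos a b j l n q q' * (1\<^sub>m 1 * 1\<^sub>m 1) $$ (0, 0) + basis_pos (1\<^sub>m 1) (1\<^sub>m 1) 0 0 0 0 0"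
        by (rule tens_perm_pos) (use jl 1 in simp_all)
      then show ?thesis unfolding kron_unit basis_pos_one by (simp add: 1)
    qed
  qed
qed

text \<open>This is \<open>assoc_comp\<close> for 2-vector spaces. Either side sorts the coordinates
  of a basis element into three groups, one for each tensor factor, and the encodings of triples do
  not depend on the bracketing.\<close>

lemma tensorator_assoc:
  assumes [simp]: "dim_col a = dim_row a'" "dim_col b = dim_row b'" "dim_col c = dim_row c'"
  shows "tv_vcomp (tensorator (kron a b) c (kron a' b') c') (tv_tens2 (tensorator a b a' b') (tv_id (c * c')))
    = tv_vcomp (tensorator a (kron b c) a' (kron b' c')) (tv_tens2 (tv_id (a * a')) (tensorator b c b' c'))"
proof -
  let ?K = "kron (kron a b) c" and ?K' = "kron (kron a' b') c'"
  have L: "perm_cell (tensorator (kron a b) c (kron a' b') c') (?K * ?K') (kron (kron a b * kron a' b') (c * c'))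
      (tens_perm (kron a b) c (kron a' b') c')"
    "perm_cell (tv_tens2 (tensorator a b a' b') (tv_id (c * c'))) (kron (kron a b * kron a' b') (c * c'))
      (kron (kron (a * a') (b * b')) (c * c')) (kron_perm (c * c') (c * c') (tens_perm a b a' b') (\<lambda>i j x. x))"
    by (intro perm_cell_tensorator perm_cell_tens2 perm_cell_id; simp)+
  have R: "perm_cell (tensorator a (kron b c) a' (kron b' c')) (?K * ?K') (kron (a * a') (kron b c * kron b' c'))
      (tens_perm a (kron b c) a' (kron b' c'))"
    "perm_cell (tv_tens2 (tv_id (a * a')) (tensorator b c b' c')) (kron (a * a') (kron b c * kron b' c'))
      (kron (kron (a * a') (b * b')) (c * c'))
      (kron_perm (kron b c * kron b' c') (kron (b * b') (c * c')) (\<lambda>i j x. x) (tens_perm b c b' c'))"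
    unfolding kron_assoc by (intro perm_cell_tensorator perm_cell_tens2 perm_cell_id; simp)+
  show ?thesis
  proof (rule perm_cell_eqI[OF perm_cell_vcomp[OF L] perm_cell_vcomp[OF R]])
    fix u v x assume uv: "u < dim_row (?K * ?K')" "v < dim_col (?K * ?K')" and x: "x < (?K * ?K') $$ (u, v)"
    have u: "u < dim_row a * dim_row b * dim_row c" and v: "v < dim_col a' * dim_col b' * dim_col c'"
      using uv by simp_all
    obtain ij k where ij: "ij < dim_row a * dim_row b" and k [simp]: "k < dim_row c" and u1: "u = ij * dim_row c + k"
      by (rule pair_decomp[OF u])
    obtain i j where i [simp]: "i < dim_row a" "j < dim_row b" and u2: "ij = i * dim_row b + j"
      by (rule pair_decomp[OF ij])
    obtain fg h where fg: "fg < dim_col a' * dim_col b'" and h [simp]: "h < dim_col c'" and v1: "v = fg * dim_col c' + h"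
      by (rule pair_decomp[OF v])
    obtain f g where f [simp]: "f < dim_col a'" "g < dim_col b'" and v2: "fg = f * dim_col b' + g"
      by (rule pair_decomp[OF fg])
    have "x < (?K * ?K') $$ (ij * dim_row c + k, fg * dim_col c' + h)" using x by (simp add: u1 v1)
    then obtain mn w pq r pq' r' where 1: "mn < dim_col (kron a b)" "pq < kron a b $$ (ij, mn)"
      "pq' < kron a' b' $$ (mn, fg)" and rw [simp]: "w < dim_col c" "r < c $$ (k, w)" "r' < c' $$ (w, h)"
      and xeq: "x = basis_pos ?K ?K' (ij * dim_row c + k) (fg * dim_col c' + h) (mn * dim_col c + w)
         (pq * c $$ (k, w) + r) (pq' * c' $$ (w, h) + r')"
      by (rule kron_pos_cases) (use ij fg in simp_all)
    have mnlt: "mn < dim_col a * dim_col b" using 1(1) by simp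
    obtain m n where m [simp]: "m < dim_col a" "n < dim_col b" and mneq: "mn = m * dim_col b + n"
      by (rule pair_decomp[OF mnlt])
    have [simp]: "m < dim_row a'" "n < dim_row b'" "w < dim_row c'" using m rw by simp_all
    obtain p q where p [simp]: "p < a $$ (i, m)" "q < b $$ (j, n)" and pqeq: "pq = p * b $$ (j, n) + q"
      by (rule pair_decomp) (use 1 in \<open>simp add: u2 mneq\<close>)
    obtain p' q' where p' [simp]: "p' < a' $$ (m, f)" "q' < b' $$ (n, g)" and pq'eq: "pq' = p' * b' $$ (n, g) + q'"
      by (rule pair_decomp) (use 1 in \<open>simp add: v2 mneq\<close>)
    let ?A = "basis_pos a a' i f m p p'" and ?B = "basis_pos b b' j g n q q'" and ?C = "basis_pos c c' k h w r r'"
    have [simp]: "?A < (a * a') $$ (i, f)" "?B < (b * b') $$ (j, g)" "?C < (c * c') $$ (k, h)"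
      by (simp_all add: basis_pos_less)
    have 2: "tens_perm (kron a b) c (kron a' b') c' u v x
      = basis_pos (kron a b) (kron a' b') ij fg mn pq pq' * (c * c') $$ (k, h) + ?C"
      unfolding xeq unfolding u1 v1 by (rule tens_perm_pos) (use 1 ij fg in simp_all)
    have 3: "kron_perm (c * c') (c * c') (tens_perm a b a' b') (\<lambda>i j x. x) u v
        (basis_pos (kron a b) (kron a' b') ij fg mn pq pq' * (c * c') $$ (k, h) + ?C)
      = tens_perm a b a' b' ij fg (basis_pos (kron a b) (kron a' b') ij fg mn pq pq') * (c * c') $$ (k, h) + ?C"
      unfolding u1 v1 by (rule kron_perm_pos) simp_all
    have 4: "tens_perm a b a' b' ij fg (basis_pos (kron a b) (kron a' b') ij fg mn pq pq')
      = ?A * (b * b') $$ (j, g) + ?B"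
      unfolding u2 v2 mneq pqeq pq'eq by (rule tens_perm_pos) simp_all
    \<comment> \<open>The same row and column indices, read with the other bracketing of their three
      digits.\<close>
    have u': "u = i * (dim_row b * dim_row c) + (j * dim_row c + k)"
      and v': "v = f * (dim_col b' * dim_col c') + (g * dim_col c' + h)"
      by (simp_all add: u1 u2 v1 v2 algebra_simps)
    have xeq': "x = basis_pos (kron a (kron b c)) (kron a' (kron b' c')) u v
        (m * (dim_col b * dim_col c) + (n * dim_col c + w))
        (p * (b $$ (j, n) * c $$ (k, w)) + (q * c $$ (k, w) + r))
        (p' * (b' $$ (n, g) * c' $$ (w, h)) + (q' * c' $$ (w, h) + r'))"
      unfolding xeq u1[symmetric] v1[symmetric] by (simp add: kron_assoc mneq pqeq pq'eq algebra_simps)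
    have 5: "tens_perm a (kron b c) a' (kron b' c') u v x
      = ?A * (kron b c * kron b' c') $$ (j * dim_row c + k, g * dim_col c' + h)
        + basis_pos (kron b c) (kron b' c') (j * dim_row c + k) (g * dim_col c' + h) (n * dim_col c + w)
          (q * c $$ (k, w) + r) (q' * c' $$ (w, h) + r')"
      unfolding xeq' unfolding u' v' by (rule tens_perm_pos) (simp_all add: pair_less)
    have 6: "kron_perm (kron b c * kron b' c') (kron (b * b') (c * c')) (\<lambda>i j x. x) (tens_perm b c b' c') u v
        (?A * (kron b c * kron b' c') $$ (j * dim_row c + k, g * dim_col c' + h)
        + basis_pos (kron b c) (kron b' c') (j * dim_row c + k) (g * dim_col c' + h) (n * dim_col c + w)
          (q * c $$ (k, w) + r) (q' * c' $$ (w, h) + r'))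
      = ?A * kron (b * b') (c * c') $$ (j * dim_row c + k, g * dim_col c' + h)
        + tens_perm b c b' c' (j * dim_row c + k) (g * dim_col c' + h)
         (basis_pos (kron b c) (kron b' c') (j * dim_row c + k) (g * dim_col c' + h) (n * dim_col c + w)
          (q * c $$ (k, w) + r) (q' * c' $$ (w, h) + r'))"
      unfolding u' v' by (rule kron_perm_pos) (simp_all add: pair_less kron_pos_less)
    have 7: "tens_perm b c b' c' (j * dim_row c + k) (g * dim_col c' + h)
         (basis_pos (kron b c) (kron b' c') (j * dim_row c + k) (g * dim_col c' + h) (n * dim_col c + w)
          (q * c $$ (k, w) + r) (q' * c' $$ (w, h) + r'))
      = ?B * (c * c') $$ (k, h) + ?C"
      by (rule tens_perm_pos) simp_all
    have 8: "kron (b * b') (c * c') $$ (j * dim_row c + k, g * dim_col c' + h)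
      = (b * b') $$ (j, g) * (c * c') $$ (k, h)"
      by simp
    show "kron_perm (c * c') (c * c') (tens_perm a b a' b') (\<lambda>i j x. x) u v (tens_perm (kron a b) c (kron a' b') c' u v x)
      = kron_perm (kron b c * kron b' c') (kron (b * b') (c * c')) (\<lambda>i j x. x) (tens_perm b c b' c') u v
         (tens_perm a (kron b c) a' (kron b' c') u v x)"
      unfolding 2 3 4 5 6 7 8 by (simp add: algebra_simps)
  qed
qed

text \<open>All objects, 1-cells and 2-cells of \<open>TwoVect\<close> range over whole types, so
  the compositor is the one map that has to be restricted for extensionality.\<close>

definition tv_tensor :: "(nat \<times> nat, nat mat \<times> nat mat, complex mat mat \<times> complex mat mat,
    nat, nat mat, complex mat mat) pseudofun" where
  "tv_tensor = \<lparr>ps_obj = (\<lambda>(N, M). N * M), ps_arr = (\<lambda>(a, b). kron a b),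
     ps_cell = (\<lambda>(\<alpha>, \<beta>). tv_tens2 \<alpha> \<beta>),
     ps_comp = (\<lambda>((a, b), (a', b'))\<in>composable (prod_bicat TwoVect TwoVect). tensorator a b a' b'),
     ps_unit = (\<lambda>(N, M). tv_id (1\<^sub>m (N * M)))\<rparr>"

lemma tv_tensor_simps [simp]:
  "ps_obj tv_tensor (N, M) = N * M" "ps_arr tv_tensor (a, b) = kron a b"
  "ps_cell tv_tensor (\<alpha>, \<beta>) = tv_tens2 \<alpha> \<beta>"
  "dim_col a = dim_row a' \<Longrightarrow> dim_col b = dim_row b' \<Longrightarrow>
    ps_comp tv_tensor ((a, b), (a', b')) = tensorator a b a' b'"
  "ps_unit tv_tensor (N, M) = tv_id (1\<^sub>m (N * M))"
  by (simp_all add: tv_tensor_def composable_def)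

lemma pseudofunctor_tv_tensor: "pseudofunctor (prod_bicat TwoVect TwoVect) TwoVect tv_tensor"
proof -
  interpret V: su_bicat TwoVect by (rule su_bicat_TwoVect)
  note [simp] = hom1_def
  have hom2_pair: "\<alpha> \<in> hom2 (prod_bicat TwoVect TwoVect) f g \<longleftrightarrow>
      tvhom (fst f) (fst g) (fst \<alpha>) \<and> tvhom (snd f) (snd g) (snd \<alpha>)" for \<alpha> f g
    by (cases \<alpha>; cases f; cases g) (auto simp: hom2_def tvhom_def)
  show ?thesis
  proof (intro pseudofunctor.intro pseudofunctor_axioms.intro bicategory_prod V.bicategory_axioms,
      goal_cases)
    case (8 \<alpha> f g) then show ?case
      by (cases \<alpha>; cases f; cases g) (simp add: hom2_pair hom2_TwoVect tvhom_tens2)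
  next
    case (9 \<alpha> f g \<beta> h) then show ?case
      by (cases \<alpha>; cases f; cases g; cases h; cases \<beta>) (auto simp: hom2_pair intro: tv_tens2_vcomp)
  next
    case (10 f) then show ?case by (cases f) (simp add: tv_tens2_id)
  next
    case (11 f g) then show ?case
      by (cases f; cases g) (auto simp: composable_def hom2_TwoVect intro: perm_cellD(1)[OF perm_cell_tensorator])
  next
    case (12 f g) then show ?case
      by (cases f; cases g) (auto simp: composable_def intro: perm_cell_invertible[OF perm_cell_tensorator])
  next
    case (13 \<alpha> f f' \<beta> g g')
    obtain \<alpha>1 \<alpha>2 where [simp]: "\<alpha> = (\<alpha>1, \<alpha>2)" by (cases \<alpha>)
    obtain \<beta>1 \<beta>2 where [simp]: "\<beta> = (\<beta>1, \<beta>2)" by (cases \<beta>)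
    obtain f1 f2 where [simp]: "f = (f1, f2)" by (cases f)
    obtain g1 g2 where [simp]: "g = (g1, g2)" by (cases g)
    obtain f1' f2' where [simp]: "f' = (f1', f2')" by (cases f')
    obtain g1' g2' where [simp]: "g' = (g1', g2')" by (cases g')
    have h: "tvhom f1 f1' \<alpha>1" "tvhom f2 f2' \<alpha>2" "tvhom g1 g1' \<beta>1" "tvhom g2 g2' \<beta>2"
      "dim_col f1 = dim_row g1" "dim_col f2 = dim_row g2"
      using 13 by (auto simp: hom2_pair)
    then show ?case
      using tensorator_nat[OF h] tvhomD(3,4)[OF h(1)] tvhomD(3,4)[OF h(2)] tvhomD(3,4)[OF h(3)]
        tvhomD(3,4)[OF h(4)] by simp
  next
    case (14 X) then show ?case
      by (cases X) (simp add: hom2_TwoVect kron_one tvhom_id)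
  next
    case (15 X) then show ?case
      by (cases X) (simp add: perm_cell_invertible[OF perm_cell_id])
  next
    case (16 f g h)
    obtain f1 f2 where [simp]: "f = (f1, f2)" by (cases f)
    obtain g1 g2 where [simp]: "g = (g1, g2)" by (cases g)
    obtain h1 h2 where [simp]: "h = (h1, h2)" by (cases h)
    have "dim_col f1 = dim_row g1" "dim_col f2 = dim_row g2" "dim_col g1 = dim_row h1" "dim_col g2 = dim_row h2"
      using 16 by (auto simp: composable_def)
    then show ?case using tensorator_coh_assoc[of f1 g1 f2 g2 h1 h2] by simp
  next
    case (17 f X Y)
    obtain f1 f2 where [simp]: "f = (f1, f2)" by (cases f)
    have [simp]: "X = (dim_row f1, dim_row f2)" using 17 by auto
    show ?case
      using tensorator_unit_left[of f1 f2] tv_hcomp_unit_left[OF tvhom_id[of "kron f1 f2"]]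
      by (simp add: tv_tens2_id tv_vcomp_id[OF tvhom_id])
  next
    case (18 f X Y)
    obtain f1 f2 where [simp]: "f = (f1, f2)" by (cases f)
    have [simp]: "Y = (dim_col f1, dim_col f2)" using 18 by auto
    show ?case
      using tensorator_unit_right[of f1 f2] tv_hcomp_unit_right[OF tvhom_id[of "kron f1 f2"]]
      by (simp add: tv_tens2_id tv_vcomp_id[OF tvhom_id])
  qed (auto simp: tv_tensor_def)
qed

text \<open>The base case of the construction, with the one-dimensional 2-vector space as unit
  object.\<close>

lemma strict_tensor_TwoVect: "strict_tensor TwoVect tv_tensor 1"
proof -
  interpret V: su_bicat TwoVect by (rule su_bicat_TwoVect)
  have su: "strictly_unitary (prod_bicat TwoVect TwoVect) TwoVect tv_tensor"
    by (auto simp: strictly_unitary_def kron_one)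
  show ?thesis
    by (intro strict_tensor.intro su_functor.intro su_functor_axioms.intro strict_tensor_axioms.intro
        su_bicat_TwoVect su_bicat_prod pseudofunctor_tv_tensor su)
      (simp_all add: mult.assoc kron_assoc tv_tens2_assoc tensorator_assoc kron_unit[unfolded One_nat_def]
        tv_tens2_unit[unfolded One_nat_def] tensorator_one_left[unfolded One_nat_def]
        tensorator_one_right[unfolded One_nat_def])
qed

section \<open>Categorical representations\<close>

text \<open>The laws of the product are strict, so associators and unitors are identities, and the
  coherence axioms reduce to composition with identities in the groupoid.\<close>

lemma bicategory_closure:
  assumes "categorical_group G"
  shows "bicategory (closure G)"
proof -
  interpret categorical_group G by fact
  have hom: "hom2 (closure G) = ghom G" by (auto simp: hom2_def ghom_def closure_def fun_eq_iff)
  have [simp]: "Obj (closure G) = {()}" "Arr (closure G) = GObj G" "Cell (closure G) = GMor G"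
    "src (closure G) = (\<lambda>_. ())" "tgt (closure G) = (\<lambda>_. ())" "dom2 (closure G) = gdom G"
    "cod2 (closure G) = gcod G" "id1 (closure G) = (\<lambda>_. gone G)" "id2 (closure G) = gid G"
    "vcomp (closure G) = gcomp G" "hcomp1 (closure G) = gmul0 G" "hcomp2 (closure G) = gmul1 G"
    "associator (closure G) = (\<lambda>X Y Z. gid G (gmul0 G (gmul0 G X Y) Z))"
    "lunitor (closure G) = gid G" "runitor (closure G) = gid G"
    by (simp_all add: closure_def)
  have mor: "f \<in> GMor G" if "f \<in> ghom G X Y" for f X Y using that by (simp add: ghom_def)
  have obj: "X \<in> GObj G" "Y \<in> GObj G" if "f \<in> ghom G X Y" for f X Y
    using that gdom_in gcod_in by (auto simp: ghom_def)
  have gid: "gid G X \<in> GMor G" "gdom G (gid G X) = X" "gcod G (gid G X) = X" if "X \<in> GObj G" for X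
    using gid_hom[OF that] by (auto simp: ghom_def)
  have inv: "invertible2 (closure G) (gid G X)" if "X \<in> GObj G" for X
    using gid[OF that] gid_hom[OF that] gcomp_gid
    by (auto simp: invertible2_def inverse_cells_def hom intro!: exI[of _ "gid G X"])
  note [simp] = hom hom1_def composable_def gone_in gmul0_in gmul0_assoc gmul0_gone gid_hom inv gmul1_gid
  show ?thesis
  proof (intro bicategory.intro, goal_cases)
    case 9 then show ?case by (auto intro: gcomp_hom)
  next
    case 10 then show ?case by (auto intro: gcomp_assoc)
  next
    case 14 then show ?case by (auto intro: gmul1_hom)
  next
    case (16 \<alpha> f f' \<alpha>' f'' \<beta> g g' \<beta>' g'') then show ?case by (auto intro: gmul1_gcomp)
  next
    case (19 \<alpha> f f' \<beta> g g' \<gamma> h h')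
    then have h: "gmul1 G \<alpha> (gmul1 G \<beta> \<gamma>) \<in> ghom G (gmul0 G f (gmul0 G g h)) (gmul0 G f' (gmul0 G g' h'))"
      by (auto intro!: gmul1_hom)
    from 19 show ?case
      using gcomp_gid[OF h] by (auto simp: gmul1_assoc mor obj)
  next
    case (22 \<alpha> f g X Y) then show ?case
      using gcomp_gid[of \<alpha> f g] by (auto simp: gmul1_gone mor)
  next
    case (25 \<alpha> f g X Y) then show ?case
      using gcomp_gid[of \<alpha> f g] by (auto simp: gmul1_gone mor)
  next
    case (26 f g h k) then show ?case
      using gcomp_gid[OF gid_hom] by auto
  next
    case (27 f X Y g Z) then show ?case
      using gcomp_gid[OF gid_hom] by auto
  qed (auto simp: gdom_in gcod_in gcomp_gid)
qed

lemma closure_Obj: "Obj (closure G) = {()}"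
  by (simp add: closure_def)

text \<open>The explicit product prescribes identity unit constraints, while composition with
  \<open>tv_tensor\<close> computes them from those of the factors; they coincide because
  representations are strictly unitary. The other maps agree by unfolding, once dimensions show that
  the compositor of \<open>tv_tensor\<close> is applied to composable pairs.\<close>

lemma rep_tensor_eq:
  assumes "categorical_group G"
  shows "rep_tensor G = pw_tensor (closure G) TwoVect tv_tensor"
proof -
  let ?G = "closure G"
  interpret G: bicategory ?G by (rule bicategory_closure) fact
  interpret V: strict_tensor TwoVect tv_tensor 1 by (rule strict_tensor_TwoVect)
  interpret X: strict_pointwise_tensor ?G TwoVect tv_tensor 1 ..
  let ?A = "full_sub (ps_bicat ?G TwoVect) (strictly_unitary ?G TwoVect)"
  have unit: "ps_unit R x = tv_id (1\<^sub>m (ps_obj R x))" if "R \<in> Obj ?A" "x \<in> Obj ?G" for R x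
    using that by (auto simp: strictly_unitary_def)
  \<comment> \<open>Composability for \<open>tv_tensor\<close>: outside composable pairs its
    compositor is \<open>undefined\<close> and would not be the tensorator.\<close>
  have dims: "dim_row (ps_arr R X) = ps_obj R ()" "dim_col (ps_arr R X) = ps_obj R ()"
    if "pseudofunctor ?G TwoVect R" "X \<in> Arr ?G" for R X
  proof -
    interpret R: pseudofunctor ?G TwoVect R by fact
    show "dim_row (ps_arr R X) = ps_obj R ()" "dim_col (ps_arr R X) = ps_obj R ()"
      using R.arr_typing[OF that(2)] by simp_all
  qed
  have map_dims: "dim_row (pt_map h x) = ps_obj (pt_src h) x" "dim_col (pt_map h x) = ps_obj (pt_tgt h) x"
    if "su_pseudonatural ?G TwoVect h" "x \<in> Obj ?G" for h x
    using X.BC.su_pseudonaturalD[OF that(1)] that(2) by simp_all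
  have obj: "rep_tens0 G R S = ps_then ?G TwoVect (ps_pair ?G R S) tv_tensor"
    if "R \<in> Obj ?A" "S \<in> Obj ?A" for R S
  proof (rule pseudofun_eqI)
    show "ps_comp (rep_tens0 G R S) = ps_comp (ps_then ?G TwoVect (ps_pair ?G R S) tv_tensor)"
    proof (rule extensionalityI[where A = "composable ?G"])
      fix fg assume "fg \<in> composable ?G"
      then show "ps_comp (rep_tens0 G R S) fg = ps_comp (ps_then ?G TwoVect (ps_pair ?G R S) tv_tensor) fg"
        using that dims by (auto simp: rep_tens0_def ps_then_def elim!: composableE)
    qed (simp_all add: rep_tens0_def)
    show "ps_unit (rep_tens0 G R S) = ps_unit (ps_then ?G TwoVect (ps_pair ?G R S) tv_tensor)"
      using that unit by (intro extensionalityI[where A = "Obj ?G"])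
        (auto simp: rep_tens0_def tv_tens2_id kron_one tv_vcomp_id[OF tvhom_id])
  qed (use that in \<open>auto simp: rep_tens0_def ps_then_def intro!: restrict_ext\<close>)
  have arr: "rep_tens1 G h k = pt_post ?G TwoVect (pt_pair ?G h k) tv_tensor"
    if "h \<in> Arr ?A" "k \<in> Arr ?A" for h k
  proof -
    have hk: "su_pseudonatural ?G TwoVect h" "su_pseudonatural ?G TwoVect k"
      using that by (simp_all add: X.BC.su_pseudonatural_iff)
    have o: "pt_src h \<in> Obj ?A" "pt_src k \<in> Obj ?A" "pt_tgt h \<in> Obj ?A" "pt_tgt k \<in> Obj ?A"
      using that hk by simp_all
    \<comment> \<open>\<open>rep_tens1\<close> takes components at the only object,
      \<open>pt_post\<close> at the endpoints of a 1-cell.\<close>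
    have [simp]: "src ?G f = ()" "tgt ?G f = ()" "() \<in> Obj ?G" for f by (simp_all add: closure_Obj)
    show ?thesis
    proof (rule pseudonat_eqI)
      show "pt_nat (rep_tens1 G h k) = pt_nat (pt_post ?G TwoVect (pt_pair ?G h k) tv_tensor)"
        using o dims map_dims[OF hk(1)] map_dims[OF hk(2)]
        by (auto simp: rep_tens1_def pt_post_def intro!: restrict_ext)
    qed (use o obj in \<open>auto simp: rep_tens1_def pt_post_def intro!: restrict_ext\<close>)
  qed
  have cell: "rep_tens2 G m n = md_post ?G TwoVect (md_pair ?G m n) tv_tensor"
    if "m \<in> Cell ?A" "n \<in> Cell ?A" for m n
  proof (rule modif_eqI)
    have "md_src m \<in> Arr ?A" "md_src n \<in> Arr ?A" "md_tgt m \<in> Arr ?A" "md_tgt n \<in> Arr ?A"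
      using that by (simp_all flip: X.BC.su_pseudonatural_iff)
    then show "md_src (rep_tens2 G m n) = md_src (md_post ?G TwoVect (md_pair ?G m n) tv_tensor)"
      "md_tgt (rep_tens2 G m n) = md_tgt (md_post ?G TwoVect (md_pair ?G m n) tv_tensor)"
      using arr by (simp_all add: rep_tens2_def)
    show "md_map (rep_tens2 G m n) = md_map (md_post ?G TwoVect (md_pair ?G m n) tv_tensor)"
      by (auto simp: rep_tens2_def intro!: restrict_ext)
  qed
  have then_arr: "pt_then ?G TwoVect h k \<in> Arr ?A" if "h \<in> Arr ?A" "k \<in> Arr ?A" "pt_tgt h = pt_src k" for h k
    using that by (simp flip: X.BC.su_pseudonatural_iff)
  have id_arr: "pt_id ?G TwoVect R \<in> Arr ?A" if "R \<in> Obj ?A" for R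
    using that X.BC.pseudonatural_pt_id[of R] by (simp flip: X.BC.su_pseudonatural_iff)
  show ?thesis
  proof (rule pseudofun_eqI)
    show "ps_obj (rep_tensor G) = ps_obj (pw_tensor ?G TwoVect tv_tensor)"
      by (auto simp: rep_tensor_def pw_tensor_def Let_def rep_bicat_def obj intro!: restrict_ext)
    show "ps_arr (rep_tensor G) = ps_arr (pw_tensor ?G TwoVect tv_tensor)"
      by (auto simp: rep_tensor_def pw_tensor_def Let_def rep_bicat_def arr intro!: restrict_ext
          simp del: full_sub_simps)
    show "ps_cell (rep_tensor G) = ps_cell (pw_tensor ?G TwoVect tv_tensor)"
      by (auto simp: rep_tensor_def pw_tensor_def Let_def rep_bicat_def cell intro!: restrict_ext
          simp del: full_sub_simps)
    show "ps_comp (rep_tensor G) = ps_comp (pw_tensor ?G TwoVect tv_tensor)"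
    proof (rule extensionalityI[where A = "composable (prod_bicat ?A ?A)"])
      fix x assume x: "x \<in> composable (prod_bicat ?A ?A)"
      then obtain h k h' k' where [simp]: "x = ((h, k), (h', k'))"
        and a: "h \<in> Arr ?A" "k \<in> Arr ?A" "h' \<in> Arr ?A" "k' \<in> Arr ?A" "pt_tgt h = pt_src h'" "pt_tgt k = pt_src k'"
        by (auto simp: composable_def simp del: full_sub_simps(2))
      have "su_pseudonatural ?G TwoVect h" "su_pseudonatural ?G TwoVect k"
        "su_pseudonatural ?G TwoVect h'" "su_pseudonatural ?G TwoVect k'"
        using a by (simp_all add: X.BC.su_pseudonatural_iff)
      note md = this[THEN map_dims(1)] this[THEN map_dims(2)]
      show "ps_comp (rep_tensor G) x = ps_comp (pw_tensor ?G TwoVect tv_tensor) x"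
        using x a(5,6) arr[OF a(1,2)] arr[OF a(3,4)] arr[OF then_arr[OF a(1,3,5)] then_arr[OF a(2,4,6)]] md
        by (simp add: rep_tensor_def pw_tensor_def Let_def rep_bicat_def cong: restrict_cong)
    qed (simp_all add: rep_tensor_def pw_tensor_def Let_def rep_bicat_def)
    show "ps_unit (rep_tensor G) = ps_unit (pw_tensor ?G TwoVect tv_tensor)"
      using obj arr id_arr
      by (auto simp: rep_tensor_def pw_tensor_def Let_def rep_bicat_def intro!: restrict_ext)
  qed
qed

theorem mainTheorem1:
  fixes G :: "('x, 'm) cat_group"
  assumes "categorical_group G"
  shows "\<exists>U a l r \<pi> \<mu> \<Lambda> \<rho>.
    monoidal_bicategory (rep_bicat G) (rep_tensor G) U a l r \<pi> \<mu> \<Lambda> \<rho>"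
proof -
  interpret G: bicategory "closure G" by (rule bicategory_closure) fact
  interpret V: strict_tensor TwoVect tv_tensor 1 by (rule strict_tensor_TwoVect)
  interpret X: strict_pointwise_tensor "closure G" TwoVect tv_tensor 1 ..
  \<comment> \<open>The unit object is the constant representation with value 1;
    \<open>rep_tensor_eq\<close> exhibits the explicit product as the pointwise one, to which
    \<open>strict_tensor_T\<close> applies.\<close>
  interpret R: strict_tensor "rep_bicat G" "rep_tensor G" "ps_const (closure G) TwoVect 1"
    unfolding rep_tensor_eq[OF assms] rep_bicat_def by (rule X.strict_tensor_T)
  show ?thesis
    using R.monoidal_bicategory_strict by blast
qed

end
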